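(* Suppose $k\ge 3$, that the homogeneous lattice is stable, i.e. there is $c_A>0$ with $$\sum_{\ell\in A\mathbb Z^d}\langle \delta^2V(0)Dv(\ell),Dv(\ell)\rangle\ \ge\ c_A\|\nabla v\|_{L^2}^2\qquad\forall v\in\dot{\mathcal W}^{\rm c}(A\mathbb Z^d),$$ and that $u\in\dot{\mathcal W}^{1,2}$ is a critical point of $\mathcal E$, $\delta\mathcal E(u)=0$. Then there exist constants $C>0$ and $u_\infty\in\mathbb R^d$ such that, for $1\le j\le k-2$ and for $|\ell|$ sufficiently large ($\ell\in\Lambda$), $$|D^ju(\ell)|\le C|\ell|^{1-d-j}\qquad\text{and}\qquad |u(\ell)-u_\infty|\le C|\ell|^{1-d}.$$
   Context: Setting (point defect). Let $d\in\{2,3\}$, $A\in\mathbb R^{d\times d}$ nonsingular, $B_r$ the ball of radius $r$ centred at $0$. The reference configuration $\Lambda\subset\mathbb R^d$ satisfies, for some $R_{\rm def}>0$, $\Lambda\setminus B_{R_{\rm def}}=A\mathbb Z^d\setminus B_{R_{\rm def}}$ and $\Lambda\cap B_{R_{\rm def}}$ is finite. $\mathcal T_\Lambda$ is a regular (conforming, shape-regular) partition of $\mathbb R^d$ into triangles ($d=2$) or tetrahedra ($d=3$) with node set $\Lambda$, homogeneous outside $B_{R_{\rm def}}$: if $T\in\mathcal T_\Lambda$, $\rho\in A\mathbb Z^d$ and $T,\rho+T\subset\mathbb R^d\setminus B_{R_{\rm def}}$, then $\rho+T\in\mathcal T_\Lambda$. For $u:\Lambda\to\mathbb R^d$, $Iu$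 is its continuous piecewise affine interpolant with respect to $\mathcal T_\Lambda$ and $\nabla u:=\nabla Iu$. Define $\dot{\mathcal W}^{\rm c}:=\{u:\Lambda\to\mathbb R^d:\ \mathrm{supp}(\nabla u)\text{ compact}\}$ and $\dot{\mathcal W}^{1,2}:=\{u:\Lambda\to\mathbb R^d:\ \nabla u\in L^2\}$ (with semi-norm $\|\nabla u\|_{L^2}$). Stencils: for each $\ell\in\Lambda$ a set $\mathcal R_\ell\subset(B_{r_{\rm cut}}\cap(\Lambda-\ell))\setminus\{0\}$ is given, $r_{\rm cut}>0$ fixed; $D_\rho u(\ell):=u(\ell+\rho)-u(\ell)$, $Du(\ell):=(D_\rho u(\ell))_{\rho\in\mathcal R_\ell}$, $D^ju:=DD^{j-1}u$ (the collection of all $D_{\rho_1}\cdots D_{\rho_j}u(\ell)$). If $(\ell,\ell+\rho)$ is an edge of $\mathcal T_\Lambda$ then $\rho\in\mathcal R_\ell$. Energy: $V_\ell\in C^k((\mathbb R^d)^{\mathcal R_\ell})$ with $V_\ell(0)=0$. For $|\ell|\ge R_{\rm def}$: $\mathcal R_\ell\equiv\mathcal R$, $V_\ell\equiv V$, and point symmetry holds: $-\mathcal R=\mathcal R$ and $V((-g_{-\rho})_{\rho\in\mathcal R})=V(g)$ for all $g\in(\mathbb R^d)^{\mathcal R}$. Moreover $Ae_n\in\mathcal R$, $n=1,\dots,d$. $\mathcal E(u):=\sum_{\ell\in\Lambda}V_\ell(Du(\ell))$ for $u\in\dot{\mathcal W}^{\rm c}$; $\mathcal E$ has a unique continuous extension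 to $\dot{\mathcal W}^{1,2}$, also denoted $\mathcal E$, which is of class $C^k$. $\delta,\delta^2$ denote first and second variations. On the homogeneous lattice $A\mathbb Z^d$ (stencil $\mathcal R$ at every site), $\dot{\mathcal W}^{\rm c}(A\mathbb Z^d)$ is defined in the same way, with $\nabla v$ the gradient of the P1 interpolant on an $A\mathbb Z^d$-translation-invariant triangulation with node set $A\mathbb Z^d$. *)

theory Defs
  imports "HOL-Analysis.Analysis"
begin

section \<open>Lattices and triangulations\<close>

definition bravais_lattice :: "real^'n^'n \<Rightarrow> (real^'n) set" where
  "bravais_lattice A = {A *v z | z. \<forall>i. z $ i \<in> \<int>}"

definition nodes :: "(real^'n) set set \<Rightarrow> (real^'n) set" where
  "nodes \<T> = (\<Union>T\<in>\<T>. {x. x extreme_point_of T})"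

text \<open>
  A regular partition of the whole space: it consists of nondegenerate closed simplices, is
  conforming (any two elements meet in a common, possibly empty, face) and shape-regular (the ratio
  of the diameter to the radius of an inscribed ball is uniformly bounded).  The library's
  \<open>triangulation\<close> is not applicable, since it requires finitely many simplices.
\<close>

definition regular_triangulation :: "(real^'n) set set \<Rightarrow> bool" where
  "regular_triangulation \<T> \<longleftrightarrow>
     (\<forall>T\<in>\<T>. int CARD('n) simplex T) \<and>
     \<Union>\<T> = UNIV \<and>
     (\<forall>T\<in>\<T>. \<forall>T'\<in>\<T>. (T \<inter> T') face_of T \<and> (T \<inter> T') face_of T') \<and>
     (\<exists>\<sigma>. \<forall>T\<in>\<T>. \<exists>x r. r > 0 \<and> ball x r \<subseteq> T \<and> diameter T \<le> \<sigma> * r)"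


section \<open>Lattice functions and their interpolants\<close>

text \<open>
  A function on a node set \<open>\<Lambda>\<close> is represented by a function on the whole space
  of which only the values on \<open>\<Lambda>\<close> matter.
\<close>

definition p1_interpolant ::
    "(real^'n) set set \<Rightarrow> (real^'n \<Rightarrow> real^'n) \<Rightarrow> (real^'n \<Rightarrow> real^'n)" where
  "p1_interpolant \<T> u =
     (THE w. continuous_on UNIV w \<and>
             (\<forall>T\<in>\<T>. \<exists>c L. linear L \<and> (\<forall>x\<in>T. w x = c + L x)) \<and>
             (\<forall>l\<in>nodes \<T>. w l = u l))"

text \<open>
  The value 0 is chosen on the null set (contained in the union of the element boundaries) where
  the interpolant is not differentiable.  It keeps the set where the gradient is
  nonzero free of junk values, so that its closure is the (essential) support.  The norm on
  the matrix type \<open>real^'n^'n\<close> is the Frobenius norm.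
\<close>

definition p1_grad :: "(real^'n) set set \<Rightarrow> (real^'n \<Rightarrow> real^'n) \<Rightarrow> real^'n \<Rightarrow> real^'n^'n" where
  "p1_grad \<T> u x =
     (if p1_interpolant \<T> u differentiable (at x)
      then matrix (frechet_derivative (p1_interpolant \<T> u) (at x)) else 0)"

definition W_c :: "(real^'n) set set \<Rightarrow> (real^'n \<Rightarrow> real^'n) set" where
  "W_c \<T> = {u. compact (closure {x. p1_grad \<T> u x \<noteq> 0})}"

definition W_12 :: "(real^'n) set set \<Rightarrow> (real^'n \<Rightarrow> real^'n) set" where
  "W_12 \<T> = {u. p1_grad \<T> u \<in> borel_measurable lebesgue \<and>
                 integrable lebesgue (\<lambda>x. (norm (p1_grad \<T> u x))\<^sup>2)}"

definition W_seminorm :: "(real^'n) set set \<Rightarrow> (real^'n \<Rightarrow> real^'n) \<Rightarrow> real" where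
  "W_seminorm \<T> u = sqrt (LINT x|lebesgue. (norm (p1_grad \<T> u x))\<^sup>2)"


section \<open>Finite differences\<close>

text \<open>
  The stencil \<open>(D\<^sub>\<rho> u(l))\<^sub>\<rho>\<close> as a function of \<open>\<rho>\<close>; only the values
  at \<open>\<rho>\<close> in the stencil of \<open>l\<close> matter.
\<close>

definition stencil_diff :: "('v::real_vector \<Rightarrow> 'w::real_vector) \<Rightarrow> 'v \<Rightarrow> 'v \<Rightarrow> 'w" where
  "stencil_diff u l = (\<lambda>\<rho>. u (l + \<rho>) - u l)"

primrec iter_diff :: "'v::real_vector list \<Rightarrow> ('v \<Rightarrow> 'w::real_vector) \<Rightarrow> 'v \<Rightarrow> 'w" where
  "iter_diff [] u = u"
| "iter_diff (\<rho> # \<rho>s) u = (\<lambda>l. iter_diff \<rho>s u (l + \<rho>) - iter_diff \<rho>s u l)"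

text \<open>
  Euclidean norm of the collection \<open>D^j u(l)\<close> of all iterated differences with increments
  in \<open>S\<close>; appropriate wherever the stencil of \<open>l\<close> and of the neighbours reached from it is
  the same set \<open>S\<close>, as is the case far from the defect.
\<close>

definition iter_diff_norm ::
    "'v::real_vector set \<Rightarrow> nat \<Rightarrow> ('v \<Rightarrow> 'w::real_normed_vector) \<Rightarrow> 'v \<Rightarrow> real" where
  "iter_diff_norm S j u l =
     L2_set (\<lambda>\<rho>s. norm (iter_diff \<rho>s u l)) {\<rho>s. set \<rho>s \<subseteq> S \<and> length \<rho>s = j}"


section \<open>Functions of a stencil, variations, energy\<close>

text \<open>
  A function on the finite-dimensional space \<open>W^S\<close>, \<open>S\<close> a finite set of
  indices, is represented by a function of \<open>g :: 'i \<Rightarrow> 'w\<close> which only depends on the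
  values of \<open>g\<close> on \<open>S\<close>.
\<close>

definition depends_only_on :: "'i set \<Rightarrow> (('i \<Rightarrow> 'w) \<Rightarrow> real) \<Rightarrow> bool" where
  "depends_only_on S F \<longleftrightarrow> (\<forall>g h. (\<forall>i\<in>S. g i = h i) \<longrightarrow> F g = F h)"

text \<open>
  \<open>F\<close> is of class \<open>C^k\<close>: all iterated directional derivatives up to order \<open>k\<close> exist
  everywhere and are continuous.  Continuity refers to the product topology; for a
  function depending only on finitely many coordinates (with values in a Euclidean space) this is
  the usual notion of a \<open>C^k\<close> function on a finite-dimensional space.
\<close>

primrec class_C :: "nat \<Rightarrow> (('i \<Rightarrow> 'w::real_normed_vector) \<Rightarrow> real) \<Rightarrow> bool" where
  "class_C 0 F \<longleftrightarrow> continuous_on UNIV F"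
| "class_C (Suc k) F \<longleftrightarrow> continuous_on UNIV F \<and>
     (\<forall>h. \<exists>F'. (\<forall>g. ((\<lambda>t. F (\<lambda>i. g i + t *\<^sub>R h i)) has_real_derivative F' g) (at 0)) \<and>
               class_C k F')"

definition first_variation ::
    "(('i \<Rightarrow> 'w::real_vector) \<Rightarrow> real) \<Rightarrow> ('i \<Rightarrow> 'w) \<Rightarrow> ('i \<Rightarrow> 'w) \<Rightarrow> real" where
  "first_variation F g h = deriv (\<lambda>t. F (\<lambda>i. g i + t *\<^sub>R h i)) 0"

definition second_variation ::
    "(('i \<Rightarrow> 'w::real_vector) \<Rightarrow> real) \<Rightarrow> ('i \<Rightarrow> 'w) \<Rightarrow> ('i \<Rightarrow> 'w) \<Rightarrow> ('i \<Rightarrow> 'w) \<Rightarrow> real" where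
  "second_variation F g h h' = deriv (\<lambda>t. first_variation F (\<lambda>i. g i + t *\<^sub>R h i) h') 0"

text \<open>
  \<open>E\<close> is the continuous extension of the energy from \<open>W_c\<close> to \<open>W_12\<close>,
  continuity being with respect to the seminorm (in particular \<open>E\<close> is
  invariant under changes of \<open>u\<close> off the node set).  For \<open>u\<close> in \<open>W_c\<close> only finitely many
  summands of the site energy sum are nonzero.
\<close>

definition energy_extension ::
    "(real^'n) set set \<Rightarrow> (real^'n \<Rightarrow> (real^'n \<Rightarrow> real^'n) \<Rightarrow> real) \<Rightarrow>
     ((real^'n \<Rightarrow> real^'n) \<Rightarrow> real) \<Rightarrow> bool" where
  "energy_extension \<T> V E \<longleftrightarrow>
     (\<forall>u\<in>W_c \<T>. E u = (\<Sum>\<^sub>\<infinity>l\<in>nodes \<T>. V l (stencil_diff u l))) \<and>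
     (\<forall>u\<in>W_12 \<T>. \<forall>\<epsilon>>0. \<exists>\<delta>>0. \<forall>v\<in>W_12 \<T>.
        W_seminorm \<T> (\<lambda>l. v l - u l) < \<delta> \<longrightarrow> \<bar>E v - E u\<bar> < \<epsilon>)"

definition critical_point ::
    "(real^'n) set set \<Rightarrow> ((real^'n \<Rightarrow> real^'n) \<Rightarrow> real) \<Rightarrow> (real^'n \<Rightarrow> real^'n) \<Rightarrow> bool" where
  "critical_point \<T> E u \<longleftrightarrow> u \<in> W_12 \<T> \<and>
     (\<forall>v\<in>W_12 \<T>. ((\<lambda>t. E (\<lambda>l. u l + t *\<^sub>R v l)) has_real_derivative 0) (at 0))"

end

theory Submission
  imports Defs
begin

text \<open>
  The argument is purely variational and uses no lattice Green's function.  Far from the defect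
  write \<open>u\<close> as a function on \<open>\<int>\<^sup>d\<close>.  Testing the Euler--Lagrange equation with functions that are
  constant on a large cube and Taylor expanding at \<open>0\<close> gives a linear equation \<open>H u = div g\<close> outside
  the cube, where \<open>H\<close> is the elliptic operator of the homogeneous lattice and
  \<open>\<bar>g\<bar> \<le> C \<bar>D u\<bar>\<^sup>2\<close>; the contribution of the zeroth order term \<open>\<delta>V(0)\<close> vanishes by summation by parts.

  Let \<open>t R\<close> be the energy of \<open>u\<close> outside the cube of radius \<open>R\<close>.  Testing with
  the solution of a dual problem, whose gradient decays in the hole by interior estimates, gives
  \<open>t (4 R) \<le> C (R powr -d + (t R)\<^sup>2)\<close> and hence \<open>t R \<le> C R powr -d\<close>.  Interior estimates for
  \<open>H\<close> (Caccioppoli and a discrete Sobolev inequality) turn this into \<open>\<bar>D u\<bar> \<le> C \<bar>x\<bar> powr -d\<close>, and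
  each further difference of the equation gains one power of \<open>\<bar>x\<bar>\<close>, as long as the remainder \<open>g\<close> can be
  Taylor expanded with an error that decays fast enough.  Since \<open>d \<ge> 2\<close>,
  summing \<open>D u\<close> along paths gives the limit at infinity.
\<close>

section \<open>Variations and Taylor expansion\<close>

text \<open>The form of the homogeneous lattice is coercive only after summation over all sites, not
  site by site, so every energy estimate has to come from an admissible test function. The defect is
  felt only through the demand that test functions be constant on a cube. That they need not vanish
  there is decisive: making a dual solution constant near the origin costs only differences of it,
  and interior estimates in the hole of radius R bound these by R^(-d/2) times the root of its
  energy. This is the origin of the R^(-d) in the recursion. The square of the tail has a discrete
  reason: a term of a nonnegative sum is at most the sum, so the squared density of D u is summable
  with the squared tail as bound. Since the tail tends to 0, this term is eventually absorbed. Count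
  of derivatives: one of the k derivatives of V is spent on the variation, k - 1 on its Taylor
  expansion. The remainder has size |x|^(-d(k-1)), and d(k-1) >= 2d + (k-3), so its differences can
  be estimated by its values alone; this leaves k - 3 differences beyond the first.\<close>

lemma class_C_continuous: "class_C k F \<Longrightarrow> continuous_on UNIV F"
  by (cases k) auto

lemma class_C_SucD: "class_C (Suc k) F \<Longrightarrow> class_C k F"
proof (induction k arbitrary: F)
  case 0 then show ?case by (simp only: class_C.simps)
next
  case (Suc k)
  from Suc.prems have c: "continuous_on UNIV F" by (simp only: class_C.simps)
  have "\<exists>F'. (\<forall>g. ((\<lambda>t. F (\<lambda>i. g i + t *\<^sub>R h i)) has_real_derivative F' g) (at 0)) \<and> class_C k F'" for h
  proof -
    from Suc.prems have "\<exists>F'. (\<forall>g. ((\<lambda>t. F (\<lambda>i. g i + t *\<^sub>R h i)) has_real_derivative F' g) (at 0)) \<and> class_C (Suc k) F'"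
      by (simp only: class_C.simps)
    then show ?thesis using Suc.IH by blast
  qed
  with c show ?case by simp
qed

lemma first_variationI:
  "((\<lambda>t. F (\<lambda>i. g i + t *\<^sub>R h i)) has_real_derivative D) (at 0) \<Longrightarrow> first_variation F g h = D"
  unfolding first_variation_def by (rule DERIV_imp_deriv)

lemma class_C_Suc_first_variation:
  assumes "class_C (Suc k) F"
  shows "((\<lambda>t. F (\<lambda>i. g i + t *\<^sub>R h i)) has_real_derivative first_variation F g h) (at 0)"
    and "class_C k (\<lambda>g. first_variation F g h)"
proof -
  obtain F' where F': "\<And>g. ((\<lambda>t. F (\<lambda>i. g i + t *\<^sub>R h i)) has_real_derivative F' g) (at 0)"
    and C: "class_C k F'" using assms by (auto simp: class_C.simps(2))
  have eq: "(\<lambda>g. first_variation F g h) = F'"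
    by (rule ext, rule first_variationI, rule F')
  show "class_C k (\<lambda>g. first_variation F g h)" using C eq by simp
  show "((\<lambda>t. F (\<lambda>i. g i + t *\<^sub>R h i)) has_real_derivative first_variation F g h) (at 0)"
    using F'[of g] eq by (simp add: fun_eq_iff)
qed

text \<open>The definition differentiates at parameter 0 only. The base point is arbitrary, so
  moving it along the line gives the derivative at every parameter, as the mean value theorem
  requires.\<close>

lemma DERIV_first_variation:
  assumes "class_C (Suc k) F"
  shows "((\<lambda>t. F (\<lambda>i. g i + t *\<^sub>R h i)) has_real_derivative
           first_variation F (\<lambda>i. g i + t *\<^sub>R h i) h) (at t)"
proof -
  have "((\<lambda>s. F (\<lambda>i. (g i + t *\<^sub>R h i) + s *\<^sub>R h i)) has_real_derivative
           first_variation F (\<lambda>i. g i + t *\<^sub>R h i) h) (at 0)"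
    by (rule class_C_Suc_first_variation(1)[OF assms])
  then have "((\<lambda>s. F (\<lambda>i. g i + (s + t) *\<^sub>R h i)) has_real_derivative
           first_variation F (\<lambda>i. g i + t *\<^sub>R h i) h) (at 0)"
    by (simp add: algebra_simps)
  then show ?thesis
    using DERIV_shift[of "\<lambda>s. F (\<lambda>i. g i + s *\<^sub>R h i)" "first_variation F (\<lambda>i. g i + t *\<^sub>R h i) h" 0 t]
    by simp
qed

text \<open>The mean value theorem evaluates derivatives at intermediate points of a plane through
  \<open>g\<close>; continuity in the product topology is used there as joint continuity in the two
  parameters.\<close>

lemma continuous_two_parameters:
  fixes F :: "('i \<Rightarrow> 'w::real_normed_vector) \<Rightarrow> real"
  assumes "continuous_on UNIV F" "e > 0"
  obtains d where "d > 0"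
    "\<And>s t. \<bar>s\<bar> < d \<Longrightarrow> \<bar>t\<bar> < d \<Longrightarrow> \<bar>F (\<lambda>i. g i + s *\<^sub>R h i + t *\<^sub>R h' i) - F g\<bar> < e"
proof -
  have "continuous_on UNIV (\<lambda>p::real\<times>real. F (\<lambda>i. g i + fst p *\<^sub>R h i + snd p *\<^sub>R h' i))"
    by (rule continuous_on_compose2[OF assms(1)])
       (auto intro!: continuous_on_coordinatewise_then_product continuous_intros)
  then have "isCont (\<lambda>p::real\<times>real. F (\<lambda>i. g i + fst p *\<^sub>R h i + snd p *\<^sub>R h' i)) (0,0)"
    by (simp add: continuous_on_eq_continuous_at)
  then obtain d where d: "d > 0" "\<And>p. dist p (0,0) < d \<Longrightarrow>
      dist (F (\<lambda>i. g i + fst p *\<^sub>R h i + snd p *\<^sub>R h' i)) (F g) < e"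
    using assms(2) by (fastforce simp: continuous_at_eps_delta)
  show thesis
  proof (rule that[of "d/2"])
    show "d/2 > 0" using d by simp
    fix s t :: real assume "\<bar>s\<bar> < d/2" "\<bar>t\<bar> < d/2"
    then have "dist (s,t) (0,0) < d"
      using sqrt_sum_squares_le_sum_abs[of s t] by (simp add: dist_Pair_Pair)
    from d(2)[OF this] show "\<bar>F (\<lambda>i. g i + s *\<^sub>R h i + t *\<^sub>R h' i) - F g\<bar> < e"
      by (simp add: dist_real_def)
  qed
qed

text \<open>\<open>class_C\<close> postulates directional derivatives only, so additivity in the
  direction has to be proved. It comes from continuity of the derivative in the base point: the step
  along \<open>h'\<close> is started at \<open>g + t h\<close> instead of \<open>g\<close>, and the
  mean value theorem makes the discrepancy o(t).\<close>

lemma first_variation_add: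
  assumes F: "class_C (Suc k) F"
  shows "first_variation F g (\<lambda>i. h i + h' i) = first_variation F g h + first_variation F g h'"
proof -
  define c where "c = first_variation F g h'"
  have cont: "continuous_on UNIV (\<lambda>g. first_variation F g h')"
    by (rule class_C_continuous[OF class_C_Suc_first_variation(2)[OF F]])
  have key: "((\<lambda>t. F (\<lambda>i. g i + t *\<^sub>R h i + t *\<^sub>R h' i) - F (\<lambda>i. g i + t *\<^sub>R h i))
      has_real_derivative c) (at 0)"
    unfolding DERIV_def
  proof (rule LIM_I)
    fix r :: real assume r: "0 < r"
    obtain d where d: "d > 0" "\<And>s t. \<bar>s\<bar> < d \<Longrightarrow> \<bar>t\<bar> < d \<Longrightarrow>
        \<bar>first_variation F (\<lambda>i. g i + s *\<^sub>R h i + t *\<^sub>R h' i) h' - first_variation F g h'\<bar> < r/2"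
      using continuous_two_parameters[OF cont, of "r/2" g h h'] r by auto
    have "norm ((F (\<lambda>i. g i + (0+t) *\<^sub>R h i + (0+t) *\<^sub>R h' i) - F (\<lambda>i. g i + (0+t) *\<^sub>R h i)
        - (F (\<lambda>i. g i + 0 *\<^sub>R h i + 0 *\<^sub>R h' i) - F (\<lambda>i. g i + 0 *\<^sub>R h i))) / t - c) < r"
      if t: "t \<noteq> 0" "norm (t - 0) < d" for t
    proof -
      let ?f = "\<lambda>s. F (\<lambda>i. (g i + t *\<^sub>R h i) + s *\<^sub>R h' i) - s * c"
      have "norm (?f t - ?f 0) \<le> (r/2) * norm (t - 0)"
      proof (rule field_differentiable_bound[where S = "closed_segment 0 t" and
            f' = "\<lambda>s. first_variation F (\<lambda>i. (g i + t *\<^sub>R h i) + s *\<^sub>R h' i) h' - c"])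
        fix s assume "s \<in> closed_segment 0 t"
        then have "\<bar>s\<bar> \<le> \<bar>t\<bar>" by (auto simp: closed_segment_eq_real_ivl split: if_splits)
        then have s: "\<bar>s\<bar> < d" "\<bar>t\<bar> < d" using t by auto
        show "norm (first_variation F (\<lambda>i. (g i + t *\<^sub>R h i) + s *\<^sub>R h' i) h' - c) \<le> r/2"
          using d(2)[OF s(2) s(1)] by (simp add: c_def)
        have "(?f has_real_derivative first_variation F (\<lambda>i. (g i + t *\<^sub>R h i) + s *\<^sub>R h' i) h' - c) (at s)"
          by (rule derivative_eq_intros DERIV_first_variation[OF F] refl | simp)+
        then show "(?f has_real_derivative first_variation F (\<lambda>i. (g i + t *\<^sub>R h i) + s *\<^sub>R h' i) h' - c)
            (at s within closed_segment 0 t)"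
          by (rule has_field_derivative_at_within)
      qed auto
      then have "\<bar>F (\<lambda>i. g i + t *\<^sub>R h i + t *\<^sub>R h' i) - F (\<lambda>i. g i + t *\<^sub>R h i) - t * c\<bar> \<le> r/2 * \<bar>t\<bar>"
        by (simp add: algebra_simps)
      then have "\<bar>F (\<lambda>i. g i + t *\<^sub>R h i + t *\<^sub>R h' i) - F (\<lambda>i. g i + t *\<^sub>R h i) - t * c\<bar> / \<bar>t\<bar> \<le> r/2"
        by (subst pos_divide_le_eq) (use t in auto)
      moreover have "(F (\<lambda>i. g i + t *\<^sub>R h i + t *\<^sub>R h' i) - F (\<lambda>i. g i + t *\<^sub>R h i)) / t - c
        = (F (\<lambda>i. g i + t *\<^sub>R h i + t *\<^sub>R h' i) - F (\<lambda>i. g i + t *\<^sub>R h i) - t * c) / t"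
        using t by (simp add: divide_simps)
      ultimately show ?thesis using r by (simp flip: abs_divide)
    qed
    then show "\<exists>s>0. \<forall>x. x \<noteq> 0 \<and> norm (x - 0) < s \<longrightarrow>
       norm ((F (\<lambda>i. g i + (0 + x) *\<^sub>R h i + (0 + x) *\<^sub>R h' i) - F (\<lambda>i. g i + (0 + x) *\<^sub>R h i)
        - (F (\<lambda>i. g i + 0 *\<^sub>R h i + 0 *\<^sub>R h' i) - F (\<lambda>i. g i + 0 *\<^sub>R h i))) / x - c) < r"
      using d(1) by blast
  qed
  have "((\<lambda>t. (F (\<lambda>i. g i + t *\<^sub>R h i + t *\<^sub>R h' i) - F (\<lambda>i. g i + t *\<^sub>R h i)) + F (\<lambda>i. g i + t *\<^sub>R h i))
      has_real_derivative c + first_variation F g h) (at 0)"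
    by (rule DERIV_add[OF key class_C_Suc_first_variation(1)[OF F]])
  then have "((\<lambda>t. F (\<lambda>i. g i + t *\<^sub>R (h i + h' i))) has_real_derivative c + first_variation F g h) (at 0)"
    by (simp add: scaleR_add_right add.assoc)
  from first_variationI[OF this] show ?thesis by (simp add: c_def)
qed

lemma first_variation_scale:
  assumes F: "class_C (Suc k) F"
  shows "first_variation F g (\<lambda>i. c *\<^sub>R h i) = c * first_variation F g h"
proof -
  have D: "((\<lambda>t. F (\<lambda>i. g i + t *\<^sub>R h i)) has_real_derivative first_variation F g h) (at (c * 0))"
    using class_C_Suc_first_variation(1)[OF F] by simp
  have "((\<lambda>t. c * t) has_real_derivative c) (at 0)"
    by (auto intro!: derivative_eq_intros)
  from DERIV_chain2[OF D this]
  have "((\<lambda>t. F (\<lambda>i. g i + t *\<^sub>R (c *\<^sub>R h i))) has_real_derivative first_variation F g h * c) (at 0)"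
    by (simp add: mult.commute)
  from first_variationI[OF this] show ?thesis by simp
qed

lemma first_variation_sum:
  assumes F: "class_C (Suc k) F" and fin: "finite J"
  shows "first_variation F g (\<lambda>i. \<Sum>j\<in>J. c j *\<^sub>R h j i) = (\<Sum>j\<in>J. c j * first_variation F g (h j))"
  using fin
proof (induction J rule: finite_induct)
  case empty
  show ?case using first_variation_scale[OF F, of g 0 "\<lambda>_. 0"] by simp
next
  case (insert x J)
  then show ?case
    by (simp add: first_variation_add[OF F] first_variation_scale[OF F])
qed

text \<open>Schwarz's theorem. The second difference of \<open>F\<close> over the parallelogram
  spanned by \<open>t h\<close> and \<open>t h'\<close> is symmetric in the two directions; applying
  the mean value theorem twice shows that it equals t^2 times either mixed derivative up to
  \<open>e * t^2\<close>.\<close>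

lemma first_variation_commute:
  assumes F: "class_C (Suc (Suc k)) F"
  shows "first_variation (\<lambda>g. first_variation F g h) g h' = first_variation (\<lambda>g. first_variation F g h') g h"
proof -
  have half: "\<exists>d>0. \<forall>t. 0 < t \<and> t < d \<longrightarrow>
      \<bar>F (\<lambda>i. g i + t *\<^sub>R h i + t *\<^sub>R h' i) - F (\<lambda>i. g i + t *\<^sub>R h i) - F (\<lambda>i. g i + t *\<^sub>R h' i) + F g
        - t * t * first_variation (\<lambda>g. first_variation F g h) g h'\<bar> \<le> e * (t * t)"
    if e: "e > 0" for e h h'
  proof -
    let ?F' = "\<lambda>g. first_variation F g h"
    let ?F'' = "\<lambda>g. first_variation ?F' g h'"
    define c where "c = ?F'' g"
    have F': "class_C (Suc k) ?F'" by (rule class_C_Suc_first_variation(2)[OF F])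
    have cont: "continuous_on UNIV ?F''"
      by (rule class_C_continuous[OF class_C_Suc_first_variation(2)[OF F']])
    obtain d where d: "d > 0" "\<And>s t. \<bar>s\<bar> < d \<Longrightarrow> \<bar>t\<bar> < d \<Longrightarrow>
        \<bar>?F'' (\<lambda>i. g i + s *\<^sub>R h i + t *\<^sub>R h' i) - ?F'' g\<bar> < e"
      using continuous_two_parameters[OF cont, of e g h h'] e by auto
    have "\<bar>F (\<lambda>i. g i + t *\<^sub>R h i + t *\<^sub>R h' i) - F (\<lambda>i. g i + t *\<^sub>R h i) - F (\<lambda>i. g i + t *\<^sub>R h' i) + F g
        - t * t * c\<bar> \<le> e * (t * t)" if t: "0 < t" "t < d" for t
    proof -
      have inner: "norm ((?F' (\<lambda>i. (g i + s *\<^sub>R h i) + t *\<^sub>R h' i) - t * c) - (?F' (\<lambda>i. (g i + s *\<^sub>R h i) + 0 *\<^sub>R h' i) - 0 * c))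
          \<le> e * norm (t - 0)" if s: "s \<in> {0..t}" for s
      proof (rule field_differentiable_bound[where S = "{0..t}" and f = "\<lambda>r. ?F' (\<lambda>i. (g i + s *\<^sub>R h i) + r *\<^sub>R h' i) - r * c"
            and f' = "\<lambda>r. ?F'' (\<lambda>i. (g i + s *\<^sub>R h i) + r *\<^sub>R h' i) - c"])
        fix r assume "r \<in> {0..t}"
        then show "norm (?F'' (\<lambda>i. (g i + s *\<^sub>R h i) + r *\<^sub>R h' i) - c) \<le> e"
          using d(2)[of s r] s t by (auto simp: c_def)
        have "((\<lambda>r. ?F' (\<lambda>i. (g i + s *\<^sub>R h i) + r *\<^sub>R h' i) - r * c) has_real_derivative
            ?F'' (\<lambda>i. (g i + s *\<^sub>R h i) + r *\<^sub>R h' i) - c) (at r)"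
          by (rule derivative_eq_intros DERIV_first_variation[OF F'] refl | simp)+
        then show "((\<lambda>r. ?F' (\<lambda>i. (g i + s *\<^sub>R h i) + r *\<^sub>R h' i) - r * c) has_real_derivative
            ?F'' (\<lambda>i. (g i + s *\<^sub>R h i) + r *\<^sub>R h' i) - c) (at r within {0..t})"
          by (rule has_field_derivative_at_within)
      qed (use t in auto)
      let ?f = "\<lambda>s. F (\<lambda>i. (g i + t *\<^sub>R h' i) + s *\<^sub>R h i) - F (\<lambda>i. g i + s *\<^sub>R h i) - s * (t * c)"
      have "norm (?f t - ?f 0) \<le> (e * t) * norm (t - 0)"
      proof (rule field_differentiable_bound[where S = "{0..t}" and
            f' = "\<lambda>s. ?F' (\<lambda>i. (g i + t *\<^sub>R h' i) + s *\<^sub>R h i) - ?F' (\<lambda>i. g i + s *\<^sub>R h i) - t * c"])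
        fix s assume s: "s \<in> {0..t}"
        show "norm (?F' (\<lambda>i. (g i + t *\<^sub>R h' i) + s *\<^sub>R h i) - ?F' (\<lambda>i. g i + s *\<^sub>R h i) - t * c) \<le> e * t"
          using inner[OF s] t by (simp add: algebra_simps)
        have "(?f has_real_derivative
            ?F' (\<lambda>i. (g i + t *\<^sub>R h' i) + s *\<^sub>R h i) - ?F' (\<lambda>i. g i + s *\<^sub>R h i) - t * c) (at s)"
          by (rule derivative_eq_intros DERIV_first_variation[OF F] refl | simp)+
        then show "(?f has_real_derivative
            ?F' (\<lambda>i. (g i + t *\<^sub>R h' i) + s *\<^sub>R h i) - ?F' (\<lambda>i. g i + s *\<^sub>R h i) - t * c) (at s within {0..t})"
          by (rule has_field_derivative_at_within)
      qed (use t in auto)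
      moreover have "?f t - ?f 0 = F (\<lambda>i. g i + t *\<^sub>R h i + t *\<^sub>R h' i) - F (\<lambda>i. g i + t *\<^sub>R h i) - F (\<lambda>i. g i + t *\<^sub>R h' i) + F g
        - t * t * c" by (simp add: algebra_simps)
      ultimately show ?thesis using t by (simp add: mult.assoc)
    qed
    then show ?thesis using d(1) c_def by blast
  qed
  define c where "c = first_variation (\<lambda>g. first_variation F g h) g h'"
  define c' where "c' = first_variation (\<lambda>g. first_variation F g h') g h"
  have "\<bar>c - c'\<bar> \<le> 2 * e" if e: "e > 0" for e
  proof -
    obtain d where d: "d > 0" "\<And>t. 0 < t \<Longrightarrow> t < d \<Longrightarrow>
      \<bar>F (\<lambda>i. g i + t *\<^sub>R h i + t *\<^sub>R h' i) - F (\<lambda>i. g i + t *\<^sub>R h i) - F (\<lambda>i. g i + t *\<^sub>R h' i) + F g - t * t * c\<bar> \<le> e * (t * t)"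
      using half[OF e, of h h'] unfolding c_def by blast
    obtain d' where d': "d' > 0" "\<And>t. 0 < t \<Longrightarrow> t < d' \<Longrightarrow>
      \<bar>F (\<lambda>i. g i + t *\<^sub>R h' i + t *\<^sub>R h i) - F (\<lambda>i. g i + t *\<^sub>R h' i) - F (\<lambda>i. g i + t *\<^sub>R h i) + F g - t * t * c'\<bar> \<le> e * (t * t)"
      using half[OF e, of h' h] unfolding c'_def by blast
    define t where "t = min d d' / 2"
    have t: "0 < t" "t < d" "t < d'" using d(1) d'(1) by (auto simp: t_def)
    have comm: "(\<lambda>i. g i + t *\<^sub>R h' i + t *\<^sub>R h i) = (\<lambda>i. g i + t *\<^sub>R h i + t *\<^sub>R h' i)" by (auto simp: algebra_simps)
    have "\<bar>t * t * c - t * t * c'\<bar> \<le> 2 * (e * (t * t))"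
      using d(2)[OF t(1,2)] d'(2)[OF t(1,3)] unfolding comm by linarith
    moreover have "\<bar>t * t * c - t * t * c'\<bar> = t * t * \<bar>c - c'\<bar>"
      using t by (simp add: abs_mult flip: right_diff_distrib)
    ultimately have "t * t * \<bar>c - c'\<bar> \<le> t * t * (2 * e)"
      by (simp add: algebra_simps)
    then show ?thesis using t by simp
  qed
  then have "\<bar>c - c'\<bar> \<le> 0 + e" if "e > 0" for e
    using that by (metis add_0 half_gt_zero mult_2 field_sum_of_halves)
  then have "\<bar>c - c'\<bar> \<le> 0"
    by (rule field_le_epsilon)
  then show ?thesis by (simp add: c_def c'_def)
qed

section \<open>Taylor polynomials in finitely many stencil coordinates\<close>

definition stencil_unit :: "'i \<times> 'w \<Rightarrow> 'i \<Rightarrow> 'w::real_vector" where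
  "stencil_unit p = (\<lambda>i. if i = fst p then snd p else 0)"

lemma depends_only_onD: "depends_only_on S F \<Longrightarrow> (\<And>i. i \<in> S \<Longrightarrow> g i = h i) \<Longrightarrow> F g = F h"
  unfolding depends_only_on_def by blast

lemma first_variation_depends:
  assumes "depends_only_on S F" "\<And>i. i \<in> S \<Longrightarrow> g i = g' i" "\<And>i. i \<in> S \<Longrightarrow> h i = h' i"
  shows "first_variation F g h = first_variation F g' h'"
proof -
  have "F (\<lambda>i. g i + t *\<^sub>R h i) = F (\<lambda>i. g' i + t *\<^sub>R h' i)" for t
    by (rule depends_only_onD[OF assms(1)]) (use assms(2,3) in auto)
  then show ?thesis unfolding first_variation_def by simp
qed

lemma depends_only_on_first_variation:
  "depends_only_on S F \<Longrightarrow> depends_only_on S (\<lambda>g. first_variation F g h)"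
  unfolding depends_only_on_def[of S "\<lambda>g. first_variation F g h"]
  by (intro allI impI first_variation_depends[where S = S]) auto

lemma first_variation_expand:
  fixes F :: "('i \<Rightarrow> 'w::euclidean_space) \<Rightarrow> real"
  assumes F: "class_C (Suc k) F" and S: "finite S" "depends_only_on S F"
  shows "first_variation F g h
    = (\<Sum>p\<in>S \<times> Basis. (h (fst p) \<bullet> snd p) * first_variation F g (stencil_unit p))"
proof -
  have "first_variation F g h = first_variation F g (\<lambda>i. \<Sum>p\<in>S \<times> Basis. (h (fst p) \<bullet> snd p) *\<^sub>R stencil_unit p i)"
  proof (rule first_variation_depends[OF S(2) refl])
    fix i assume i: "i \<in> S"
    have "(\<Sum>p\<in>S \<times> Basis. (h (fst p) \<bullet> snd p) *\<^sub>R stencil_unit p i)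
        = (\<Sum>s\<in>S. \<Sum>b\<in>Basis. (h s \<bullet> b) *\<^sub>R (if i = s then b else 0))"
      by (simp add: sum.cartesian_product stencil_unit_def case_prod_unfold)
    also have "\<dots> = (\<Sum>s\<in>S. if i = s then h i else 0)"
      by (rule sum.cong) (auto simp: euclidean_representation)
    also have "\<dots> = h i" using i S(1) by simp
    finally show "h i = (\<Sum>p\<in>S \<times> Basis. (h (fst p) \<bullet> snd p) *\<^sub>R stencil_unit p i)" by simp
  qed
  also have "\<dots> = (\<Sum>p\<in>S \<times> Basis. (h (fst p) \<bullet> snd p) * first_variation F g (stencil_unit p))"
    by (rule first_variation_sum[OF F]) (use S in auto)
  finally show ?thesis .
qed

text \<open>A neighbourhood in the product topology restricts its coordinates by different amounts.
  \<open>F\<close> sees only the finitely many coordinates in \<open>S\<close>, so the smallest of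
  these radii serves for all. This is the Taylor expansion of order 0.\<close>

lemma bounded_near_zero:
  fixes F :: "('i \<Rightarrow> 'w::real_normed_vector) \<Rightarrow> real"
  assumes F: "continuous_on UNIV F" and S: "finite S" "depends_only_on S F"
  obtains e where "e > 0" "\<And>X. (\<And>s. s \<in> S \<Longrightarrow> norm (X s) \<le> e) \<Longrightarrow> \<bar>F X\<bar> \<le> \<bar>F (\<lambda>_. 0)\<bar> + 1"
proof -
  define U where "U = F -` {F (\<lambda>_. 0) - 1 <..< F (\<lambda>_. 0) + 1}"
  have "open U" unfolding U_def by (rule open_vimage[OF open_greaterThanLessThan F])
  then have op: "openin (product_topology (\<lambda>i. euclidean) UNIV) U" by (simp add: open_fun_def)
  have "(\<lambda>_. 0) \<in> U" by (simp add: U_def)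
  from product_topology_open_contains_basis[OF op this]
  obtain Y where Y: "(\<lambda>_. 0) \<in> (\<Pi>\<^sub>E i\<in>UNIV. Y i)" "\<And>i. open (Y i)" "(\<Pi>\<^sub>E i\<in>UNIV. Y i) \<subseteq> U"
    by auto
  have "\<exists>e>0. cball 0 e \<subseteq> Y i" for i
    using Y(1,2) by (metis PiE_mem UNIV_I open_contains_cball)
  then obtain e where e: "\<And>i. e i > 0" "\<And>i. cball 0 (e i) \<subseteq> Y i" by metis
  define d where "d = Min (insert 1 (e ` S))"
  have d: "d > 0" using S(1) e(1) by (auto simp: d_def)
  have dle: "d \<le> e s" if "s \<in> S" for s using S(1) that by (auto simp: d_def)
  show thesis
  proof (rule that[OF d])
    fix X :: "'i \<Rightarrow> 'w" assume X: "\<And>s. s \<in> S \<Longrightarrow> norm (X s) \<le> d"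
    define X' where "X' = (\<lambda>i. if i \<in> S then X i else 0)"
    have "X' i \<in> Y i" for i
    proof (cases "i \<in> S")
      case True
      then have "norm (X' i) \<le> e i" using X dle by (fastforce simp: X'_def)
      then show ?thesis using e(2)[of i] by auto
    next
      case False then show ?thesis using Y(1) by (auto simp: X'_def)
    qed
    then have "X' \<in> U" using Y(3) by auto
    moreover have "F X' = F X" by (rule depends_only_onD[OF S(2)]) (auto simp: X'_def)
    ultimately show "\<bar>F X\<bar> \<le> \<bar>F (\<lambda>_. 0)\<bar> + 1" by (auto simp: U_def)
  qed
qed


abbreviation index_lists :: "'a set \<Rightarrow> nat \<Rightarrow> 'a list set" where
  "index_lists I q \<equiv> {ps. set ps \<subseteq> I \<and> length ps = q}"

text \<open>A coordinate is a stencil vector paired with a basis vector, and a monomial is a list of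
  coordinates. Monomials that differ in the order of factors are kept apart, which spares
  multinomial coefficients.\<close>

definition stencil_monomial :: "('i \<Rightarrow> 'w::real_inner) \<Rightarrow> ('i \<times> 'w) list \<Rightarrow> real" where
  "stencil_monomial X ps = (\<Prod>p\<leftarrow>ps. X (fst p) \<bullet> snd p)"

lemma stencil_monomial_scale:
  "stencil_monomial (\<lambda>i. t *\<^sub>R X i) ps = t ^ length ps * stencil_monomial X ps"
  by (induction ps) (auto simp: stencil_monomial_def)

lemma sum_index_lists_Suc:
  "(\<Sum>ps\<in>index_lists I (Suc q). f ps) = (\<Sum>p\<in>I. \<Sum>qs\<in>index_lists I q. f (p # qs))"
proof -
  have "index_lists I (Suc q) = (\<lambda>(p,qs). p # qs) ` (I \<times> index_lists I q)"
    by (auto simp: image_iff length_Suc_conv)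
  moreover have "inj_on (\<lambda>(p,qs). p # qs) (I \<times> index_lists I q)" by (auto simp: inj_on_def)
  ultimately show ?thesis
    by (simp add: sum.reindex sum.cartesian_product case_prod_unfold)
qed

text \<open>Induction on the order: the partial derivatives are expanded to order \<open>m\<close>
  and integrated along the ray from 0 to \<open>X\<close>. Of the coefficients only those of degree
  0 and 1 are identified, because these are the terms that linearisation at 0 subtracts.\<close>

lemma taylor_stencil:
  fixes G :: "('i \<Rightarrow> 'w::euclidean_space) \<Rightarrow> real"
  assumes S: "finite S" and "depends_only_on S G" "class_C m G"
  shows "\<exists>c C e. e > 0 \<and> (m \<ge> 1 \<longrightarrow> c [] = G (\<lambda>_. 0)) \<and>
    (m \<ge> 2 \<longrightarrow> (\<forall>p\<in>S \<times> Basis. c [p] = first_variation G (\<lambda>_. 0) (stencil_unit p))) \<and>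
    (\<forall>X. (\<forall>s\<in>S. norm (X s) \<le> e) \<longrightarrow>
      \<bar>G X - (\<Sum>q<m. \<Sum>ps\<in>index_lists (S \<times> Basis) q. c ps * stencil_monomial X ps)\<bar>
        \<le> C * (\<Sum>s\<in>S. norm (X s)) ^ m)"
  using assms(2,3)
proof (induction m arbitrary: G)
  case 0
  from 0 have "continuous_on UNIV G" by simp
  from bounded_near_zero[OF this S 0(1)] obtain e where
    "e > 0" "\<And>X. (\<And>s. s \<in> S \<Longrightarrow> norm (X s) \<le> e) \<Longrightarrow> \<bar>G X\<bar> \<le> \<bar>G (\<lambda>_. 0)\<bar> + 1" by metis
  then show ?case by (intro exI[of _ "\<lambda>_. 0"] exI[of _ "\<bar>G (\<lambda>_. 0)\<bar> + 1"] exI[of _ e]) auto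
next
  case (Suc m)
  let ?I = "S \<times> (Basis :: 'w set)"
  let ?G = "\<lambda>p g. first_variation G g (stencil_unit p)"
  note G = \<open>class_C (Suc m) G\<close>
  have finI: "finite ?I" using S by auto
  have "\<forall>p. \<exists>c C e. e > 0 \<and> (m \<ge> 1 \<longrightarrow> c [] = ?G p (\<lambda>_. 0)) \<and>
    (\<forall>X. (\<forall>s\<in>S. norm (X s) \<le> e) \<longrightarrow>
      \<bar>?G p X - (\<Sum>q<m. \<Sum>ps\<in>index_lists ?I q. c ps * stencil_monomial X ps)\<bar>
        \<le> C * (\<Sum>s\<in>S. norm (X s)) ^ m)"
  proof
    fix p
    from Suc.IH[OF depends_only_on_first_variation[OF Suc.prems(1)] class_C_Suc_first_variation(2)[OF G], of "stencil_unit p"]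
    show "\<exists>c C e. e > 0 \<and> (m \<ge> 1 \<longrightarrow> c [] = ?G p (\<lambda>_. 0)) \<and>
    (\<forall>X. (\<forall>s\<in>S. norm (X s) \<le> e) \<longrightarrow>
      \<bar>?G p X - (\<Sum>q<m. \<Sum>ps\<in>index_lists ?I q. c ps * stencil_monomial X ps)\<bar>
        \<le> C * (\<Sum>s\<in>S. norm (X s)) ^ m)"
      by meson
  qed
  then obtain c' C' e' where P: "\<forall>p. e' p > 0 \<and> (m \<ge> 1 \<longrightarrow> c' p [] = ?G p (\<lambda>_. 0)) \<and>
    (\<forall>X. (\<forall>s\<in>S. norm (X s) \<le> e' p) \<longrightarrow>
      \<bar>?G p X - (\<Sum>q<m. \<Sum>ps\<in>index_lists ?I q. c' p ps * stencil_monomial X ps)\<bar>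
        \<le> C' p * (\<Sum>s\<in>S. norm (X s)) ^ m)"
    unfolding choice_iff by (elim exE) (rule that)
  have e': "e' p > 0" for p using spec[OF P, of p] by (elim conjE)
  have c': "m \<ge> 1 \<Longrightarrow> c' p [] = ?G p (\<lambda>_. 0)" for p using spec[OF P, of p] by (elim conjE) (rule mp)
  have T: "\<forall>s\<in>S. norm (X s) \<le> e' p \<Longrightarrow>
      \<bar>?G p X - (\<Sum>q<m. \<Sum>ps\<in>index_lists ?I q. c' p ps * stencil_monomial X ps)\<bar>
        \<le> C' p * (\<Sum>s\<in>S. norm (X s)) ^ m" for p X using spec[OF P, of p] by (elim conjE) (drule spec[of _ X], erule mp)
  define e where "e = Min (insert 1 (e' ` ?I))"
  have e: "e > 0" using finI e' by (auto simp: e_def)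
  have ele: "e \<le> e' p" if "p \<in> ?I" for p using finI that by (auto simp: e_def)
  define C where "C = (\<Sum>p\<in>?I. \<bar>C' p\<bar>)"
  \<comment> \<open>Integration along the ray divides a term of degree q of a partial derivative by
    q + 1.\<close>
  define c where "c = (\<lambda>ps. case ps of [] \<Rightarrow> G (\<lambda>_. 0) | p # qs \<Rightarrow> c' p qs / (length qs + 1))"
  have main: "\<bar>G X - (\<Sum>q<Suc m. \<Sum>ps\<in>index_lists ?I q. c ps * stencil_monomial X ps)\<bar>
        \<le> C * (\<Sum>s\<in>S. norm (X s)) ^ Suc m" if X: "\<forall>s\<in>S. norm (X s) \<le> e" for X
  proof -
    define N where "N = (\<Sum>s\<in>S. norm (X s))"
    have N0: "N \<ge> 0" by (auto simp: N_def intro: sum_nonneg)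
    have NX: "norm (X s) \<le> N" if "s \<in> S" for s
      unfolding N_def by (rule member_le_sum) (use that S in auto)
    let ?x = "\<lambda>p. X (fst p) \<bullet> snd p"
    have xN: "\<bar>?x p\<bar> \<le> N" if "p \<in> ?I" for p
    proof -
      have "\<bar>?x p\<bar> \<le> norm (X (fst p)) * norm (snd p)" by (rule Cauchy_Schwarz_ineq2)
      also have "\<dots> \<le> N" using that NX by auto
      finally show ?thesis .
    qed
    \<comment> \<open>\<open>psi t\<close> is the error of the expansion at \<open>t X\<close>, up
      to the constant term. By the chain rule its derivative \<open>psi'\<close> combines the errors
      of the partial derivatives, each weighted by a coordinate of \<open>X\<close>; that weight is
      the additional factor \<open>N\<close> in the remainder.\<close>
    define psi where "psi = (\<lambda>t. G (\<lambda>i. 0 + t *\<^sub>R X i)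
      - (\<Sum>q<m. \<Sum>qs\<in>index_lists ?I q. \<Sum>p\<in>?I. t ^ Suc q * (?x p * c' p qs * stencil_monomial X qs / Suc q)))"
    define psi' where "psi' = (\<lambda>t. \<Sum>p\<in>?I. ?x p * (?G p (\<lambda>i. 0 + t *\<^sub>R X i)
      - (\<Sum>q<m. \<Sum>qs\<in>index_lists ?I q. c' p qs * stencil_monomial (\<lambda>i. 0 + t *\<^sub>R X i) qs)))"
    have D: "(psi has_real_derivative psi' t) (at t)" for t
    proof -
      have pw: "((\<lambda>t. t ^ Suc q * (a / Suc q)) has_real_derivative t ^ q * a) (at t)" for a q
        by (rule derivative_eq_intros refl | simp)+
      have "(psi has_real_derivative first_variation G (\<lambda>i. 0 + t *\<^sub>R X i) X
        - (\<Sum>q<m. \<Sum>qs\<in>index_lists ?I q. \<Sum>p\<in>?I. t ^ q * (?x p * c' p qs * stencil_monomial X qs))) (at t)"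
        unfolding psi_def by (intro DERIV_diff DERIV_first_variation[OF G] DERIV_sum pw)
      moreover have "first_variation G (\<lambda>i. 0 + t *\<^sub>R X i) X
        - (\<Sum>q<m. \<Sum>qs\<in>index_lists ?I q. \<Sum>p\<in>?I. t ^ q * (?x p * c' p qs * stencil_monomial X qs)) = psi' t"
      proof -
        have "(\<Sum>q<m. \<Sum>qs\<in>index_lists ?I q. \<Sum>p\<in>?I. t ^ q * (?x p * c' p qs * stencil_monomial X qs))
          = (\<Sum>q<m. \<Sum>p\<in>?I. \<Sum>qs\<in>index_lists ?I q. t ^ q * (?x p * c' p qs * stencil_monomial X qs))"
          by (intro sum.cong refl sum.swap)
        also have "\<dots> = (\<Sum>p\<in>?I. \<Sum>q<m. \<Sum>qs\<in>index_lists ?I q. t ^ q * (?x p * c' p qs * stencil_monomial X qs))"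
          by (rule sum.swap)
        also have "\<dots> = (\<Sum>p\<in>?I. ?x p * (\<Sum>q<m. \<Sum>qs\<in>index_lists ?I q. c' p qs * stencil_monomial (\<lambda>i. 0 + t *\<^sub>R X i) qs))"
          by (simp add: sum_distrib_left stencil_monomial_scale mult_ac)
        finally show ?thesis
          unfolding psi'_def first_variation_expand[OF G S Suc.prems(1), of _ X]
          by (simp add: right_diff_distrib sum_subtractf)
      qed
      ultimately show ?thesis by simp
    qed
    have bd: "norm (psi' t) \<le> C * N ^ Suc m" if t: "t \<in> {0..1}" for t
    proof -
      have "norm (psi' t) \<le> (\<Sum>p\<in>?I. N * (\<bar>C' p\<bar> * N ^ m))"
        unfolding psi'_def real_norm_def
      proof (rule order_trans[OF sum_abs], rule sum_mono)
        fix p assume p: "p \<in> ?I"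
        let ?Y = "\<lambda>i. 0 + t *\<^sub>R X i"
        have Y: "norm (?Y s) \<le> norm (X s)" for s using t by (simp add: mult_left_le_one_le)
        have "\<forall>s\<in>S. norm (?Y s) \<le> e' p" using X ele[OF p] Y by (meson order_trans)
        from T[OF this]
        have "\<bar>?G p ?Y - (\<Sum>q<m. \<Sum>ps\<in>index_lists ?I q. c' p ps * stencil_monomial ?Y ps)\<bar>
          \<le> C' p * (\<Sum>s\<in>S. norm (?Y s)) ^ m" .
        also have "\<dots> \<le> \<bar>C' p\<bar> * N ^ m"
          unfolding N_def by (intro mult_mono power_mono sum_mono Y abs_ge_self sum_nonneg zero_le_power) auto
        finally show "\<bar>?x p * (?G p ?Y - (\<Sum>q<m. \<Sum>ps\<in>index_lists ?I q. c' p ps * stencil_monomial ?Y ps))\<bar>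
          \<le> N * (\<bar>C' p\<bar> * N ^ m)"
          unfolding abs_mult by (intro mult_mono xN p N0) auto
      qed
      also have "\<dots> = C * N ^ Suc m" by (simp add: C_def sum_distrib_right sum_distrib_left mult_ac)
      finally show ?thesis .
    qed
    have "norm (psi 1 - psi 0) \<le> (C * N ^ Suc m) * norm (1 - 0 :: real)"
      by (rule field_differentiable_bound[where S = "{0..1}" and f' = psi'])
         (use bd has_field_derivative_at_within[OF D] in auto)
    moreover have "psi 1 - psi 0 = G X - (\<Sum>q<Suc m. \<Sum>ps\<in>index_lists ?I q. c ps * stencil_monomial X ps)"
    proof -
      have "(\<Sum>q<Suc m. \<Sum>ps\<in>index_lists ?I q. c ps * stencil_monomial X ps)
        = (\<Sum>ps\<in>index_lists ?I 0. c ps * stencil_monomial X ps)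
          + (\<Sum>q<m. \<Sum>ps\<in>index_lists ?I (Suc q). c ps * stencil_monomial X ps)"
        by (rule sum.lessThan_Suc_shift)
      also have "index_lists ?I 0 = {[]}" by auto
      also have "(\<Sum>q<m. \<Sum>ps\<in>index_lists ?I (Suc q). c ps * stencil_monomial X ps)
        = (\<Sum>q<m. \<Sum>qs\<in>index_lists ?I q. \<Sum>p\<in>?I. c (p # qs) * stencil_monomial X (p # qs))"
        unfolding sum_index_lists_Suc by (intro sum.cong refl sum.swap)
      also have "\<dots> = (\<Sum>q<m. \<Sum>qs\<in>index_lists ?I q. \<Sum>p\<in>?I. ?x p * c' p qs * stencil_monomial X qs / Suc q)"
        by (intro sum.cong refl) (auto simp: c_def stencil_monomial_def)
      finally show ?thesis by (simp add: psi_def c_def stencil_monomial_def)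
    qed
    ultimately show ?thesis by (simp add: N_def)
  qed
  have "c [] = G (\<lambda>_. 0)" by (simp add: c_def)
  moreover have "Suc m \<ge> 2 \<longrightarrow> (\<forall>p\<in>?I. c [p] = ?G p (\<lambda>_. 0))"
    using c' by (auto simp: c_def)
  ultimately show ?case using e main by blast
qed

section \<open>The second variation as a symmetric bilinear form\<close>

lemma second_variation_eq:
  "second_variation F g h h' = first_variation (\<lambda>g. first_variation F g h') g h"
  by (simp add: second_variation_def first_variation_def)

lemma class_C_mono: "class_C k F \<Longrightarrow> j \<le> k \<Longrightarrow> class_C j F"
proof (induction k)
  case (Suc k) then show ?case using class_C_SucD by (cases "j = Suc k") auto
qed simp

lemma second_variation_sym:
  "class_C (Suc (Suc k)) F \<Longrightarrow> second_variation F g h h' = second_variation F g h' h"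
  unfolding second_variation_eq by (rule first_variation_commute)

lemma second_variation_add:
  assumes "class_C (Suc (Suc k)) F"
  shows "second_variation F g (\<lambda>i. h1 i + h2 i) h' = second_variation F g h1 h' + second_variation F g h2 h'"
  unfolding second_variation_eq by (rule first_variation_add[OF class_C_Suc_first_variation(2)[OF assms]])

lemma second_variation_scale:
  assumes "class_C (Suc (Suc k)) F"
  shows "second_variation F g (\<lambda>i. c *\<^sub>R h i) h' = c * second_variation F g h h'"
  unfolding second_variation_eq by (rule first_variation_scale[OF class_C_Suc_first_variation(2)[OF assms]])

lemma second_variation_depends:
  assumes "depends_only_on S F" "\<And>i. i \<in> S \<Longrightarrow> h1 i = h2 i" "\<And>i. i \<in> S \<Longrightarrow> h1' i = h2' i"
  shows "second_variation F g h1 h1' = second_variation F g h2 h2'"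
proof -
  have "first_variation F g' h1' = first_variation F g' h2'" for g'
    by (rule first_variation_depends[OF assms(1)]) (auto simp: assms(3))
  then have "(\<lambda>g. first_variation F g h1') = (\<lambda>g. first_variation F g h2')" by auto
  then have "second_variation F g h1 h1' = first_variation (\<lambda>g. first_variation F g h2') g h1"
    by (simp add: second_variation_eq)
  also have "\<dots> = first_variation (\<lambda>g. first_variation F g h2') g h2"
    by (rule first_variation_depends[OF depends_only_on_first_variation[OF assms(1)] refl]) (simp add: assms(2))
  finally show ?thesis by (simp add: second_variation_eq)
qed

lemma second_variation_sum:
  assumes F: "class_C (Suc (Suc k)) F" and fin: "finite J"
  shows "second_variation F g (\<lambda>i. \<Sum>j\<in>J. h j i) h' = (\<Sum>j\<in>J. second_variation F g (h j) h')"
  unfolding second_variation_eq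
  using first_variation_sum[OF class_C_Suc_first_variation(2)[OF F] fin, where c = "\<lambda>_. 1" and h = h and g = g] by simp

lemma second_variation_stencil:
  fixes F :: "('i \<Rightarrow> 'w::real_normed_vector) \<Rightarrow> real"
  assumes F: "class_C (Suc (Suc k)) F" "depends_only_on S F" "finite S"
  shows "second_variation F g h h'
    = (\<Sum>\<rho>\<in>S. \<Sum>\<sigma>\<in>S. second_variation F g (stencil_unit (\<rho>, h \<rho>)) (stencil_unit (\<sigma>, h' \<sigma>)))"
proof -
  have unit: "(\<Sum>\<rho>\<in>S. stencil_unit (\<rho>, h \<rho>) i) = h i" if "i \<in> S" for i and h :: "'i \<Rightarrow> 'w"
    using that F(3) by (simp add: stencil_unit_def)
  have "second_variation F g h h' = second_variation F g (\<lambda>i. \<Sum>\<rho>\<in>S. stencil_unit (\<rho>, h \<rho>) i) h'"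
    by (rule second_variation_depends[OF F(2)]) (auto simp: unit)
  also have "\<dots> = (\<Sum>\<rho>\<in>S. second_variation F g (stencil_unit (\<rho>, h \<rho>)) h')"
    by (rule second_variation_sum[OF F(1,3)])
  also have "\<dots> = (\<Sum>\<rho>\<in>S. \<Sum>\<sigma>\<in>S. second_variation F g (stencil_unit (\<rho>, h \<rho>)) (stencil_unit (\<sigma>, h' \<sigma>)))"
  proof (rule sum.cong[OF refl])
    fix \<rho>
    let ?e = "stencil_unit (\<rho>, h \<rho>)"
    have "second_variation F g ?e h' = second_variation F g h' ?e" by (rule second_variation_sym[OF F(1)])
    also have "\<dots> = second_variation F g (\<lambda>i. \<Sum>\<sigma>\<in>S. stencil_unit (\<sigma>, h' \<sigma>) i) ?e"
      by (rule second_variation_depends[OF F(2)]) (auto simp: unit)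
    also have "\<dots> = (\<Sum>\<sigma>\<in>S. second_variation F g (stencil_unit (\<sigma>, h' \<sigma>)) ?e)"
      by (rule second_variation_sum[OF F(1,3)])
    also have "\<dots> = (\<Sum>\<sigma>\<in>S. second_variation F g ?e (stencil_unit (\<sigma>, h' \<sigma>)))"
      by (intro sum.cong refl second_variation_sym[OF F(1)])
    finally show "second_variation F g ?e h' = (\<Sum>\<sigma>\<in>S. second_variation F g ?e (stencil_unit (\<sigma>, h' \<sigma>)))" .
  qed
  finally show ?thesis .
qed

lemma bounded_bilinear_second_variation:
  fixes F :: "('i \<Rightarrow> 'w::euclidean_space) \<Rightarrow> real"
  assumes F: "class_C (Suc (Suc k)) F"
  shows "bounded_bilinear (\<lambda>x y. second_variation F g (stencil_unit (\<rho>, x)) (stencil_unit (\<sigma>, y)))"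
proof -
  have add: "stencil_unit (\<rho>, x + y) = (\<lambda>i. stencil_unit (\<rho>, x) i + stencil_unit (\<rho>, y) i)"
    and sc: "stencil_unit (\<rho>, c *\<^sub>R x) = (\<lambda>i. c *\<^sub>R stencil_unit (\<rho>, x) i)" for \<rho> :: 'i and x y :: 'w and c
    by (auto simp: stencil_unit_def)
  have lin: "linear (\<lambda>x. second_variation F g (stencil_unit (\<rho>, x)) h')" for \<rho> h'
    by (rule linearI) (simp_all add: add sc second_variation_add[OF F] second_variation_scale[OF F])
  have "bilinear (\<lambda>x y. second_variation F g (stencil_unit (\<rho>, x)) (stencil_unit (\<sigma>, y)))"
    unfolding bilinear_def using lin[of \<rho>] lin[of \<sigma>] by (simp add: second_variation_sym[OF F, of g "stencil_unit (\<rho>, _)"])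
  then show ?thesis by (simp add: bilinear_conv_bounded_bilinear)
qed

section \<open>Finite differences on the integer lattice\<close>

definition fdiff :: "'z::plus \<Rightarrow> ('z \<Rightarrow> 'b::minus) \<Rightarrow> 'z \<Rightarrow> 'b" where
  "fdiff \<xi> u = (\<lambda>x. u (x + \<xi>) - u x)"

text \<open>The maximum norm with natural values: radii of cubes can then be divided with rounding
  and serve for induction, as in \<open>tail_decay\<close>.\<close>

definition supnorm :: "int^'n \<Rightarrow> nat" where
  "supnorm x = Max (range (\<lambda>i. nat \<bar>x $ i\<bar>))"

definition cube :: "nat \<Rightarrow> int^'n \<Rightarrow> (int^'n) set" where
  "cube N z = {x. supnorm (x - z) \<le> N}"

lemma supnorm_le_iff: "supnorm x \<le> N \<longleftrightarrow> (\<forall>i. \<bar>x $ i\<bar> \<le> int N)"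
  unfolding supnorm_def by (subst Max_le_iff) (auto simp: nat_le_iff)

lemma supnorm_component: "\<bar>x $ i\<bar> \<le> int (supnorm x)"
  using supnorm_le_iff[of x "supnorm x"] by simp

lemma supnorm_attained: "\<exists>i. \<bar>x $ i\<bar> = int (supnorm x)"
proof -
  have "supnorm x \<in> range (\<lambda>i. nat \<bar>x $ i\<bar>)"
    unfolding supnorm_def by (rule Max_in) auto
  then show ?thesis by auto
qed

lemma supnorm_add: "supnorm (x + y) \<le> supnorm x + supnorm y"
proof -
  have "\<bar>x $ i + y $ i\<bar> \<le> int (supnorm x + supnorm y)" for i
    using supnorm_component[of x i] supnorm_component[of y i] by linarith
  then show ?thesis unfolding supnorm_le_iff by simp
qed

lemma supnorm_minus [simp]: "supnorm (- x) = supnorm x"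
  by (simp add: supnorm_def)

lemma supnorm_zero [simp]: "supnorm 0 = 0"
  by (simp add: supnorm_def)

lemma supnorm_eq_0: "supnorm x = 0 \<longleftrightarrow> x = 0"
proof
  assume "supnorm x = 0"
  then have "x $ i = 0" for i using supnorm_component[of x i] by simp
  then show "x = 0" by (simp add: vec_eq_iff)
qed simp

lemma supnorm_diff: "supnorm (x - y) \<le> supnorm x + supnorm y"
  using supnorm_add[of x "- y"] by simp

lemma supnorm_axis [simp]: "supnorm (axis i m) = nat \<bar>m\<bar>"
proof (rule antisym)
  show "supnorm (axis i m) \<le> nat \<bar>m\<bar>" unfolding supnorm_le_iff by (auto simp: axis_def)
  show "nat \<bar>m\<bar> \<le> supnorm (axis i m)" using supnorm_component[of "axis i m" i] by (simp add: axis_def)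
qed

lemma cube_iff: "x \<in> cube N z \<longleftrightarrow> (\<forall>i. \<bar>x $ i - z $ i\<bar> \<le> int N)"
  by (simp add: cube_def supnorm_le_iff)

lemma cube_mono: "M \<le> N \<Longrightarrow> cube M z \<subseteq> cube N z"
  by (auto simp: cube_def)

lemma cube_add: "x \<in> cube N z \<Longrightarrow> supnorm \<xi> \<le> p \<Longrightarrow> x + \<xi> \<in> cube (N + p) z"
  using supnorm_add[of "x - z" \<xi>] by (auto simp: cube_def algebra_simps)

lemma cube_trans: "x \<in> cube N y \<Longrightarrow> y \<in> cube M z \<Longrightarrow> x \<in> cube (N + M) z"
  using supnorm_add[of "x - y" "y - z"] by (auto simp: cube_def)

lemma cube_sym: "x \<in> cube N y \<longleftrightarrow> y \<in> cube N x"
  using supnorm_minus[of "x - y"] by (simp add: cube_def del: supnorm_minus)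

lemma mem_cube_self [simp]: "z \<in> cube N z" by (simp add: cube_def)

lemma cube_bij: "bij_betw (\<lambda>x i. x $ i) (cube N (z::int^'n)) (PiE UNIV (\<lambda>i. {z $ i - int N..z $ i + int N}))"
proof (rule bij_betwI[where g = vec_lambda])
  show "(\<lambda>x i. x $ i) \<in> cube N z \<rightarrow> (\<Pi>\<^sub>E i\<in>UNIV. {z $ i - int N..z $ i + int N})"
    by (auto simp: cube_iff abs_le_iff) (smt (verit))+
  show "vec_lambda \<in> (\<Pi>\<^sub>E i\<in>UNIV. {z $ i - int N..z $ i + int N}) \<rightarrow> cube N z"
    by (auto simp: cube_iff PiE_iff abs_le_iff) (smt (verit))+
qed (auto simp: vec_lambda_inverse)

lemma finite_cube [simp]: "finite (cube N z)"
  using bij_betw_finite[OF cube_bij[of N z]] by (simp add: finite_PiE)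

lemma card_cube: "card (cube N (z::int^'n)) = (2 * N + 1) ^ CARD('n)"
proof -
  have "nat (2 * int N + 1) = 2 * N + 1" by simp
  then show ?thesis using bij_betw_same_card[OF cube_bij[of N z]] by (simp add: card_PiE)
qed

lemma finite_subset_cube:
  assumes "finite F" obtains N where "F \<subseteq> cube N 0"
proof
  show "F \<subseteq> cube (Max (insert 0 (supnorm ` F))) 0"
    using assms by (auto simp: cube_def)
qed

subsection \<open>Square-summable lattice functions\<close>

abbreviation summable_sq :: "('z \<Rightarrow> 'b::real_normed_vector) \<Rightarrow> bool" where
  "summable_sq f \<equiv> (\<lambda>x. (norm (f x))\<^sup>2) summable_on UNIV"

abbreviation sum_sq :: "('z \<Rightarrow> 'b::real_normed_vector) \<Rightarrow> real" where
  "sum_sq f \<equiv> infsum (\<lambda>x. (norm (f x))\<^sup>2) UNIV"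

lemma bij_shift: "bij (\<lambda>x::'z::group_add. x + \<xi>)"
  by (rule bijI') (auto intro: exI[of _ "y - \<xi>" for y])

lemma summable_shift: "f summable_on UNIV \<Longrightarrow> (\<lambda>x::'z::group_add. f (x + \<xi>)) summable_on UNIV"
  using summable_on_reindex_bij_betw[OF bij_shift[of \<xi>], of f] by simp

lemma infsum_shift: "infsum (\<lambda>x::'z::group_add. f (x + \<xi>)) UNIV = infsum f UNIV"
  using infsum_reindex_bij_betw[OF bij_shift[of \<xi>], of f] by simp

lemma infsum_dominated:
  fixes f g :: "'z \<Rightarrow> real"
  assumes "g summable_on UNIV" "\<And>x. 0 \<le> f x" "\<And>x. f x \<le> g x"
  shows "f summable_on UNIV" "infsum f UNIV \<le> infsum g UNIV"
proof -
  show s: "f summable_on UNIV" by (rule summable_on_comparison_test[OF assms(1)]) (use assms in auto)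
  show "infsum f UNIV \<le> infsum g UNIV" by (rule infsum_mono[OF s assms(1)]) (use assms in auto)
qed

lemma summable_on_sum':
  fixes f :: "'i \<Rightarrow> 'z \<Rightarrow> real"
  assumes "finite I" "\<And>i. i \<in> I \<Longrightarrow> f i summable_on A"
  shows "(\<lambda>x. \<Sum>i\<in>I. f i x) summable_on A \<and> infsum (\<lambda>x. \<Sum>i\<in>I. f i x) A = (\<Sum>i\<in>I. infsum (f i) A)"
  using assms by (induction I rule: finite_induct) (auto simp: summable_on_add infsum_add)

lemma norm_sum_sq_le:
  fixes f :: "'i \<Rightarrow> 'b::real_normed_vector"
  assumes "finite I"
  shows "(norm (\<Sum>i\<in>I. f i))\<^sup>2 \<le> card I * (\<Sum>i\<in>I. (norm (f i))\<^sup>2)"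
proof -
  have "(norm (\<Sum>i\<in>I. f i))\<^sup>2 \<le> (\<Sum>i\<in>I. norm (f i) * 1)\<^sup>2"
    using norm_sum[of f I] by (intro power_mono) auto
  also have "\<dots> \<le> (\<Sum>i\<in>I. (norm (f i))\<^sup>2) * (\<Sum>i\<in>I. 1\<^sup>2)"
    by (rule Cauchy_Schwarz_ineq_sum)
  finally show ?thesis by (simp add: mult.commute)
qed

lemma norm_add_sq_le: "(norm (a + b))\<^sup>2 \<le> 2 * (norm a)\<^sup>2 + 2 * (norm (b::'b::real_normed_vector))\<^sup>2"
proof -
  have "(norm (a + b))\<^sup>2 \<le> (norm a + norm b)\<^sup>2" by (intro power_mono norm_triangle_ineq) auto
  also have "\<dots> \<le> 2 * (norm a)\<^sup>2 + 2 * (norm b)\<^sup>2"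
    using sum_squares_bound[of "norm a" "norm b"] by (simp add: power2_sum)
  finally show ?thesis .
qed

lemma norm_diff_sq_le: "(norm (a - b))\<^sup>2 \<le> 2 * (norm a)\<^sup>2 + 2 * (norm (b::'b::real_normed_vector))\<^sup>2"
  using norm_add_sq_le[of a "- b"] by simp

lemma sum_sq_add_le:
  assumes "summable_sq f" "summable_sq g"
  shows "summable_sq (\<lambda>x. f x + g x)" "sum_sq (\<lambda>x. f x + g x) \<le> 2 * sum_sq f + 2 * sum_sq g"
proof -
  have s: "(\<lambda>x. 2 * (norm (f x))\<^sup>2 + 2 * (norm (g x))\<^sup>2) summable_on UNIV"
    by (intro summable_on_add summable_on_cmult_right assms)
  have e: "infsum (\<lambda>x. 2 * (norm (f x))\<^sup>2 + 2 * (norm (g x))\<^sup>2) UNIV = 2 * sum_sq f + 2 * sum_sq g"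
    by (simp add: infsum_add infsum_cmult_right summable_on_cmult_right assms)
  show "summable_sq (\<lambda>x. f x + g x)" "sum_sq (\<lambda>x. f x + g x) \<le> 2 * sum_sq f + 2 * sum_sq g"
    using infsum_dominated[OF s, of "\<lambda>x. (norm (f x + g x))\<^sup>2"] norm_add_sq_le e by auto
qed

lemma sum_sq_sum_le:
  assumes "finite I" "\<And>i. i \<in> I \<Longrightarrow> summable_sq (f i)"
  shows "summable_sq (\<lambda>x. \<Sum>i\<in>I. f i x)" "sum_sq (\<lambda>x. \<Sum>i\<in>I. f i x) \<le> card I * (\<Sum>i\<in>I. sum_sq (f i))"
proof -
  have s: "(\<lambda>x. card I * (\<Sum>i\<in>I. (norm (f i x))\<^sup>2)) summable_on UNIV"
    using summable_on_sum'[OF assms] by (intro summable_on_cmult_right) auto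
  have e: "infsum (\<lambda>x. card I * (\<Sum>i\<in>I. (norm (f i x))\<^sup>2)) UNIV = card I * (\<Sum>i\<in>I. sum_sq (f i))"
    using summable_on_sum'[OF assms] by (simp add: infsum_cmult_right)
  show "summable_sq (\<lambda>x. \<Sum>i\<in>I. f i x)" "sum_sq (\<lambda>x. \<Sum>i\<in>I. f i x) \<le> card I * (\<Sum>i\<in>I. sum_sq (f i))"
    using infsum_dominated[OF s, of "\<lambda>x. (norm (\<Sum>i\<in>I. f i x))\<^sup>2"] norm_sum_sq_le[OF assms(1)] e by auto
qed

lemma summable_tail:
  fixes f :: "int^'n \<Rightarrow> real"
  assumes f: "f summable_on UNIV" "\<And>x. f x \<ge> 0" and e: "e > 0"
  obtains L where "infsum f (- cube L 0) < e"
proof -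
  obtain F where F: "finite F" "F \<subseteq> UNIV" "dist (sum f F) (infsum f UNIV) \<le> e/2"
    using infsum_finite_approximation[OF f(1), of "e/2"] e by auto
  obtain L where L: "F \<subseteq> cube L 0" using finite_subset_cube[OF F(1)] .
  have "infsum f (cube L 0 \<union> - cube L 0) = infsum f (cube L 0) + infsum f (- cube L 0)"
    by (rule infsum_Un_disjoint) (auto intro: summable_on_subset_banach[OF f(1)])
  moreover have "sum f F \<le> sum f (cube L 0)"
    by (rule sum_mono2) (use L f in auto)
  ultimately have "infsum f (- cube L 0) < e"
    using F(3) e unfolding dist_real_def by (simp only: Compl_partition infsum_finite finite_cube)
  then show thesis using that by blast
qed

subsection \<open>Functions of finite energy\<close>

text \<open>Finiteness gives interactions of bounded range. The unit vectors connect the lattice by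
  stencil steps, so that the energy controls differences along every vector.\<close>

locale lattice_stencil =
  fixes P :: "(int^'n) set"
  assumes finite_stencil: "finite P" and axis_stencil: "axis i 1 \<in> P"
begin

definition dens :: "(int^'n \<Rightarrow> 'b::real_normed_vector) \<Rightarrow> int^'n \<Rightarrow> real" where
  "dens u x = (\<Sum>\<rho>\<in>P. (norm (fdiff \<rho> u x))\<^sup>2)"

definition finite_energy :: "(int^'n \<Rightarrow> 'b::real_normed_vector) \<Rightarrow> bool" where
  "finite_energy u \<longleftrightarrow> dens u summable_on UNIV"

definition energy :: "(int^'n \<Rightarrow> 'b::real_normed_vector) \<Rightarrow> real" where
  "energy u = infsum (dens u) UNIV"

definition range_bound :: nat where
  "range_bound = Max (supnorm ` P)"

lemma supnorm_stencil: "\<rho> \<in> P \<Longrightarrow> supnorm \<rho> \<le> range_bound"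
  unfolding range_bound_def using finite_stencil by auto

lemma range_bound_ge_1: "range_bound \<ge> 1"
  using supnorm_stencil[OF axis_stencil[of undefined]] by simp

lemma dens_nonneg [simp]: "dens u x \<ge> 0"
  unfolding dens_def by (intro sum_nonneg) auto

lemma energy_nonneg [simp]: "energy u \<ge> 0"
  unfolding energy_def by (intro infsum_nonneg) auto

lemma dens_ge: "\<rho> \<in> P \<Longrightarrow> (norm (fdiff \<rho> u x))\<^sup>2 \<le> dens u x"
  unfolding dens_def by (rule member_le_sum) (auto simp: finite_stencil)

lemma energy_stencil:
  assumes "finite_energy u" "\<rho> \<in> P"
  shows "summable_sq (fdiff \<rho> u)" "sum_sq (fdiff \<rho> u) \<le> energy u"
  using infsum_dominated[of "dens u" "\<lambda>x. (norm (fdiff \<rho> u x))\<^sup>2"] assms dens_ge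
  unfolding finite_energy_def energy_def by auto

lemma finite_energyI:
  assumes "\<And>\<rho>. \<rho> \<in> P \<Longrightarrow> summable_sq (fdiff \<rho> u)"
  shows "finite_energy u" "energy u = (\<Sum>\<rho>\<in>P. sum_sq (fdiff \<rho> u))"
  using summable_on_sum'[OF finite_stencil assms]
  unfolding finite_energy_def energy_def dens_def by auto

lemma dens_sum_le_energy:
  assumes "finite_energy u" "finite F" shows "sum (dens u) F \<le> energy u"
  unfolding energy_def by (rule finite_sum_le_infsum) (use assms in \<open>auto simp: finite_energy_def\<close>)

lemma fdiff_fsupp:
  fixes u :: "int^'n \<Rightarrow> 'b::real_vector"
  assumes "finite {x. u x \<noteq> 0}" shows "finite {x. fdiff \<xi> u x \<noteq> 0}"
proof (rule finite_subset)
  show "{x. fdiff \<xi> u x \<noteq> 0} \<subseteq> {x. u x \<noteq> 0} \<union> (\<lambda>x. x - \<xi>) ` {x. u x \<noteq> 0}"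
  proof
    fix x assume "x \<in> {x. fdiff \<xi> u x \<noteq> 0}"
    then have "u x \<noteq> 0 \<or> u (x + \<xi>) \<noteq> 0" by (auto simp: fdiff_def)
    moreover have "u (x + \<xi>) \<noteq> 0 \<Longrightarrow> x \<in> (\<lambda>x. x - \<xi>) ` {x. u x \<noteq> 0}"
      by (rule image_eqI[of _ _ "x + \<xi>"]) auto
    ultimately show "x \<in> {x. u x \<noteq> 0} \<union> (\<lambda>x. x - \<xi>) ` {x. u x \<noteq> 0}"
      by blast
  qed
qed (use assms in auto)

lemma summable_on_fsupp:
  fixes f :: "'z \<Rightarrow> 'c::{topological_comm_monoid_add,t2_space}"
  assumes "finite {x. f x \<noteq> 0}"
  shows "f summable_on UNIV"
proof -
  have "f summable_on {x. f x \<noteq> 0} \<longleftrightarrow> f summable_on UNIV"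
    by (rule summable_on_cong_neutral) auto
  then show ?thesis using assms by simp
qed

lemma finite_energy_fsupp:
  assumes "finite {x. u x \<noteq> 0}" shows "finite_energy u"
proof (rule finite_energyI)
  fix \<rho>
  show "summable_sq (fdiff \<rho> u)"
    using fdiff_fsupp[OF assms, of \<rho>] by (intro summable_on_fsupp) simp
qed

lemma energy_add:
  assumes "finite_energy u" "finite_energy v"
  shows "finite_energy (\<lambda>x. u x + v x)" "energy (\<lambda>x. u x + v x) \<le> 2 * energy u + 2 * energy v"
proof -
  have eq: "fdiff \<rho> (\<lambda>x. u x + v x) = (\<lambda>x. fdiff \<rho> u x + fdiff \<rho> v x)" for \<rho> by (auto simp: fdiff_def)
  have s: "summable_sq (fdiff \<rho> (\<lambda>x. u x + v x))" if "\<rho> \<in> P" for \<rho>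
    unfolding eq using that by (intro sum_sq_add_le energy_stencil assms)
  show "finite_energy (\<lambda>x. u x + v x)" by (rule finite_energyI[OF s])
  have "energy (\<lambda>x. u x + v x) = (\<Sum>\<rho>\<in>P. sum_sq (fdiff \<rho> (\<lambda>x. u x + v x)))" by (rule finite_energyI[OF s])
  also have "\<dots> \<le> (\<Sum>\<rho>\<in>P. 2 * sum_sq (fdiff \<rho> u) + 2 * sum_sq (fdiff \<rho> v))"
    unfolding eq by (intro sum_mono sum_sq_add_le energy_stencil assms)
  also have "\<dots> = 2 * energy u + 2 * energy v"
    by (simp add: sum.distrib sum_distrib_left finite_energyI(2)[OF energy_stencil(1)] assms)
  finally show "energy (\<lambda>x. u x + v x) \<le> 2 * energy u + 2 * energy v" .
qed

lemma energy_scale: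
  assumes "finite_energy u"
  shows "finite_energy (\<lambda>x. c *\<^sub>R u x)" "energy (\<lambda>x. c *\<^sub>R u x) = c\<^sup>2 * energy u"
proof -
  have eq: "dens (\<lambda>x. c *\<^sub>R u x) = (\<lambda>x. c\<^sup>2 * dens u x)"
    by (auto simp: dens_def fdiff_def sum_distrib_left power_mult_distrib simp flip: scaleR_diff_right)
  show "finite_energy (\<lambda>x. c *\<^sub>R u x)" "energy (\<lambda>x. c *\<^sub>R u x) = c\<^sup>2 * energy u"
    using assms unfolding finite_energy_def energy_def eq
    by (auto intro: summable_on_cmult_right infsum_cmult_right)
qed

lemma energy_diff:
  assumes "finite_energy u" "finite_energy v"
  shows "finite_energy (\<lambda>x. u x - v x)" "energy (\<lambda>x. u x - v x) \<le> 2 * energy u + 2 * energy v"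
  using energy_add[OF assms(1) energy_scale(1)[OF assms(2), of "-1"]] energy_scale(2)[OF assms(2), of "-1"] by auto

text \<open>A difference along \<open>\<xi>\<close> telescopes into unit steps, one coordinate after
  the other. Cauchy--Schwarz for m steps costs m^2, hence the square of the length; the power of 2
  comes from adding up the coordinates with |a + b|^2 <= 2 |a|^2 + 2 |b|^2.\<close>

lemma energy_fdiff:
  fixes u :: "int^'n \<Rightarrow> 'b::real_normed_vector"
  assumes u: "finite_energy u"
  shows "summable_sq (fdiff \<xi> u)"
    and "sum_sq (fdiff \<xi> u) \<le> 2 ^ (CARD('n) + 1) * (real (supnorm \<xi>))\<^sup>2 * energy u"
proof -
  have pos: "summable_sq (fdiff (axis i (int n)) u) \<and> sum_sq (fdiff (axis i (int n)) u) \<le> (real n)\<^sup>2 * energy u" for i n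
  proof -
    have tele: "fdiff (axis i (int n)) u x = (\<Sum>j<n. fdiff (axis i 1) u (x + axis i (int j)))" for x
    proof (induction n)
      case 0 show ?case by (simp add: fdiff_def axis_def zero_vec_def[symmetric])
    next
      case (Suc n)
      have "axis i (int (Suc n)) = (axis i (int n) + axis i 1 :: int^'n)"
        by (auto simp: axis_def vec_eq_iff)
      then have "fdiff (axis i (int (Suc n))) u x = fdiff (axis i (int n)) u x + fdiff (axis i 1) u (x + axis i (int n))"
        by (simp add: fdiff_def add.assoc)
      then show ?case using Suc by simp
    qed
    have s: "summable_sq (\<lambda>x. fdiff (axis i 1) u (x + axis i (int j)))" for j
      using summable_shift[OF energy_stencil(1)[OF u axis_stencil[of i]], of "axis i (int j)"] .
    have e: "sum_sq (\<lambda>x. fdiff (axis i 1) u (x + axis i (int j))) \<le> energy u" for j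
      using energy_stencil(2)[OF u axis_stencil[of i]]
        infsum_shift[of "\<lambda>x. (norm (fdiff (axis i 1) u x))\<^sup>2" "axis i (int j)"] by simp
    have "sum_sq (\<lambda>x. \<Sum>j<n. fdiff (axis i 1) u (x + axis i (int j))) \<le> card {..<n} * (\<Sum>j<n. sum_sq (\<lambda>x. fdiff (axis i 1) u (x + axis i (int j))))"
      by (rule sum_sq_sum_le[OF _ s]) auto
    also have "\<dots> \<le> card {..<n} * (\<Sum>j<n. energy u)" by (intro mult_left_mono sum_mono e) auto
    finally show ?thesis
      using sum_sq_sum_le(1)[OF _ s, of "{..<n}"] by (simp add: tele power2_eq_square)
  qed
  have coord: "summable_sq (fdiff (axis i m) u) \<and> sum_sq (fdiff (axis i m) u) \<le> (real_of_int \<bar>m\<bar>)\<^sup>2 * energy u" for i m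
  proof (cases "m \<ge> 0")
    case True then show ?thesis using pos[of i "nat m"] by simp
  next
    case False
    then have eq: "norm (fdiff (axis i m) u x) = norm (fdiff (axis i (int (nat (- m)))) u (x + axis i m))" for x
    proof -
      have "axis i m + axis i (- m) = (0 :: int^'n)" by (auto simp: axis_def vec_eq_iff)
      then show ?thesis using False by (simp add: fdiff_def norm_minus_commute add.assoc)
    qed
    show ?thesis
      using summable_shift[of "\<lambda>x. (norm (fdiff (axis i (int (nat (- m)))) u x))\<^sup>2" "axis i m"]
        infsum_shift[of "\<lambda>x. (norm (fdiff (axis i (int (nat (- m)))) u x))\<^sup>2" "axis i m"]
        pos[of i "nat (- m)"] False unfolding eq by simp
  qed
  \<comment> \<open>\<open>part J\<close> keeps the coordinates in \<open>J\<close>. The factor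
    \<open>2 ^ (card J + 1) - 2\<close> is the solution of a' = 2 + 2 a with a = 0 for the empty
    set, the recursion produced by splitting off one coordinate.\<close>
  define part where "part J = (\<chi> i. if i \<in> J then \<xi> $ i else 0)" for J
  have "summable_sq (fdiff (part J) u) \<and>
      sum_sq (fdiff (part J) u) \<le> (2 ^ (card J + 1) - 2) * (real (supnorm \<xi>))\<^sup>2 * energy u" if "finite J" for J
    using that
  proof (induction J rule: finite_induct)
    case empty
    have "part {} = 0" by (simp add: part_def vec_eq_iff)
    then show ?case by (simp add: fdiff_def)
  next
    case (insert i J)
    have split: "part (insert i J) = part J + axis i (\<xi> $ i)"
      using insert(2) by (auto simp: part_def axis_def vec_eq_iff)
    have eq: "fdiff (part (insert i J)) u = (\<lambda>x. fdiff (axis i (\<xi> $ i)) u (x + part J) + fdiff (part J) u x)"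
      unfolding split by (auto simp: fdiff_def add_ac)
    have s1: "summable_sq (\<lambda>x. fdiff (axis i (\<xi> $ i)) u (x + part J))"
      using summable_shift[OF conjunct1[OF coord]] .
    have e1: "sum_sq (\<lambda>x. fdiff (axis i (\<xi> $ i)) u (x + part J)) \<le> (real (supnorm \<xi>))\<^sup>2 * energy u"
    proof -
      have "sum_sq (\<lambda>x. fdiff (axis i (\<xi> $ i)) u (x + part J)) \<le> (real_of_int \<bar>\<xi> $ i\<bar>)\<^sup>2 * energy u"
        using infsum_shift[of "\<lambda>x. (norm (fdiff (axis i (\<xi> $ i)) u x))\<^sup>2" "part J"] coord[of i "\<xi> $ i"] by simp
      also have "\<dots> \<le> (real (supnorm \<xi>))\<^sup>2 * energy u"
        using supnorm_component[of \<xi> i] by (intro mult_right_mono power_mono) auto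
      finally show ?thesis .
    qed
    have "sum_sq (fdiff (part (insert i J)) u) \<le> 2 * sum_sq (\<lambda>x. fdiff (axis i (\<xi> $ i)) u (x + part J)) + 2 * sum_sq (fdiff (part J) u)"
      unfolding eq by (rule sum_sq_add_le[OF s1 conjunct1[OF insert.IH]])
    also have "\<dots> \<le> 2 * ((real (supnorm \<xi>))\<^sup>2 * energy u) + 2 * ((2 ^ (card J + 1) - 2) * (real (supnorm \<xi>))\<^sup>2 * energy u)"
      using e1 insert.IH by linarith
    also have "\<dots> = (2 ^ (card (insert i J) + 1) - 2) * (real (supnorm \<xi>))\<^sup>2 * energy u"
      using insert(1,2) by (simp add: algebra_simps)
    finally show ?case using sum_sq_add_le(1)[OF s1 conjunct1[OF insert.IH]] eq by simp
  qed
  from this[of UNIV] have *: "summable_sq (fdiff \<xi> u)"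
     "sum_sq (fdiff \<xi> u) \<le> (2 ^ (CARD('n) + 1) - 2) * (real (supnorm \<xi>))\<^sup>2 * energy u"
    by (auto simp: part_def)
  show "summable_sq (fdiff \<xi> u)" by fact
  show "sum_sq (fdiff \<xi> u) \<le> 2 ^ (CARD('n) + 1) * (real (supnorm \<xi>))\<^sup>2 * energy u"
    by (rule order_trans[OF *(2)]) (intro mult_right_mono, auto)
qed

lemma finite_energy_fdiff:
  assumes "finite_energy u" shows "finite_energy (fdiff \<xi> u)"
proof (rule finite_energyI)
  fix \<rho>
  have "fdiff \<rho> (fdiff \<xi> u) = (\<lambda>x. fdiff \<xi> u (x + \<rho>) + - fdiff \<xi> u x)" by (auto simp: fdiff_def)
  moreover have "summable_sq (\<lambda>x. fdiff \<xi> u (x + \<rho>))" by (rule summable_shift[OF energy_fdiff(1)[OF assms]])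
  moreover have "summable_sq (\<lambda>x. - fdiff \<xi> u x)" using energy_fdiff(1)[OF assms] by simp
  ultimately show "summable_sq (fdiff \<rho> (fdiff \<xi> u))" by (simp only: sum_sq_add_le(1))
qed

definition poincare_const :: real where
  "poincare_const = 2 ^ CARD('n) * 2 ^ (CARD('n) + 1) * 4"

text \<open>The constant is the value of \<open>u\<close> at a good site instead of the mean. Summed
  over all sites \<open>y\<close> of the cube, the squared deviations from \<open>u y\<close>
  rearrange into differences along vectors of the cube of radius \<open>2 * N\<close>, which the
  global energy controls; some \<open>y\<close> is at least as good as the average. The factor
  \<open>2 ^ CARD('n)\<close> compares the two cubes.\<close>

lemma poincare:
  fixes u :: "int^'n \<Rightarrow> 'b::real_normed_vector"
  assumes u: "finite_energy u"
  obtains c where "(\<Sum>x\<in>cube N z. (norm (u x - c))\<^sup>2) \<le> poincare_const * (real N)\<^sup>2 * energy u"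
proof -
  let ?B = "poincare_const * (real N)\<^sup>2 * energy u"
  have "\<exists>y\<in>cube N z. (\<Sum>x\<in>cube N z. (norm (u x - u y))\<^sup>2) \<le> ?B"
  proof (rule ccontr)
    assume "\<not> ?thesis"
    then have gt: "\<And>y. y \<in> cube N z \<Longrightarrow> ?B < (\<Sum>x\<in>cube N z. (norm (u x - u y))\<^sup>2)" by auto
    have "cube N z \<noteq> {}" using mem_cube_self by blast
    then have "(\<Sum>y\<in>cube N z. ?B) < (\<Sum>y\<in>cube N z. \<Sum>x\<in>cube N z. (norm (u x - u y))\<^sup>2)"
      by (intro sum_strict_mono gt) auto
    also have "\<dots> \<le> (\<Sum>y\<in>cube N z. \<Sum>h\<in>cube (2*N) 0. (norm (fdiff h u y))\<^sup>2)"
    proof (rule sum_mono)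
      fix y assume y: "y \<in> cube N z"
      have "(\<Sum>x\<in>cube N z. (norm (u x - u y))\<^sup>2) = (\<Sum>h\<in>(\<lambda>x. x - y) ` cube N z. (norm (fdiff h u y))\<^sup>2)"
        by (subst sum.reindex) (auto simp: inj_on_def fdiff_def)
      also have "\<dots> \<le> (\<Sum>h\<in>cube (2*N) 0. (norm (fdiff h u y))\<^sup>2)"
      proof (rule sum_mono2)
        show "(\<lambda>x. x - y) ` cube N z \<subseteq> cube (2*N) 0"
        proof clarify
          fix x assume "x \<in> cube N z"
          then have "x \<in> cube (N + N) y" using y cube_sym cube_trans by blast
          then show "x - y \<in> cube (2*N) 0" by (simp add: cube_def mult_2)
        qed
      qed auto
      finally show "(\<Sum>x\<in>cube N z. (norm (u x - u y))\<^sup>2) \<le> (\<Sum>h\<in>cube (2*N) 0. (norm (fdiff h u y))\<^sup>2)" .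
    qed
    also have "\<dots> = (\<Sum>h\<in>cube (2*N) 0. \<Sum>y\<in>cube N z. (norm (fdiff h u y))\<^sup>2)" by (rule sum.swap)
    also have "\<dots> \<le> (\<Sum>h\<in>cube (2*N) (0::int^'n). 2 ^ (CARD('n) + 1) * (real (2 * N))\<^sup>2 * energy u)"
    proof (rule sum_mono)
      fix h :: "int^'n" assume h: "h \<in> cube (2*N) 0"
      have "(\<Sum>y\<in>cube N z. (norm (fdiff h u y))\<^sup>2) \<le> sum_sq (fdiff h u)"
        by (rule finite_sum_le_infsum) (auto intro: energy_fdiff(1)[OF u])
      also have "\<dots> \<le> 2 ^ (CARD('n) + 1) * (real (supnorm h))\<^sup>2 * energy u" by (rule energy_fdiff(2)[OF u])
      also have "\<dots> \<le> 2 ^ (CARD('n) + 1) * (real (2 * N))\<^sup>2 * energy u"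
        using h by (intro mult_right_mono mult_left_mono power_mono) (auto simp: cube_def)
      finally show "(\<Sum>y\<in>cube N z. (norm (fdiff h u y))\<^sup>2) \<le> 2 ^ (CARD('n) + 1) * (real (2 * N))\<^sup>2 * energy u" .
    qed
    also have "\<dots> = real ((2 * (2 * N) + 1) ^ CARD('n)) * (2 ^ (CARD('n) + 1) * (real (2 * N))\<^sup>2 * energy u)"
      by (simp add: card_cube)
    also have "\<dots> \<le> real ((2 * (2 * N + 1)) ^ CARD('n)) * (2 ^ (CARD('n) + 1) * (real (2 * N))\<^sup>2 * energy u)"
      by (intro mult_right_mono of_nat_mono power_mono) auto
    also have "\<dots> = real ((2 * N + 1) ^ CARD('n)) * ?B"
    proof -
      have "real ((2 * (2 * N + 1)) ^ CARD('n)) = 2 ^ CARD('n) * real ((2 * N + 1) ^ CARD('n))"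
        by (simp only: power_mult_distrib of_nat_mult of_nat_power of_nat_numeral)
      moreover have "(real (2 * N))\<^sup>2 = 4 * (real N)\<^sup>2" by (simp add: power_mult_distrib)
      ultimately show ?thesis by (simp only: poincare_const_def mult_ac)
    qed
    also have "\<dots> = (\<Sum>y\<in>cube N z. ?B)" by (simp add: card_cube)
    finally show False by simp
  qed
  then show thesis using that by blast
qed

end

section \<open>Cutoffs and approximation by finitely supported functions\<close>

definition cutoff :: "nat \<Rightarrow> int^'n \<Rightarrow> real" where
  "cutoff N x = max 0 (min 1 (2 - supnorm x / N))"

lemma cutoff_bounds: "0 \<le> cutoff N x" "cutoff N x \<le> 1"
  by (auto simp: cutoff_def)

lemma cutoff_inside: "N > 0 \<Longrightarrow> supnorm x \<le> N \<Longrightarrow> cutoff N x = 1"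
  by (simp add: cutoff_def divide_simps)

lemma cutoff_outside: "N > 0 \<Longrightarrow> supnorm x \<ge> 2 * N \<Longrightarrow> cutoff N x = 0"
proof -
  assume "N > 0" "supnorm x \<ge> 2 * N"
  then have "real (supnorm x) / real N \<ge> 2"
    by (simp add: pos_le_divide_eq)
  then show ?thesis by (simp add: cutoff_def)
qed

lemma cutoff_lipschitz: "\<bar>cutoff N (x + \<xi>) - cutoff N x\<bar> \<le> supnorm \<xi> / N"
proof -
  have "\<bar>real (supnorm (x + \<xi>)) - real (supnorm x)\<bar> \<le> real (supnorm \<xi>)"
    using supnorm_add[of x \<xi>] supnorm_add[of "x + \<xi>" "- \<xi>"] by simp
  then have "\<bar>real (supnorm (x + \<xi>)) / N - real (supnorm x) / N\<bar> \<le> supnorm \<xi> / N"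
    by (simp add: divide_right_mono flip: diff_divide_distrib)
  then show ?thesis unfolding cutoff_def by linarith
qed


context lattice_stencil
begin

text \<open>The differences of a cutoff live in an annulus thickened by the interaction range.
  Annuli belonging to sufficiently separated scales are therefore disjoint.\<close>

lemma fdiff_cutoff_nonzero:
  assumes "\<rho> \<in> P" "N > 0" "fdiff \<rho> (cutoff N) x \<noteq> 0"
  shows "N < supnorm x + range_bound" "supnorm x < 2 * N + range_bound"
proof -
  have p: "supnorm \<rho> \<le> range_bound" by (rule supnorm_stencil[OF assms(1)])
  have 1: "supnorm (x + \<rho>) \<le> supnorm x + range_bound" using supnorm_add[of x \<rho>] p by linarith
  have 2: "supnorm x \<le> supnorm (x + \<rho>) + range_bound" using supnorm_diff[of "x + \<rho>" \<rho>] p by simp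
  show "N < supnorm x + range_bound"
  proof (rule ccontr)
    assume "\<not> ?thesis"
    then have "cutoff N x = 1" "cutoff N (x + \<rho>) = 1" using 1 assms(2) by (auto intro!: cutoff_inside)
    then show False using assms(3) by (simp add: fdiff_def)
  qed
  show "supnorm x < 2 * N + range_bound"
  proof (rule ccontr)
    assume "\<not> ?thesis"
    then have "cutoff N x = 0" "cutoff N (x + \<rho>) = 0" using 2 assms(2) by (auto intro!: cutoff_outside)
    then show False using assms(3) by (simp add: fdiff_def)
  qed
qed

text \<open>
  A single cutoff only changes the gradient by a bounded amount.  Averaging cutoffs
  at geometrically growing scales makes the error small, since the gradients of the cutoffs have
  disjoint supports.
\<close>

lemma finite_support_approximation:
  fixes u :: "int^'n \<Rightarrow> 'b::real_normed_vector"
  assumes u: "finite_energy u" and e: "e > 0"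
  obtains w c where "finite {x. w x \<noteq> 0}" "\<And>x. x \<in> cube M 0 \<Longrightarrow> w x = u x - c"
    "finite_energy (\<lambda>x. u x - w x)" "energy (\<lambda>x. u x - w x) < e"
proof -
  define p where "p = range_bound"
  have p: "\<And>\<rho>. \<rho> \<in> P \<Longrightarrow> supnorm \<rho> \<le> p" by (simp add: p_def supnorm_stencil)
  define m where "m = real (card P)"
  have m: "m \<ge> 0" by (simp add: m_def)
  obtain L where L: "infsum (dens u) (- cube L 0) < e / (4 * (m + 1))"
    using summable_tail[of "dens u" "e / (4 * (m + 1))"] u e m by (auto simp: finite_energy_def)
  define T where "T = infsum (dens u) (- cube L 0)"
  \<comment> \<open>Bound for one cutoff error: the slope \<open>p / N\<close> against the Poincare
    inequality on the cube of radius \<open>3 * N\<close>, which contains the annulus. The scale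
    \<open>N\<close> cancels and leaves the factor 9, so \<open>D\<close> is the same at all
    scales.\<close>
  define D where "D = 9 * (real p)\<^sup>2 * poincare_const * energy u"
  have D: "D \<ge> 0" by (auto simp: D_def poincare_const_def)
  obtain K :: nat where K: "real K > 4 * m * D / e" using reals_Archimedean2 by blast
  have "4 * m * D / e \<ge> 0" using m D e by simp
  then have K0: "K > 0" using K by linarith
  \<comment> \<open>The offset makes every cutoff equal to 1 on \<open>cube M 0\<close>, and on
    \<open>cube L 0\<close> together with its stencil neighbours. The ratio 4 separates the annuli,
    since 2 N + p <= 4 N - p for N > p.\<close>
  define N where "N = (\<lambda>k::nat. (M + L + p + 1) * 4 ^ k)"
  have N1: "N k \<ge> M + L + p + 1" for k
    using mult_le_mono2[of 1 "4 ^ k" "M + L + p + 1"] unfolding N_def by simp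
  have N0: "N k > 0" for k using N1[of k] by linarith
  have Nlt: "4 * N k \<le> N k'" if "k < k'" for k k'
  proof -
    have "(4::nat) ^ Suc k \<le> 4 ^ k'" using that by (intro power_increasing) auto
    from mult_le_mono2[OF this, of "M + L + p + 1"] show ?thesis unfolding N_def by (simp only: power_Suc mult_ac)
  qed
  have "\<exists>c. (\<Sum>x\<in>cube (3 * N k) 0. (norm (u x - c))\<^sup>2) \<le> poincare_const * (real (3 * N k))\<^sup>2 * energy u" for k
    using poincare[OF u, of "3 * N k" 0] by blast
  then obtain c where c: "\<And>k. (\<Sum>x\<in>cube (3 * N k) 0. (norm (u x - c k))\<^sup>2) \<le> poincare_const * (real (3 * N k))\<^sup>2 * energy u"
    by metis
  define w where "w = (\<lambda>x. (1/K) *\<^sub>R (\<Sum>k<K. cutoff (N k) x *\<^sub>R (u x - c k)))"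
  define b where "b = (\<lambda>\<rho> k x. fdiff \<rho> (cutoff (N k)) x *\<^sub>R (u x - c k))"
  \<comment> \<open>The gradient of \<open>u - w\<close> is \<open>A - B\<close>. In
    \<open>A\<close> the gradient of \<open>u\<close> carries a weight between 0 and 1 that vanishes
    on \<open>cube L 0\<close>, so its norm is a tail of the energy. \<open>B\<close> collects the
    gradients of the cutoffs: K pieces with disjoint supports and weight 1/K give K * D / K^2 = D /
    K.\<close>
  define A where "A = (\<lambda>\<rho> x. ((1/K) * (\<Sum>k<K. 1 - cutoff (N k) (x + \<rho>))) *\<^sub>R fdiff \<rho> u x)"
  define B where "B = (\<lambda>\<rho> x. (1/K) *\<^sub>R (\<Sum>k<K. b \<rho> k x))"
  have fdiff_eq: "fdiff \<rho> (\<lambda>x. u x - w x) = (\<lambda>x. A \<rho> x + - B \<rho> x)" for \<rho>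
  proof
    fix x
    have one: "v = (1/K) *\<^sub>R (\<Sum>k<K. v)" for v :: 'b
      using K0 by (simp add: sum_constant_scaleR)
    have "fdiff \<rho> (\<lambda>x. u x - w x) x = fdiff \<rho> u x - (1/K) *\<^sub>R (\<Sum>k<K. cutoff (N k) (x + \<rho>) *\<^sub>R fdiff \<rho> u x + b \<rho> k x)"
      by (simp add: fdiff_def w_def b_def algebra_simps flip: scaleR_diff_right sum_subtractf sum.distrib scaleR_add_right)
    also have "\<dots> = (1/K) *\<^sub>R (\<Sum>k<K. fdiff \<rho> u x) - (1/K) *\<^sub>R (\<Sum>k<K. cutoff (N k) (x + \<rho>) *\<^sub>R fdiff \<rho> u x + b \<rho> k x)"
      by (rule arg_cong2[where f = minus]) (rule one, rule refl)
    also have "\<dots> = A \<rho> x + - B \<rho> x"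
    proof -
      have "(\<Sum>k<K. 1 - cutoff (N k) (x + \<rho>)) *\<^sub>R fdiff \<rho> u x
          = (\<Sum>k<K. fdiff \<rho> u x) - (\<Sum>k<K. cutoff (N k) (x + \<rho>) *\<^sub>R fdiff \<rho> u x)"
        unfolding scaleR_sum_left scaleR_diff_left sum_subtractf by simp
      then have "A \<rho> x = (1/K) *\<^sub>R ((\<Sum>k<K. fdiff \<rho> u x) - (\<Sum>k<K. cutoff (N k) (x + \<rho>) *\<^sub>R fdiff \<rho> u x))"
        unfolding A_def by (simp only: scaleR_scaleR[symmetric])
      then show ?thesis
        by (simp only: B_def sum.distrib scaleR_add_right scaleR_diff_right) (simp only: diff_diff_eq diff_conv_add_uminus[symmetric] add.assoc)
    qed
    finally show "fdiff \<rho> (\<lambda>x. u x - w x) x = A \<rho> x + - B \<rho> x" .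
  qed
  have A: "summable_sq (A \<rho>) \<and> sum_sq (A \<rho>) \<le> T" if \<rho>: "\<rho> \<in> P" for \<rho>
  proof -
    have sT: "dens u summable_on (- cube L 0)"
      using u summable_on_subset_banach unfolding finite_energy_def by blast
    have s: "(\<lambda>x. if x \<in> cube L 0 then 0 else dens u x) summable_on UNIV"
      using sT summable_on_cong_neutral[of UNIV "- cube L 0" "\<lambda>x. if x \<in> cube L 0 then 0 else dens u x" "dens u"] by auto
    have i: "infsum (\<lambda>x. if x \<in> cube L 0 then 0 else dens u x) UNIV = T"
      unfolding T_def by (rule infsum_cong_neutral) auto
    have "(norm (A \<rho> x))\<^sup>2 \<le> (if x \<in> cube L 0 then 0 else dens u x)" for x
    proof (cases "x \<in> cube L 0")
      case True
      then have "supnorm (x + \<rho>) \<le> N k" for k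
        using supnorm_add[of x \<rho>] p[OF \<rho>] N1[of k] by (auto simp: cube_def)
      then show ?thesis using True by (simp add: A_def cutoff_inside N0)
    next
      case False
      define a where "a = (1/K) * (\<Sum>k<K. 1 - cutoff (N k) (x + \<rho>))"
      have "0 \<le> a" unfolding a_def by (intro mult_nonneg_nonneg sum_nonneg) (auto simp: cutoff_bounds)
      moreover have "(\<Sum>k<K. 1 - cutoff (N k) (x + \<rho>)) \<le> (\<Sum>k<K. 1)"
        by (intro sum_mono) (auto simp: cutoff_bounds)
      then have "a \<le> 1" using K0 by (simp add: a_def)
      ultimately have "a\<^sup>2 \<le> 1" by (simp add: power_le_one)
      then have le: "(norm (A \<rho> x))\<^sup>2 \<le> 1 * (norm (fdiff \<rho> u x))\<^sup>2"
        unfolding A_def a_def[symmetric] norm_scaleR power_mult_distrib by (intro mult_right_mono) auto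
      then show ?thesis
        using False order_trans[OF le[unfolded mult_1] dens_ge[OF \<rho>, of u x]] by (simp only: if_False)
    qed
    from infsum_dominated[OF s _ this] show ?thesis using i by simp
  qed
  have b_nz: "N k < supnorm x + p \<and> supnorm x < 2 * N k + p" if "b \<rho> k x \<noteq> 0" "\<rho> \<in> P" for \<rho> k x
    using that fdiff_cutoff_nonzero[OF that(2) N0, of k x] by (auto simp: b_def p_def)
  have b: "summable_sq (b \<rho> k) \<and> sum_sq (b \<rho> k) \<le> D" if \<rho>: "\<rho> \<in> P" for \<rho> k
  proof -
    have sub: "b \<rho> k x = 0" if "x \<notin> cube (3 * N k) 0" for x
      using b_nz[OF _ \<rho>, of k x] N1[of k] that by (auto simp: cube_def)
    have fs: "{x. (norm (b \<rho> k x))\<^sup>2 \<noteq> 0} \<subseteq> cube (3 * N k) 0" using sub by auto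
    have 1: "summable_sq (b \<rho> k)"
      by (rule summable_on_fsupp) (rule finite_subset[OF fs], simp)
    have "sum_sq (b \<rho> k) = (\<Sum>x\<in>cube (3 * N k) 0. (norm (b \<rho> k x))\<^sup>2)"
      by (subst infsum_finite[symmetric], simp, rule infsum_cong_neutral) (use sub in auto)
    also have "\<dots> \<le> (\<Sum>x\<in>cube (3 * N k) 0. (real p / N k)\<^sup>2 * (norm (u x - c k))\<^sup>2)"
    proof (rule sum_mono)
      fix x
      have "\<bar>fdiff \<rho> (cutoff (N k)) x\<bar> \<le> supnorm \<rho> / N k"
        using cutoff_lipschitz[of "N k" x \<rho>] by (simp add: fdiff_def)
      also have "\<dots> \<le> real p / N k" using p[OF \<rho>] by (simp add: divide_right_mono)
      finally have "\<bar>fdiff \<rho> (cutoff (N k)) x\<bar>\<^sup>2 \<le> (real p / N k)\<^sup>2" by (intro power_mono) auto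
      then show "(norm (b \<rho> k x))\<^sup>2 \<le> (real p / N k)\<^sup>2 * (norm (u x - c k))\<^sup>2"
        unfolding b_def norm_scaleR power_mult_distrib by (intro mult_right_mono) auto
    qed
    also have "\<dots> \<le> (real p / N k)\<^sup>2 * (poincare_const * (real (3 * N k))\<^sup>2 * energy u)"
      unfolding sum_distrib_left[symmetric] by (intro mult_left_mono c) auto
    also have "\<dots> = D" using N0[of k] by (simp add: D_def power_mult_distrib power_divide)
    finally show ?thesis using 1 by simp
  qed
  have B: "summable_sq (B \<rho>) \<and> sum_sq (B \<rho>) \<le> D / K" if \<rho>: "\<rho> \<in> P" for \<rho>
  proof -
    have eq: "(norm (B \<rho> x))\<^sup>2 = (1/K)\<^sup>2 * (\<Sum>k<K. (norm (b \<rho> k x))\<^sup>2)" for x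
    proof (cases "\<exists>k0<K. b \<rho> k0 x \<noteq> 0")
      case False
      then show ?thesis by (simp add: B_def)
    next
      case True
      then obtain k0 where k0: "k0 < K" "b \<rho> k0 x \<noteq> 0" by auto
      have z: "b \<rho> k x = 0" if "k \<noteq> k0" for k
      proof (rule ccontr)
        assume nz: "b \<rho> k x \<noteq> 0"
        have "k < k0 \<or> k0 < k" using that by auto
        then show False
          using Nlt[of k k0] Nlt[of k0 k] b_nz[OF nz \<rho>] b_nz[OF k0(2) \<rho>] N1[of k] N1[of k0] by auto
      qed
      have "(\<Sum>k<K. b \<rho> k x) = (\<Sum>k\<in>{k0}. b \<rho> k x)"
        by (rule sum.mono_neutral_right) (use k0 z in auto)
      moreover have "(\<Sum>k<K. (norm (b \<rho> k x))\<^sup>2) = (\<Sum>k\<in>{k0}. (norm (b \<rho> k x))\<^sup>2)"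
        by (rule sum.mono_neutral_right) (use k0 z in auto)
      ultimately show ?thesis by (simp add: B_def power_mult_distrib power_divide)
    qed
    have s: "(\<lambda>x. \<Sum>k<K. (norm (b \<rho> k x))\<^sup>2) summable_on UNIV"
      "infsum (\<lambda>x. \<Sum>k<K. (norm (b \<rho> k x))\<^sup>2) UNIV = (\<Sum>k<K. sum_sq (b \<rho> k))"
      using summable_on_sum'[of "{..<K}" "\<lambda>k x. (norm (b \<rho> k x))\<^sup>2" UNIV] b[OF \<rho>] by auto
    have "sum_sq (B \<rho>) = (1/K)\<^sup>2 * (\<Sum>k<K. sum_sq (b \<rho> k))"
      unfolding eq using s by (simp add: infsum_cmult_right)
    also have "\<dots> \<le> (1/K)\<^sup>2 * (\<Sum>k<K. D)" using b[OF \<rho>] by (intro mult_left_mono sum_mono) auto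
    also have "\<dots> = D / K" using K0 by (simp add: power2_eq_square)
    finally show ?thesis unfolding eq using s summable_on_cmult_right by blast
  qed
  have fs: "summable_sq (fdiff \<rho> (\<lambda>x. u x - w x)) \<and> sum_sq (fdiff \<rho> (\<lambda>x. u x - w x)) \<le> 2 * T + 2 * (D / K)"
    if \<rho>: "\<rho> \<in> P" for \<rho>
  proof -
    have "summable_sq (\<lambda>x. - B \<rho> x)" using B[OF \<rho>] by simp
    from sum_sq_add_le[OF conjunct1[OF A[OF \<rho>]] this] A[OF \<rho>] B[OF \<rho>]
    show ?thesis unfolding fdiff_eq by auto
  qed
  show thesis
  proof (rule that[of w "(1/K) *\<^sub>R (\<Sum>k<K. c k)"])
    have "w x = 0" if "x \<notin> cube (2 * N K) 0" for x
    proof -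
      have "cutoff (N k) x = 0" if "k < K" for k
        by (rule cutoff_outside[OF N0]) (use Nlt[OF that] \<open>x \<notin> _\<close> in \<open>auto simp: cube_def\<close>)
      then show ?thesis by (simp add: w_def)
    qed
    then have "{x. w x \<noteq> 0} \<subseteq> cube (2 * N K) 0" by auto
    then show "finite {x. w x \<noteq> 0}" by (rule finite_subset) simp
    show "w x = u x - (1/K) *\<^sub>R (\<Sum>k<K. c k)" if "x \<in> cube M 0" for x
    proof -
      have "cutoff (N k) x = 1" for k
        by (rule cutoff_inside[OF N0]) (use that N1[of k] in \<open>auto simp: cube_def\<close>)
      then show ?thesis using K0 by (simp add: w_def sum_subtractf sum_constant_scaleR scaleR_diff_right)
    qed
    show "finite_energy (\<lambda>x. u x - w x)" using fs by (intro finite_energyI) auto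
    have "energy (\<lambda>x. u x - w x) = (\<Sum>\<rho>\<in>P. sum_sq (fdiff \<rho> (\<lambda>x. u x - w x)))"
      using fs by (intro finite_energyI) auto
    also have "\<dots> \<le> (\<Sum>\<rho>\<in>P. 2 * T + 2 * (D / K))" using fs by (intro sum_mono) auto
    also have "\<dots> = m * (2 * T) + 2 * (m * D / K)" by (simp add: m_def algebra_simps)
    also have "\<dots> < e"
    proof -
      have "T \<ge> 0" unfolding T_def by (intro infsum_nonneg) auto
      then have "m * (2 * T) \<le> (m + 1) * (2 * T)" by (intro mult_right_mono) auto
      also have "\<dots> < e / 2" using L m by (simp add: T_def field_simps)
      finally have 1: "m * (2 * T) < e / 2" .
      have "4 * m * D < e * K" using K e by (simp add: field_simps)
      then have "2 * (m * D / K) < e / 2" using K0 by (simp add: field_simps)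
      with 1 show ?thesis by linarith
    qed
    finally show "energy (\<lambda>x. u x - w x) < e" .
  qed
qed

end

section \<open>Fluxes and their pairing with gradients\<close>

lemma sum_product_le_L2:
  fixes f g :: "'z \<Rightarrow> real"
  assumes f: "(\<lambda>x. (f x)\<^sup>2) summable_on UNIV" and g: "(\<lambda>x. (g x)\<^sup>2) summable_on UNIV"
    and h: "\<And>x. \<bar>h x\<bar> \<le> f x * g x"
  shows "h summable_on UNIV" "(\<lambda>x. \<bar>h x\<bar>) summable_on UNIV"
    "\<bar>infsum h UNIV\<bar> \<le> sqrt (infsum (\<lambda>x. (f x)\<^sup>2) UNIV) * sqrt (infsum (\<lambda>x. (g x)\<^sup>2) UNIV)"
proof -
  have "\<bar>h x\<bar> \<le> (f x)\<^sup>2 + (g x)\<^sup>2" for x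
    using h[of x] sum_squares_bound[of "f x" "g x"] zero_le_power2[of "f x"] zero_le_power2[of "g x"]
    by linarith
  then show s: "(\<lambda>x. \<bar>h x\<bar>) summable_on UNIV"
    by (intro infsum_dominated(1)[OF summable_on_add[OF f g]]) auto
  then have "(\<lambda>x. norm (h x)) summable_on UNIV" by simp
  then show sh: "h summable_on UNIV" by (rule abs_summable_summable)
  have "\<bar>infsum h UNIV\<bar> \<le> infsum (\<lambda>x. \<bar>h x\<bar>) UNIV"
    using norm_infsum_bound[of h UNIV] s by simp
  also have "\<dots> \<le> sqrt (infsum (\<lambda>x. (f x)\<^sup>2) UNIV) * sqrt (infsum (\<lambda>x. (g x)\<^sup>2) UNIV)"
  proof (rule infsum_le_finite_sums[OF s])
    fix F :: "'z set" assume F: "finite F"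
    have "(\<Sum>x\<in>F. \<bar>h x\<bar>) \<le> (\<Sum>x\<in>F. \<bar>f x\<bar> * \<bar>g x\<bar>)"
      by (intro sum_mono order_trans[OF h]) (simp flip: abs_mult)
    also have "\<dots> \<le> L2_set f F * L2_set g F" by (rule L2_set_mult_ineq)
    also have "\<dots> \<le> sqrt (infsum (\<lambda>x. (f x)\<^sup>2) UNIV) * sqrt (infsum (\<lambda>x. (g x)\<^sup>2) UNIV)"
      unfolding L2_set_def
      by (intro mult_mono real_sqrt_le_mono finite_sum_le_infsum f g F)
         (auto intro!: infsum_nonneg sum_nonneg)
    finally show "(\<Sum>x\<in>F. \<bar>h x\<bar>) \<le> sqrt (infsum (\<lambda>x. (f x)\<^sup>2) UNIV) * sqrt (infsum (\<lambda>x. (g x)\<^sup>2) UNIV)" .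
  qed
  finally show "\<bar>infsum h UNIV\<bar> \<le> sqrt (infsum (\<lambda>x. (f x)\<^sup>2) UNIV) * sqrt (infsum (\<lambda>x. (g x)\<^sup>2) UNIV)" .
qed

definition vanishes_off :: "'z set \<Rightarrow> ('z \<Rightarrow> 'b::zero) \<Rightarrow> bool" where
  "vanishes_off S v \<longleftrightarrow> (\<forall>x. x \<notin> S \<longrightarrow> v x = 0)"

lemma vanishes_off_finite: "vanishes_off S v \<Longrightarrow> finite S \<Longrightarrow> finite {x. v x \<noteq> 0}"
  unfolding vanishes_off_def by (rule finite_subset[of _ S]) auto

lemma vanishes_off_mono: "vanishes_off S v \<Longrightarrow> S \<subseteq> S' \<Longrightarrow> vanishes_off S' v"
  unfolding vanishes_off_def by auto

lemma vanishes_off_fdiff: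
  fixes v :: "int^'n \<Rightarrow> 'b::real_vector"
  assumes "vanishes_off (cube N z) v" "supnorm \<xi> \<le> p"
  shows "vanishes_off (cube (N + p) z) (fdiff \<xi> v)"
  unfolding vanishes_off_def
proof (intro allI impI)
  fix x assume x: "x \<notin> cube (N + p) z"
  then have "x \<notin> cube N z" using cube_mono[of N "N + p" z] by auto
  moreover have "x + \<xi> \<notin> cube N z"
  proof
    assume "x + \<xi> \<in> cube N z"
    from cube_add[OF this, of "- \<xi>" p] assms(2) have "x \<in> cube (N + p) z" by simp
    with x show False ..
  qed
  ultimately show "fdiff \<xi> v x = 0" using assms(1) by (simp add: fdiff_def vanishes_off_def)
qed

context lattice_stencil
begin

definition dens_root :: "(int^'n \<Rightarrow> 'b::real_normed_vector) \<Rightarrow> int^'n \<Rightarrow> real" where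
  "dens_root u x = sqrt (dens u x)"

lemma dens_root_sq: "(dens_root u x)\<^sup>2 = dens u x" by (simp add: dens_root_def)

lemma fdiff_le_dens_root: "\<rho> \<in> P \<Longrightarrow> norm (fdiff \<rho> u x) \<le> dens_root u x"
  unfolding dens_root_def by (rule real_le_rsqrt) (rule dens_ge)

definition flux_dens :: "(int^'n \<Rightarrow> int^'n \<Rightarrow> 'b::real_normed_vector) \<Rightarrow> int^'n \<Rightarrow> real" where
  "flux_dens G x = (\<Sum>\<rho>\<in>P. (norm (G \<rho> x))\<^sup>2)"

text \<open>The weak form of the (negative) discrete divergence of \<open>G\<close>, tested with
  \<open>w\<close>.\<close>

definition flux_pair :: "(int^'n \<Rightarrow> int^'n \<Rightarrow> 'b::real_inner) \<Rightarrow> (int^'n \<Rightarrow> 'b) \<Rightarrow> real" where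
  "flux_pair G w = infsum (\<lambda>x. \<Sum>\<rho>\<in>P. G \<rho> x \<bullet> fdiff \<rho> w x) UNIV"

lemma flux_dens_nonneg [simp]: "flux_dens G x \<ge> 0" unfolding flux_dens_def by (intro sum_nonneg) auto

lemma flux_pointwise:
  fixes w :: "int^'n \<Rightarrow> 'b::real_inner"
  shows "\<bar>\<Sum>\<rho>\<in>P. G \<rho> x \<bullet> fdiff \<rho> w x\<bar> \<le> sqrt (flux_dens G x) * dens_root w x"
proof -
  have "\<bar>\<Sum>\<rho>\<in>P. G \<rho> x \<bullet> fdiff \<rho> w x\<bar> \<le> (\<Sum>\<rho>\<in>P. \<bar>norm (G \<rho> x)\<bar> * \<bar>norm (fdiff \<rho> w x)\<bar>)"
    by (rule order_trans[OF sum_abs]) (intro sum_mono, simp add: Cauchy_Schwarz_ineq2)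
  also have "\<dots> \<le> L2_set (\<lambda>\<rho>. norm (G \<rho> x)) P * L2_set (\<lambda>\<rho>. norm (fdiff \<rho> w x)) P"
    by (rule L2_set_mult_ineq)
  also have "\<dots> = sqrt (flux_dens G x) * dens_root w x"
    by (simp add: L2_set_def flux_dens_def dens_root_def dens_def)
  finally show ?thesis .
qed

lemma flux_pair_bound:
  fixes w :: "int^'n \<Rightarrow> 'b::real_inner"
  assumes "flux_dens G summable_on UNIV" "finite_energy w"
  shows "(\<lambda>x. \<Sum>\<rho>\<in>P. G \<rho> x \<bullet> fdiff \<rho> w x) summable_on UNIV"
    "\<bar>flux_pair G w\<bar> \<le> sqrt (infsum (flux_dens G) UNIV) * sqrt (energy w)"
  using sum_product_le_L2[of "\<lambda>x. sqrt (flux_dens G x)" "dens_root w", OF _ _ flux_pointwise] assms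
  by (auto simp: dens_root_sq finite_energy_def energy_def flux_pair_def)

lemma fsupp_flux:
  fixes w :: "int^'n \<Rightarrow> 'b::real_inner"
  assumes "finite {x. w x \<noteq> 0}"
  shows "finite {x. (\<Sum>\<rho>\<in>P. G \<rho> x \<bullet> fdiff \<rho> w x) \<noteq> 0}"
proof (rule finite_subset)
  show "{x. (\<Sum>\<rho>\<in>P. G \<rho> x \<bullet> fdiff \<rho> w x) \<noteq> 0} \<subseteq> (\<Union>\<rho>\<in>P. {x. fdiff \<rho> w x \<noteq> 0})"
  proof
    fix x assume "x \<in> {x. (\<Sum>\<rho>\<in>P. G \<rho> x \<bullet> fdiff \<rho> w x) \<noteq> 0}"
    moreover have "(\<Sum>\<rho>\<in>P. G \<rho> x \<bullet> fdiff \<rho> w x) = 0" if "\<forall>\<rho>\<in>P. fdiff \<rho> w x = 0"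
      using that by simp
    ultimately show "x \<in> (\<Union>\<rho>\<in>P. {x. fdiff \<rho> w x \<noteq> 0})" by blast
  qed
  show "finite (\<Union>\<rho>\<in>P. {x. fdiff \<rho> w x \<noteq> 0})" using fdiff_fsupp[OF assms] finite_stencil by auto
qed

lemma flux_pair_cube_bound:
  fixes w :: "int^'n \<Rightarrow> 'b::real_inner"
  assumes w: "vanishes_off (cube N z) w"
  shows "\<bar>flux_pair G w\<bar> \<le> sqrt (sum (flux_dens G) (cube (N + range_bound) z)) * sqrt (energy w)"
proof -
  let ?S = "cube (N + range_bound) z"
  define G' where "G' = (\<lambda>\<rho> x. if x \<in> ?S then G \<rho> x else 0)"
  have "flux_pair G w = flux_pair G' w"
    unfolding flux_pair_def
  proof (intro infsum_cong sum.cong refl)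
    fix x \<rho> assume "\<rho> \<in> P"
    then show "G \<rho> x \<bullet> fdiff \<rho> w x = G' \<rho> x \<bullet> fdiff \<rho> w x"
      using vanishes_off_fdiff[OF w supnorm_stencil] by (auto simp: G'_def vanishes_off_def)
  qed
  moreover have fd: "flux_dens G' = (\<lambda>x. if x \<in> ?S then flux_dens G x else 0)"
    by (auto simp: flux_dens_def G'_def)
  have "flux_dens G' summable_on UNIV"
    unfolding fd by (rule summable_on_fsupp) (rule finite_subset[of _ ?S], auto)
  moreover have "infsum (flux_dens G') UNIV = sum (flux_dens G) ?S"
    unfolding fd by (subst infsum_finite[symmetric], simp, rule infsum_cong_neutral) auto
  moreover have "finite_energy w"
    by (rule finite_energy_fsupp) (rule vanishes_off_finite[OF w], simp)
  ultimately show ?thesis using flux_pair_bound(2)[of G' w] by simp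
qed

end

section \<open>Elliptic forms\<close>

text \<open>Coercivity is a global statement about finitely supported functions; the summand at a
  single site may well be negative. Estimates on cubes therefore have to pass through functions that
  vanish off a cube.\<close>

locale elliptic_form = lattice_stencil P for P :: "(int^'n) set" +
  fixes q :: "int^'n \<Rightarrow> int^'n \<Rightarrow> 'b::euclidean_space \<Rightarrow> 'b \<Rightarrow> real" and c0 :: real
  assumes q_bilinear: "bounded_bilinear (q \<rho> \<sigma>)"
    and q_symmetric: "\<rho> \<in> P \<Longrightarrow> \<sigma> \<in> P \<Longrightarrow> q \<rho> \<sigma> x y = q \<sigma> \<rho> y x"
    and c0: "c0 > 0"
    and coercive: "finite {x. v x \<noteq> 0} \<Longrightarrow>
      infsum (\<lambda>x. \<Sum>\<rho>\<in>P. \<Sum>\<sigma>\<in>P. q \<rho> \<sigma> (fdiff \<rho> v x) (fdiff \<sigma> v x)) UNIV \<ge> c0 * energy v"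
begin

definition form_dens :: "(int^'n \<Rightarrow> 'b) \<Rightarrow> (int^'n \<Rightarrow> 'b) \<Rightarrow> int^'n \<Rightarrow> real" where
  "form_dens v w x = (\<Sum>\<rho>\<in>P. \<Sum>\<sigma>\<in>P. q \<rho> \<sigma> (fdiff \<rho> v x) (fdiff \<sigma> w x))"

definition form :: "(int^'n \<Rightarrow> 'b) \<Rightarrow> (int^'n \<Rightarrow> 'b) \<Rightarrow> real" where
  "form v w = infsum (form_dens v w) UNIV"

lemmas q_algebra =
  bounded_bilinear.add_left[OF q_bilinear] bounded_bilinear.add_right[OF q_bilinear]
  bounded_bilinear.diff_left[OF q_bilinear] bounded_bilinear.diff_right[OF q_bilinear]
  bounded_bilinear.scaleR_left[OF q_bilinear] bounded_bilinear.scaleR_right[OF q_bilinear]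
  bounded_bilinear.zero_left[OF q_bilinear] bounded_bilinear.zero_right[OF q_bilinear]

lemma q_bound: obtains K where "K > 0" "\<And>\<rho> \<sigma> x y. \<rho> \<in> P \<Longrightarrow> \<sigma> \<in> P \<Longrightarrow> \<bar>q \<rho> \<sigma> x y\<bar> \<le> K * (norm x * norm y)"
proof -
  have "\<exists>K. K > 0 \<and> (\<forall>x y. \<bar>q \<rho> \<sigma> x y\<bar> \<le> norm x * norm y * K)" for \<rho> \<sigma>
    using bounded_bilinear.pos_bounded[OF q_bilinear, of \<rho> \<sigma>] by (simp only: real_norm_def)
  then obtain K where K: "\<And>\<rho> \<sigma>. K \<rho> \<sigma> > 0" "\<And>\<rho> \<sigma> x y. \<bar>q \<rho> \<sigma> x y\<bar> \<le> norm x * norm y * K \<rho> \<sigma>" by metis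
  define M where "M = 1 + (\<Sum>\<rho>\<in>P. \<Sum>\<sigma>\<in>P. K \<rho> \<sigma>)"
  have K0: "K \<rho> \<sigma> \<ge> 0" for \<rho> \<sigma> using K(1) less_imp_le by blast
  have KM: "K \<rho> \<sigma> \<le> M" if "\<rho> \<in> P" "\<sigma> \<in> P" for \<rho> \<sigma>
  proof -
    have "K \<rho> \<sigma> \<le> (\<Sum>\<sigma>\<in>P. K \<rho> \<sigma>)" by (rule member_le_sum) (use that finite_stencil K0 in auto)
    also have "\<dots> \<le> (\<Sum>\<rho>\<in>P. \<Sum>\<sigma>\<in>P. K \<rho> \<sigma>)"
      by (rule member_le_sum[of \<rho> P "\<lambda>\<rho>. \<Sum>\<sigma>\<in>P. K \<rho> \<sigma>"]) (use that finite_stencil K0 in \<open>auto intro: sum_nonneg\<close>)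
    finally show ?thesis by (simp add: M_def)
  qed
  show thesis
  proof
    show "M > 0" unfolding M_def using K0 by (intro add_pos_nonneg sum_nonneg) auto
    fix \<rho> \<sigma> x y assume "\<rho> \<in> P" "\<sigma> \<in> P"
    then show "\<bar>q \<rho> \<sigma> x y\<bar> \<le> M * (norm x * norm y)"
      using K(2)[of \<rho> \<sigma> x y] mult_left_mono[OF KM, of \<rho> \<sigma> "norm x * norm y"] by (simp add: mult.commute)
  qed
qed

definition form_const :: real where
  "form_const = (SOME C. C > 0 \<and> (\<forall>v w x. \<bar>form_dens v w x\<bar> \<le> C * (dens_root v x * dens_root w x)))"

lemma form_const: "form_const > 0" "\<bar>form_dens v w x\<bar> \<le> form_const * (dens_root v x * dens_root w x)"
proof -
  obtain K where K: "K > 0" "\<And>\<rho> \<sigma> x y. \<rho> \<in> P \<Longrightarrow> \<sigma> \<in> P \<Longrightarrow> \<bar>q \<rho> \<sigma> x y\<bar> \<le> K * (norm x * norm y)"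
    by (rule q_bound) (rule that)
  have cP: "card P > 0" using finite_stencil axis_stencil card_gt_0_iff by blast
  let ?C = "card P * card P * K"
  have "\<bar>form_dens v w x\<bar> \<le> ?C * (dens_root v x * dens_root w x)" for v w x
  proof -
    have "\<bar>form_dens v w x\<bar> \<le> (\<Sum>\<rho>\<in>P. \<Sum>\<sigma>\<in>P. \<bar>q \<rho> \<sigma> (fdiff \<rho> v x) (fdiff \<sigma> w x)\<bar>)"
      unfolding form_dens_def by (rule order_trans[OF sum_abs sum_mono[OF sum_abs]])
    also have "\<dots> \<le> (\<Sum>\<rho>\<in>P. \<Sum>\<sigma>\<in>P. K * (dens_root v x * dens_root w x))"
    proof (intro sum_mono)
      fix \<rho> \<sigma> assume m: "\<rho> \<in> P" "\<sigma> \<in> P"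
      have "\<bar>q \<rho> \<sigma> (fdiff \<rho> v x) (fdiff \<sigma> w x)\<bar> \<le> K * (norm (fdiff \<rho> v x) * norm (fdiff \<sigma> w x))"
        by (rule K(2)[OF m])
      also have "\<dots> \<le> K * (dens_root v x * dens_root w x)"
        using K(1) by (intro mult_left_mono mult_mono fdiff_le_dens_root m) (auto simp: dens_root_def)
      finally show "\<bar>q \<rho> \<sigma> (fdiff \<rho> v x) (fdiff \<sigma> w x)\<bar> \<le> K * (dens_root v x * dens_root w x)" .
    qed
    also have "\<dots> = ?C * (dens_root v x * dens_root w x)" by simp
    finally show ?thesis .
  qed
  then have "\<exists>C. C > 0 \<and> (\<forall>v w x. \<bar>form_dens v w x\<bar> \<le> C * (dens_root v x * dens_root w x))"
    using cP K(1) by (intro exI[of _ ?C]) auto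
  from someI_ex[OF this] show "form_const > 0" "\<bar>form_dens v w x\<bar> \<le> form_const * (dens_root v x * dens_root w x)"
    unfolding form_const_def by blast+
qed

lemma form_bound:
  assumes "finite_energy v" "finite_energy w"
  shows "form_dens v w summable_on UNIV" "\<bar>form v w\<bar> \<le> form_const * (sqrt (energy v) * sqrt (energy w))"
proof -
  have s: "(\<lambda>x. (form_const * dens_root v x)\<^sup>2) summable_on UNIV"
    "infsum (\<lambda>x. (form_const * dens_root v x)\<^sup>2) UNIV = form_const\<^sup>2 * energy v"
    using assms(1) by (auto simp: power_mult_distrib dens_root_sq finite_energy_def energy_def
        summable_on_cmult_right infsum_cmult_right)
  have t: "(\<lambda>x. (dens_root w x)\<^sup>2) summable_on UNIV" "infsum (\<lambda>x. (dens_root w x)\<^sup>2) UNIV = energy w"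
    using assms(2) by (auto simp: dens_root_sq finite_energy_def energy_def)
  have "\<bar>form_dens v w x\<bar> \<le> form_const * dens_root v x * dens_root w x" for x
    using form_const(2)[of v w x] by (simp add: mult.assoc)
  from sum_product_le_L2[OF s(1) t(1) this]
  show "form_dens v w summable_on UNIV" "\<bar>form v w\<bar> \<le> form_const * (sqrt (energy v) * sqrt (energy w))"
    using form_const(1) by (auto simp: form_def s(2) t(2) real_sqrt_mult)
qed

lemma form_sym: "form v w = form w v"
proof -
  have "form_dens v w x = form_dens w v x" for x
    unfolding form_dens_def by (subst sum.swap) (intro sum.cong refl, rule q_symmetric)
  then show ?thesis unfolding form_def by presburger
qed

lemma form_add_left:
  assumes "finite_energy u" "finite_energy v" "finite_energy w"
  shows "form (\<lambda>x. u x + t *\<^sub>R v x) w = form u w + t * form v w"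
proof -
  have eq: "form_dens (\<lambda>x. u x + t *\<^sub>R v x) w = (\<lambda>x. form_dens u w x + t * form_dens v w x)"
  proof
    fix x
    have "fdiff \<rho> (\<lambda>x. u x + t *\<^sub>R v x) x = fdiff \<rho> u x + t *\<^sub>R fdiff \<rho> v x" for \<rho>
      by (simp add: fdiff_def algebra_simps)
    then show "form_dens (\<lambda>x. u x + t *\<^sub>R v x) w x = form_dens u w x + t * form_dens v w x"
      by (simp add: form_dens_def q_algebra sum.distrib sum_distrib_left)
  qed
  show ?thesis unfolding form_def eq
    using form_bound(1)[OF assms(1,3)] form_bound(1)[OF assms(2,3)]
    by (simp add: infsum_add infsum_cmult_right summable_on_cmult_right)
qed

lemma form_add_right:
  assumes "finite_energy u" "finite_energy v" "finite_energy w"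
  shows "form w (\<lambda>x. u x + t *\<^sub>R v x) = form w u + t * form w v"
  using form_add_left[OF assms] by (simp add: form_sym)

lemma form_diff_left:
  assumes "finite_energy u" "finite_energy v" "finite_energy w"
  shows "form (\<lambda>x. u x - v x) w = form u w - form v w"
  using form_add_left[OF assms, of "-1"] by simp

lemma form_coercive: "finite {x. v x \<noteq> 0} \<Longrightarrow> form v v \<ge> c0 * energy v"
  using coercive[of v] by (simp add: form_def form_dens_def[abs_def])

lemma form_shift: "form (\<lambda>x. v (x + \<xi>)) w = form v (\<lambda>x. w (x - \<xi>))"
proof -
  have "form_dens v (\<lambda>x. w (x - \<xi>)) (x + \<xi>) = form_dens (\<lambda>x. v (x + \<xi>)) w x" for x
    by (simp add: form_dens_def fdiff_def algebra_simps)
  then show ?thesis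
    unfolding form_def using infsum_shift[of "form_dens v (\<lambda>x. w (x - \<xi>))" \<xi>] by simp
qed

text \<open>Without energy \<open>v\<close> is invariant under a unit step, so a nonzero value would
  spread along an infinite half-line, contrary to the finite support.\<close>

lemma energy_pos:
  fixes v :: "int^'n \<Rightarrow> 'b"
  assumes "finite {x. v x \<noteq> 0}" "v z \<noteq> 0"
  shows "energy v > 0"
proof (rule ccontr)
  assume "\<not> energy v > 0"
  then have e: "energy v = 0" using energy_nonneg[of v] by linarith
  obtain i :: 'n where True by blast
  have step: "v (x + axis i 1) = v x" for x
  proof -
    have "(norm (fdiff (axis i 1) v x))\<^sup>2 \<le> sum (dens v) {x}"
      using dens_ge[OF axis_stencil, of i v x] by simp
    also have "\<dots> \<le> 0" using dens_sum_le_energy[OF finite_energy_fsupp[OF assms(1)], of "{x}"] e by simp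
    finally show ?thesis by (simp add: fdiff_def)
  qed
  have "v (z + axis i (int m)) = v z" for m
  proof (induction m)
    case 0 show ?case by (simp add: axis_def flip: zero_vec_def)
  next
    case (Suc m)
    have "z + axis i (int (Suc m)) = z + axis i (int m) + axis i 1" by (auto simp: axis_def vec_eq_iff)
    then show ?case using step Suc by presburger
  qed
  then have "range (\<lambda>m. z + axis i (int m)) \<subseteq> {x. v x \<noteq> 0}" using assms(2) by auto
  moreover have "inj (\<lambda>m. z + axis i (int m))"
    by (rule injI) (metis add_left_cancel axis_eq_axis of_nat_eq_iff)
  ultimately show False using assms(1) finite_subset infinite_iff_countable_subset by (metis range_inj_infinite)
qed

text \<open>Gram--Schmidt, one coordinate at a time.\<close>

lemma dirichlet_solution:
  assumes S: "finite S"
    and F: "\<And>u v t. vanishes_off S u \<Longrightarrow> vanishes_off S v \<Longrightarrow> F (\<lambda>x. u x + t *\<^sub>R v x) = F u + t * F v"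
  obtains v where "vanishes_off S v" "\<And>w. vanishes_off S w \<Longrightarrow> form v w = F w"
proof -
  define sp where "sp I v \<longleftrightarrow> (\<forall>x b. b \<in> Basis \<longrightarrow> (x,b) \<notin> I \<longrightarrow> v x \<bullet> b = 0)" for I and v :: "int^'n \<Rightarrow> 'b"
  have sp_full: "sp (S \<times> Basis) v \<longleftrightarrow> vanishes_off S v" for v
    unfolding sp_def vanishes_off_def
    by (auto intro!: euclidean_eqI[where 'a = 'b])
  have sp_mono: "sp I v \<Longrightarrow> I \<subseteq> J \<Longrightarrow> sp J v" for I J v unfolding sp_def by blast
  have sp_lin: "sp I u \<Longrightarrow> sp I v \<Longrightarrow> sp I (\<lambda>x. u x + t *\<^sub>R v x)" for I u v t
    unfolding sp_def by (simp add: inner_add_left)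
  have main: "\<exists>v. sp I v \<and> (\<forall>w. sp I w \<longrightarrow> form v w = F w)"
    if "finite I" "I \<subseteq> S \<times> Basis"
      "\<And>u v t. vanishes_off S u \<Longrightarrow> vanishes_off S v \<Longrightarrow> F (\<lambda>x. u x + t *\<^sub>R v x) = F u + t * F v" for I F
    using that
  proof (induction I arbitrary: F rule: finite_induct)
    case empty
    have fe: "finite_energy (\<lambda>x. 0::'b)" by (rule finite_energy_fsupp) simp
    have "F (\<lambda>_. 0) = F (\<lambda>_. 0) + 1 * F (\<lambda>_. 0)"
      using empty(2)[of "\<lambda>_. 0" "\<lambda>_. 0" 1] by (simp add: vanishes_off_def)
    then have F0: "F (\<lambda>_. 0) = 0" by simp
    have f0: "form (\<lambda>_. 0) (\<lambda>_. 0) = 0" using form_add_left[OF fe fe fe, of 1] by simp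
    have "w = (\<lambda>_. 0)" if "sp {} w" for w
      using that by (auto simp: sp_def fun_eq_iff intro!: euclidean_eqI[where 'a = 'b])
    then show ?case using F0 f0 by (intro exI[of _ "\<lambda>_. 0"]) (auto simp: sp_def)
  next
    case (insert p I)
    obtain z b where p: "p = (z,b)" by (cases p)
    have zb: "z \<in> S" "b \<in> Basis" using insert.prems(1) p by auto
    have vS: "vanishes_off S v" if "sp (insert p I) v" for v
      using sp_mono[OF that insert.prems(1)] sp_full by simp
    have vI: "sp I v \<Longrightarrow> sp (insert p I) v" for v by (rule sp_mono) auto
    have fe: "finite_energy v" if "vanishes_off S v" for v :: "int^'n \<Rightarrow> 'b"
      using vanishes_off_finite[OF that S] by (rule finite_energy_fsupp)
    define d0 :: "int^'n \<Rightarrow> 'b" where "d0 = (\<lambda>x. if x = z then b else 0)"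
    have d0: "sp (insert p I) d0" unfolding sp_def d0_def p using zb(2) by (auto simp: inner_not_same_Basis)
    have lin0: "\<And>u v t. vanishes_off S u \<Longrightarrow> vanishes_off S v \<Longrightarrow>
        form d0 (\<lambda>x. u x + t *\<^sub>R v x) = form d0 u + t * form d0 v"
      by (intro form_add_right fe vS[OF d0])
    \<comment> \<open>The projection of the new coordinate vector \<open>d0\<close> onto the span of
      the earlier coordinates solves the same problem with right-hand side \<open>form d0\<close>.
      This is why the induction ranges over all functionals \<open>F\<close>.\<close>
    obtain pr where pr: "sp I pr" "\<And>w. sp I w \<Longrightarrow> form pr w = form d0 w"
      using insert.IH[of "form d0", OF _ lin0] insert.prems(1) by auto
    obtain v0 where v0: "sp I v0" "\<And>w. sp I w \<Longrightarrow> form v0 w = F w"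
      using insert.IH[of F, OF _ insert.prems(2)] insert.prems(1) by auto
    define d where "d = (\<lambda>x. d0 x + (-1) *\<^sub>R pr x)"
    have d: "sp (insert p I) d" unfolding d_def by (rule sp_lin[OF d0 vI[OF pr(1)]])
    have "pr z \<bullet> b = 0" using pr(1) insert(2) zb p by (auto simp: sp_def)
    then have dz: "d z \<bullet> b = 1" using zb by (simp add: d_def d0_def inner_diff_left)
    have feI: "finite_energy w" "vanishes_off S w" if "sp I w" for w using fe vS vI that by auto
    have orth: "form d w = 0" if "sp I w" for w
      unfolding d_def using form_add_left[OF fe[OF vS[OF d0]] feI(1)[OF pr(1)] feI(1)[OF that], of "-1"] pr(2)[OF that] by simp
    have pos: "form d d > 0"
    proof -
      have "energy d > 0"
        by (rule energy_pos[of d z]) (use dz vanishes_off_finite[OF vS[OF d] S] in auto)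
      then have "c0 * energy d > 0" using c0 by simp
      then show ?thesis using form_coercive[OF vanishes_off_finite[OF vS[OF d] S]] by linarith
    qed
    define t where "t = F d / form d d"
    define v where "v = (\<lambda>x. v0 x + t *\<^sub>R d x)"
    have v: "sp (insert p I) v" unfolding v_def by (rule sp_lin[OF vI[OF v0(1)] d])
    have "form v w = F w" if w: "sp (insert p I) w" for w
    proof -
      define s where "s = w z \<bullet> b"
      define w' where "w' = (\<lambda>x. w x + (- s) *\<^sub>R d x)"
      have w'1: "sp (insert p I) w'" unfolding w'_def by (rule sp_lin[OF w d])
      have "w' z \<bullet> b = 0" using dz by (simp add: w'_def s_def inner_diff_left)
      then have w': "sp I w'" using w'1 p unfolding sp_def by auto
      have weq: "w = (\<lambda>x. w' x + s *\<^sub>R d x)" by (simp add: w'_def)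
      have "form v w = form v w' + s * form v d"
        unfolding weq by (intro form_add_right feI(1)[OF w'] fe[OF vS[OF d]] fe[OF vS[OF v]])
      also have "form v w' = F w'"
        unfolding v_def using form_add_left[OF feI(1)[OF v0(1)] fe[OF vS[OF d]] feI(1)[OF w'], of t] v0(2)[OF w'] orth[OF w'] by simp
      also have "form v d = F d"
        unfolding v_def using form_add_left[OF feI(1)[OF v0(1)] fe[OF vS[OF d]] fe[OF vS[OF d]], of t] orth[OF v0(1)] pos
        by (simp add: t_def form_sym)
      also have "F w' + s * F d = F w"
        unfolding weq using insert.prems(2)[OF feI(2)[OF w'] vS[OF d], of s] by simp
      finally show ?thesis .
    qed
    then show ?case using v by blast
  qed
  have fin: "finite (S \<times> (Basis :: 'b set))" using S by simp
  obtain v where "sp (S \<times> Basis) v" "\<And>w. sp (S \<times> Basis) w \<Longrightarrow> form v w = F w"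
    using main[OF fin subset_refl, of F, OF F] by metis
  then show thesis using that by (simp add: sp_full)
qed

subsection \<open>Interior estimates\<close>

definition harmonic :: "(int^'n \<Rightarrow> 'b) \<Rightarrow> (int^'n) set \<Rightarrow> bool" where
  "harmonic v K \<longleftrightarrow> (\<forall>w. vanishes_off K w \<longrightarrow> form v w = 0)"

lemma harmonic_mono: "harmonic v K \<Longrightarrow> K' \<subseteq> K \<Longrightarrow> harmonic v K'"
  unfolding harmonic_def using vanishes_off_mono by blast

lemma finite_energy_shift:
  fixes v :: "int^'n \<Rightarrow> 'c::real_normed_vector"
  assumes "finite_energy v" shows "finite_energy (\<lambda>x. v (x + \<xi>))"
proof -
  have "dens (\<lambda>x. v (x + \<xi>)) = (\<lambda>x. dens v (x + \<xi>))" by (auto simp: dens_def fdiff_def add_ac)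
  then show ?thesis using assms summable_shift unfolding finite_energy_def by metis
qed

lemma finite_energy_vanishes: "vanishes_off (cube N z) w \<Longrightarrow> finite_energy w"
  by (rule finite_energy_fsupp) (rule vanishes_off_finite, auto)

text \<open>Discrete integration by parts. The coefficients do not depend on the site, so a
  translation of one argument can be moved to the other with the opposite sign. Consequently
  differences of solutions are solutions again, on a slightly smaller cube.\<close>

lemma form_fdiff_left:
  assumes v: "finite_energy v" and w: "finite_energy w"
  shows "form (fdiff \<xi> v) w = form v (fdiff (- \<xi>) w)"
proof -
  have "form (fdiff \<xi> v) w = form (\<lambda>x. v (x + \<xi>)) w - form v w"
    unfolding fdiff_def by (rule form_diff_left[OF finite_energy_shift[OF v] v w])
  also have "form (\<lambda>x. v (x + \<xi>)) w = form v (\<lambda>x. w (x + - \<xi>))"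
    using form_shift[of v \<xi> w] by simp
  also have "form v (\<lambda>x. w (x + - \<xi>)) - form v w = form v (fdiff (- \<xi>) w)"
    unfolding fdiff_def using form_diff_left[OF finite_energy_shift[OF w] w v, of "- \<xi>"]
    by (simp only: form_sym[of v])
  finally show ?thesis .
qed

lemma harmonic_fdiff:
  assumes v: "finite_energy v" "harmonic v (cube (N + p) z)" and \<xi>: "supnorm \<xi> \<le> p"
  shows "harmonic (fdiff \<xi> v) (cube N z)"
  unfolding harmonic_def
proof (intro allI impI)
  fix w :: "int^'n \<Rightarrow> 'b" assume w: "vanishes_off (cube N z) w"
  have "vanishes_off (cube (N + p) z) (fdiff (- \<xi>) w)"
    by (rule vanishes_off_fdiff[OF w]) (use \<xi> in simp)
  then show "form (fdiff \<xi> v) w = 0"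
    using v(2) form_fdiff_left[OF v(1) finite_energy_vanishes[OF w]] by (simp add: harmonic_def)
qed

lemma sum_cube_shift_le:
  fixes f :: "int^'n \<Rightarrow> real"
  assumes "\<And>x. f x \<ge> 0" "supnorm \<xi> \<le> p"
  shows "(\<Sum>x\<in>cube N z. f (x + \<xi>)) \<le> sum f (cube (N + p) z)"
proof -
  have "(\<Sum>x\<in>cube N z. f (x + \<xi>)) = sum f ((\<lambda>x. x + \<xi>) ` cube N z)"
    by (subst sum.reindex) (auto simp: inj_on_def)
  also have "\<dots> \<le> sum f (cube (N + p) z)"
    by (rule sum_mono2) (use assms cube_add in auto)
  finally show ?thesis .
qed

lemma sum_cube_mono:
  fixes f :: "int^'n \<Rightarrow> real"
  assumes "\<And>x. f x \<ge> 0" "M \<le> N" shows "sum f (cube M z) \<le> sum f (cube N z)"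
  by (rule sum_mono2) (use assms cube_mono[of M N z] in auto)

text \<open>The test function is \<open>\<eta>^2 v\<close>. Symmetrised in the two stencil
  directions, the density of \<open>form (\<eta> v) (\<eta> v) - form v (\<eta>^2 v)\<close>
  contains only squared differences of \<open>\<eta>\<close> multiplied by values of
  \<open>v\<close>: all terms with differences of \<open>v\<close> cancel. So nothing has to be
  absorbed, which a form that is not coercive site by site would not permit.\<close>

lemma cutoff_energy_bound:
  "\<exists>C>0. \<forall>v M z. M \<ge> 1 \<longrightarrow> finite_energy v \<longrightarrow> harmonic v (cube (2 * M) z) \<longrightarrow>
     energy (\<lambda>x. cutoff M (x - z) *\<^sub>R v x)
       \<le> C / (real M)\<^sup>2 * (\<Sum>x\<in>cube (2 * M + 2 * range_bound) z. (norm (v x))\<^sup>2)"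
proof -
  obtain K where K: "K > 0" "\<And>\<rho> \<sigma> x y. \<rho> \<in> P \<Longrightarrow> \<sigma> \<in> P \<Longrightarrow> \<bar>q \<rho> \<sigma> x y\<bar> \<le> K * (norm x * norm y)"
    by (rule q_bound) (rule that)
  define p where "p = range_bound"
  define m where "m = real (card P)"
  have p1: "p \<ge> 1" using range_bound_ge_1 by (simp add: p_def)
  have "card P > 0" using finite_stencil axis_stencil card_gt_0_iff by blast
  then have m: "m > 0" by (simp add: m_def)
  \<comment> \<open>Here 6 = (1/2) * 2^2 * 3: one half from the symmetrisation, the square of the
    bound \<open>2 * p / M\<close> for differences of the cutoff between two stencil points, and the
    three terms of the symmetrised density.\<close>
  define C where "C = 6 * (real p)\<^sup>2 * K * m\<^sup>2 / c0"
  have C: "C > 0" using p1 K(1) m c0 by (simp add: C_def)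
  have "energy (\<lambda>x. cutoff M (x - z) *\<^sub>R v x) \<le> C / (real M)\<^sup>2 * (\<Sum>x\<in>cube (2 * M + 2 * p) z. (norm (v x))\<^sup>2)"
    if M: "M \<ge> 1" and v: "finite_energy v" and h: "harmonic v (cube (2 * M) z)" for v M z
  proof -
    define \<eta> where "\<eta> = (\<lambda>x. cutoff M (x - z))"
    define v1 where "v1 = (\<lambda>x. \<eta> x *\<^sub>R v x)"
    define v2 where "v2 = (\<lambda>x. (\<eta> x * \<eta> x) *\<^sub>R v x)"
    define S where "S = (\<Sum>x\<in>cube (2 * M + 2 * p) z. (norm (v x))\<^sup>2)"
    have eta0: "\<eta> x = 0" if "x \<notin> cube (2 * M) z" for x
      unfolding \<eta>_def by (rule cutoff_outside) (use that M in \<open>auto simp: cube_def\<close>)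
    have lip: "\<bar>\<eta> (x + \<rho>) - \<eta> x\<bar> \<le> real p / M" if "\<rho> \<in> P" for x \<rho>
    proof -
      have "\<bar>\<eta> (x + \<rho>) - \<eta> x\<bar> \<le> supnorm \<rho> / M"
        unfolding \<eta>_def using cutoff_lipschitz[of M "x - z" \<rho>] by (simp add: algebra_simps)
      also have "\<dots> \<le> real p / M" using supnorm_stencil[OF that] by (simp add: p_def divide_right_mono)
      finally show ?thesis .
    qed
    have V1: "vanishes_off (cube (2 * M) z) v1" and V2: "vanishes_off (cube (2 * M) z) v2"
      using eta0 by (auto simp: vanishes_off_def v1_def v2_def)
    define T where "T = (\<lambda>\<rho> \<sigma> x. q \<rho> \<sigma> (fdiff \<rho> v1 x) (fdiff \<sigma> v1 x) - q \<rho> \<sigma> (fdiff \<rho> v x) (fdiff \<sigma> v2 x))"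
    have Tsym: "T \<rho> \<sigma> x + T \<sigma> \<rho> x = - (\<eta> (x + \<rho>) - \<eta> (x + \<sigma>))\<^sup>2 * q \<rho> \<sigma> (v (x + \<rho>)) (v (x + \<sigma>))
        + (\<eta> (x + \<rho>) - \<eta> x)\<^sup>2 * q \<rho> \<sigma> (v (x + \<rho>)) (v x) + (\<eta> (x + \<sigma>) - \<eta> x)\<^sup>2 * q \<rho> \<sigma> (v x) (v (x + \<sigma>))"
      if "\<rho> \<in> P" "\<sigma> \<in> P" for \<rho> \<sigma> x
    proof -
      have sy: "q \<sigma> \<rho> a b = q \<rho> \<sigma> b a" for a b by (rule q_symmetric[OF that(2,1)])
      show ?thesis unfolding T_def fdiff_def v1_def v2_def sy
        by (simp add: q_algebra algebra_simps power2_eq_square)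
    qed
    have Tbd: "\<bar>T \<rho> \<sigma> x + T \<sigma> \<rho> x\<bar> \<le> (2 * real p / M)\<^sup>2 * K * ((norm (v (x + \<rho>)))\<^sup>2 + (norm (v (x + \<sigma>)))\<^sup>2 + (norm (v x))\<^sup>2)"
      if m: "\<rho> \<in> P" "\<sigma> \<in> P" for \<rho> \<sigma> x
    proof -
      let ?L = "(2 * real p / M)\<^sup>2"
      have l1: "\<bar>\<eta> (x + \<rho>) - \<eta> x\<bar> \<le> 2 * real p / M" "\<bar>\<eta> (x + \<sigma>) - \<eta> x\<bar> \<le> 2 * real p / M"
         "\<bar>\<eta> (x + \<rho>) - \<eta> (x + \<sigma>)\<bar> \<le> 2 * real p / M"
        using lip[OF m(1), of x] lip[OF m(2), of x] by (auto simp: abs_le_iff)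
      have sq: "t\<^sup>2 \<le> ?L" if "\<bar>t\<bar> \<le> 2 * real p / M" for t
        using power_mono[OF that, of 2] by simp
      have bd: "\<bar>t\<^sup>2 * q \<rho> \<sigma> a b\<bar> \<le> ?L * K * (norm a * norm b)" if "\<bar>t\<bar> \<le> 2 * real p / M" for t a b
        using mult_mono[OF sq[OF that] K(2)[OF m, of a b]] by (simp add: abs_mult mult.assoc)
      have "\<bar>T \<rho> \<sigma> x + T \<sigma> \<rho> x\<bar> \<le> ?L * K * (norm (v (x + \<rho>)) * norm (v (x + \<sigma>)))
        + ?L * K * (norm (v (x + \<rho>)) * norm (v x)) + ?L * K * (norm (v x) * norm (v (x + \<sigma>)))"
        using bd[OF l1(3), of "v (x + \<rho>)" "v (x + \<sigma>)"] bd[OF l1(1), of "v (x + \<rho>)" "v x"]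
          bd[OF l1(2), of "v x" "v (x + \<sigma>)"] unfolding Tsym[OF m] by linarith
      also have "\<dots> = ?L * K * (norm (v (x + \<rho>)) * norm (v (x + \<sigma>)) + norm (v (x + \<rho>)) * norm (v x) + norm (v x) * norm (v (x + \<sigma>)))"
        by (simp add: algebra_simps)
      also have "\<dots> \<le> ?L * K * ((norm (v (x + \<rho>)))\<^sup>2 + (norm (v (x + \<sigma>)))\<^sup>2 + (norm (v x))\<^sup>2)"
        using K(1) sum_squares_bound[of "norm (v (x + \<rho>))" "norm (v (x + \<sigma>))"]
          sum_squares_bound[of "norm (v (x + \<rho>))" "norm (v x)"] sum_squares_bound[of "norm (v x)" "norm (v (x + \<sigma>))"]
        by (intro mult_left_mono) auto
      finally show ?thesis .
    qed
    define D where "D = (\<lambda>x. form_dens v1 v1 x - form_dens v v2 x)"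
    have D_T: "D x = (1/2) * (\<Sum>\<rho>\<in>P. \<Sum>\<sigma>\<in>P. T \<rho> \<sigma> x + T \<sigma> \<rho> x)" for x
    proof -
      have "(\<Sum>\<rho>\<in>P. \<Sum>\<sigma>\<in>P. T \<sigma> \<rho> x) = (\<Sum>\<rho>\<in>P. \<Sum>\<sigma>\<in>P. T \<rho> \<sigma> x)" by (rule sum.swap)
      moreover have "D x = (\<Sum>\<rho>\<in>P. \<Sum>\<sigma>\<in>P. T \<rho> \<sigma> x)"
        by (simp add: D_def form_dens_def T_def sum_subtractf)
      ultimately show ?thesis by (simp add: sum.distrib)
    qed
    have D0: "D x = 0" if "x \<notin> cube (2 * M + p) z" for x
    proof -
      have "fdiff \<rho> v1 x = 0" "fdiff \<rho> v2 x = 0" if "\<rho> \<in> P" for \<rho>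
        using vanishes_off_fdiff[OF V1 supnorm_stencil[OF that]] vanishes_off_fdiff[OF V2 supnorm_stencil[OF that]]
          \<open>x \<notin> _\<close> by (auto simp: vanishes_off_def p_def)
      then show ?thesis by (simp add: D_def form_dens_def q_algebra)
    qed
    have "infsum D UNIV = sum D (cube (2 * M + p) z)"
      by (subst infsum_finite[symmetric], simp, rule infsum_cong_neutral) (use D0 in auto)
    also have "\<dots> \<le> (\<Sum>x\<in>cube (2 * M + p) z. (1/2) * (\<Sum>\<rho>\<in>P. \<Sum>\<sigma>\<in>P. (2 * real p / M)\<^sup>2 * K * ((norm (v (x + \<rho>)))\<^sup>2 + (norm (v (x + \<sigma>)))\<^sup>2 + (norm (v x))\<^sup>2)))"
      unfolding D_T by (intro sum_mono mult_left_mono order_trans[OF abs_ge_self Tbd]) auto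
    also have "\<dots> = (1/2) * ((2 * real p / M)\<^sup>2 * K) * (\<Sum>\<rho>\<in>P. \<Sum>\<sigma>\<in>P. (\<Sum>x\<in>cube (2 * M + p) z. (norm (v (x + \<rho>)))\<^sup>2) + (\<Sum>x\<in>cube (2 * M + p) z. (norm (v (x + \<sigma>)))\<^sup>2) + (\<Sum>x\<in>cube (2 * M + p) z. (norm (v x))\<^sup>2))"
      unfolding sum_distrib_left[symmetric] sum.distrib[symmetric] mult.assoc[symmetric]
      by (subst sum.swap, subst (2) sum.swap) simp
    also have "\<dots> \<le> (1/2) * ((2 * real p / M)\<^sup>2 * K) * (\<Sum>\<rho>\<in>P. \<Sum>\<sigma>\<in>P. S + S + S)"
    proof -
      have "(\<Sum>x\<in>cube (2 * M + p) z. (norm (v (x + \<xi>)))\<^sup>2) \<le> S" if "supnorm \<xi> \<le> p" for \<xi>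
        using sum_cube_shift_le[OF _ that, of "\<lambda>x. (norm (v x))\<^sup>2" "2 * M + p" z] by (simp add: S_def add.assoc mult_2)
      from this[OF supnorm_stencil[folded p_def]] this[of 0] show ?thesis
        using K(1) by (intro mult_left_mono sum_mono add_mono) auto
    qed
    also have "\<dots> = c0 * (C / (real M)\<^sup>2 * S)"
      using c0 by (simp add: C_def m_def power_divide power_mult_distrib power2_eq_square)
    finally have Dle: "infsum D UNIV \<le> c0 * (C / (real M)\<^sup>2 * S)" .
    have s1: "form_dens v1 v1 summable_on UNIV"
      by (intro form_bound finite_energy_vanishes[OF V1])
    have s2: "form_dens v v2 summable_on UNIV"
      by (intro form_bound v finite_energy_vanishes[OF V2])
    have s2': "(\<lambda>x. - form_dens v v2 x) summable_on UNIV"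
      using summable_on_cmult_right[OF s2, of "-1"] by simp
    have "form v v2 = 0" using h V2 by (simp add: harmonic_def)
    moreover have "infsum D UNIV = form v1 v1 - form v v2"
      using infsum_add[OF s1 s2']
      by (simp add: D_def form_def infsum_uminus)
    moreover have "c0 * energy v1 \<le> form v1 v1"
      by (rule form_coercive) (rule vanishes_off_finite[OF V1], simp)
    ultimately have "c0 * energy v1 \<le> c0 * (C / (real M)\<^sup>2 * S)" using Dle by linarith
    then show ?thesis using c0 by (simp only: mult_le_cancel_left_pos v1_def \<eta>_def S_def)
  qed
  then show ?thesis using C unfolding p_def by blast
qed

text \<open>The cutoff for the cube of radius N reaches to 2 (N + p) and its estimate to 2 (N + p) +
  2 p = 2 N + 4 p, where p is \<open>range_bound\<close>; for N >= 1 this is at most (4 p + 2)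
  N.\<close>

definition widen :: nat where "widen = 4 * range_bound + 2"

lemma widen_ge: "widen \<ge> 6" using range_bound_ge_1 by (simp add: widen_def)

lemma caccioppoli:
  "\<exists>C>0. \<forall>v N z. N \<ge> 1 \<longrightarrow> finite_energy v \<longrightarrow> harmonic v (cube (widen * N) z) \<longrightarrow>
     sum (dens v) (cube N z) \<le> C / (real N)\<^sup>2 * (\<Sum>x\<in>cube (widen * N) z. (norm (v x))\<^sup>2)"
proof -
  define p where "p = range_bound"
  obtain C where C: "C > 0" "\<And>v M z. M \<ge> 1 \<Longrightarrow> finite_energy v \<Longrightarrow> harmonic v (cube (2 * M) z) \<Longrightarrow>
     energy (\<lambda>x. cutoff M (x - z) *\<^sub>R v x)
       \<le> C / (real M)\<^sup>2 * (\<Sum>x\<in>cube (2 * M + 2 * p) z. (norm (v x))\<^sup>2)"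
    using cutoff_energy_bound unfolding p_def by blast
  have "sum (dens v) (cube N z) \<le> C / (real N)\<^sup>2 * (\<Sum>x\<in>cube (widen * N) z. (norm (v x))\<^sup>2)"
    if N: "N \<ge> 1" and v: "finite_energy v" and h: "harmonic v (cube (widen * N) z)" for v N z
  proof -
    \<comment> \<open>Enlarging the cutoff by the interaction range makes it equal to 1 at all
      stencil neighbours of the cube, so that the densities of \<open>v\<close> and of the cut
      function agree there.\<close>
    let ?M = "N + p"
    have pN: "p \<le> p * N" using N by simp
    have le: "2 * ?M + 2 * p \<le> widen * N"
      using pN by (simp add: widen_def p_def[symmetric] algebra_simps)
    define v1 where "v1 = (\<lambda>x. cutoff ?M (x - z) *\<^sub>R v x)"
    have V1: "vanishes_off (cube (2 * ?M) z) v1"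
      unfolding vanishes_off_def v1_def using N by (auto simp: cube_def intro!: cutoff_outside)
    have "dens v x = dens v1 x" if x: "x \<in> cube N z" for x
    proof -
      have "cutoff ?M (x + \<rho> - z) = 1" if "supnorm \<rho> \<le> p" for \<rho>
        by (rule cutoff_inside) (use cube_add[OF x that] N in \<open>auto simp: cube_def\<close>)
      from this[of 0] this[OF supnorm_stencil[folded p_def]] show ?thesis
        unfolding dens_def by (intro sum.cong refl) (simp add: fdiff_def v1_def)
    qed
    then have "sum (dens v) (cube N z) = sum (dens v1) (cube N z)" by (rule sum.cong[OF refl])
    also have "\<dots> \<le> energy v1"
      by (rule dens_sum_le_energy[OF finite_energy_vanishes[OF V1]]) simp
    also have "\<dots> \<le> C / (real ?M)\<^sup>2 * (\<Sum>x\<in>cube (2 * ?M + 2 * p) z. (norm (v x))\<^sup>2)"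
      unfolding v1_def by (rule C(2)[OF _ v harmonic_mono[OF h]]) (use N le in \<open>auto intro!: cube_mono\<close>)
    also have "\<dots> \<le> C / (real N)\<^sup>2 * (\<Sum>x\<in>cube (widen * N) z. (norm (v x))\<^sup>2)"
      using N C(1) le by (intro mult_mono sum_cube_mono divide_left_mono power_mono) (auto intro: sum_nonneg)
    finally show ?thesis .
  qed
  then show ?thesis using C(1) by blast
qed

end

text \<open>
  The discrete Sobolev inequality is obtained from the one-dimensional one, applied in one
  coordinate after the other; \<open>iterd K\<close> takes one difference in every coordinate of the list \<open>K\<close>.
\<close>

primrec iterd :: "'n list \<Rightarrow> (int^'n \<Rightarrow> 'b::real_vector) \<Rightarrow> int^'n \<Rightarrow> 'b" where
  "iterd [] v = v"
| "iterd (i # K) v = iterd K (fdiff (axis i 1) v)"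

text \<open>A sum over the one-sided box of side \<open>N\<close> with corner \<open>z\<close> in
  the listed coordinates, nested so that it matches the induction over coordinates.\<close>

primrec box_sum :: "'n list \<Rightarrow> nat \<Rightarrow> int^'n \<Rightarrow> (int^'n \<Rightarrow> real) \<Rightarrow> real" where
  "box_sum [] N z f = f z"
| "box_sum (i # is) N z f = (\<Sum>s<N. box_sum is N (z + axis i (int s)) f)"

lemma box_sum_add: "box_sum is N z (\<lambda>x. f x + g x) = box_sum is N z f + box_sum is N z g"
  by (induction "is" arbitrary: z) (auto simp: sum.distrib)

lemma box_sum_cmult: "box_sum is N z (\<lambda>x. c * f x) = c * box_sum is N z f"
  by (induction "is" arbitrary: z) (auto simp: sum_distrib_left)

text \<open>Distinct coordinates make the slices of the box disjoint, so no site is counted twice;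
  only then is the nested sum bounded by a sum over a set.\<close>

lemma box_sum_le_cube:
  fixes f :: "int^'n \<Rightarrow> real"
  assumes "distinct is" and f: "\<And>x. f x \<ge> 0"
  shows "box_sum is N z f \<le> sum f (cube N z)"
proof -
  define B where "B is z = {x. \<forall>i. if i \<in> set is then z $ i \<le> x $ i \<and> x $ i < z $ i + int N else x $ i = z $ i}"
    for "is" and z :: "int^'n"
  have sub: "B is z \<subseteq> cube N z" for "is" z
  proof
    fix x assume "x \<in> B is z"
    then have "\<bar>x $ i - z $ i\<bar> \<le> int N" for i unfolding B_def by (cases "i \<in> set is") (force split: if_splits)+
    then show "x \<in> cube N z" by (simp add: cube_iff)
  qed
  have fin: "finite (B is z)" for "is" z using finite_subset[OF sub] by simp
  have "box_sum is N z f \<le> sum f (B is z)" using assms(1)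
  proof (induction "is" arbitrary: z)
    case Nil
    have "B [] z = {z}" by (auto simp: B_def vec_eq_iff)
    then show ?case by simp
  next
    case (Cons i "is")
    have "box_sum (i # is) N z f \<le> (\<Sum>s<N. sum f (B is (z + axis i (int s))))"
      using Cons by (auto intro!: sum_mono)
    also have "\<dots> = sum f (\<Union>s<N. B is (z + axis i (int s)))"
    proof (rule sum.UNION_disjoint[symmetric])
      have val: "x $ i = z $ i + int s" if "x \<in> B is (z + axis i (int s))" for x s
      proof -
        have "if i \<in> set is then (z + axis i (int s)) $ i \<le> x $ i \<and> x $ i < (z + axis i (int s)) $ i + int N
            else x $ i = (z + axis i (int s)) $ i"
          using that unfolding B_def by blast
        then show ?thesis using Cons.prems by (simp add: axis_def)
      qed
      show "\<forall>s\<in>{..<N}. \<forall>t\<in>{..<N}. s \<noteq> t \<longrightarrow> B is (z + axis i (int s)) \<inter> B is (z + axis i (int t)) = {}"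
      proof (intro ballI impI equals0I)
        fix s t x assume "s \<noteq> t" "x \<in> B is (z + axis i (int s)) \<inter> B is (z + axis i (int t))"
        then show False using val[of x s] val[of x t] by simp
      qed
    qed (auto simp: fin)
    also have "\<dots> \<le> sum f (B (i # is) z)"
    proof (rule sum_mono2)
      show "(\<Union>s<N. B is (z + axis i (int s))) \<subseteq> B (i # is) z"
      proof clarify
        fix s x assume s: "s < N" and x: "x \<in> B is (z + axis i (int s))"
        have "if j \<in> set (i # is) then z $ j \<le> x $ j \<and> x $ j < z $ j + int N else x $ j = z $ j" for j
        proof -
          have "if j \<in> set is then (z + axis i (int s)) $ j \<le> x $ j \<and> x $ j < (z + axis i (int s)) $ j + int N
            else x $ j = (z + axis i (int s)) $ j"
            using x unfolding B_def by blast
          then show ?thesis using Cons.prems s by (cases "j = i") (auto simp: axis_def)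
        qed
        then show "x \<in> B (i # is) z" unfolding B_def by blast
      qed
    qed (auto simp: fin f)
    finally show ?case .
  qed
  also have "\<dots> \<le> sum f (cube N z)" by (rule sum_mono2) (auto simp: f sub)
  finally show ?thesis .
qed

text \<open>The value at \<open>z\<close> is recovered from each of the \<open>N\<close> points of
  the segment by telescoping, and the resulting bounds are averaged. The weight \<open>N^2\<close>
  on the difference is the one invariant under scaling.\<close>

lemma sobolev_line:
  fixes v :: "int^'n \<Rightarrow> 'b::real_normed_vector"
  assumes "N \<ge> 1"
  shows "(norm (v z))\<^sup>2 \<le> (2 / N) * (\<Sum>s<N. (norm (v (z + axis i (int s))))\<^sup>2 + (real N)\<^sup>2 * (norm (fdiff (axis i 1) v (z + axis i (int s))))\<^sup>2)"
proof -
  let ?v = "\<lambda>s. v (z + axis i (int s))"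
  let ?d = "\<lambda>s. fdiff (axis i 1) v (z + axis i (int s))"
  have tele: "?v n - v z = (\<Sum>j<n. ?d j)" for n
  proof (induction n)
    case 0 show ?case by (simp add: axis_def flip: zero_vec_def)
  next
    case (Suc n)
    have "axis i (int (Suc n)) = (axis i (int n) + axis i 1 :: int^'n)" by (auto simp: axis_def vec_eq_iff)
    then have "?v (Suc n) = ?v n + ?d n" by (simp add: fdiff_def add.assoc)
    then show ?case using Suc by simp
  qed
  let ?D = "\<Sum>j<N. (norm (?d j))\<^sup>2"
  have each: "(norm (v z))\<^sup>2 \<le> 2 * (norm (?v s))\<^sup>2 + 2 * (real N * ?D)" if "s < N" for s
  proof -
    have "(norm (v z))\<^sup>2 = (norm (?v s - (\<Sum>j<s. ?d j)))\<^sup>2" using tele[of s] by (simp add: algebra_simps)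
    also have "\<dots> \<le> 2 * (norm (?v s))\<^sup>2 + 2 * (norm (\<Sum>j<s. ?d j))\<^sup>2" by (rule norm_diff_sq_le)
    also have "(norm (\<Sum>j<s. ?d j))\<^sup>2 \<le> real (card {..<s}) * (\<Sum>j<s. (norm (?d j))\<^sup>2)" by (rule norm_sum_sq_le) auto
    also have "\<dots> \<le> real N * ?D" using that by (intro mult_mono sum_mono2) (auto intro: sum_nonneg)
    finally show ?thesis by simp
  qed
  have "N * (norm (v z))\<^sup>2 = (\<Sum>s<N. (norm (v z))\<^sup>2)" by simp
  also have "\<dots> \<le> (\<Sum>s<N. 2 * (norm (?v s))\<^sup>2 + 2 * (real N * ?D))" by (intro sum_mono each) auto
  also have "\<dots> = 2 * (\<Sum>s<N. (norm (?v s))\<^sup>2 + (real N)\<^sup>2 * (norm (?d s))\<^sup>2)"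
    by (simp add: sum.distrib sum_distrib_left power2_eq_square algebra_simps)
  finally show ?thesis using assms by (simp add: field_simps)
qed

text \<open>Applying the one-dimensional inequality coordinate by coordinate produces exactly these
  mixed differences, at most one per coordinate, each weighted by its scaling power.\<close>

definition sobolev_density :: "'n list \<Rightarrow> nat \<Rightarrow> (int^'n \<Rightarrow> 'b::real_normed_vector) \<Rightarrow> int^'n \<Rightarrow> real" where
  "sobolev_density is N v x = (\<Sum>K\<leftarrow>subseqs is. (real N) ^ (2 * length K) * (norm (iterd K v x))\<^sup>2)"

lemma sobolev_density_Cons:
  "sobolev_density (i # is) N v x
    = sobolev_density is N v x + (real N)\<^sup>2 * sobolev_density is N (fdiff (axis i 1) v) x"
proof -
  have "(\<Sum>K\<leftarrow>subseqs is. (real N) ^ (2 * length (i # K)) * (norm (iterd (i # K) v x))\<^sup>2)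
     = (real N)\<^sup>2 * sobolev_density is N (fdiff (axis i 1) v) x"
    unfolding sobolev_density_def sum_list_const_mult[symmetric]
    by (simp add: power2_eq_square mult.assoc)
  then show ?thesis by (simp add: sobolev_density_def Let_def o_def)
qed

lemma sobolev_box:
  fixes v :: "int^'n \<Rightarrow> 'b::real_normed_vector"
  assumes N: "N \<ge> 1"
  shows "(norm (v z))\<^sup>2 \<le> (2 / N) ^ length is * box_sum is N z (sobolev_density is N v)"
proof (induction "is" arbitrary: v z)
  case Nil show ?case by (simp add: sobolev_density_def)
next
  case (Cons i "is")
  let ?d = "fdiff (axis i 1) v"
  have "(norm (v z))\<^sup>2 \<le> (2 / N) * (\<Sum>s<N. (norm (v (z + axis i (int s))))\<^sup>2 + (real N)\<^sup>2 * (norm (?d (z + axis i (int s))))\<^sup>2)"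
    by (rule sobolev_line[OF N])
  also have "\<dots> \<le> (2 / N) * (\<Sum>s<N. (2 / N) ^ length is * box_sum is N (z + axis i (int s)) (sobolev_density is N v)
       + (real N)\<^sup>2 * ((2 / N) ^ length is * box_sum is N (z + axis i (int s)) (sobolev_density is N ?d)))"
    by (intro mult_left_mono sum_mono add_mono Cons.IH) auto
  also have "\<dots> = (2 / N) * (\<Sum>s<N. (2 / N) ^ length is * box_sum is N (z + axis i (int s)) (\<lambda>x. sobolev_density is N v x + (real N)\<^sup>2 * sobolev_density is N ?d x))"
    unfolding box_sum_add box_sum_cmult by (simp add: algebra_simps)
  also have "(\<lambda>x. sobolev_density is N v x + (real N)\<^sup>2 * sobolev_density is N ?d x) = sobolev_density (i # is) N v"
    by (rule ext) (rule sobolev_density_Cons[symmetric])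
  also have "(2 / N) * (\<Sum>s<N. (2 / N) ^ length is * box_sum is N (z + axis i (int s)) (sobolev_density (i # is) N v))
     = (2 / N) ^ length (i # is) * box_sum (i # is) N z (sobolev_density (i # is) N v)"
    by (simp add: sum_distrib_left mult.assoc)
  finally show ?case .
qed

context elliptic_form
begin

text \<open>Each application of \<open>caccioppoli\<close> trades one difference for a factor 1/N
  and a cube larger by the factor \<open>widen\<close>; it can be repeated because a difference of a
  harmonic function is harmonic.\<close>

lemma iterd_caccioppoli:
  "\<exists>C>0. \<forall>v N z. N \<ge> 1 \<longrightarrow> finite_energy v \<longrightarrow> harmonic v (cube (widen ^ length K * N) z) \<longrightarrow>
     (\<Sum>x\<in>cube N z. (real N) ^ (2 * length K) * (norm (iterd K v x))\<^sup>2)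
       \<le> C * (\<Sum>x\<in>cube (widen ^ length K * N) z. (norm (v x))\<^sup>2)"
proof (induction K)
  case Nil show ?case by (intro exI[of _ 1]) auto
next
  case (Cons i K)
  let ?R = "widen ^ length K"
  obtain C where C: "C > 0" "\<And>v N z. N \<ge> 1 \<Longrightarrow> finite_energy v \<Longrightarrow> harmonic v (cube (?R * N) z) \<Longrightarrow>
     (\<Sum>x\<in>cube N z. (real N) ^ (2 * length K) * (norm (iterd K v x))\<^sup>2)
       \<le> C * (\<Sum>x\<in>cube (?R * N) z. (norm (v x))\<^sup>2)" using Cons.IH by blast
  obtain C' where C': "C' > 0" "\<And>v N z. N \<ge> 1 \<Longrightarrow> finite_energy v \<Longrightarrow> harmonic v (cube (widen * N) z) \<Longrightarrow>
     sum (dens v) (cube N z) \<le> C' / (real N)\<^sup>2 * (\<Sum>x\<in>cube (widen * N) z. (norm (v x))\<^sup>2)"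
    using caccioppoli by blast
  have "(\<Sum>x\<in>cube N z. (real N) ^ (2 * length (i # K)) * (norm (iterd (i # K) v x))\<^sup>2)
       \<le> C * C' * (\<Sum>x\<in>cube (widen ^ length (i # K) * N) z. (norm (v x))\<^sup>2)"
    if N: "N \<ge> 1" and v: "finite_energy v" and h: "harmonic v (cube (widen ^ length (i # K) * N) z)" for v N z
  proof -
    let ?d = "fdiff (axis i 1) v"
    have R1: "?R * N \<ge> N" "?R * N \<ge> 1" using N widen_ge by auto
    have "?R * N + 1 \<le> widen * (?R * N)"
      using mult_le_mono1[of 2 widen "?R * N"] R1 widen_ge by linarith
    then have h1: "harmonic v (cube (?R * N + 1) z)"
      by (intro harmonic_mono[OF h] cube_mono) (simp add: mult.assoc)
    have hd: "harmonic ?d (cube (?R * N) z)" by (rule harmonic_fdiff[OF v h1]) simp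
    have "(\<Sum>x\<in>cube N z. (real N) ^ (2 * length (i # K)) * (norm (iterd (i # K) v x))\<^sup>2)
      = (real N)\<^sup>2 * (\<Sum>x\<in>cube N z. (real N) ^ (2 * length K) * (norm (iterd K ?d x))\<^sup>2)"
      by (simp add: sum_distrib_left power2_eq_square mult.assoc)
    also have "\<dots> \<le> (real N)\<^sup>2 * (C * (\<Sum>x\<in>cube (?R * N) z. (norm (?d x))\<^sup>2))"
      by (intro mult_left_mono C(2) N finite_energy_fdiff v hd) auto
    also have "\<dots> \<le> (real N)\<^sup>2 * (C * sum (dens v) (cube (?R * N) z))"
      using C(1) by (intro mult_left_mono sum_mono dens_ge axis_stencil) auto
    also have "\<dots> \<le> (real N)\<^sup>2 * (C * (C' / (real (?R * N))\<^sup>2 * (\<Sum>x\<in>cube (widen * (?R * N)) z. (norm (v x))\<^sup>2)))"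
      using C(1) h by (intro mult_left_mono C'(2) R1 v) (auto simp: mult.assoc)
    also have "\<dots> \<le> (real N)\<^sup>2 * (C * (C' / (real N)\<^sup>2 * (\<Sum>x\<in>cube (widen * (?R * N)) z. (norm (v x))\<^sup>2)))"
    proof -
      have "real N \<le> real (?R * N)" using R1(1) by (rule of_nat_mono)
      then have "C' / (real (?R * N))\<^sup>2 \<le> C' / (real N)\<^sup>2"
        using C'(1) N R1(2) by (intro divide_left_mono power_mono mult_pos_pos zero_less_power) linarith+
      then show ?thesis using C(1) by (intro mult_left_mono mult_right_mono) (auto intro: sum_nonneg)
    qed
    also have "\<dots> = C * C' * (\<Sum>x\<in>cube (widen ^ length (i # K) * N) z. (norm (v x))\<^sup>2)"
      using N by (simp add: mult.assoc)
    finally show ?thesis .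
  qed
  then show ?case using C(1) C'(1) by (intro exI[of _ "C * C'"]) auto
qed

text \<open>The Sobolev inequality on a box bounds the value by mixed differences, and these are
  bounded by the values on a larger cube. The result is a mean value inequality, the source of all
  pointwise bounds below.\<close>

lemma interior_estimate:
  "\<exists>C>0. \<forall>v r z. r \<ge> 1 \<longrightarrow> finite_energy v \<longrightarrow> harmonic v (cube r z) \<longrightarrow>
     (norm (v z))\<^sup>2 \<le> C / (real r) ^ CARD('n) * (\<Sum>x\<in>cube r z. (norm (v x))\<^sup>2)"
proof -
  obtain cs :: "'n list" where cs: "distinct cs" "set cs = UNIV" using finite_distinct_list[of "UNIV :: 'n set"] by auto
  have len: "length cs = CARD('n)" using distinct_card[OF cs(1)] cs(2) by simp
  let ?d = "CARD('n)"
  define R where "R = widen ^ ?d"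
  have R: "R \<ge> 1" using widen_ge by (simp add: R_def)
  have "\<forall>K. \<exists>C>0. \<forall>v N z. N \<ge> 1 \<longrightarrow> finite_energy v \<longrightarrow> harmonic v (cube (widen ^ length K * N) z) \<longrightarrow>
     (\<Sum>x\<in>cube N z. (real N) ^ (2 * length K) * (norm (iterd K v x))\<^sup>2)
       \<le> C * (\<Sum>x\<in>cube (widen ^ length (K :: 'n list) * N) z. (norm (v x))\<^sup>2)"
    using iterd_caccioppoli by blast
  then obtain CK where "\<forall>K. CK K > 0 \<and> (\<forall>v N z. N \<ge> 1 \<longrightarrow> finite_energy v \<longrightarrow> harmonic v (cube (widen ^ length K * N) z) \<longrightarrow>
     (\<Sum>x\<in>cube N z. (real N) ^ (2 * length K) * (norm (iterd K v x))\<^sup>2)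
       \<le> CK K * (\<Sum>x\<in>cube (widen ^ length (K :: 'n list) * N) z. (norm (v x))\<^sup>2))"
    unfolding choice_iff by (elim exE) (rule that)
  then have CK: "CK K > 0" "\<And>v N z. N \<ge> 1 \<Longrightarrow> finite_energy v \<Longrightarrow> harmonic v (cube (widen ^ length K * N) z) \<Longrightarrow>
     (\<Sum>x\<in>cube N z. (real N) ^ (2 * length K) * (norm (iterd K v x))\<^sup>2)
       \<le> CK K * (\<Sum>x\<in>cube (widen ^ length K * N) z. (norm (v x))\<^sup>2)" for K by blast+
  define C1 where "C1 = (\<Sum>K\<leftarrow>subseqs cs. CK K)"
  have C1: "C1 \<ge> 0" unfolding C1_def by (intro sum_list_nonneg) (use CK(1) less_imp_le in auto)
  have big: "(norm (v z))\<^sup>2 \<le> (2 / N) ^ ?d * (C1 * (\<Sum>x\<in>cube (R * N) z. (norm (v x))\<^sup>2))"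
    if N: "N \<ge> 1" and v: "finite_energy v" and h: "harmonic v (cube (R * N) z)" for v N z
  proof -
    let ?S = "\<Sum>x\<in>cube (R * N) z. (norm (v x))\<^sup>2"
    have nn: "sobolev_density cs N v x \<ge> 0" for x
      unfolding sobolev_density_def by (intro sum_list_nonneg) auto
    have "sum (sobolev_density cs N v) (cube N z)
      = (\<Sum>K\<leftarrow>subseqs cs. \<Sum>x\<in>cube N z. (real N) ^ (2 * length K) * (norm (iterd K v x))\<^sup>2)"
    proof -
      have "(\<Sum>x\<in>A. \<Sum>K\<leftarrow>L. f K x) = (\<Sum>K\<leftarrow>L. \<Sum>x\<in>A. f K x)" for A L and f :: "'n list \<Rightarrow> int^'n \<Rightarrow> real"
        by (induction L) (auto simp: sum.distrib)
      then show ?thesis unfolding sobolev_density_def .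
    qed
    also have "\<dots> \<le> (\<Sum>K\<leftarrow>subseqs cs. CK K * ?S)"
    proof (rule sum_list_mono)
      fix K assume "K \<in> set (subseqs cs)"
      then have "set K \<subseteq> set cs" "distinct K"
        using subseqs_powset[of cs] subseqs_distinctD[OF _ cs(1)] by (auto simp flip: image_set)
      then have "length K \<le> ?d" using distinct_card[of K] card_mono[of "UNIV :: 'n set" "set K"] by simp
      then have "widen ^ length K * N \<le> R * N"
        unfolding R_def using widen_ge by (intro mult_le_mono1 power_increasing) auto
      then have sub: "cube (widen ^ length K * N) z \<subseteq> cube (R * N) z" by (rule cube_mono)
      have "(\<Sum>x\<in>cube N z. (real N) ^ (2 * length K) * (norm (iterd K v x))\<^sup>2)
         \<le> CK K * (\<Sum>x\<in>cube (widen ^ length K * N) z. (norm (v x))\<^sup>2)"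
        by (rule CK(2)[OF N v harmonic_mono[OF h sub]])
      also have "\<dots> \<le> CK K * ?S" using CK(1)[of K] sub by (intro mult_left_mono sum_mono2) auto
      finally show "(\<Sum>x\<in>cube N z. (real N) ^ (2 * length K) * (norm (iterd K v x))\<^sup>2) \<le> CK K * ?S" .
    qed
    also have "\<dots> = C1 * ?S" by (simp add: C1_def sum_list_mult_const)
    finally have "sum (sobolev_density cs N v) (cube N z) \<le> C1 * ?S" .
    then have "box_sum cs N z (sobolev_density cs N v) \<le> C1 * ?S"
      using box_sum_le_cube[of cs "sobolev_density cs N v" N z, OF cs(1) nn] by linarith
    then have "(2 / N) ^ ?d * box_sum cs N z (sobolev_density cs N v) \<le> (2 / N) ^ ?d * (C1 * ?S)"
      by (intro mult_left_mono) auto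
    then show ?thesis using sobolev_box[OF N, of v z cs] unfolding len by linarith
  qed
  \<comment> \<open>The base \<open>4 * R\<close> serves two purposes. For r < R it makes
    \<open>C\<close> at least r^d, and the claim is trivial since \<open>v z\<close> occurs in the
    sum. For r >= R rounding to a multiple of \<open>R\<close> loses at most a factor 2, so that 2 /
    N <= 4 R / r.\<close>
  define C where "C = (4 * real R) ^ ?d * (C1 + 1)"
  have Cpos: "C > 0" using R C1 by (simp add: C_def)
  have "(norm (v z))\<^sup>2 \<le> C / (real r) ^ ?d * (\<Sum>x\<in>cube r z. (norm (v x))\<^sup>2)"
    if r: "r \<ge> 1" and v: "finite_energy v" and h: "harmonic v (cube r z)" for v r z
  proof (cases "r < R")
    case True
    let ?S = "\<Sum>x\<in>cube r z. (norm (v x))\<^sup>2"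
    have S: "(norm (v z))\<^sup>2 \<le> ?S" by (rule member_le_sum) auto
    have "(real r) ^ ?d \<le> (4 * real R) ^ ?d" using True by (intro power_mono) auto
    also have "\<dots> \<le> C" unfolding C_def using C1 by (simp add: algebra_simps)
    finally have "1 \<le> C / (real r) ^ ?d" using r by (simp add: le_divide_eq)
    then have "1 * ?S \<le> C / (real r) ^ ?d * ?S" by (intro mult_right_mono) (auto intro: sum_nonneg)
    then show ?thesis using S by linarith
  next
    case False
    let ?S = "\<Sum>x\<in>cube r z. (norm (v x))\<^sup>2"
    define N where "N = r div R"
    have N: "N \<ge> 1" using False R by (simp add: N_def div_greater_zero_iff Suc_le_eq)
    have RN: "R * N \<le> r" by (simp add: N_def)
    have "r < R * N + R" using R mod_less_divisor[of R r] mult_div_mod_eq[of R r] unfolding N_def by linarith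
    also have "\<dots> \<le> 2 * (R * N)" using N by simp
    finally have "real r \<le> 2 * (real R * real N)" by (metis less_imp_le of_nat_le_iff of_nat_mult of_nat_numeral)
    then have "2 / real N \<le> 4 * real R / real r" using N r by (simp add: field_simps)
    then have pw: "(2 / real N) ^ ?d \<le> (4 * real R / real r) ^ ?d" by (intro power_mono) auto
    have "(norm (v z))\<^sup>2 \<le> (2 / N) ^ ?d * (C1 * (\<Sum>x\<in>cube (R * N) z. (norm (v x))\<^sup>2))"
      by (rule big[OF N v harmonic_mono[OF h cube_mono[OF RN]]])
    also have "\<dots> \<le> (4 * real R / real r) ^ ?d * ((C1 + 1) * ?S)"
      using C1 pw RN by (intro mult_mono sum_cube_mono) (auto intro!: sum_nonneg mult_nonneg_nonneg)
    also have "\<dots> = C / (real r) ^ ?d * ?S" by (simp add: C_def power_divide)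
    finally show ?thesis .
  qed
  then show ?thesis using Cpos by blast
qed

lemma harmonic_dens_bound:
  "\<exists>C>0. \<forall>v r z. r \<ge> 2 * range_bound \<longrightarrow> finite_energy v \<longrightarrow> harmonic v (cube r z) \<longrightarrow>
     dens v z \<le> C / (real r) ^ CARD('n) * sum (dens v) (cube r z)"
proof -
  obtain C where C: "C > 0" "\<And>v r z. r \<ge> 1 \<Longrightarrow> finite_energy v \<Longrightarrow> harmonic v (cube r z) \<Longrightarrow>
     (norm (v z))\<^sup>2 \<le> C / (real r) ^ CARD('n) * (\<Sum>x\<in>cube r z. (norm (v x))\<^sup>2)"
    using interior_estimate by blast
  let ?d = "CARD('n)"
  have "dens v z \<le> C * 2 ^ ?d / (real r) ^ ?d * sum (dens v) (cube r z)"
    if r: "r \<ge> 2 * range_bound" and v: "finite_energy v" and h: "harmonic v (cube r z)" for v r z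
  proof -
    define r' where "r' = r - range_bound"
    have r': "r' \<ge> 1" "r = r' + range_bound" "r \<le> 2 * r'" "r' \<le> r"
      using r range_bound_ge_1 by (auto simp: r'_def)
    have "dens v z \<le> (\<Sum>\<rho>\<in>P. C / (real r') ^ ?d * (\<Sum>x\<in>cube r' z. (norm (fdiff \<rho> v x))\<^sup>2))"
      unfolding dens_def
      by (intro sum_mono C(2) r'(1) finite_energy_fdiff v harmonic_fdiff[OF v])
         (use h r'(2) supnorm_stencil in auto)
    also have "\<dots> = C / (real r') ^ ?d * sum (dens v) (cube r' z)"
      unfolding sum_distrib_left[symmetric] dens_def by (subst sum.swap) simp
    also have "\<dots> \<le> (C * 2 ^ ?d / (real r) ^ ?d) * sum (dens v) (cube r z)"
    proof (intro mult_mono sum_cube_mono)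
      have "(real r) ^ ?d \<le> (2 * real r') ^ ?d" using r'(3) by (intro power_mono) auto
      then have "C * (real r) ^ ?d \<le> C * (2 ^ ?d * (real r') ^ ?d)" using C(1) by (simp add: power_mult_distrib)
      then show "C / (real r') ^ ?d \<le> C * 2 ^ ?d / (real r) ^ ?d"
        using r' by (simp add: field_simps)
    qed (use C(1) r' in \<open>auto intro: sum_nonneg\<close>)
    finally show ?thesis .
  qed
  then show ?thesis using C(1) by (intro exI[of _ "C * 2 ^ ?d"]) auto
qed

text \<open>One more Caccioppoli step replaces the gradient on the right by values and gains
  \<open>r^-2\<close>. This gain is what turns each further difference into one more power of
  decay.\<close>

lemma harmonic_dens_bound_values:
  "\<exists>C>0. \<forall>v r z. r \<ge> 2 * range_bound * widen \<longrightarrow> finite_energy v \<longrightarrow> harmonic v (cube r z) \<longrightarrow>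
     dens v z \<le> C / (real r) ^ (CARD('n) + 2) * (\<Sum>x\<in>cube r z. (norm (v x))\<^sup>2)"
proof -
  let ?d = "CARD('n)"
  obtain C where C: "C > 0" "\<And>v r z. r \<ge> 2 * range_bound \<Longrightarrow> finite_energy v \<Longrightarrow> harmonic v (cube r z) \<Longrightarrow>
     dens v z \<le> C / (real r) ^ ?d * sum (dens v) (cube r z)"
    using harmonic_dens_bound by blast
  obtain C' where C': "C' > 0" "\<And>v N z. N \<ge> 1 \<Longrightarrow> finite_energy v \<Longrightarrow> harmonic v (cube (widen * N) z) \<Longrightarrow>
     sum (dens v) (cube N z) \<le> C' / (real N)\<^sup>2 * (\<Sum>x\<in>cube (widen * N) z. (norm (v x))\<^sup>2)"
    using caccioppoli by blast
  define W where "W = (2 * real widen) ^ (?d + 2)"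
  have W: "W > 0" using widen_ge by (simp add: W_def)
  have "dens v z \<le> C * C' * W / (real r) ^ (?d + 2) * (\<Sum>x\<in>cube r z. (norm (v x))\<^sup>2)"
    if r: "r \<ge> 2 * range_bound * widen" and v: "finite_energy v" and h: "harmonic v (cube r z)" for v r z
  proof -
    define N where "N = r div widen"
    have w0: "widen > 0" using widen_ge by simp
    have N2: "N \<ge> 2 * range_bound" using div_le_mono[OF r, of widen] w0 by (simp add: N_def)
    have N1: "N \<ge> 1" using N2 range_bound_ge_1 by simp
    have wN: "widen * N \<le> r" by (simp add: N_def)
    have Nr: "N \<le> r" using wN w0 by (metis le_trans mult_le_mono1 nat_mult_1 Suc_leI One_nat_def)
    have hN: "harmonic v (cube (widen * N) z)" by (rule harmonic_mono[OF h cube_mono[OF wN]])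
    have "r < widen * N + widen" using w0 mod_less_divisor[of widen r] mult_div_mod_eq[of widen r] unfolding N_def by linarith
    also have "\<dots> \<le> 2 * (widen * N)" using N1 by simp
    finally have "real r \<le> 2 * (real widen * real N)" by (metis less_imp_le of_nat_le_iff of_nat_mult of_nat_numeral)
    then have "real r \<le> (2 * real widen) * real N" by simp
    then have "(real r) ^ (?d + 2) \<le> ((2 * real widen) * real N) ^ (?d + 2)" by (rule power_mono) simp
    then have rW: "(real r) ^ (?d + 2) \<le> W * (real N) ^ (?d + 2)" by (simp only: W_def power_mult_distrib)
    have "dens v z \<le> C / (real N) ^ ?d * sum (dens v) (cube N z)"
      by (rule C(2)[OF N2 v harmonic_mono[OF h cube_mono[OF Nr]]])
    also have "\<dots> \<le> C / (real N) ^ ?d * (C' / (real N)\<^sup>2 * (\<Sum>x\<in>cube (widen * N) z. (norm (v x))\<^sup>2))"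
      using C(1) by (intro mult_left_mono C'(2) N1 v hN) auto
    also have "\<dots> = C * C' / (real N) ^ (?d + 2) * (\<Sum>x\<in>cube (widen * N) z. (norm (v x))\<^sup>2)"
      by (simp add: power_add power2_eq_square mult_ac)
    also have "\<dots> \<le> C * C' * W / (real r) ^ (?d + 2) * (\<Sum>x\<in>cube r z. (norm (v x))\<^sup>2)"
    proof (intro mult_mono sum_cube_mono wN)
      have p1: "(real N) ^ (?d + 2) > 0" "(real r) ^ (?d + 2) > 0" using N1 Nr by auto
      have "C * C' * (real r) ^ (?d + 2) \<le> C * C' * (W * (real N) ^ (?d + 2))"
        using rW C(1) C'(1) by (intro mult_left_mono) auto
      moreover have "x / M \<le> y / R" if "x * R \<le> y * M" "M > 0" "R > 0" for x y M R :: real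
        using that by (simp add: field_simps)
      ultimately show "C * C' / (real N) ^ (?d + 2) \<le> C * C' * W / (real r) ^ (?d + 2)"
        using p1 by (simp only: mult.assoc)
    qed (use C(1) C'(1) W in \<open>auto intro: sum_nonneg\<close>)
    finally show ?thesis .
  qed
  then show ?thesis using C(1) C'(1) W by (intro exI[of _ "C * C' * W"]) auto
qed

text \<open>Meant for a fixed vector and a large radius: by \<open>energy_fdiff\<close> the sum of
  squares in the interior estimate is bounded by the energy, leaving the factor r^-d. It measures
  how far a function harmonic in a large hole is from being constant near the centre.\<close>

lemma harmonic_fdiff_bound:
  "\<exists>C>0. \<forall>v r z \<xi>. r \<ge> 2 \<longrightarrow> r \<ge> 2 * supnorm \<xi> \<longrightarrow> finite_energy v \<longrightarrow> harmonic v (cube r z) \<longrightarrow>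
     (norm (fdiff \<xi> v z))\<^sup>2 \<le> C / (real r) ^ CARD('n) * ((real (supnorm \<xi>))\<^sup>2 * energy v)"
proof -
  obtain C where C: "C > 0" "\<And>v r z. r \<ge> 1 \<Longrightarrow> finite_energy v \<Longrightarrow> harmonic v (cube r z) \<Longrightarrow>
     (norm (v z))\<^sup>2 \<le> C / (real r) ^ CARD('n) * (\<Sum>x\<in>cube r z. (norm (v x))\<^sup>2)"
    using interior_estimate by blast
  let ?d = "CARD('n)"
  have "(norm (fdiff \<xi> v z))\<^sup>2 \<le> (C * 2 ^ ?d * 2 ^ (?d + 1)) / (real r) ^ ?d * ((real (supnorm \<xi>))\<^sup>2 * energy v)"
    if r: "r \<ge> 2" "r \<ge> 2 * supnorm \<xi>" and v: "finite_energy v" and h: "harmonic v (cube r z)" for v r z \<xi>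
  proof -
    define r' where "r' = r - supnorm \<xi>"
    have r': "r' \<ge> 1" "r = r' + supnorm \<xi>" "r \<le> 2 * r'" using r by (auto simp: r'_def)
    have "(norm (fdiff \<xi> v z))\<^sup>2 \<le> C / (real r') ^ ?d * (\<Sum>x\<in>cube r' z. (norm (fdiff \<xi> v x))\<^sup>2)"
      by (intro C(2) r'(1) finite_energy_fdiff v harmonic_fdiff[OF v]) (use h r'(2) in auto)
    also have "\<dots> \<le> C / (real r') ^ ?d * (2 ^ (?d + 1) * (real (supnorm \<xi>))\<^sup>2 * energy v)"
    proof (intro mult_left_mono)
      have "(\<Sum>x\<in>cube r' z. (norm (fdiff \<xi> v x))\<^sup>2) \<le> sum_sq (fdiff \<xi> v)"
        by (rule finite_sum_le_infsum) (auto intro: energy_fdiff(1)[OF v])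
      then show "(\<Sum>x\<in>cube r' z. (norm (fdiff \<xi> v x))\<^sup>2) \<le> 2 ^ (?d + 1) * (real (supnorm \<xi>))\<^sup>2 * energy v"
        using energy_fdiff(2)[OF v, of \<xi>] by linarith
    qed (use C(1) in auto)
    also have "\<dots> \<le> (C * 2 ^ ?d / (real r) ^ ?d) * (2 ^ (?d + 1) * (real (supnorm \<xi>))\<^sup>2 * energy v)"
    proof (intro mult_right_mono)
      have "(real r) ^ ?d \<le> (2 * real r') ^ ?d" using r'(3) by (intro power_mono) auto
      then have "C * (real r) ^ ?d \<le> C * (2 ^ ?d * (real r') ^ ?d)" using C(1) by (simp add: power_mult_distrib)
      then show "C / (real r') ^ ?d \<le> C * 2 ^ ?d / (real r) ^ ?d"
        using r' r by (simp add: field_simps)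
    qed auto
    finally show ?thesis by (simp add: mult_ac)
  qed
  then show ?thesis using C(1) by (intro exI[of _ "C * 2 ^ ?d * 2 ^ (?d + 1)"]) auto
qed

text \<open>A shift by \<open>2 * r + 1\<close> along one coordinate moves the cube off itself. So
  on the cube the difference along this vector is \<open>- v\<close>, and
  \<open>energy_fdiff\<close> applies.\<close>

lemma friedrichs:
  fixes v :: "int^'n \<Rightarrow> 'b"
  assumes v: "vanishes_off (cube r z) v"
  shows "(\<Sum>x\<in>cube r z. (norm (v x))\<^sup>2) \<le> 2 ^ (CARD('n) + 1) * (real (2 * r + 1))\<^sup>2 * energy v"
proof -
  obtain i :: 'n where True by blast
  let ?\<xi> = "axis i (int (2 * r + 1)) :: int^'n"
  have "(\<Sum>x\<in>cube r z. (norm (v x))\<^sup>2) = (\<Sum>x\<in>cube r z. (norm (fdiff ?\<xi> v x))\<^sup>2)"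
  proof (rule sum.cong[OF refl])
    fix x assume x: "x \<in> cube r z"
    have "x + ?\<xi> \<notin> cube r z"
    proof
      assume "x + ?\<xi> \<in> cube r z"
      then have "\<bar>(x + ?\<xi>) $ i - z $ i\<bar> \<le> int r" unfolding cube_iff by blast
      moreover have "\<bar>x $ i - z $ i\<bar> \<le> int r" using x unfolding cube_iff by blast
      ultimately show False by (simp add: axis_def)
    qed
    then have "v (x + ?\<xi>) = 0" using v by (simp add: vanishes_off_def)
    then show "(norm (v x))\<^sup>2 = (norm (fdiff ?\<xi> v x))\<^sup>2" by (simp add: fdiff_def)
  qed
  also have "\<dots> \<le> sum_sq (fdiff ?\<xi> v)"
    by (rule finite_sum_le_infsum) (auto intro: energy_fdiff(1)[OF finite_energy_vanishes[OF v]])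
  also have "\<dots> \<le> 2 ^ (CARD('n) + 1) * (real (supnorm ?\<xi>))\<^sup>2 * energy v"
    by (rule energy_fdiff(2)[OF finite_energy_vanishes[OF v]])
  also have "supnorm ?\<xi> = 2 * r + 1" by simp
  finally show ?thesis by simp
qed

section \<open>Weak solutions with a flux as right-hand side\<close>

lemma flux_pair_add:
  fixes u v :: "int^'n \<Rightarrow> 'b"
  assumes "finite {x. u x \<noteq> 0}" "finite {x. v x \<noteq> 0}"
  shows "flux_pair G (\<lambda>x. u x + t *\<^sub>R v x) = flux_pair G u + t * flux_pair G v"
proof -
  have "(\<Sum>\<rho>\<in>P. G \<rho> x \<bullet> fdiff \<rho> (\<lambda>x. u x + t *\<^sub>R v x) x)
     = (\<Sum>\<rho>\<in>P. G \<rho> x \<bullet> fdiff \<rho> u x) + t * (\<Sum>\<rho>\<in>P. G \<rho> x \<bullet> fdiff \<rho> v x)" for x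
  proof -
    have "fdiff \<rho> (\<lambda>x. u x + t *\<^sub>R v x) x = fdiff \<rho> u x + t *\<^sub>R fdiff \<rho> v x" for \<rho>
      by (simp add: fdiff_def algebra_simps)
    then show ?thesis by (simp add: inner_add_right sum.distrib sum_distrib_left)
  qed
  then show ?thesis unfolding flux_pair_def
    using summable_on_fsupp[OF fsupp_flux[OF assms(1), of G]] summable_on_fsupp[OF fsupp_flux[OF assms(2), of G]]
    by (simp add: infsum_add infsum_cmult_right summable_on_cmult_right)
qed

text \<open>The solution with zero values off the cube. Coercivity applied to it and the
  Cauchy--Schwarz bound for the flux control its root energy by the root of the flux; subtracting it
  from a weak solution leaves a harmonic function.\<close>

lemma local_corrector:
  obtains v where "vanishes_off (cube r z) v" "\<And>w. vanishes_off (cube r z) w \<Longrightarrow> form v w = flux_pair G w"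
    "energy v \<le> sum (flux_dens G) (cube (r + range_bound) z) / c0\<^sup>2"
proof -
  let ?S = "sum (flux_dens G) (cube (r + range_bound) z)"
  have lin: "flux_pair G (\<lambda>x. u x + t *\<^sub>R v x) = flux_pair G u + t * flux_pair G v"
    if "vanishes_off (cube r z) u" "vanishes_off (cube r z) v" for u v :: "int^'n \<Rightarrow> 'b" and t
    by (intro flux_pair_add vanishes_off_finite[of "cube r z"] that) auto
  obtain v where v: "vanishes_off (cube r z) v" "\<And>w. vanishes_off (cube r z) w \<Longrightarrow> form v w = flux_pair G w"
    using dirichlet_solution[of "cube r z" "flux_pair G", OF finite_cube lin] by metis
  have fin: "finite {x. v x \<noteq> 0}" by (rule vanishes_off_finite[OF v(1)]) simp
  have S: "?S \<ge> 0" by (intro sum_nonneg) auto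
  have "c0 * energy v \<le> sqrt ?S * sqrt (energy v)"
    using form_coercive[OF fin] v(2)[OF v(1)] flux_pair_cube_bound[OF v(1), of G] by linarith
  then have "c0 * (sqrt (energy v) * sqrt (energy v)) \<le> sqrt ?S * sqrt (energy v)" by simp
  then have "(c0 * sqrt (energy v)) * sqrt (energy v) \<le> sqrt ?S * sqrt (energy v)" by (simp only: mult.assoc)
  then have "c0 * sqrt (energy v) \<le> sqrt ?S"
  proof (cases "sqrt (energy v) > 0")
    case False
    then have "sqrt (energy v) = 0" using real_sqrt_ge_zero[OF energy_nonneg, of v] by linarith
    then show ?thesis using S by simp
  qed (simp only: mult_le_cancel_right_pos)
  then have "(c0 * sqrt (energy v))\<^sup>2 \<le> (sqrt ?S)\<^sup>2" using c0 by (intro power_mono) auto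
  then have "c0\<^sup>2 * energy v \<le> ?S" using S by (simp add: power_mult_distrib)
  then have "energy v \<le> ?S / c0\<^sup>2" using c0 by (simp add: field_simps)
  with v that show thesis by blast
qed

definition weak_solution :: "(int^'n \<Rightarrow> 'b) \<Rightarrow> (int^'n \<Rightarrow> int^'n \<Rightarrow> 'b) \<Rightarrow> (int^'n) set \<Rightarrow> bool" where
  "weak_solution v G K \<longleftrightarrow> (\<forall>w. vanishes_off K w \<longrightarrow> form v w = flux_pair G w)"

lemma dens_add_le:
  fixes u v :: "int^'n \<Rightarrow> 'c::real_normed_vector"
  shows "dens (\<lambda>x. u x + v x) x \<le> 2 * dens u x + 2 * dens v x"
proof -
  have "dens (\<lambda>x. u x + v x) x = (\<Sum>\<rho>\<in>P. (norm (fdiff \<rho> u x + fdiff \<rho> v x))\<^sup>2)"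
    unfolding dens_def by (intro sum.cong refl) (simp add: fdiff_def algebra_simps)
  also have "\<dots> \<le> (\<Sum>\<rho>\<in>P. 2 * (norm (fdiff \<rho> u x))\<^sup>2 + 2 * (norm (fdiff \<rho> v x))\<^sup>2)"
    by (intro sum_mono norm_add_sq_le)
  also have "\<dots> = 2 * dens u x + 2 * dens v x" by (simp add: dens_def sum.distrib sum_distrib_left)
  finally show ?thesis .
qed

lemma dens_diff_le:
  fixes u v :: "int^'n \<Rightarrow> 'c::real_normed_vector"
  shows "dens (\<lambda>x. u x - v x) x \<le> 2 * dens u x + 2 * dens v x"
proof -
  have "dens (\<lambda>x. - v x) x = dens v x" by (simp add: dens_def fdiff_def norm_minus_commute)
  then show ?thesis using dens_add_le[of u "\<lambda>x. - v x" x] by simp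
qed

lemma weak_solution_split:
  assumes w: "finite_energy w" "weak_solution w G (cube r z)"
  obtains h v where "finite_energy h" "harmonic h (cube r z)" "vanishes_off (cube r z) v"
    "\<And>x. w x = h x + v x" "energy v \<le> sum (flux_dens G) (cube (r + range_bound) z) / c0\<^sup>2"
proof -
  obtain v where v: "vanishes_off (cube r z) v" "\<And>w. vanishes_off (cube r z) w \<Longrightarrow> form v w = flux_pair G w"
    "energy v \<le> sum (flux_dens G) (cube (r + range_bound) z) / c0\<^sup>2"
    by (rule local_corrector[of r z G]) (rule that)
  have fv: "finite_energy v" by (rule finite_energy_vanishes[OF v(1)])
  show thesis
  proof (rule that[of "\<lambda>x. w x - v x" v])
    show "harmonic (\<lambda>x. w x - v x) (cube r z)"
      unfolding harmonic_def
    proof (intro allI impI)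
      fix \<phi> :: "int^'n \<Rightarrow> 'b" assume \<phi>: "vanishes_off (cube r z) \<phi>"
      show "form (\<lambda>x. w x - v x) \<phi> = 0"
        using form_diff_left[OF w(1) fv finite_energy_vanishes[OF \<phi>]] v(2)[OF \<phi>] w(2) \<phi>
        by (simp add: weak_solution_def)
    qed
  qed (use v energy_diff(1)[OF w(1) fv] in auto)
qed

text \<open>The weak solution is split into a harmonic part and the corrector. The interior estimate
  applies to the former; the density of the latter at a site is at most its whole energy, hence
  bounded by the flux.\<close>

lemma weak_solution_dens_bound:
  "\<exists>C>0. \<forall>w G r z. r \<ge> 2 * range_bound \<longrightarrow> finite_energy w \<longrightarrow> weak_solution w G (cube r z) \<longrightarrow>
     dens w z \<le> C / (real r) ^ CARD('n) * sum (dens w) (cube r z) + C * sum (flux_dens G) (cube (r + range_bound) z)"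
proof -
  let ?d = "CARD('n)"
  obtain C where C: "C > 0" "\<And>v r z. r \<ge> 2 * range_bound \<Longrightarrow> finite_energy v \<Longrightarrow> harmonic v (cube r z) \<Longrightarrow>
     dens v z \<le> C / (real r) ^ ?d * sum (dens v) (cube r z)"
    using harmonic_dens_bound by blast
  define B where "B = 4 * C + (4 * C + 2) / c0\<^sup>2"
  have B: "B > 0" using C(1) c0 by (simp add: B_def add_pos_pos)
  have "dens w z \<le> B / (real r) ^ ?d * sum (dens w) (cube r z) + B * sum (flux_dens G) (cube (r + range_bound) z)"
    if r: "r \<ge> 2 * range_bound" and w: "finite_energy w" "weak_solution w G (cube r z)" for w G r z
  proof -
    let ?F = "sum (flux_dens G) (cube (r + range_bound) z)"
    let ?D = "sum (dens w) (cube r z)"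
    obtain h v where hv: "finite_energy h" "harmonic h (cube r z)" "vanishes_off (cube r z) v"
      "\<And>x. w x = h x + v x" "energy v \<le> ?F / c0\<^sup>2"
      by (rule weak_solution_split[OF w]) (rule that)
    have fv: "finite_energy v" by (rule finite_energy_vanishes[OF hv(3)])
    have w_eq: "w = (\<lambda>x. h x + v x)" and h_eq: "h = (\<lambda>x. w x - v x)" using hv(4) by auto
    have v1: "dens v z \<le> energy v" using dens_sum_le_energy[OF fv, of "{z}"] by simp
    have "sum (dens h) (cube r z) \<le> (\<Sum>x\<in>cube r z. 2 * dens w x + 2 * dens v x)"
      unfolding h_eq by (intro sum_mono dens_diff_le)
    also have "\<dots> \<le> 2 * ?D + 2 * (?F / c0\<^sup>2)"
      using dens_sum_le_energy[OF fv, of "cube r z"] hv(5) by (simp add: sum.distrib flip: sum_distrib_left)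
    finally have hs: "sum (dens h) (cube r z) \<le> 2 * ?D + 2 * (?F / c0\<^sup>2)" .
    have F0: "?F \<ge> 0" by (intro sum_nonneg) auto
    have D0: "?D \<ge> 0" by (intro sum_nonneg) auto
    have r1: "(real r) ^ ?d \<ge> 1" using r range_bound_ge_1 by (intro one_le_power) auto
    have "dens w z \<le> 2 * dens h z + 2 * dens v z" unfolding w_eq by (rule dens_add_le)
    also have "\<dots> \<le> 2 * (C / (real r) ^ ?d * (2 * ?D + 2 * (?F / c0\<^sup>2))) + 2 * (?F / c0\<^sup>2)"
    proof -
      have "dens h z \<le> C / (real r) ^ ?d * sum (dens h) (cube r z)" by (rule C(2)[OF r hv(1,2)])
      also have "\<dots> \<le> C / (real r) ^ ?d * (2 * ?D + 2 * (?F / c0\<^sup>2))"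
        using C(1) by (intro mult_left_mono hs) auto
      finally show ?thesis using v1 hv(5) by linarith
    qed
    also have "\<dots> = 4 * (C / (real r) ^ ?d) * ?D + (4 * (C / (real r) ^ ?d) + 2) * (?F / c0\<^sup>2)"
    proof -
      have "2 * (x * (2 * D + 2 * y)) + 2 * y = 4 * x * D + (4 * x + 2) * y" for x y D :: real
        by (simp add: algebra_simps)
      then show ?thesis .
    qed
    also have "\<dots> \<le> B / (real r) ^ ?d * ?D + (4 * C + 2) * (?F / c0\<^sup>2)"
    proof (intro add_mono mult_right_mono)
      have "4 * C / (real r) ^ ?d \<le> B / (real r) ^ ?d"
        using C(1) c0 by (intro divide_right_mono) (auto simp: B_def)
      then show "4 * (C / (real r) ^ ?d) \<le> B / (real r) ^ ?d" by simp
      have "r > 0" using r range_bound_ge_1 by linarith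
      then have "C / (real r) ^ ?d \<le> C / 1" using C(1) r1 by (intro divide_left_mono) auto
      then show "4 * (C / (real r) ^ ?d) \<le> 4 * C" by simp
    qed (use F0 D0 in auto)
    also have "(4 * C + 2) * (?F / c0\<^sup>2) \<le> B * ?F"
      using C(1) F0 by (simp add: B_def algebra_simps)
    finally show ?thesis by simp
  qed
  then show ?thesis using B by blast
qed

text \<open>As before, but now values of the corrector enter the estimate of the harmonic part. The
  corrector vanishes off the cube, so \<open>friedrichs\<close> bounds them by \<open>r^2\<close>
  times its energy, which the factor \<open>r^-(d+2)\<close> more than compensates.\<close>

lemma weak_solution_dens_bound_values:
  "\<exists>C>0. \<forall>w G r z. r \<ge> 2 * range_bound * widen \<longrightarrow> finite_energy w \<longrightarrow> weak_solution w G (cube r z) \<longrightarrow>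
     dens w z \<le> C / (real r) ^ (CARD('n) + 2) * (\<Sum>x\<in>cube r z. (norm (w x))\<^sup>2)
       + C * sum (flux_dens G) (cube (r + range_bound) z)"
proof -
  let ?d = "CARD('n)"
  obtain C where C: "C > 0" "\<And>v r z. r \<ge> 2 * range_bound * widen \<Longrightarrow> finite_energy v \<Longrightarrow> harmonic v (cube r z) \<Longrightarrow>
     dens v z \<le> C / (real r) ^ (?d + 2) * (\<Sum>x\<in>cube r z. (norm (v x))\<^sup>2)"
    using harmonic_dens_bound_values by blast
  \<comment> \<open>The 9 comes from (2 r + 1)^2 <= (3 r)^2 in \<open>friedrichs\<close>, the power
    of \<open>c0\<close> from the energy of the corrector.\<close>
  define A where "A = 2 ^ (?d + 1) * 9 / c0\<^sup>2"
  have A: "A > 0" using c0 by (simp add: A_def)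
  define B where "B = 4 * C + (4 * C * A + 2 / c0\<^sup>2)"
  have B: "B > 0" using C(1) c0 A by (simp add: B_def add_pos_pos)
  have "dens w z \<le> B / (real r) ^ (?d + 2) * (\<Sum>x\<in>cube r z. (norm (w x))\<^sup>2) + B * sum (flux_dens G) (cube (r + range_bound) z)"
    if r: "r \<ge> 2 * range_bound * widen" and w: "finite_energy w" "weak_solution w G (cube r z)" for w G r z
  proof -
    let ?F = "sum (flux_dens G) (cube (r + range_bound) z)"
    let ?D = "\<Sum>x\<in>cube r z. (norm (w x))\<^sup>2"
    obtain h v where hv: "finite_energy h" "harmonic h (cube r z)" "vanishes_off (cube r z) v"
      "\<And>x. w x = h x + v x" "energy v \<le> ?F / c0\<^sup>2"
      by (rule weak_solution_split[OF w]) (rule that)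
    have fv: "finite_energy v" by (rule finite_energy_vanishes[OF hv(3)])
    have w_eq: "w = (\<lambda>x. h x + v x)" using hv(4) by auto
    have v1: "dens v z \<le> energy v" using dens_sum_le_energy[OF fv, of "{z}"] by simp
    have F0: "?F \<ge> 0" by (intro sum_nonneg) auto
    have D0: "?D \<ge> 0" by (intro sum_nonneg) auto
    have "2 * range_bound * widen \<ge> 1" using range_bound_ge_1 widen_ge by simp
    then have rr: "real r \<ge> 1" using r by linarith
    have vs: "(\<Sum>x\<in>cube r z. (norm (v x))\<^sup>2) \<le> A * (real r)\<^sup>2 * ?F"
    proof -
      have "(\<Sum>x\<in>cube r z. (norm (v x))\<^sup>2) \<le> 2 ^ (?d + 1) * (real (2 * r + 1))\<^sup>2 * energy v"
        by (rule friedrichs[OF hv(3)])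
      also have "\<dots> \<le> 2 ^ (?d + 1) * (3 * real r)\<^sup>2 * (?F / c0\<^sup>2)"
        using rr by (intro mult_mono power_mono hv(5)) auto
      also have "\<dots> = A * (real r)\<^sup>2 * ?F" by (simp add: A_def power_mult_distrib)
      finally show ?thesis .
    qed
    have "(\<Sum>x\<in>cube r z. (norm (h x))\<^sup>2) \<le> (\<Sum>x\<in>cube r z. 2 * (norm (w x))\<^sup>2 + 2 * (norm (v x))\<^sup>2)"
      using norm_diff_sq_le[of "w x" "v x" for x] hv(4) by (intro sum_mono) (metis add_diff_cancel_right')
    also have "\<dots> \<le> 2 * ?D + 2 * (A * (real r)\<^sup>2 * ?F)"
      using vs by (simp add: sum.distrib flip: sum_distrib_left)
    finally have hs: "(\<Sum>x\<in>cube r z. (norm (h x))\<^sup>2) \<le> 2 * ?D + 2 * (A * (real r)\<^sup>2 * ?F)" .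
    have "dens w z \<le> 2 * dens h z + 2 * dens v z" unfolding w_eq by (rule dens_add_le)
    also have "\<dots> \<le> 2 * (C / (real r) ^ (?d + 2) * (2 * ?D + 2 * (A * (real r)\<^sup>2 * ?F))) + 2 * (?F / c0\<^sup>2)"
    proof -
      have "dens h z \<le> C / (real r) ^ (?d + 2) * (\<Sum>x\<in>cube r z. (norm (h x))\<^sup>2)" by (rule C(2)[OF r hv(1,2)])
      also have "\<dots> \<le> C / (real r) ^ (?d + 2) * (2 * ?D + 2 * (A * (real r)\<^sup>2 * ?F))"
        using C(1) by (intro mult_left_mono hs) auto
      finally show ?thesis using v1 hv(5) by linarith
    qed
    also have "\<dots> = 4 * C / (real r) ^ (?d + 2) * ?D + 4 * C * A * ((real r)\<^sup>2 / (real r) ^ (?d + 2)) * ?F + 2 / c0\<^sup>2 * ?F"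
      by (simp add: algebra_simps)
    also have "\<dots> \<le> B / (real r) ^ (?d + 2) * ?D + 4 * C * A * 1 * ?F + 2 / c0\<^sup>2 * ?F"
    proof (intro add_mono mult_right_mono mult_left_mono)
      show "4 * C / (real r) ^ (?d + 2) \<le> B / (real r) ^ (?d + 2)"
        using C(1) c0 A by (intro divide_right_mono) (auto simp: B_def)
      have "(real r)\<^sup>2 \<le> (real r) ^ (?d + 2)" using rr by (intro power_increasing) auto
      then show "(real r)\<^sup>2 / (real r) ^ (?d + 2) \<le> 1" using rr by (simp add: divide_le_eq)
    qed (use F0 D0 C(1) A in auto)
    also have "\<dots> \<le> B / (real r) ^ (?d + 2) * ?D + B * ?F"
      using C(1) F0 by (simp add: B_def algebra_simps)
    finally show ?thesis .
  qed
  then show ?thesis using B by blast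
qed

end

context lattice_stencil
begin

lemma energy_le_values:
  fixes v :: "int^'n \<Rightarrow> 'c::real_normed_vector"
  assumes v: "vanishes_off S v" "finite S"
  shows "energy v \<le> 4 * card P * (\<Sum>x\<in>S. (norm (v x))\<^sup>2)"
proof -
  let ?T = "\<Sum>x\<in>S. (norm (v x))\<^sup>2"
  have s: "summable_sq v"
    by (rule summable_on_fsupp) (use vanishes_off_finite[OF v] in simp)
  have e: "sum_sq v = ?T"
    by (subst infsum_finite[symmetric], fact v(2), rule infsum_cong_neutral) (use v(1) in \<open>auto simp: vanishes_off_def\<close>)
  have b: "summable_sq (fdiff \<rho> v) \<and> sum_sq (fdiff \<rho> v) \<le> 4 * ?T" for \<rho>
  proof -
    have 1: "summable_sq (\<lambda>x. v (x + \<rho>))" by (rule summable_shift[OF s])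
    have 2: "sum_sq (\<lambda>x. v (x + \<rho>)) = ?T" using infsum_shift[of "\<lambda>x. (norm (v x))\<^sup>2" \<rho>] e by simp
    have 3: "summable_sq (\<lambda>x. - v x)" "sum_sq (\<lambda>x. - v x) = ?T" using s e by auto
    have "fdiff \<rho> v = (\<lambda>x. v (x + \<rho>) + - v x)" by (auto simp: fdiff_def)
    then show ?thesis using sum_sq_add_le[OF 1 3(1)] 2 3(2) by auto
  qed
  have "energy v = (\<Sum>\<rho>\<in>P. sum_sq (fdiff \<rho> v))" using b by (intro finite_energyI) auto
  also have "\<dots> \<le> (\<Sum>\<rho>\<in>P. 4 * ?T)" using b by (intro sum_mono) auto
  finally show ?thesis by simp
qed

lemma flux_pair_add_right:
  fixes u v :: "int^'n \<Rightarrow> 'c::real_inner"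
  assumes "flux_dens G summable_on UNIV" "finite_energy u" "finite_energy v"
  shows "flux_pair G (\<lambda>x. u x + v x) = flux_pair G u + flux_pair G v"
proof -
  have "(\<Sum>\<rho>\<in>P. G \<rho> x \<bullet> fdiff \<rho> (\<lambda>x. u x + v x) x)
     = (\<Sum>\<rho>\<in>P. G \<rho> x \<bullet> fdiff \<rho> u x) + (\<Sum>\<rho>\<in>P. G \<rho> x \<bullet> fdiff \<rho> v x)" for x
  proof -
    have "fdiff \<rho> (\<lambda>x. u x + v x) x = fdiff \<rho> u x + fdiff \<rho> v x" for \<rho>
      by (simp add: fdiff_def algebra_simps)
    then show ?thesis by (simp add: inner_add_right sum.distrib)
  qed
  then show ?thesis unfolding flux_pair_def
    using flux_pair_bound(1)[OF assms(1,2)] flux_pair_bound(1)[OF assms(1,3)]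
    by (simp add: infsum_add)
qed

lemma flux_pair_add_left:
  fixes v :: "int^'n \<Rightarrow> 'c::real_inner"
  assumes "flux_dens G summable_on UNIV" "flux_dens G' summable_on UNIV" "finite_energy v"
  shows "flux_pair (\<lambda>\<rho> x. G \<rho> x + G' \<rho> x) v = flux_pair G v + flux_pair G' v"
  unfolding flux_pair_def
  using flux_pair_bound(1)[OF assms(1,3)] flux_pair_bound(1)[OF assms(2,3)]
  by (simp add: inner_add_left sum.distrib infsum_add)

section \<open>A calculus of decay rates\<close>

primrec idiff :: "(int^'n) list \<Rightarrow> (int^'n \<Rightarrow> 'c::real_vector) \<Rightarrow> int^'n \<Rightarrow> 'c" where
  "idiff [] u = u"
| "idiff (\<rho> # \<rho>s) u = fdiff \<rho> (idiff \<rho>s u)"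

text \<open>A discrete symbol class: \<open>a\<close> is the rate of \<open>f\<close> itself, and
  each of up to \<open>m\<close> stencil differences gains one power. Only large \<open>x\<close>
  matter, so values near the defect are irrelevant.\<close>

definition decays :: "nat \<Rightarrow> nat \<Rightarrow> (int^'n \<Rightarrow> 'c::real_normed_vector) \<Rightarrow> bool" where
  "decays a m f \<longleftrightarrow> (\<exists>C R. \<forall>\<rho>s x. set \<rho>s \<subseteq> P \<longrightarrow> length \<rho>s \<le> m \<longrightarrow> supnorm x \<ge> R \<longrightarrow>
     norm (idiff \<rho>s f x) \<le> C / real (supnorm x) ^ (a + length \<rho>s))"

lemma fdiff_commute:
  fixes u :: "int^'n \<Rightarrow> 'c::real_vector"
  shows "fdiff \<rho> (fdiff \<sigma> u) = fdiff \<sigma> (fdiff \<rho> u)"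
  by (auto simp: fdiff_def add_ac)

lemma idiff_fdiff:
  fixes u :: "int^'n \<Rightarrow> 'c::real_vector"
  shows "idiff \<rho>s (fdiff \<sigma> u) = fdiff \<sigma> (idiff \<rho>s u)"
  by (induction \<rho>s) (auto simp: fdiff_commute)

lemma decays_uniform:
  fixes f :: "int^'n \<Rightarrow> int^'n \<Rightarrow> 'c::real_normed_vector"
  assumes "\<And>\<sigma>. \<sigma> \<in> P \<Longrightarrow> decays a m (f \<sigma>)"
  obtains C R where "C > 0" "\<And>\<sigma> \<rho>s x. \<sigma> \<in> P \<Longrightarrow> set \<rho>s \<subseteq> P \<Longrightarrow> length \<rho>s \<le> m \<Longrightarrow> supnorm x \<ge> R \<Longrightarrow>
     norm (idiff \<rho>s (f \<sigma>) x) \<le> C / real (supnorm x) ^ (a + length \<rho>s)"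
proof -
  have "\<forall>\<sigma>\<in>P. \<exists>C R. \<forall>\<rho>s x. set \<rho>s \<subseteq> P \<longrightarrow> length \<rho>s \<le> m \<longrightarrow> supnorm x \<ge> R \<longrightarrow>
     norm (idiff \<rho>s (f \<sigma>) x) \<le> C / real (supnorm x) ^ (a + length \<rho>s)"
    using assms unfolding decays_def by blast
  then obtain C R where CR: "\<forall>\<sigma>\<in>P. \<forall>\<rho>s x. set \<rho>s \<subseteq> P \<longrightarrow> length \<rho>s \<le> m \<longrightarrow> supnorm x \<ge> R \<sigma> \<longrightarrow>
     norm (idiff \<rho>s (f \<sigma>) x) \<le> C \<sigma> / real (supnorm x) ^ (a + length \<rho>s)"
    unfolding bchoice_iff by (elim exE) (rule that)
  define C' where "C' = 1 + (\<Sum>\<sigma>\<in>P. \<bar>C \<sigma>\<bar>)"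
  define R' where "R' = (\<Sum>\<sigma>\<in>P. R \<sigma>)"
  have le: "C \<sigma> \<le> C'" "R \<sigma> \<le> R'" if "\<sigma> \<in> P" for \<sigma>
  proof -
    have "\<bar>C \<sigma>\<bar> \<le> (\<Sum>\<sigma>\<in>P. \<bar>C \<sigma>\<bar>)" by (rule member_le_sum[of \<sigma> P "\<lambda>\<sigma>. \<bar>C \<sigma>\<bar>"]) (use that finite_stencil in auto)
    then show "C \<sigma> \<le> C'" by (simp add: C'_def)
    show "R \<sigma> \<le> R'" unfolding R'_def by (rule member_le_sum) (use that finite_stencil in auto)
  qed
  show thesis
  proof
    show "C' > 0" unfolding C'_def by (intro add_pos_nonneg sum_nonneg) auto
    fix \<sigma> \<rho>s and x :: "int^'n" assume *: "\<sigma> \<in> P" "set \<rho>s \<subseteq> P" "length \<rho>s \<le> m" "supnorm x \<ge> R'"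
    have "norm (idiff \<rho>s (f \<sigma>) x) \<le> C \<sigma> / real (supnorm x) ^ (a + length \<rho>s)"
      using CR * le(2)[OF *(1)] by (meson order_trans)
    also have "\<dots> \<le> C' / real (supnorm x) ^ (a + length \<rho>s)" by (intro divide_right_mono le *) auto
    finally show "norm (idiff \<rho>s (f \<sigma>) x) \<le> C' / real (supnorm x) ^ (a + length \<rho>s)" .
  qed
qed

lemma decays_0: "decays a 0 f \<longleftrightarrow> (\<exists>C R. \<forall>x. supnorm x \<ge> R \<longrightarrow> norm (f x) \<le> C / real (supnorm x) ^ a)"
  for f :: "int^'n \<Rightarrow> 'c::real_normed_vector"
  unfolding decays_def by auto

text \<open>This recursive description, base rate plus the same property of all first differences
  with the rate raised by one, is the form in which the product rule and the trivial estimate are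
  proved by induction.\<close>

lemma decays_Suc:
  fixes f :: "int^'n \<Rightarrow> 'c::real_normed_vector"
  shows "decays a (Suc m) f \<longleftrightarrow> decays a 0 f \<and> (\<forall>\<rho>\<in>P. decays (Suc a) m (fdiff \<rho> f))"
proof
  assume "decays a (Suc m) f"
  then obtain C R where CR: "\<And>\<rho>s x. set \<rho>s \<subseteq> P \<Longrightarrow> length \<rho>s \<le> Suc m \<Longrightarrow> supnorm x \<ge> R \<Longrightarrow>
     norm (idiff \<rho>s f x) \<le> C / real (supnorm x) ^ (a + length \<rho>s)"
    unfolding decays_def by blast
  have "decays a 0 f" unfolding decays_0 using CR[of "[]"] by auto
  moreover have "decays (Suc a) m (fdiff \<rho> f)" if "\<rho> \<in> P" for \<rho>
    unfolding decays_def
  proof (intro exI[of _ C] exI[of _ R] allI impI)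
    fix \<rho>s and x :: "int^'n" assume "set \<rho>s \<subseteq> P" "length \<rho>s \<le> m" "supnorm x \<ge> R"
    then show "norm (idiff \<rho>s (fdiff \<rho> f) x) \<le> C / real (supnorm x) ^ (Suc a + length \<rho>s)"
      using CR[of "\<rho> # \<rho>s" x] that by (simp add: idiff_fdiff)
  qed
  ultimately show "decays a 0 f \<and> (\<forall>\<rho>\<in>P. decays (Suc a) m (fdiff \<rho> f))" by blast
next
  assume *: "decays a 0 f \<and> (\<forall>\<rho>\<in>P. decays (Suc a) m (fdiff \<rho> f))"
  then obtain C0 R0 where 0: "\<And>x. supnorm x \<ge> R0 \<Longrightarrow> norm (f x) \<le> C0 / real (supnorm x) ^ a"
    unfolding decays_0 by blast
  obtain C R where CR: "C > 0" "\<And>\<sigma> \<rho>s x. \<sigma> \<in> P \<Longrightarrow> set \<rho>s \<subseteq> P \<Longrightarrow> length \<rho>s \<le> m \<Longrightarrow> supnorm x \<ge> R \<Longrightarrow>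
     norm (idiff \<rho>s (fdiff \<sigma> f) x) \<le> C / real (supnorm x) ^ (Suc a + length \<rho>s)"
    using decays_uniform[where f = "\<lambda>\<sigma>. fdiff \<sigma> f" and a = "Suc a" and m = m] * by metis
  show "decays a (Suc m) f"
    unfolding decays_def
  proof (intro exI[of _ "max C0 C"] exI[of _ "max R0 R"] allI impI)
    fix \<rho>s and x :: "int^'n" assume \<rho>s: "set \<rho>s \<subseteq> P" "length \<rho>s \<le> Suc m" "supnorm x \<ge> max R0 R"
    show "norm (idiff \<rho>s f x) \<le> max C0 C / real (supnorm x) ^ (a + length \<rho>s)"
    proof (cases \<rho>s)
      case Nil
      have "norm (f x) \<le> C0 / real (supnorm x) ^ a" using 0 \<rho>s by simp
      also have "\<dots> \<le> max C0 C / real (supnorm x) ^ a" by (intro divide_right_mono) auto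
      finally show ?thesis using Nil by simp
    next
      case (Cons \<sigma> \<tau>)
      have "norm (idiff \<rho>s f x) \<le> C / real (supnorm x) ^ (Suc a + length \<tau>)"
        using CR(2)[of \<sigma> \<tau> x] \<rho>s Cons by (simp add: idiff_fdiff)
      also have "\<dots> \<le> max C0 C / real (supnorm x) ^ (Suc a + length \<tau>)" by (intro divide_right_mono) auto
      finally show ?thesis using Cons by simp
    qed
  qed
qed

lemma decays_mono_order: "decays a m f \<Longrightarrow> m' \<le> m \<Longrightarrow> decays a m' f"
  unfolding decays_def by (meson order_trans)

lemma decays_mono:
  fixes f :: "int^'n \<Rightarrow> 'c::real_normed_vector"
  assumes "decays a m f" "a' \<le> a" shows "decays a' m f"
proof -
  obtain C R where CR: "\<And>\<rho>s x. set \<rho>s \<subseteq> P \<Longrightarrow> length \<rho>s \<le> m \<Longrightarrow> supnorm x \<ge> R \<Longrightarrow>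
     norm (idiff \<rho>s f x) \<le> C / real (supnorm x) ^ (a + length \<rho>s)"
    using assms(1) unfolding decays_def by blast
  show ?thesis unfolding decays_def
  proof (intro exI[of _ "\<bar>C\<bar>"] exI[of _ "max R 1"] allI impI)
    fix \<rho>s and x :: "int^'n" assume \<rho>s: "set \<rho>s \<subseteq> P" "length \<rho>s \<le> m" "supnorm x \<ge> max R 1"
    have "norm (idiff \<rho>s f x) \<le> C / real (supnorm x) ^ (a + length \<rho>s)" using CR \<rho>s by simp
    also have "\<dots> \<le> \<bar>C\<bar> / real (supnorm x) ^ (a + length \<rho>s)" by (intro divide_right_mono) auto
    also have "\<dots> \<le> \<bar>C\<bar> / real (supnorm x) ^ (a' + length \<rho>s)"
      using \<rho>s(3) assms(2) by (intro divide_left_mono power_increasing) auto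
    finally show "norm (idiff \<rho>s f x) \<le> \<bar>C\<bar> / real (supnorm x) ^ (a' + length \<rho>s)" .
  qed
qed

lemma decays_add:
  fixes f h :: "int^'n \<Rightarrow> 'c::real_normed_vector"
  assumes "decays a m f" "decays a m h" shows "decays a m (\<lambda>x. f x + h x)"
proof -
  obtain C R where CR: "\<And>\<rho>s x. set \<rho>s \<subseteq> P \<Longrightarrow> length \<rho>s \<le> m \<Longrightarrow> supnorm x \<ge> R \<Longrightarrow>
     norm (idiff \<rho>s f x) \<le> C / real (supnorm x) ^ (a + length \<rho>s)"
    using assms(1) unfolding decays_def by blast
  obtain C' R' where CR': "\<And>\<rho>s x. set \<rho>s \<subseteq> P \<Longrightarrow> length \<rho>s \<le> m \<Longrightarrow> supnorm x \<ge> R' \<Longrightarrow>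
     norm (idiff \<rho>s h x) \<le> C' / real (supnorm x) ^ (a + length \<rho>s)"
    using assms(2) unfolding decays_def by blast
  have lin: "idiff \<rho>s (\<lambda>x. f x + h x) x = idiff \<rho>s f x + idiff \<rho>s h x" for \<rho>s x
    by (induction \<rho>s arbitrary: x) (auto simp: fdiff_def)
  show ?thesis unfolding decays_def
  proof (intro exI[of _ "C + C'"] exI[of _ "max R R'"] allI impI)
    fix \<rho>s and x :: "int^'n" assume \<rho>s: "set \<rho>s \<subseteq> P" "length \<rho>s \<le> m" "supnorm x \<ge> max R R'"
    then have "norm (idiff \<rho>s f x) + norm (idiff \<rho>s h x) \<le> (C + C') / real (supnorm x) ^ (a + length \<rho>s)"
      using CR[of \<rho>s x] CR'[of \<rho>s x] by (simp add: add_divide_distrib)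
    then show "norm (idiff \<rho>s (\<lambda>x. f x + h x) x) \<le> (C + C') / real (supnorm x) ^ (a + length \<rho>s)"
      unfolding lin using norm_triangle_ineq order_trans by blast
  qed
qed

lemma decays_bounded_linear:
  fixes f :: "int^'n \<Rightarrow> 'c::real_normed_vector" and L :: "'c \<Rightarrow> 'e::real_normed_vector"
  assumes "decays a m f" "bounded_linear L" shows "decays a m (\<lambda>x. L (f x))"
proof -
  interpret L: bounded_linear L by fact
  obtain K where K: "K \<ge> 0" "\<And>x. norm (L x) \<le> norm x * K" using L.nonneg_bounded by blast
  obtain C R where CR: "\<And>\<rho>s x. set \<rho>s \<subseteq> P \<Longrightarrow> length \<rho>s \<le> m \<Longrightarrow> supnorm x \<ge> R \<Longrightarrow>
     norm (idiff \<rho>s f x) \<le> C / real (supnorm x) ^ (a + length \<rho>s)"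
    using assms(1) unfolding decays_def by blast
  have lin: "idiff \<rho>s (\<lambda>x. L (f x)) x = L (idiff \<rho>s f x)" for \<rho>s x
    by (induction \<rho>s arbitrary: x) (auto simp: fdiff_def L.diff)
  show ?thesis unfolding decays_def lin
  proof (intro exI[of _ "C * K"] exI[of _ R] allI impI)
    fix \<rho>s and x :: "int^'n" assume "set \<rho>s \<subseteq> P" "length \<rho>s \<le> m" "supnorm x \<ge> R"
    then have "norm (idiff \<rho>s f x) * K \<le> C / real (supnorm x) ^ (a + length \<rho>s) * K"
      using CR K(1) by (intro mult_right_mono) auto
    then show "norm (L (idiff \<rho>s f x)) \<le> C * K / real (supnorm x) ^ (a + length \<rho>s)"
      using K(2)[of "idiff \<rho>s f x"] by simp
  qed
qed

lemma decays_zero: "decays a m (\<lambda>_. 0 :: 'c::real_normed_vector)"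
proof -
  have "idiff \<rho>s (\<lambda>_. 0 :: 'c) x = 0" for \<rho>s x by (induction \<rho>s arbitrary: x) (auto simp: fdiff_def)
  then show ?thesis unfolding decays_def by (intro exI[of _ 0]) auto
qed

lemma decays_sum:
  fixes f :: "'i \<Rightarrow> int^'n \<Rightarrow> 'c::real_normed_vector"
  assumes "\<And>i. i \<in> I \<Longrightarrow> decays a m (f i)" shows "decays a m (\<lambda>x. \<Sum>i\<in>I. f i x)"
  using assms by (induction I rule: infinite_finite_induct) (auto intro: decays_zero decays_add)

text \<open>The discrete product rule has a third term, the product of the two differences; it
  decays faster by one more power than the other two.\<close>

lemma decays_mult:
  fixes f h :: "int^'n \<Rightarrow> real"
  shows "decays a m f \<Longrightarrow> decays b m h \<Longrightarrow> decays (a + b) m (\<lambda>x. f x * h x)"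
proof (induction m arbitrary: a b f h)
  case 0
  obtain C R where CR: "\<And>x. supnorm x \<ge> R \<Longrightarrow> norm (f x) \<le> C / real (supnorm x) ^ a"
    using 0(1) unfolding decays_0 by blast
  obtain C' R' where CR': "\<And>x. supnorm x \<ge> R' \<Longrightarrow> norm (h x) \<le> C' / real (supnorm x) ^ b"
    using 0(2) unfolding decays_0 by blast
  show ?case unfolding decays_0
  proof (intro exI[of _ "C * C'"] exI[of _ "max R R'"] allI impI)
    fix x :: "int^'n" assume x: "supnorm x \<ge> max R R'"
    have "norm (f x) * norm (h x) \<le> (C / real (supnorm x) ^ a) * (C' / real (supnorm x) ^ b)"
      by (intro mult_mono' CR CR') (use x in auto)
    then show "norm (f x * h x) \<le> C * C' / real (supnorm x) ^ (a + b)" by (simp add: abs_mult power_add)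
  qed
next
  case (Suc m)
  have f0: "decays a 0 f" and h0: "decays b 0 h" using Suc.prems unfolding decays_Suc by blast+
  have fm: "decays a m f" and hm: "decays b m h" using Suc.prems decays_mono_order[of _ "Suc m" _ m] by auto
  have base: "decays (a + b) 0 (\<lambda>x. f x * h x)"
  proof -
    obtain C R where CR: "\<And>x. supnorm x \<ge> R \<Longrightarrow> norm (f x) \<le> C / real (supnorm x) ^ a"
      using f0 unfolding decays_0 by blast
    obtain C' R' where CR': "\<And>x. supnorm x \<ge> R' \<Longrightarrow> norm (h x) \<le> C' / real (supnorm x) ^ b"
      using h0 unfolding decays_0 by blast
    show ?thesis unfolding decays_0
    proof (intro exI[of _ "C * C'"] exI[of _ "max R R'"] allI impI)
      fix x :: "int^'n" assume x: "supnorm x \<ge> max R R'"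
      have "norm (f x) * norm (h x) \<le> (C / real (supnorm x) ^ a) * (C' / real (supnorm x) ^ b)"
        by (intro mult_mono' CR CR') (use x in auto)
      then show "norm (f x * h x) \<le> C * C' / real (supnorm x) ^ (a + b)" by (simp add: abs_mult power_add)
    qed
  qed
  have "decays (Suc (a + b)) m (fdiff \<rho> (\<lambda>x. f x * h x))" if \<rho>: "\<rho> \<in> P" for \<rho>
  proof -
    have df: "decays (Suc a) m (fdiff \<rho> f)" and dh: "decays (Suc b) m (fdiff \<rho> h)"
      using Suc.prems \<rho> unfolding decays_Suc by blast+
    have "decays (Suc a + b) m (\<lambda>x. fdiff \<rho> f x * h x)" by (rule Suc.IH[OF df hm])
    moreover have "decays (a + Suc b) m (\<lambda>x. f x * fdiff \<rho> h x)" by (rule Suc.IH[OF fm dh])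
    moreover have "decays (Suc a + Suc b) m (\<lambda>x. fdiff \<rho> f x * fdiff \<rho> h x)" by (rule Suc.IH[OF df dh])
    ultimately have "decays (Suc (a + b)) m (\<lambda>x. (fdiff \<rho> f x * h x + f x * fdiff \<rho> h x) + fdiff \<rho> f x * fdiff \<rho> h x)"
      by (intro decays_add) (auto elim: decays_mono)
    moreover have "fdiff \<rho> (\<lambda>x. f x * h x) = (\<lambda>x. (fdiff \<rho> f x * h x + f x * fdiff \<rho> h x) + fdiff \<rho> f x * fdiff \<rho> h x)"
      by (auto simp: fdiff_def algebra_simps)
    ultimately show ?thesis by simp
  qed
  then show ?case unfolding decays_Suc using base by blast
qed

lemma supnorm_shift_stencil:
  assumes "\<rho> \<in> P" shows "supnorm x \<le> supnorm (x + \<rho>) + range_bound"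
  using supnorm_diff[of "x + \<rho>" \<rho>] supnorm_stencil[OF assms] by simp

lemma decays_cong_far:
  fixes f h :: "int^'n \<Rightarrow> 'c::real_normed_vector"
  assumes "decays a m f" "\<And>x. supnorm x \<ge> R0 \<Longrightarrow> f x = h x" shows "decays a m h"
proof -
  obtain C R where CR: "\<And>\<rho>s x. set \<rho>s \<subseteq> P \<Longrightarrow> length \<rho>s \<le> m \<Longrightarrow> supnorm x \<ge> R \<Longrightarrow>
     norm (idiff \<rho>s f x) \<le> C / real (supnorm x) ^ (a + length \<rho>s)"
    using assms(1) unfolding decays_def by blast
  have eq: "idiff \<rho>s f x = idiff \<rho>s h x" if "set \<rho>s \<subseteq> P" "supnorm x \<ge> R0 + length \<rho>s * range_bound" for \<rho>s x
    using that
  proof (induction \<rho>s arbitrary: x)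
    case (Cons \<rho> \<rho>s)
    then have "supnorm (x + \<rho>) \<ge> R0 + length \<rho>s * range_bound" "supnorm x \<ge> R0 + length \<rho>s * range_bound"
      using supnorm_shift_stencil[of \<rho> x] by auto
    then show ?case using Cons by (simp add: fdiff_def)
  qed (simp add: assms(2))
  show ?thesis unfolding decays_def
  proof (intro exI[of _ C] exI[of _ "max R (R0 + m * range_bound)"] allI impI)
    fix \<rho>s and x :: "int^'n" assume \<rho>s: "set \<rho>s \<subseteq> P" "length \<rho>s \<le> m" "supnorm x \<ge> max R (R0 + m * range_bound)"
    have "length \<rho>s * range_bound \<le> m * range_bound" using \<rho>s(2) by (rule mult_le_mono1)
    then have "supnorm x \<ge> R0 + length \<rho>s * range_bound" using \<rho>s(3) by linarith
    then have "idiff \<rho>s f x = idiff \<rho>s h x" by (rule eq[OF \<rho>s(1)])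
    then show "norm (idiff \<rho>s h x) \<le> C / real (supnorm x) ^ (a + length \<rho>s)" using CR \<rho>s by (metis max.boundedE)
  qed
qed

text \<open>A difference is at most a sum of two values, so \<open>m\<close> spare powers of decay
  can be spent, one on each difference. This handles functions about whose differences nothing is
  known, such as the remainder of a Taylor expansion.\<close>

lemma decays_of_bound:
  fixes f :: "int^'n \<Rightarrow> 'c::real_normed_vector"
  assumes "decays (a + m) 0 f" shows "decays a m f"
  using assms
proof (induction m arbitrary: a f)
  case (Suc m)
  have f: "decays (Suc a + m) 0 f" using Suc.prems by simp
  obtain C R where CR: "\<And>x. supnorm x \<ge> R \<Longrightarrow> norm (f x) \<le> C / real (supnorm x) ^ (Suc a + m)"
    using f unfolding decays_0 by blast
  let ?n = "Suc a + m"
  have "decays (Suc a) m (fdiff \<rho> f)" if \<rho>: "\<rho> \<in> P" for \<rho>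
  proof (rule Suc.IH)
    show "decays ?n 0 (fdiff \<rho> f)"
      unfolding decays_0
    \<comment> \<open>The 1 is for the value at \<open>x\<close>; the power of 2 is for the value at
      \<open>x + \<rho>\<close>, whose norm is at least half of that of \<open>x\<close> outside the
      stated radius.\<close>
    proof (intro exI[of _ "(2 ^ ?n + 1) * \<bar>C\<bar>"] exI[of _ "R + 2 * range_bound"] allI impI)
      fix x :: "int^'n" assume x: "supnorm x \<ge> R + 2 * range_bound"
      have s: "supnorm x \<le> supnorm (x + \<rho>) + range_bound" by (rule supnorm_shift_stencil[OF \<rho>])
      then have s2: "supnorm (x + \<rho>) \<ge> R" "supnorm x \<le> 2 * supnorm (x + \<rho>)" "supnorm x > 0" "supnorm (x + \<rho>) > 0"
        using x range_bound_ge_1 by auto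
      have "norm (f (x + \<rho>)) \<le> C / real (supnorm (x + \<rho>)) ^ ?n" by (rule CR[OF s2(1)])
      also have "\<dots> \<le> \<bar>C\<bar> / real (supnorm (x + \<rho>)) ^ ?n" by (intro divide_right_mono) auto
      also have "\<dots> \<le> \<bar>C\<bar> * 2 ^ ?n / real (supnorm x) ^ ?n"
      proof -
        have "real (supnorm x) \<le> 2 * real (supnorm (x + \<rho>))" using s2(2) by linarith
        then have "real (supnorm x) ^ ?n \<le> 2 ^ ?n * real (supnorm (x + \<rho>)) ^ ?n"
          using power_mono[of "real (supnorm x)" "2 * real (supnorm (x + \<rho>))" ?n] by (simp only: power_mult_distrib of_nat_0_le_iff)
        then have "\<bar>C\<bar> * real (supnorm x) ^ ?n \<le> \<bar>C\<bar> * 2 ^ ?n * real (supnorm (x + \<rho>)) ^ ?n"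
          unfolding mult.assoc by (intro mult_left_mono) auto
        moreover have "c / y \<le> d / z" if "c * z \<le> d * y" "y > 0" "z > 0" for c d y z :: real
          using that by (simp add: field_simps)
        ultimately show ?thesis using s2(3,4) by simp
      qed
      finally have 1: "norm (f (x + \<rho>)) \<le> \<bar>C\<bar> * 2 ^ ?n / real (supnorm x) ^ ?n" .
      have "norm (f x) \<le> C / real (supnorm x) ^ ?n" by (rule CR) (use x in simp)
      also have "\<dots> \<le> \<bar>C\<bar> / real (supnorm x) ^ ?n" by (intro divide_right_mono) auto
      finally have "norm (f (x + \<rho>)) + norm (f x) \<le> \<bar>C\<bar> * 2 ^ ?n / real (supnorm x) ^ ?n + \<bar>C\<bar> / real (supnorm x) ^ ?n"
        using 1 by linarith
      also have "\<dots> = (2 ^ ?n + 1) * \<bar>C\<bar> / real (supnorm x) ^ ?n"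
        by (simp add: add_divide_distrib algebra_simps)
      finally show "norm (fdiff \<rho> f x) \<le> (2 ^ ?n + 1) * \<bar>C\<bar> / real (supnorm x) ^ ?n"
        unfolding fdiff_def using norm_triangle_ineq4[of "f (x + \<rho>)" "f x"] by linarith
    qed
  qed
  moreover have "decays a 0 f" by (rule decays_mono[OF f]) simp
  ultimately show ?case unfolding decays_Suc by blast
qed simp

lemma decays_stencil_monomial:
  fixes X :: "int^'n \<Rightarrow> 'i \<Rightarrow> 'c::euclidean_space"
  assumes "\<And>p. p \<in> I \<Longrightarrow> decays a m (\<lambda>x. X x (fst p) \<bullet> snd p)"
    and ps: "set ps \<subseteq> I" "length ps \<ge> 1"
  shows "decays (length ps * a) m (\<lambda>x. stencil_monomial (X x) ps)"
  using ps
proof (induction ps)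
  case (Cons p ps)
  have p: "decays a m (\<lambda>x. X x (fst p) \<bullet> snd p)" using assms(1) Cons.prems by simp
  show ?case
  proof (cases ps)
    case Nil then show ?thesis using p by (simp add: stencil_monomial_def)
  next
    case (Cons p' ps')
    then have "decays (length ps * a) m (\<lambda>x. stencil_monomial (X x) ps)" using Cons.IH Cons.prems by simp
    from decays_mult[OF p this] show ?thesis by (simp add: stencil_monomial_def)
  qed
qed simp

end

lemma infsum_inner_fdiff:
  fixes v :: "int^'n \<Rightarrow> 'b::real_inner"
  assumes "finite {x. v x \<noteq> 0}"
  shows "(\<lambda>x. c \<bullet> fdiff \<xi> v x) summable_on UNIV" "infsum (\<lambda>x. c \<bullet> fdiff \<xi> v x) UNIV = 0"
proof -
  have fs: "finite {x. c \<bullet> v x \<noteq> 0}" by (rule finite_subset[OF _ assms]) auto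
  have gen: "f summable_on UNIV" if "finite {x. f x \<noteq> 0}" for f :: "int^'n \<Rightarrow> real"
  proof -
    have "f summable_on {x. f x \<noteq> 0} \<longleftrightarrow> f summable_on UNIV" by (rule summable_on_cong_neutral) auto
    then show ?thesis using that by simp
  qed
  have s: "(\<lambda>x. c \<bullet> v x) summable_on UNIV" by (rule gen[OF fs])
  then have s': "(\<lambda>x. - (c \<bullet> v x)) summable_on UNIV" using summable_on_cmult_right[OF s, of "-1"] by simp
  have eq: "(\<lambda>x. c \<bullet> fdiff \<xi> v x) = (\<lambda>x. c \<bullet> v (x + \<xi>) + - (c \<bullet> v x))"
    by (auto simp: fdiff_def inner_diff_right)
  have sh: "(\<lambda>x. c \<bullet> v (x + \<xi>)) summable_on UNIV" using summable_shift[OF s, of \<xi>] .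
  show "(\<lambda>x. c \<bullet> fdiff \<xi> v x) summable_on UNIV" unfolding eq by (rule summable_on_add[OF sh s'])
  show "infsum (\<lambda>x. c \<bullet> fdiff \<xi> v x) UNIV = 0"
    unfolding eq using infsum_add[OF sh s'] infsum_shift[of "\<lambda>x. c \<bullet> v x" \<xi>] by (simp add: infsum_uminus)
qed

subsection \<open>Decay in the far field\<close>

text \<open>The interface between lattice analysis and mechanics. The defect survives only in the
  radius \<open>M\<close>; \<open>flux_decays\<close> is the conditional property that the bootstrap
  feeds on: decay of \<open>m\<close> differences of the gradient yields decay of \<open>m\<close>
  differences of the flux, at twice the base rate.\<close>

locale far_field = elliptic_form P q c0
  for P :: "(int^'n) set" and q :: "int^'n \<Rightarrow> int^'n \<Rightarrow> 'b::euclidean_space \<Rightarrow> 'b \<Rightarrow> real" and c0 :: real +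
  fixes ut :: "int^'n \<Rightarrow> 'b" and g :: "int^'n \<Rightarrow> int^'n \<Rightarrow> 'b" and M J :: nat and Cg :: real
  assumes dim: "CARD('n) \<ge> 2"
    and finite_energy_ut: "finite_energy ut"
    and far_equation: "finite {x. v x \<noteq> 0} \<Longrightarrow> (\<And>x. x \<in> cube M 0 \<Longrightarrow> v x = v 0) \<Longrightarrow>
        form ut v = flux_pair g v"
    and flux_quadratic: "flux_dens g x \<le> Cg * (dens ut x)\<^sup>2"
    and flux_decays: "m < J \<Longrightarrow> (\<And>\<sigma>. \<sigma> \<in> P \<Longrightarrow> decays CARD('n) m (fdiff \<sigma> ut)) \<Longrightarrow> \<rho> \<in> P \<Longrightarrow>
        decays (2 * CARD('n)) m (g \<rho>)"
begin

definition tail :: "nat \<Rightarrow> real" where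
  "tail R = infsum (dens ut) (- cube R 0)"

lemma dens_ut_summable: "dens ut summable_on A"
  using finite_energy_ut summable_on_subset_banach unfolding finite_energy_def by blast

lemma tail_nonneg [simp]: "tail R \<ge> 0"
  unfolding tail_def by (intro infsum_nonneg) auto

lemma sum_le_tail: "finite F \<Longrightarrow> F \<inter> cube R 0 = {} \<Longrightarrow> sum (dens ut) F \<le> tail R"
  unfolding tail_def by (rule finite_sum_le_infsum[OF dens_ut_summable]) auto

lemma tail_antimono: "R \<le> R' \<Longrightarrow> tail R' \<le> tail R"
  unfolding tail_def using cube_mono[of R R' 0]
  by (intro infsum_mono2 dens_ut_summable) auto

lemma tail_to_0: "e > 0 \<Longrightarrow> \<exists>L. \<forall>R\<ge>L. tail R < e"
proof -
  assume "e > 0"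
  then obtain L where "tail L < e"
    using summable_tail[OF dens_ut_summable dens_nonneg, of e] unfolding tail_def by auto
  then show ?thesis using tail_antimono by (meson le_less_trans)
qed

lemma flux_quadratic_abs: "flux_dens g x \<le> \<bar>Cg\<bar> * (dens ut x)\<^sup>2"
  using flux_quadratic[of x] by (smt (verit) abs_ge_self mult_right_mono zero_le_power2)

text \<open>Each value of the density off the cube is at most the tail, so the sum of squares is at
  most the tail times the tail. This is the inclusion of l^1 in l^2 and bounds the quadratic flux in
  the norm of the dual problem.\<close>

lemma dens_sq_summable: "(\<lambda>x. (dens ut x)\<^sup>2) summable_on A" 
  "infsum (\<lambda>x. (dens ut x)\<^sup>2) (- cube R 0) \<le> (tail R)\<^sup>2"
proof -
  have le: "(dens ut x)\<^sup>2 \<le> energy ut * dens ut x" for x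
    using dens_sum_le_energy[OF finite_energy_ut, of "{x}"] by (simp add: power2_eq_square mult_right_mono)
  show s: "(\<lambda>x. (dens ut x)\<^sup>2) summable_on A" for A
    by (rule summable_on_comparison_test[OF summable_on_cmult_right[OF dens_ut_summable]]) (use le in auto)
  show "infsum (\<lambda>x. (dens ut x)\<^sup>2) (- cube R 0) \<le> (tail R)\<^sup>2"
  proof (rule infsum_le_finite_sums[OF s])
    fix F assume F: "finite F" "F \<subseteq> - cube R (0::int^'n)"
    have "(\<Sum>x\<in>F. (dens ut x)\<^sup>2) \<le> (\<Sum>x\<in>F. tail R * dens ut x)"
    proof (rule sum_mono)
      fix x assume "x \<in> F"
      then have "sum (dens ut) {x} \<le> tail R" using F by (intro sum_le_tail) auto
      then show "(dens ut x)\<^sup>2 \<le> tail R * dens ut x" by (simp add: power2_eq_square mult_right_mono)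
    qed
    also have "\<dots> \<le> tail R * tail R"
      unfolding sum_distrib_left[symmetric] using F by (intro mult_left_mono sum_le_tail) auto
    finally show "(\<Sum>x\<in>F. (dens ut x)\<^sup>2) \<le> (tail R)\<^sup>2" by (simp add: power2_eq_square)
  qed
qed

lemma flux_summable: "flux_dens g summable_on UNIV"
  by (rule summable_on_comparison_test[OF summable_on_cmult_right[OF dens_sq_summable(1)[of UNIV], of "\<bar>Cg\<bar>"]])
     (use flux_quadratic_abs in auto)

text \<open>The equation may be tested only with functions constant on \<open>cube M 0\<close>.
  Replacing \<open>v\<close> there by \<open>v 0\<close> changes it by differences of
  \<open>v\<close> at the origin along vectors of length at most \<open>M\<close>; as
  \<open>v\<close> is harmonic in a much larger cube, \<open>harmonic_fdiff_bound\<close> makes them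
  small.\<close>

lemma hole_defect:
  "\<exists>C>0. \<exists>R0. \<forall>v R. R \<ge> R0 \<longrightarrow> finite {x. v x \<noteq> 0} \<longrightarrow> harmonic v (cube R 0) \<longrightarrow>
     \<bar>form ut v - flux_pair g v\<bar> \<le> C / sqrt (real R ^ CARD('n)) * sqrt (energy v)"
proof -
  let ?d = "CARD('n)"
  obtain C where C: "C > 0" "\<And>v r z \<xi>. r \<ge> 2 \<Longrightarrow> r \<ge> 2 * supnorm \<xi> \<Longrightarrow> finite_energy v \<Longrightarrow> harmonic v (cube r z) \<Longrightarrow>
     (norm (fdiff \<xi> v z))\<^sup>2 \<le> C / (real r) ^ ?d * ((real (supnorm \<xi>))\<^sup>2 * energy v)"
    using harmonic_fdiff_bound by blast
  define B where "B = 4 * card P * (real (card (cube M (0::int^'n))) * (C * (real M)\<^sup>2))"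
  have B: "B \<ge> 0" using C(1) by (simp add: B_def)
  define D where "D = (form_const * sqrt (energy ut) + sqrt (infsum (flux_dens g) UNIV)) * sqrt B + 1"
  have D0: "form_const * sqrt (energy ut) + sqrt (infsum (flux_dens g) UNIV) \<ge> 0"
    using form_const(1) by (intro add_nonneg_nonneg mult_nonneg_nonneg) (auto intro: infsum_nonneg)
  then have D: "D > 0" unfolding D_def using B by (smt (verit) mult_nonneg_nonneg real_sqrt_ge_zero)
  have "\<bar>form ut v - flux_pair g v\<bar> \<le> D / sqrt (real R ^ ?d) * sqrt (energy v)"
    if R: "R \<ge> max 2 (2 * M)" and fin: "finite {x. v x \<noteq> 0}" and h: "harmonic v (cube R 0)" for v R
  proof -
    have v: "finite_energy v" by (rule finite_energy_fsupp[OF fin])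
    define \<delta> where "\<delta> = (\<lambda>x. if x \<in> cube M 0 then v x - v 0 else 0)"
    define v0 where "v0 = (\<lambda>x. v x - \<delta> x)"
    have d: "vanishes_off (cube M 0) \<delta>" by (auto simp: \<delta>_def vanishes_off_def)
    have fd: "finite_energy \<delta>" by (rule finite_energy_vanishes[OF d])
    have "{x. v0 x \<noteq> 0} \<subseteq> {x. v x \<noteq> 0} \<union> cube M 0" by (auto simp: v0_def \<delta>_def)
    then have fin0: "finite {x. v0 x \<noteq> 0}" using fin finite_subset by (metis finite_Un finite_cube)
    have f0: "finite_energy v0" by (rule finite_energy_fsupp[OF fin0])
    have eq0: "form ut v0 = flux_pair g v0"
      by (rule far_equation[OF fin0]) (auto simp: v0_def \<delta>_def)
    have veq: "v = (\<lambda>x. v0 x + \<delta> x)" by (simp add: v0_def)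
    have "form ut v = form ut v0 + form ut \<delta>"
      using form_add_right[OF f0 fd finite_energy_ut, of 1] veq by simp
    moreover have "flux_pair g v = flux_pair g v0 + flux_pair g \<delta>"
      using flux_pair_add_right[OF flux_summable f0 fd] veq by simp
    ultimately have "\<bar>form ut v - flux_pair g v\<bar> \<le> \<bar>form ut \<delta>\<bar> + \<bar>flux_pair g \<delta>\<bar>" using eq0 by linarith
    also have "\<dots> \<le> form_const * (sqrt (energy ut) * sqrt (energy \<delta>)) + sqrt (infsum (flux_dens g) UNIV) * sqrt (energy \<delta>)"
      by (intro add_mono form_bound finite_energy_ut fd flux_pair_bound flux_summable)
    also have "\<dots> = (form_const * sqrt (energy ut) + sqrt (infsum (flux_dens g) UNIV)) * sqrt (energy \<delta>)"
      by (simp add: algebra_simps)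
    also have "\<dots> \<le> (form_const * sqrt (energy ut) + sqrt (infsum (flux_dens g) UNIV)) * (sqrt B / sqrt (real R ^ ?d) * sqrt (energy v))"
    proof (intro mult_left_mono D0)
      have "energy \<delta> \<le> 4 * card P * (\<Sum>x\<in>cube M 0. (norm (\<delta> x))\<^sup>2)" by (rule energy_le_values[OF d]) simp
      also have "\<dots> \<le> 4 * card P * (\<Sum>x\<in>cube M (0::int^'n). C / (real R) ^ ?d * ((real M)\<^sup>2 * energy v))"
      proof (intro mult_left_mono sum_mono)
        fix x :: "int^'n" assume x: "x \<in> cube M 0"
        then have sx: "supnorm x \<le> M" by (simp add: cube_def)
        have "(norm (\<delta> x))\<^sup>2 = (norm (fdiff x v 0))\<^sup>2" using x by (simp add: \<delta>_def fdiff_def)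
        also have "\<dots> \<le> C / (real R) ^ ?d * ((real (supnorm x))\<^sup>2 * energy v)"
          by (rule C(2)) (use R sx v h in auto)
        also have "\<dots> \<le> C / (real R) ^ ?d * ((real M)\<^sup>2 * energy v)"
          using sx C(1) by (intro mult_left_mono mult_right_mono power_mono) auto
        finally show "(norm (\<delta> x))\<^sup>2 \<le> C / (real R) ^ ?d * ((real M)\<^sup>2 * energy v)" .
      qed auto
      also have "\<dots> = B / real R ^ ?d * energy v" by (simp add: B_def)
      finally have "sqrt (energy \<delta>) \<le> sqrt (B / real R ^ ?d * energy v)" by (rule real_sqrt_le_mono)
      then show "sqrt (energy \<delta>) \<le> sqrt B / sqrt (real R ^ ?d) * sqrt (energy v)"
        by (simp only: real_sqrt_mult real_sqrt_divide)
    qed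
    also have "\<dots> = ((form_const * sqrt (energy ut) + sqrt (infsum (flux_dens g) UNIV)) * sqrt B) / sqrt (real R ^ ?d) * sqrt (energy v)"
      by simp
    also have "\<dots> \<le> D / sqrt (real R ^ ?d) * sqrt (energy v)"
      by (intro mult_right_mono divide_right_mono) (auto simp: D_def)
    finally show ?thesis .
  qed
  then show ?thesis using D by blast
qed

text \<open>The flux is split at radius \<open>R\<close>. Outside, its norm is bounded by the tail.
  Inside, the root of its density is summable, being at most a multiple of the density of
  \<open>ut\<close>, while \<open>v\<close> has gradient of size R^(-d/2) at every site;
  \<open>v\<close> is taken harmonic in radius \<open>2 * R\<close> so that each site of the inner
  cube has a cube of radius \<open>R\<close> to itself.\<close>

lemma flux_pair_harmonic:
  "\<exists>C>0. \<exists>R0. \<forall>v R. R \<ge> R0 \<longrightarrow> finite_energy v \<longrightarrow> harmonic v (cube (2 * R) 0) \<longrightarrow>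
     \<bar>flux_pair g v\<bar> \<le> C * (1 / sqrt (real R ^ CARD('n)) + tail R) * sqrt (energy v)"
proof -
  let ?d = "CARD('n)"
  obtain C where C: "C > 0" "\<And>v r z. r \<ge> 2 * range_bound \<Longrightarrow> finite_energy v \<Longrightarrow> harmonic v (cube r z) \<Longrightarrow>
     dens v z \<le> C / (real r) ^ ?d * sum (dens v) (cube r z)"
    using harmonic_dens_bound by blast
  define G where "G = sqrt \<bar>Cg\<bar>"
  define B where "B = G * energy ut * sqrt C + G + 1"
  have G0: "G \<ge> 0" by (simp add: G_def)
  have B: "B > 0" using G0 C(1) by (simp add: B_def add_nonneg_pos)
  have "\<bar>flux_pair g v\<bar> \<le> B * (1 / sqrt (real R ^ ?d) + tail R) * sqrt (energy v)"
    if R: "R \<ge> 2 * range_bound" and v: "finite_energy v" and h: "harmonic v (cube (2 * R) 0)" for v R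
  proof -
    define g1 where "g1 = (\<lambda>\<rho> x. if x \<in> cube R 0 then g \<rho> x else 0)"
    define g2 where "g2 = (\<lambda>\<rho> x. if x \<in> cube R 0 then 0 else g \<rho> x)"
    have fd1: "flux_dens g1 = (\<lambda>x. if x \<in> cube R 0 then flux_dens g x else 0)"
      and fd2: "flux_dens g2 = (\<lambda>x. if x \<in> cube R 0 then 0 else flux_dens g x)"
      by (auto simp: flux_dens_def g1_def g2_def)
    have s1: "flux_dens g1 summable_on UNIV" unfolding fd1
      by (rule infsum_dominated(1)[OF flux_summable]) auto
    have s2: "flux_dens g2 summable_on UNIV" unfolding fd2
      by (rule infsum_dominated(1)[OF flux_summable]) auto
    have "g = (\<lambda>\<rho> x. g1 \<rho> x + g2 \<rho> x)" by (auto simp: g1_def g2_def fun_eq_iff)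
    then have split: "flux_pair g v = flux_pair g1 v + flux_pair g2 v"
      using flux_pair_add_left[OF s1 s2 v] by simp
    have "infsum (flux_dens g2) UNIV = infsum (flux_dens g) (- cube R 0)"
      unfolding fd2 by (rule infsum_cong_neutral) auto
    also have "\<dots> \<le> infsum (\<lambda>x. \<bar>Cg\<bar> * (dens ut x)\<^sup>2) (- cube R 0)"
      by (rule infsum_mono[OF summable_on_subset_banach[OF flux_summable] summable_on_cmult_right[OF dens_sq_summable(1)] flux_quadratic_abs]) auto
    also have "\<dots> \<le> \<bar>Cg\<bar> * (tail R)\<^sup>2"
      by (simp add: infsum_cmult_right dens_sq_summable(1)) (intro mult_left_mono dens_sq_summable(2), simp)
    finally have "sqrt (infsum (flux_dens g2) UNIV) \<le> sqrt (\<bar>Cg\<bar> * (tail R)\<^sup>2)" by (rule real_sqrt_le_mono)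
    then have "sqrt (infsum (flux_dens g2) UNIV) \<le> G * tail R" by (simp add: real_sqrt_mult G_def)
    then have b2: "\<bar>flux_pair g2 v\<bar> \<le> G * tail R * sqrt (energy v)"
      using flux_pair_bound(2)[OF s2 v] by (meson energy_nonneg mult_right_mono order_trans real_sqrt_ge_zero)
    have "flux_pair g1 v = (\<Sum>x\<in>cube R 0. \<Sum>\<rho>\<in>P. g \<rho> x \<bullet> fdiff \<rho> v x)"
      unfolding flux_pair_def
      by (subst infsum_finite[symmetric], simp, rule infsum_cong_neutral) (auto simp: g1_def)
    also have "\<bar>\<dots>\<bar> \<le> (\<Sum>x\<in>cube R 0. sqrt (flux_dens g x) * dens_root v x)"
      by (rule order_trans[OF sum_abs]) (intro sum_mono flux_pointwise)
    also have "\<dots> \<le> (\<Sum>x\<in>cube R (0::int^'n). (G * dens ut x) * (sqrt C / sqrt (real R ^ ?d) * sqrt (energy v)))"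
    proof (intro sum_mono mult_mono)
      fix x :: "int^'n" assume x: "x \<in> cube R 0"
      have "sqrt (flux_dens g x) \<le> sqrt (\<bar>Cg\<bar> * (dens ut x)\<^sup>2)" by (rule real_sqrt_le_mono[OF flux_quadratic_abs])
      then show "sqrt (flux_dens g x) \<le> G * dens ut x" by (simp add: real_sqrt_mult G_def)
      have "cube R x \<subseteq> cube (2 * R) 0" using cube_trans[OF _ x, of _ R] by (auto simp: mult_2)
      then have "harmonic v (cube R x)" by (rule harmonic_mono[OF h])
      from C(2)[OF R v this] have "dens v x \<le> C / real R ^ ?d * sum (dens v) (cube R x)" .
      also have "\<dots> \<le> C / real R ^ ?d * energy v"
        using C(1) by (intro mult_left_mono dens_sum_le_energy[OF v]) auto
      finally have "sqrt (dens v x) \<le> sqrt (C / real R ^ ?d * energy v)" by (rule real_sqrt_le_mono)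
      then show "dens_root v x \<le> sqrt C / sqrt (real R ^ ?d) * sqrt (energy v)"
        by (simp only: real_sqrt_mult real_sqrt_divide dens_root_def)
    qed (use G0 in \<open>auto simp: dens_root_def\<close>)
    also have "\<dots> = (G * sum (dens ut) (cube R 0)) * (sqrt C / sqrt (real R ^ ?d) * sqrt (energy v))"
      by (simp only: sum_distrib_left sum_distrib_right)
    also have "\<dots> \<le> (G * energy ut) * (sqrt C / sqrt (real R ^ ?d) * sqrt (energy v))"
      using G0 C(1) by (intro mult_right_mono mult_left_mono dens_sum_le_energy finite_energy_ut) auto
    finally have b1: "\<bar>flux_pair g1 v\<bar> \<le> (G * energy ut) * (sqrt C / sqrt (real R ^ ?d) * sqrt (energy v))" .
    have "\<bar>flux_pair g v\<bar> \<le> (G * energy ut) * (sqrt C / sqrt (real R ^ ?d) * sqrt (energy v)) + G * tail R * sqrt (energy v)"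
      using b1 b2 split by linarith
    also have "\<dots> = ((G * energy ut * sqrt C) * (1 / sqrt (real R ^ ?d)) + G * tail R) * sqrt (energy v)"
      by (simp add: algebra_simps)
    also have "\<dots> \<le> (B * (1 / sqrt (real R ^ ?d)) + B * tail R) * sqrt (energy v)"
      using G0 C(1) by (intro mult_right_mono add_mono) (auto simp: B_def)
    finally show ?thesis by (simp add: algebra_simps)
  qed
  then show ?thesis using B by blast
qed

text \<open>
  Duality: the corrector \<open>v\<close> for the far part of \<open>D ut\<close> is harmonic near the hole, so only
  a small part of the right-hand side is seen by \<open>v\<close>.
\<close>

lemma tail_recursion:
  "\<exists>A>0. \<exists>R0. \<forall>R\<ge>R0. tail (4 * R) \<le> A * (1 / real R ^ CARD('n) + (tail R)\<^sup>2)"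
proof -
  let ?d = "CARD('n)"
  obtain C1 R1 where C1: "C1 > 0" "\<And>v R. R \<ge> R1 \<Longrightarrow> finite {x. v x \<noteq> 0} \<Longrightarrow> harmonic v (cube R 0) \<Longrightarrow>
     \<bar>form ut v - flux_pair g v\<bar> \<le> C1 / sqrt (real R ^ ?d) * sqrt (energy v)"
    using hole_defect by blast
  obtain C2 R2 where C2: "C2 > 0" "\<And>v R. R \<ge> R2 \<Longrightarrow> finite_energy v \<Longrightarrow> harmonic v (cube (2 * R) 0) \<Longrightarrow>
     \<bar>flux_pair g v\<bar> \<le> C2 * (1 / sqrt (real R ^ ?d) + tail R) * sqrt (energy v)"
    using flux_pair_harmonic by blast
  define A where "A = 2 * ((C1 + C2) / c0)\<^sup>2"
  have A: "A > 0" using C1(1) C2(1) c0 by (simp add: A_def)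
  have "tail (4 * R) \<le> A * (1 / real R ^ ?d + (tail R)\<^sup>2)" if R: "R \<ge> max (max R1 R2) range_bound" for R
  proof -
    define B where "B = (C1 + C2) * (1 / sqrt (real R ^ ?d) + tail R)"
    have B0: "B \<ge> 0" using C1(1) C2(1) by (simp add: B_def)
    have fin_part: "sum (dens ut) F \<le> (B / c0)\<^sup>2" if F: "finite F" "F \<subseteq> - cube (4 * R) (0::int^'n)" for F
    proof -
      \<comment> \<open>The dual flux is the gradient of \<open>ut\<close> on a finite far set
        \<open>F\<close>, so its pairing with \<open>ut\<close> is the energy density summed over
        \<open>F\<close>, the quantity to be estimated. Finiteness of \<open>F\<close> allows a
        corrector on a cube.\<close>
      define \<phi> where "\<phi> = (\<lambda>\<rho> x. if x \<in> F then fdiff \<rho> ut x else 0)"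
      define T where "T = sum (dens ut) F"
      have T0: "T \<ge> 0" unfolding T_def by (intro sum_nonneg) auto
      have fdphi: "flux_dens \<phi> = (\<lambda>x. if x \<in> F then dens ut x else 0)"
        by (auto simp: flux_dens_def \<phi>_def dens_def)
      have sphi: "flux_dens \<phi> summable_on UNIV" unfolding fdphi
        by (rule summable_on_fsupp) (rule finite_subset[OF _ F(1)], auto)
      have iphi: "infsum (flux_dens \<phi>) UNIV = T" unfolding fdphi T_def
        by (subst infsum_finite[symmetric], fact F(1), rule infsum_cong_neutral) auto
      have pair_ut: "flux_pair \<phi> ut = T"
        unfolding flux_pair_def T_def
        by (subst infsum_finite[symmetric], fact F(1), rule infsum_cong_neutral)
           (auto simp: \<phi>_def dens_def power2_norm_eq_inner)
      have approx: "sqrt T \<le> B / c0 + \<epsilon> * (1 + form_const / c0)" if \<epsilon>: "\<epsilon> > 0" for \<epsilon>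
      proof -
        \<comment> \<open>The corrector equation accepts only test functions that vanish off its
          cube, which \<open>ut\<close> does not. So \<open>ut\<close> is replaced by a finitely
          supported \<open>w\<close> with error \<open>\<epsilon>\<close> in energy, the cube of the
          corrector is chosen to contain the support of \<open>w\<close>, and
          \<open>\<epsilon>\<close> is sent to 0 at the end.\<close>
        obtain w c where w: "finite {x. w x \<noteq> 0}" "finite_energy (\<lambda>x. ut x - w x)" "energy (\<lambda>x. ut x - w x) < \<epsilon>\<^sup>2"
          using finite_support_approximation[OF finite_energy_ut, of "\<epsilon>\<^sup>2" 0] \<epsilon> by auto
        obtain N0 where N0: "{x. w x \<noteq> 0} \<subseteq> cube N0 0" using finite_subset_cube[OF w(1)] .
        obtain N1 where N1: "F \<subseteq> cube N1 0" using finite_subset_cube[OF F(1)] .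
        define N where "N = max (max N0 N1) (2 * R)"
        have wN: "vanishes_off (cube N 0) w"
        proof -
          have "cube N0 0 \<subseteq> cube N (0::int^'n)" by (rule cube_mono) (simp add: N_def)
          then show ?thesis unfolding vanishes_off_def using N0 by blast
        qed
        obtain v where v: "vanishes_off (cube N 0) v" "\<And>w. vanishes_off (cube N 0) w \<Longrightarrow> form v w = flux_pair \<phi> w"
          "energy v \<le> sum (flux_dens \<phi>) (cube (N + range_bound) 0) / c0\<^sup>2"
          by (rule local_corrector[of N 0 \<phi>]) (rule that)
        have fv: "finite_energy v" by (rule finite_energy_vanishes[OF v(1)])
        have finv: "finite {x. v x \<noteq> 0}" by (rule vanishes_off_finite[OF v(1)]) simp
        have fw: "finite_energy w" by (rule finite_energy_fsupp[OF w(1)])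
        have "sum (flux_dens \<phi>) (cube (N + range_bound) 0) \<le> T"
          unfolding iphi[symmetric] by (rule finite_sum_le_infsum[OF sphi]) auto
        then have "energy v \<le> T / c0\<^sup>2" using v(3) c0 by (meson divide_right_mono order_trans zero_le_power2)
        then have "sqrt (energy v) \<le> sqrt (T / c0\<^sup>2)" by (rule real_sqrt_le_mono)
        then have ev: "sqrt (energy v) \<le> sqrt T / c0" using c0 by (simp add: real_sqrt_divide)
        have hv: "harmonic v (cube (2 * R) 0)"
          unfolding harmonic_def
        proof (intro allI impI)
          fix w :: "int^'n \<Rightarrow> 'b" assume w: "vanishes_off (cube (2 * R) 0) w"
          have "fdiff \<rho> w x = 0" if "\<rho> \<in> P" "x \<in> F" for \<rho> x
          proof -
            \<comment> \<open>Room for the interaction range: the dual flux lives outside radius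
              \<open>4 * R\<close>, hence does not meet gradients of functions supported in radius
              \<open>2 * R\<close>.\<close>
            have "2 * R + range_bound \<le> 4 * R" using R by simp
            then have "cube (2 * R + range_bound) 0 \<subseteq> cube (4 * R) (0::int^'n)" by (rule cube_mono)
            then have "x \<notin> cube (2 * R + range_bound) 0" using that(2) F(2) by blast
            then show ?thesis
              using vanishes_off_fdiff[OF w supnorm_stencil[OF that(1)]] by (simp add: vanishes_off_def)
          qed
          then have z: "(\<Sum>\<rho>\<in>P. \<phi> \<rho> x \<bullet> fdiff \<rho> w x) = 0" for x
            by (intro sum.neutral) (auto simp: \<phi>_def)
          then have "flux_pair \<phi> w = 0" unfolding flux_pair_def by simp
          moreover have "vanishes_off (cube N 0) w"
            by (rule vanishes_off_mono[OF w cube_mono]) (simp add: N_def)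
          ultimately show "form v w = 0" using v(2) by simp
        qed
        have R': "R \<ge> R1" "R \<ge> R2" using R by auto
        have fuv: "\<bar>form ut v\<bar> \<le> B * sqrt (energy v)"
        proof -
          have "harmonic v (cube R 0)" by (rule harmonic_mono[OF hv cube_mono]) simp
          from C1(2)[OF R'(1) finv this] C2(2)[OF R'(2) fv hv]
          have "\<bar>form ut v\<bar> \<le> (C1 / sqrt (real R ^ ?d) + C2 * (1 / sqrt (real R ^ ?d) + tail R)) * sqrt (energy v)"
            by (simp add: algebra_simps)
          also have "\<dots> \<le> B * sqrt (energy v)"
            using C1(1) by (intro mult_right_mono) (auto simp: B_def algebra_simps add_divide_distrib)
          finally show ?thesis .
        qed
        have e: "sqrt (energy (\<lambda>x. ut x - w x)) \<le> \<epsilon>"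
          using real_sqrt_le_mono[OF less_imp_le[OF w(3)]] \<epsilon> by simp
        have "T = flux_pair \<phi> (\<lambda>x. (ut x - w x) + w x)" using pair_ut by simp
        also have "\<dots> = flux_pair \<phi> (\<lambda>x. ut x - w x) + form v w"
          using flux_pair_add_right[OF sphi w(2) fw] v(2)[OF wN] by simp
        also have "form v w = form ut v - form (\<lambda>x. ut x - w x) v"
          using form_diff_left[OF finite_energy_ut fw fv] by (simp add: form_sym[of v])
        finally have "T \<le> \<bar>flux_pair \<phi> (\<lambda>x. ut x - w x)\<bar> + \<bar>form ut v\<bar> + \<bar>form (\<lambda>x. ut x - w x) v\<bar>" by linarith
        also have "\<dots> \<le> sqrt T * sqrt (energy (\<lambda>x. ut x - w x)) + B * sqrt (energy v)
            + form_const * (sqrt (energy (\<lambda>x. ut x - w x)) * sqrt (energy v))"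
          using flux_pair_bound(2)[OF sphi w(2)] iphi by (intro add_mono fuv form_bound w(2) fv) auto
        also have "\<dots> \<le> sqrt T * \<epsilon> + B * (sqrt T / c0) + form_const * (\<epsilon> * (sqrt T / c0))"
          using form_const(1) \<epsilon> B0 T0 c0 by (intro add_mono mult_left_mono mult_mono e ev) auto
        also have "\<dots> = sqrt T * (B / c0 + \<epsilon> * (1 + form_const / c0))" by (simp add: algebra_simps)
        finally have le: "sqrt T * sqrt T \<le> sqrt T * (B / c0 + \<epsilon> * (1 + form_const / c0))" using T0 by simp
        show ?thesis
        proof (cases "sqrt T > 0")
          case True with le show ?thesis by (simp only: mult_le_cancel_left_pos)
        next
          case False
          then have "sqrt T \<le> 0" by simp
          also have "0 \<le> B / c0 + \<epsilon> * (1 + form_const / c0)"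
            using B0 c0 \<epsilon> form_const(1) by (intro add_nonneg_nonneg mult_nonneg_nonneg) auto
          finally show ?thesis .
        qed
      qed
      have "sqrt T \<le> B / c0 + e" if "e > 0" for e
      proof -
        have p: "1 + form_const / c0 > 0" using c0 form_const(1) by (simp add: add_pos_pos)
        show ?thesis using approx[of "e / (1 + form_const / c0)"] p that by simp
      qed
      then have "sqrt T \<le> B / c0" by (rule field_le_epsilon)
      then have "(sqrt T)\<^sup>2 \<le> (B / c0)\<^sup>2" using T0 by (intro power_mono) auto
      then show ?thesis using T0 by (simp add: T_def)
    qed
    have "tail (4 * R) \<le> (B / c0)\<^sup>2"
      unfolding tail_def by (rule infsum_le_finite_sums[OF dens_ut_summable fin_part])
    also have "\<dots> = ((C1 + C2) / c0)\<^sup>2 * (1 / sqrt (real R ^ ?d) + tail R)\<^sup>2"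
      by (simp add: B_def power_mult_distrib power_divide)
    also have "\<dots> \<le> ((C1 + C2) / c0)\<^sup>2 * (2 * (1 / sqrt (real R ^ ?d))\<^sup>2 + 2 * (tail R)\<^sup>2)"
      using norm_add_sq_le[of "1 / sqrt (real R ^ ?d)" "tail R"] by (intro mult_left_mono) auto
    also have "\<dots> = A * (1 / real R ^ ?d + (tail R)\<^sup>2)"
    proof -
      have sq: "(1 / sqrt (real R ^ ?d))\<^sup>2 = 1 / real R ^ ?d" by (simp add: power_divide)
      have "Q * (2 * a + 2 * b) = 2 * Q * (a + b)" for Q a b :: real by (simp add: algebra_simps)
      then show ?thesis unfolding A_def sq .
    qed
    finally show ?thesis .
  qed
  then show ?thesis using A by blast
qed

text \<open>Once the tail is below 1 / (2 A 8^d), the quadratic term of the recursion contributes at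
  most half of the claimed bound, and strong induction from \<open>R div 4\<close> to
  \<open>R\<close> closes. The 8 instead of 4 absorbs the rounding of the division.\<close>

lemma tail_decay: "\<exists>B>0. \<forall>R\<ge>1. tail R \<le> B / real R ^ CARD('n)"
proof -
  let ?d = "CARD('n)"
  obtain A R0 where A: "A > 0" "\<And>R. R \<ge> R0 \<Longrightarrow> tail (4 * R) \<le> A * (1 / real R ^ ?d + (tail R)\<^sup>2)"
    using tail_recursion by blast
  have "1 / (2 * A * 8 ^ ?d) > 0" using A(1) by simp
  then obtain L where L: "\<And>R. R \<ge> L \<Longrightarrow> tail R < 1 / (2 * A * 8 ^ ?d)" using tail_to_0 by blast
  define n0 where "n0 = max (max R0 L) 1"
  define B where "B = max (tail 0 * real (8 * n0) ^ ?d) (2 * A * 8 ^ ?d)"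
  have B: "B \<ge> 2 * A * 8 ^ ?d" "B \<ge> tail 0 * real (8 * n0) ^ ?d" by (auto simp: B_def)
  have B0: "B > 0" using B(1) A(1) by (smt (verit) mult_pos_pos zero_less_power)
  have "tail R * real R ^ ?d \<le> B" if "R \<ge> 1" for R
    using that
  proof (induction R rule: less_induct)
    case (less R)
    show ?case
    proof (cases "R < 8 * n0")
      case True
      have "tail R * real R ^ ?d \<le> tail 0 * real (8 * n0) ^ ?d"
        using True by (intro mult_mono power_mono tail_antimono) auto
      then show ?thesis using B(2) by linarith
    next
      case False
      define R' where "R' = R div 4"
      have R': "R' \<ge> n0" "R' < R" "4 * R' \<le> R" "R \<le> 8 * R'" using False by (auto simp: R'_def n0_def)
      have R'1: "R' \<ge> 1" "R' \<ge> R0" "R' \<ge> L" using R'(1) by (auto simp: n0_def)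
      have IH: "tail R' * real R' ^ ?d \<le> B" by (rule less.IH[OF R'(2) R'1(1)])
      have "real R \<le> 8 * real R'" using R'(4) by linarith
      then have pw: "real R ^ ?d \<le> 8 ^ ?d * real R' ^ ?d" using power_mono[of "real R" "8 * real R'" ?d] by (simp add: power_mult_distrib)
      have "tail R \<le> tail (4 * R')" by (rule tail_antimono[OF R'(3)])
      also have "\<dots> \<le> A * (1 / real R' ^ ?d + (tail R')\<^sup>2)" by (rule A(2)[OF R'1(2)])
      finally have "tail R * real R ^ ?d \<le> A * (1 / real R' ^ ?d + (tail R')\<^sup>2) * (8 ^ ?d * real R' ^ ?d)"
        using pw A(1) by (intro mult_mono) auto
      also have "\<dots> = A * 8 ^ ?d + (A * 8 ^ ?d * tail R') * (tail R' * real R' ^ ?d)"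
        using R'1(1) by (simp add: field_simps power2_eq_square)
      also have "\<dots> \<le> A * 8 ^ ?d + (1 / 2) * B"
      proof -
        have "A * 8 ^ ?d * tail R' \<le> A * 8 ^ ?d * (1 / (2 * A * 8 ^ ?d))"
          using A(1) L[OF R'1(3)] by (intro mult_left_mono) auto
        also have "\<dots> = 1 / 2" using A(1) by simp
        finally have "(A * 8 ^ ?d * tail R') * (tail R' * real R' ^ ?d) \<le> (1 / 2) * B"
          using IH by (intro mult_mono) auto
        then show ?thesis by simp
      qed
      also have "\<dots> \<le> B" using B(1) by simp
      finally show ?thesis .
    qed
  qed
  then have "tail R \<le> B / real R ^ ?d" if "R \<ge> 1" for R
    using that by (simp add: le_divide_eq)
  then show ?thesis using B0 by blast
qed

section \<open>Pointwise decay of the gradient\<close>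

lemma far_weak_solution:
  assumes "cube r z \<inter> cube M 0 = {}"
  shows "weak_solution ut g (cube r z)"
  unfolding weak_solution_def
proof (intro allI impI)
  fix w :: "int^'n \<Rightarrow> 'b" assume w: "vanishes_off (cube r z) w"
  have z: "w x = 0" if "x \<in> cube M 0" for x using w assms that by (auto simp: vanishes_off_def)
  show "form ut w = flux_pair g w"
    by (rule far_equation[OF vanishes_off_finite[OF w finite_cube]]) (simp add: z)
qed

lemma supnorm_in_cube: "x \<in> cube r z \<Longrightarrow> supnorm z \<le> supnorm x + r"
  using supnorm_diff[of x "x - z"] by (simp add: cube_def)

text \<open>Around a site of norm R the cube of radius r = R/4 stays outside radius r. There the
  density sums to at most \<open>tail r\<close>, of order r^-d, and the interior estimate
  contributes a second r^-d; the flux is bounded by the squared tail, again r^(-2d).\<close>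

lemma dens_decay:
  "\<exists>C>0. \<exists>R0. \<forall>z. supnorm z \<ge> R0 \<longrightarrow> dens ut z \<le> C / real (supnorm z) ^ (2 * CARD('n))"
proof -
  let ?d = "CARD('n)"
  obtain C where C: "C > 0" "\<And>w G r z. r \<ge> 2 * range_bound \<Longrightarrow> finite_energy w \<Longrightarrow> weak_solution w G (cube r z) \<Longrightarrow>
     dens w z \<le> C / (real r) ^ ?d * sum (dens w) (cube r z) + C * sum (flux_dens G) (cube (r + range_bound) z)"
    using weak_solution_dens_bound by blast
  obtain B where B: "B > 0" "\<And>R. R \<ge> 1 \<Longrightarrow> tail R \<le> B / real R ^ ?d" using tail_decay by blast
  define K where "K = C * (B + \<bar>Cg\<bar> * B\<^sup>2) * 8 ^ (2 * ?d)"
  have K: "K > 0" using C(1) B(1) by (simp add: K_def add_pos_nonneg)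
  have "dens ut z \<le> K / real (supnorm z) ^ (2 * ?d)" if z: "supnorm z \<ge> 4 * (2 * range_bound + M + 1)" for z
  proof -
    define R where "R = supnorm z"
    define r where "r = R div 4"
    have "r \<ge> 2 * range_bound + M + 1"
      unfolding r_def using div_le_mono[OF z[folded R_def], of 4] by simp
    moreover have "4 * r \<le> R" "R < 4 * r + 4" unfolding r_def by presburger+
    ultimately have r: "r \<ge> 2 * range_bound" "r \<ge> M + 1" "4 * r \<le> R" "R \<le> 8 * r" "r \<ge> 1"
      by auto
    have far: "supnorm x > r" "supnorm x > M" if "x \<in> cube (r + range_bound) z" for x
      using supnorm_in_cube[OF that] r by (auto simp: R_def)
    have sub: "cube r z \<subseteq> cube (r + range_bound) z" by (rule cube_mono) simp
    have ws: "weak_solution ut g (cube r z)"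
      by (rule far_weak_solution) (use far sub in \<open>fastforce simp: cube_def\<close>)
    have t: "tail r \<le> B / real r ^ ?d" by (rule B(2)[OF r(5)])
    have dis: "cube r z \<inter> cube r 0 = {}" using far sub by (fastforce simp: cube_def)
    have s1: "sum (dens ut) (cube r z) \<le> B / real r ^ ?d"
      by (rule order_trans[OF sum_le_tail[OF finite_cube dis] t])
    have "sum (flux_dens g) (cube (r + range_bound) z) \<le> (\<Sum>x\<in>cube (r + range_bound) z. \<bar>Cg\<bar> * (dens ut x)\<^sup>2)"
      by (intro sum_mono flux_quadratic_abs)
    also have "\<dots> \<le> \<bar>Cg\<bar> * infsum (\<lambda>x. (dens ut x)\<^sup>2) (- cube r 0)"
      unfolding sum_distrib_left[symmetric]
    proof (intro mult_left_mono finite_sum_le_infsum dens_sq_summable(1))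
      show "cube (r + range_bound) z \<subseteq> - cube r 0" using far by (fastforce simp: cube_def)
    qed auto
    also have "\<dots> \<le> \<bar>Cg\<bar> * (B / real r ^ ?d)\<^sup>2"
      using order_trans[OF dens_sq_summable(2) power_mono[OF t tail_nonneg]] by (intro mult_left_mono) auto
    finally have s2: "sum (flux_dens g) (cube (r + range_bound) z) \<le> \<bar>Cg\<bar> * (B / real r ^ ?d)\<^sup>2" .
    have "dens ut z \<le> C / (real r) ^ ?d * sum (dens ut) (cube r z) + C * sum (flux_dens g) (cube (r + range_bound) z)"
      by (rule C(2)[OF r(1) finite_energy_ut ws])
    also have "\<dots> \<le> C / (real r) ^ ?d * (B / real r ^ ?d) + C * (\<bar>Cg\<bar> * (B / real r ^ ?d)\<^sup>2)"
      using C(1) by (intro add_mono mult_left_mono s1 s2) auto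
    also have "\<dots> = C * (B + \<bar>Cg\<bar> * B\<^sup>2) / real r ^ (2 * ?d)"
    proof -
      have "a / x * (b / x) + a * (c * (b / x)\<^sup>2) = a * (b + c * b\<^sup>2) / x\<^sup>2" for a b c x :: real
        by (simp add: power_divide power2_eq_square ring_distribs add_divide_distrib)
      then show ?thesis unfolding power_even_eq .
    qed
    also have "\<dots> \<le> K / real R ^ (2 * ?d)"
    proof -
      have "real R \<le> 8 * real r" using r(4) by linarith
      then have "real R ^ (2 * ?d) \<le> 8 ^ (2 * ?d) * real r ^ (2 * ?d)"
        using power_mono[of "real R" "8 * real r" "2 * ?d"] by (simp only: power_mult_distrib of_nat_0_le_iff)
      then have le: "C * (B + \<bar>Cg\<bar> * B\<^sup>2) * real R ^ (2 * ?d) \<le> K * real r ^ (2 * ?d)"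
        unfolding K_def mult.assoc using C(1) B(1) by (intro mult_left_mono) auto
      have fr: "a / x \<le> b / y" if "a * y \<le> b * x" "x > 0" "y > 0" for a b x y :: real
        using that by (simp add: field_simps)
      show ?thesis by (rule fr[OF le]) (use r in auto)
    qed
    finally show ?thesis by (simp add: R_def)
  qed
  then show ?thesis using K by blast
qed

subsection \<open>Decay of higher differences\<close>

lemma weak_solution_fdiff:
  assumes w: "finite_energy w" "weak_solution w G (cube (r + range_bound) z)" and \<xi>: "supnorm \<xi> \<le> range_bound"
  shows "weak_solution (fdiff \<xi> w) (\<lambda>\<rho>. fdiff \<xi> (G \<rho>)) (cube r z)"
  unfolding weak_solution_def
proof (intro allI impI)
  fix \<phi> :: "int^'n \<Rightarrow> 'b" assume \<phi>: "vanishes_off (cube r z) \<phi>"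
  have fin: "finite {x. \<phi> x \<noteq> 0}" by (rule vanishes_off_finite[OF \<phi>]) simp
  have "vanishes_off (cube (r + range_bound) z) (fdiff (- \<xi>) \<phi>)"
    by (rule vanishes_off_fdiff[OF \<phi>]) (use \<xi> in simp)
  then have "form (fdiff \<xi> w) \<phi> = flux_pair G (fdiff (- \<xi>) \<phi>)"
    using w(2) form_fdiff_left[OF w(1) finite_energy_vanishes[OF \<phi>]] by (simp add: weak_solution_def)
  also have "\<dots> = flux_pair (\<lambda>\<rho>. fdiff \<xi> (G \<rho>)) \<phi>"
  proof -
    define f where "f = (\<lambda>x. \<Sum>\<rho>\<in>P. G \<rho> (x + \<xi>) \<bullet> fdiff \<rho> \<phi> x)"
    define h where "h = (\<lambda>x. \<Sum>\<rho>\<in>P. G \<rho> x \<bullet> fdiff \<rho> \<phi> x)"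
    have sf: "f summable_on UNIV" unfolding f_def
      by (rule summable_on_fsupp) (rule fsupp_flux[OF fin, of "\<lambda>\<rho> x. G \<rho> (x + \<xi>)"])
    have sh: "h summable_on UNIV" unfolding h_def
      by (rule summable_on_fsupp) (rule fsupp_flux[OF fin, of G])
    have sh': "(\<lambda>x. - h x) summable_on UNIV" using summable_on_cmult_right[OF sh, of "-1"] by simp
    have "(\<Sum>\<rho>\<in>P. G \<rho> x \<bullet> fdiff \<rho> (fdiff (- \<xi>) \<phi>) x) = f (x + - \<xi>) + - h x" for x
      by (simp add: f_def h_def fdiff_def algebra_simps inner_diff_right sum_subtractf sum.distrib)
    then have "flux_pair G (fdiff (- \<xi>) \<phi>) = infsum (\<lambda>x. f (x + - \<xi>) + - h x) UNIV"
      unfolding flux_pair_def by presburger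
    also have "\<dots> = infsum f UNIV - infsum h UNIV"
      using infsum_add[OF summable_shift[OF sf, of "- \<xi>"] sh'] infsum_shift[of f "- \<xi>"]
      by (simp add: infsum_uminus)
    also have "\<dots> = infsum (\<lambda>x. f x + - h x) UNIV"
      using infsum_add[OF sf sh'] by (simp add: infsum_uminus)
    also have "\<dots> = flux_pair (\<lambda>\<rho>. fdiff \<xi> (G \<rho>)) \<phi>"
      unfolding flux_pair_def
      by (intro infsum_cong) (simp add: f_def h_def fdiff_def inner_diff_left sum_subtractf)
    finally show ?thesis .
  qed
  finally show "form (fdiff \<xi> w) \<phi> = flux_pair (\<lambda>\<rho>. fdiff \<xi> (G \<rho>)) \<phi>" .
qed

lemma finite_energy_idiff: "finite_energy u \<Longrightarrow> finite_energy (idiff \<rho>s u)"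
  for u :: "int^'n \<Rightarrow> 'c::real_normed_vector"
  by (induction \<rho>s) (auto intro: finite_energy_fdiff)

lemma weak_solution_idiff:
  assumes "finite_energy w" "weak_solution w G (cube (r + length \<rho>s * range_bound) z)" "set \<rho>s \<subseteq> P"
  shows "weak_solution (idiff \<rho>s w) (\<lambda>\<rho>. idiff \<rho>s (G \<rho>)) (cube r z)"
  using assms(2,3)
proof (induction \<rho>s arbitrary: r)
  case (Cons \<rho> \<rho>s)
  have "weak_solution (idiff \<rho>s w) (\<lambda>\<rho>. idiff \<rho>s (G \<rho>)) (cube (r + range_bound) z)"
    using Cons by (intro Cons.IH) (auto simp: add_ac)
  from weak_solution_fdiff[OF finite_energy_idiff[OF assms(1)] this supnorm_stencil, of \<rho>] Cons.prems(2)
  show ?case by simp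
qed simp

lemma decays_first: assumes "\<sigma> \<in> P" shows "decays CARD('n) 0 (fdiff \<sigma> ut)"
proof -
  obtain C R where C: "C > 0" "\<And>z. supnorm z \<ge> R \<Longrightarrow> dens ut z \<le> C / real (supnorm z) ^ (2 * CARD('n))"
    using dens_decay by blast
  have "norm (fdiff \<sigma> ut z) \<le> sqrt C / real (supnorm z) ^ CARD('n)" if "supnorm z \<ge> R" for z
  proof -
    have "dens ut z \<le> C / (real (supnorm z) ^ CARD('n))\<^sup>2" using C(2)[OF that] by (simp add: power_even_eq)
    then have "sqrt (dens ut z) \<le> sqrt (C / (real (supnorm z) ^ CARD('n))\<^sup>2)" by (rule real_sqrt_le_mono)
    also have "\<dots> = sqrt C / real (supnorm z) ^ CARD('n)" by (simp add: real_sqrt_divide)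
    finally show ?thesis using fdiff_le_dens_root[OF assms, of ut z] by (simp add: dens_root_def)
  qed
  then show ?thesis unfolding decays_def by (intro exI[of _ "sqrt C"] exI[of _ R]) auto
qed

text \<open>The estimate in terms of values is applied to a difference of \<open>ut\<close> of order
  j + 1, which has size R^-(d+j). Its R^d sites against r^-(d+2) yield R^(-2(d+j+1)) for the
  density, one power better after taking the root. Of the j + 1 differences of the flux only j are
  controlled; the last one is estimated by two values.\<close>

lemma decays_step:
  assumes j: "j < J" and IH: "\<And>\<sigma>. \<sigma> \<in> P \<Longrightarrow> decays CARD('n) j (fdiff \<sigma> ut)"
    and \<sigma>: "\<sigma> \<in> P"
  shows "decays CARD('n) (Suc j) (fdiff \<sigma> ut)"
proof -
  let ?d = "CARD('n)"
  obtain C1 R1 where C1: "C1 > 0" "\<And>\<sigma> \<rho>s x. \<sigma> \<in> P \<Longrightarrow> set \<rho>s \<subseteq> P \<Longrightarrow> length \<rho>s \<le> j \<Longrightarrow> supnorm x \<ge> R1 \<Longrightarrow>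
     norm (idiff \<rho>s (fdiff \<sigma> ut) x) \<le> C1 / real (supnorm x) ^ (?d + length \<rho>s)"
    using decays_uniform[where f = "\<lambda>\<sigma>. fdiff \<sigma> ut", OF IH] by metis
  obtain C2 R2 where C2: "C2 > 0" "\<And>\<sigma> \<rho>s x. \<sigma> \<in> P \<Longrightarrow> set \<rho>s \<subseteq> P \<Longrightarrow> length \<rho>s \<le> j \<Longrightarrow> supnorm x \<ge> R2 \<Longrightarrow>
     norm (idiff \<rho>s (g \<sigma>) x) \<le> C2 / real (supnorm x) ^ (2 * ?d + length \<rho>s)"
    using decays_uniform[where f = g, OF flux_decays[OF j IH]] by metis
  obtain C where C: "C > 0" "\<And>w G r z. r \<ge> 2 * range_bound * widen \<Longrightarrow> finite_energy w \<Longrightarrow> weak_solution w G (cube r z) \<Longrightarrow>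
     dens w z \<le> C / (real r) ^ (?d + 2) * (\<Sum>x\<in>cube r z. (norm (w x))\<^sup>2)
       + C * sum (flux_dens G) (cube (r + range_bound) z)"
    using weak_solution_dens_bound_values by blast
  \<comment> \<open>Here 3^d stems from 2 r + 1 <= 3 r in counting sites, 256 = 16^2 from R <= 16 r,
    and the power of 2 from the fact that sites of the cube have norm at least R/2.\<close>
  define K1 where "K1 = C * 3 ^ ?d * 256 * (C1 * 2 ^ (?d + j))\<^sup>2"
  define K2 where "K2 = C * (card P * (2 * C2 * 2 ^ (2 * ?d + j))\<^sup>2)"
  define K where "K = K1 + K2"
  have K12: "K1 \<ge> 0" "K2 \<ge> 0" using C(1) by (auto simp: K1_def K2_def)
  define Rs where "Rs = 16 * (2 * range_bound * widen + (Suc j + 2) * range_bound + M + R1 + R2 + 2)"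
  have main: "norm (fdiff \<sigma> (idiff \<rho>s ut) z) \<le> sqrt K / real (supnorm z) ^ (?d + Suc j)"
    if \<rho>s: "set \<rho>s \<subseteq> P" "length \<rho>s = Suc j" and z: "supnorm z \<ge> Rs" for \<rho>s z
  proof -
    define R where "R = supnorm z"
    define r where "r = R div 8"
    define p where "p = range_bound"
    have Rs16: "Rs = 16 * (2 * p * widen + (Suc j + 2) * p + M + R1 + R2 + 2)" by (simp add: Rs_def p_def)
    have rr: "8 * r \<le> R" "R < 8 * r + 8" by (auto simp: r_def)
    have r2: "r \<ge> 2 * (2 * p * widen + (Suc j + 2) * p + M + R1 + R2 + 2)"
      unfolding r_def using div_le_mono[OF z[folded R_def], of 8] by (simp add: Rs16)
    have r: "r \<ge> 2 * p * widen" "r \<ge> Suc j * p + 2 * p" "r > M" "r \<ge> R1" "r \<ge> R2" "r \<ge> 2" "R \<le> 16 * r"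
      using r2 rr by (auto simp: algebra_simps)
    have R1': "real R \<ge> 1" using rr r(6) by linarith
    obtain \<rho> \<tau> where \<tau>: "\<rho>s = \<rho> # \<tau>" "length \<tau> = j" "\<rho> \<in> P" "set \<tau> \<subseteq> P"
      using \<rho>s by (cases \<rho>s) auto
    define w where "w = idiff \<rho>s ut"
    define G where "G = (\<lambda>\<sigma>. idiff \<rho>s (g \<sigma>))"
    have far: "2 * supnorm x \<ge> R \<and> supnorm x > r" if "x \<in> cube (r + Suc j * p + 2 * p) z" for x
      using supnorm_in_cube[OF that] rr r(2,6) by (simp add: R_def[symmetric])
    have ws: "weak_solution w G (cube r z)"
      unfolding w_def G_def
    proof (rule weak_solution_idiff[OF finite_energy_ut far_weak_solution \<rho>s(1)])
      have "cube (r + length \<rho>s * range_bound) z \<subseteq> cube (r + Suc j * p + 2 * p) z"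
        by (rule cube_mono) (simp add: \<rho>s(2) p_def)
      then show "cube (r + length \<rho>s * range_bound) z \<inter> cube M 0 = {}"
        using far r(3) by (fastforce simp: cube_def)
    qed
    have pw: "c / real (supnorm x) ^ n \<le> c * 2 ^ n / real R ^ n" if "2 * supnorm x \<ge> R" "c > 0" for c n and x :: "int^'n"
    proof -
      have "real R \<le> 2 * real (supnorm x)" using that(1) by linarith
      then have "real R ^ n \<le> 2 ^ n * real (supnorm x) ^ n"
        using power_mono[of "real R" "2 * real (supnorm x)" n] by (simp add: power_mult_distrib)
      then have "c * real R ^ n \<le> c * (2 ^ n * real (supnorm x) ^ n)" using that(2) by (intro mult_left_mono) auto
      moreover have "real (supnorm x) > 0" using \<open>real R \<le> 2 * real (supnorm x)\<close> R1' by linarith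
      ultimately show ?thesis using R1' by (simp add: field_simps)
    qed
    have wb: "(norm (w x))\<^sup>2 \<le> (C1 * 2 ^ (?d + j) / real R ^ (?d + j))\<^sup>2" if x: "x \<in> cube r z" for x
    proof -
      have x': "2 * supnorm x \<ge> R" "supnorm x > r" using far[of x] x cube_mono[of r "r + Suc j * p + 2 * p" z] by auto
      have "norm (w x) = norm (idiff \<tau> (fdiff \<rho> ut) x)" by (simp add: w_def \<tau>(1) idiff_fdiff)
      also have "\<dots> \<le> C1 / real (supnorm x) ^ (?d + length \<tau>)"
        by (rule C1(2)) (use \<tau> x' r in auto)
      also have "\<dots> \<le> C1 * 2 ^ (?d + j) / real R ^ (?d + j)" using pw[OF x'(1) C1(1)] by (simp add: \<tau>(2))
      finally show ?thesis by (intro power_mono) auto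
    qed
    \<comment> \<open>The uncontrolled outermost difference costs the factor 2 and yields no
      additional power of decay.\<close>
    have gb: "norm (G \<sigma> x) \<le> 2 * C2 * 2 ^ (2 * ?d + j) / real R ^ (2 * ?d + j)"
      if x: "x \<in> cube (r + p) z" and \<sigma>: "\<sigma> \<in> P" for x \<sigma>
    proof -
      have one: "norm (idiff \<tau> (g \<sigma>) y) \<le> C2 * 2 ^ (2 * ?d + j) / real R ^ (2 * ?d + j)"
        if y: "y \<in> cube (r + p + p) z" for y
      proof -
        have y': "2 * supnorm y \<ge> R" "supnorm y > r" using far[of y] y cube_mono[of "r + p + p" "r + Suc j * p + 2 * p" z] by auto
        have "norm (idiff \<tau> (g \<sigma>) y) \<le> C2 / real (supnorm y) ^ (2 * ?d + length \<tau>)"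
          by (rule C2(2)) (use \<tau> y' r \<sigma> in auto)
        also have "\<dots> \<le> C2 * 2 ^ (2 * ?d + j) / real R ^ (2 * ?d + j)" using pw[OF y'(1) C2(1)] by (simp add: \<tau>(2))
        finally show ?thesis .
      qed
      have "x + \<rho> \<in> cube (r + p + p) z" by (rule cube_add[OF x]) (use supnorm_stencil[OF \<tau>(3)] in \<open>simp add: p_def\<close>)
      moreover have "x \<in> cube (r + p + p) z" using x cube_mono[of "r + p" "r + p + p" z] by auto
      ultimately have "norm (idiff \<tau> (g \<sigma>) (x + \<rho>)) + norm (idiff \<tau> (g \<sigma>) x)
          \<le> C2 * 2 ^ (2 * ?d + j) / real R ^ (2 * ?d + j) + C2 * 2 ^ (2 * ?d + j) / real R ^ (2 * ?d + j)"
        by (intro add_mono one)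
      moreover have "norm (G \<sigma> x) \<le> norm (idiff \<tau> (g \<sigma>) (x + \<rho>)) + norm (idiff \<tau> (g \<sigma>) x)"
        unfolding G_def \<tau>(1) by (simp add: fdiff_def norm_triangle_ineq4)
      ultimately show ?thesis by simp
    qed
    have s1: "(\<Sum>x\<in>cube r z. (norm (w x))\<^sup>2) \<le> (3 * real r) ^ ?d * (C1 * 2 ^ (?d + j) / real R ^ (?d + j))\<^sup>2"
    proof -
      have "(\<Sum>x\<in>cube r z. (norm (w x))\<^sup>2) \<le> real (card (cube r z)) * (C1 * 2 ^ (?d + j) / real R ^ (?d + j))\<^sup>2"
        by (rule sum_bounded_above) (rule wb)
      also have "real (card (cube r z)) = real (2 * r + 1) ^ ?d" by (simp add: card_cube)
      also have "real (2 * r + 1) ^ ?d \<le> (3 * real r) ^ ?d" using r(6) by (intro power_mono) auto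
      finally show ?thesis by (simp add: mult_right_mono)
    qed
    have s2: "sum (flux_dens G) (cube (r + p) z) \<le> real R ^ ?d * (card P * (2 * C2 * 2 ^ (2 * ?d + j) / real R ^ (2 * ?d + j))\<^sup>2)"
    proof -
      have "flux_dens G x \<le> card P * (2 * C2 * 2 ^ (2 * ?d + j) / real R ^ (2 * ?d + j))\<^sup>2" if "x \<in> cube (r + p) z" for x
        unfolding flux_dens_def using that by (intro sum_bounded_above power_mono gb) auto
      then have "sum (flux_dens G) (cube (r + p) z) \<le> real (card (cube (r + p) z)) * (card P * (2 * C2 * 2 ^ (2 * ?d + j) / real R ^ (2 * ?d + j))\<^sup>2)"
        by (rule sum_bounded_above)
      also have "real (card (cube (r + p) z)) = real (2 * (r + p) + 1) ^ ?d" by (simp add: card_cube)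
      also have "real (2 * (r + p) + 1) ^ ?d \<le> real R ^ ?d"
        using r rr by (intro power_mono of_nat_mono) auto
      finally show ?thesis by (simp add: mult_right_mono)
    qed
    have "dens w z \<le> C / (real r) ^ (?d + 2) * (\<Sum>x\<in>cube r z. (norm (w x))\<^sup>2) + C * sum (flux_dens G) (cube (r + p) z)"
      unfolding p_def by (rule C(2)[OF _ _ ws]) (use r(1) finite_energy_idiff[OF finite_energy_ut] in \<open>auto simp: p_def w_def\<close>)
    also have "\<dots> \<le> C / (real r) ^ (?d + 2) * ((3 * real r) ^ ?d * (C1 * 2 ^ (?d + j) / real R ^ (?d + j))\<^sup>2)
       + C * (real R ^ ?d * (card P * (2 * C2 * 2 ^ (2 * ?d + j) / real R ^ (2 * ?d + j))\<^sup>2))"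
      using C(1) by (intro add_mono mult_left_mono s1 s2) auto
    also have "\<dots> \<le> K1 / (real R ^ (?d + Suc j))\<^sup>2 + K2 / (real R ^ (?d + Suc j))\<^sup>2"
    proof (rule add_mono)
      have r0: "real r > 0" using r(6) by simp
      have "C / (real r) ^ (?d + 2) * ((3 * real r) ^ ?d * (C1 * 2 ^ (?d + j) / real R ^ (?d + j))\<^sup>2)
         = C * 3 ^ ?d * (C1 * 2 ^ (?d + j))\<^sup>2 / ((real r)\<^sup>2 * (real R ^ (?d + j))\<^sup>2)"
        using r0 by (simp add: power_add power_mult_distrib power_divide power2_eq_square mult_ac)
      also have "\<dots> \<le> C * 3 ^ ?d * (C1 * 2 ^ (?d + j))\<^sup>2 / ((real R / 16)\<^sup>2 * (real R ^ (?d + j))\<^sup>2)"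
        using r(7) R1' C(1) r0 by (intro divide_left_mono mult_right_mono power_mono mult_pos_pos) auto
      also have "\<dots> = K1 / (real R ^ (?d + Suc j))\<^sup>2"
        by (simp add: K1_def power_divide power_mult_distrib)
      finally show "C / (real r) ^ (?d + 2) * ((3 * real r) ^ ?d * (C1 * 2 ^ (?d + j) / real R ^ (?d + j))\<^sup>2)
        \<le> K1 / (real R ^ (?d + Suc j))\<^sup>2" .
      have "C * (real R ^ ?d * (card P * (2 * C2 * 2 ^ (2 * ?d + j) / real R ^ (2 * ?d + j))\<^sup>2))
        = K2 * (real R ^ ?d / (real R ^ (2 * ?d + j))\<^sup>2)"
        by (simp add: K2_def power_divide)
      also have "\<dots> \<le> K2 * (1 / (real R ^ (?d + Suc j))\<^sup>2)"
      proof (intro mult_left_mono K12)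
        \<comment> \<open>The flux contributes R^d * R^(-2(2d+j)). This is at most R^(-2(d+j+1)),
          despite the power lost on the last difference, precisely when d >= 2.\<close>
        have "?d + 2 * (?d + Suc j) \<le> 2 * (2 * ?d + j)" using dim by simp
        then have "real R ^ (?d + 2 * (?d + Suc j)) \<le> real R ^ (2 * (2 * ?d + j))"
          using R1' by (rule power_increasing)
        then have "real R ^ ?d * (real R ^ (?d + Suc j))\<^sup>2 \<le> (real R ^ (2 * ?d + j))\<^sup>2"
          by (simp only: power_even_eq[symmetric] power_add[symmetric])
        moreover have "(real R ^ (?d + Suc j))\<^sup>2 > 0" "(real R ^ (2 * ?d + j))\<^sup>2 > 0" using R1' by auto
        moreover have "a / x \<le> 1 / y" if "a * y \<le> x" "x > 0" "y > 0" for a x y :: real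
          using that by (simp add: field_simps)
        ultimately show "real R ^ ?d / (real R ^ (2 * ?d + j))\<^sup>2 \<le> 1 / (real R ^ (?d + Suc j))\<^sup>2" by blast
      qed
      finally show "C * (real R ^ ?d * (card P * (2 * C2 * 2 ^ (2 * ?d + j) / real R ^ (2 * ?d + j))\<^sup>2))
        \<le> K2 / (real R ^ (?d + Suc j))\<^sup>2" by simp
    qed
    also have "\<dots> = K / (real R ^ (?d + Suc j))\<^sup>2" by (simp add: K_def add_divide_distrib)
    finally have "sqrt (dens w z) \<le> sqrt (K / (real R ^ (?d + Suc j))\<^sup>2)" by (rule real_sqrt_le_mono)
    also have "\<dots> = sqrt K / real R ^ (?d + Suc j)" by (simp add: real_sqrt_divide)
    finally show ?thesis using fdiff_le_dens_root[OF \<sigma>, of w z] by (simp add: dens_root_def w_def R_def)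
  qed
  define D where "D = max C1 (sqrt K)"
  have "norm (idiff \<rho>s (fdiff \<sigma> ut) x) \<le> D / real (supnorm x) ^ (?d + length \<rho>s)"
    if "set \<rho>s \<subseteq> P" "length \<rho>s \<le> Suc j" "supnorm x \<ge> max R1 Rs" for \<rho>s x
  proof (cases "length \<rho>s = Suc j")
    case True
    have "norm (idiff \<rho>s (fdiff \<sigma> ut) x) \<le> sqrt K / real (supnorm x) ^ (?d + length \<rho>s)"
      using main[OF that(1) True, of x] that(3) by (simp add: idiff_fdiff True)
    also have "\<dots> \<le> D / real (supnorm x) ^ (?d + length \<rho>s)" by (intro divide_right_mono) (auto simp: D_def)
    finally show ?thesis .
  next
    case False
    have "norm (idiff \<rho>s (fdiff \<sigma> ut) x) \<le> C1 / real (supnorm x) ^ (?d + length \<rho>s)"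
      by (rule C1(2)) (use \<sigma> that False in auto)
    also have "\<dots> \<le> D / real (supnorm x) ^ (?d + length \<rho>s)" by (intro divide_right_mono) (auto simp: D_def)
    finally show ?thesis .
  qed
  then show ?thesis unfolding decays_def by blast
qed

lemma decays_all: "j \<le> J \<Longrightarrow> \<sigma> \<in> P \<Longrightarrow> decays CARD('n) j (fdiff \<sigma> ut)"
proof (induction j arbitrary: \<sigma>)
  case 0 then show ?case by (simp add: decays_first)
next
  case (Suc j) then show ?case by (intro decays_step) auto
qed

end

subsection \<open>The limit at infinity\<close>

lemma fdiff_line_bound:
  fixes u :: "int^'n \<Rightarrow> 'c::real_normed_vector"
  assumes b: "\<And>x. supnorm x \<ge> R \<Longrightarrow> norm (fdiff (axis i 1) u x) \<le> B"
    and far: "\<And>k. supnorm (x + axis i k) \<ge> R"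
  shows "norm (u (x + axis i m) - u x) \<le> real_of_int \<bar>m\<bar> * B"
proof -
  have pos: "norm (u (y + axis i (int n)) - u y) \<le> real n * B" if "\<And>k. supnorm (y + axis i k) \<ge> R" for y n
  proof (induction n)
    case 0 show ?case by (simp add: axis_def flip: zero_vec_def)
  next
    case (Suc n)
    have "y + axis i (int (Suc n)) = y + axis i (int n) + axis i 1" by (auto simp: axis_def vec_eq_iff)
    then have "u (y + axis i (int (Suc n))) - u y = fdiff (axis i 1) u (y + axis i (int n)) + (u (y + axis i (int n)) - u y)"
      by (simp add: fdiff_def add.assoc)
    also have "norm \<dots> \<le> B + real n * B" by (intro norm_triangle_mono b that Suc)
    finally show ?case by (simp add: algebra_simps)
  qed
  show ?thesis
  proof (cases "m \<ge> 0")
    case True then show ?thesis using pos[of x "nat m"] far by simp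
  next
    case False
    have shift: "x + axis i m + axis i k = x + axis i (m + k)" for k by (auto simp: axis_def vec_eq_iff)
    have "norm (u (x + axis i m + axis i (int (nat (- m)))) - u (x + axis i m)) \<le> real (nat (- m)) * B"
      by (rule pos) (simp add: shift far)
    moreover have "x + axis i m + axis i (int (nat (- m))) = x" using False by (auto simp: axis_def vec_eq_iff)
    ultimately show ?thesis using False by (simp add: norm_minus_commute add.assoc)
  qed
qed

text \<open>
  Any \<open>x\<close> is joined to the diagonal point \<open>(R, \<dots>, R)\<close>, \<open>R = supnorm x\<close>, by moving one
  coordinate at a time; some other coordinate always keeps modulus \<open>R\<close>.
\<close>

lemma move_coordinates:
  fixes u :: "int^'n \<Rightarrow> 'c::real_normed_vector"
  assumes b: "\<And>i x. supnorm x \<ge> R \<Longrightarrow> norm (fdiff (axis i 1) u x) \<le> B"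
    and J: "finite J" and guard: "\<And>i J'. i \<in> J \<Longrightarrow> J' \<subseteq> J - {i} \<Longrightarrow> \<exists>j. j \<noteq> i \<and> \<bar>if j \<in> J' then a else x $ j\<bar> \<ge> int R"
    and D: "\<And>i. i \<in> J \<Longrightarrow> \<bar>a - x $ i\<bar> \<le> D" and B: "B \<ge> 0"
  shows "norm (u (\<chi> j. if j \<in> J then a else x $ j) - u x) \<le> real (card J) * (real_of_int D * B)"
proof -
  let ?y = "\<lambda>J'. (\<chi> j. if j \<in> J' then a else x $ j) :: int^'n"
  have "norm (u (?y J') - u x) \<le> real (card J') * (real_of_int D * B)" if "finite J'" "J' \<subseteq> J" for J'
    using that
  proof (induction J' rule: finite_induct)
    case empty
    have "?y {} = x" by (simp add: vec_eq_iff)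
    then show ?case by simp
  next
    case (insert i J')
    obtain j where j: "j \<noteq> i" "\<bar>if j \<in> J' then a else x $ j\<bar> \<ge> int R"
      using guard[of i J'] insert by auto
    have y: "?y (insert i J') = ?y J' + axis i (a - x $ i)"
      using insert(2) by (auto simp: axis_def vec_eq_iff)
    have far: "supnorm (?y J' + axis i k) \<ge> R" for k
      using supnorm_component[of "?y J' + axis i k" j] j by (simp add: axis_def split: if_splits)
    have "norm (u (?y (insert i J')) - u (?y J')) \<le> real_of_int \<bar>a - x $ i\<bar> * B"
      unfolding y by (rule fdiff_line_bound[OF b far])
    also have "\<dots> \<le> real_of_int D * B"
      using D[of i] insert.prems B by (intro mult_right_mono) auto
    finally have "norm (u (?y (insert i J')) - u (?y J')) \<le> real_of_int D * B" .
    moreover have "norm (u (?y J') - u x) \<le> real (card J') * (real_of_int D * B)" using insert by auto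
    ultimately have "norm ((u (?y (insert i J')) - u (?y J')) + (u (?y J') - u x)) \<le> real_of_int D * B + real (card J') * (real_of_int D * B)"
      by (intro norm_triangle_mono)
    then show ?case using insert(1,2) by (simp add: algebra_simps)
  qed
  then show ?thesis using J by blast
qed

text \<open>The limit is taken along the diagonal points \<open>e R\<close>, whose increments are of
  order R^-d and hence summable. An arbitrary site of norm R reaches the diagonal by a path of
  length of order R that stays at norm at least R, at cost R * R^-d. The bound d >= 2 gives
  summability and also the second coordinate that keeps the path away from the origin.\<close>

lemma limit_at_infinity:
  fixes u :: "int^'n \<Rightarrow> 'c::banach"
  assumes dim: "CARD('n) \<ge> 2" and C: "C \<ge> 0" and R0: "R0 \<ge> 1"
    and b: "\<And>i x. supnorm x \<ge> R0 \<Longrightarrow> norm (fdiff (axis i 1) u x) \<le> C / real (supnorm x) ^ CARD('n)"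
  obtains c K where "K > 0" "\<And>x. supnorm x \<ge> R0 \<Longrightarrow> norm (u x - c) \<le> K / real (supnorm x) ^ (CARD('n) - 1)"
proof -
  let ?d = "CARD('n)"
  define m where "m = ?d - 1"
  have d: "?d = Suc m" "m \<ge> 1" using dim by (auto simp: m_def)
  have other: "\<exists>j::'n. j \<noteq> i" for i
  proof (rule ccontr)
    assume "\<not> ?thesis"
    then have "UNIV = {i}" by auto
    then have "?d = 1" by (metis card_1_singleton_iff One_nat_def)
    then show False using dim by simp
  qed
  have bR: "norm (fdiff (axis i 1) u x) \<le> C / real R ^ ?d" if "R \<ge> R0" "supnorm x \<ge> R" for R i x
  proof -
    have "norm (fdiff (axis i 1) u x) \<le> C / real (supnorm x) ^ ?d" using that by (intro b) auto
    also have "\<dots> \<le> C / real R ^ ?d"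
      using that R0 C by (intro divide_left_mono power_mono mult_pos_pos zero_less_power) auto
    finally show ?thesis .
  qed
  define e where "e = (\<lambda>R::nat. (\<chi> i. int R) :: int^'n)"
  have diag: "norm (u (e R) - u x) \<le> 2 * real ?d * C / real R ^ m + 2 * C / real R ^ m" if R: "R \<ge> R0" "supnorm x = R" for x R
  proof -
    have B: "C / real R ^ ?d \<ge> 0" using C by simp
    have r0: "real R > 0" using R R0 by simp
    obtain i0 where i0: "\<bar>x $ i0\<bar> = int R" using supnorm_attained[of x] R(2) by auto
    let ?J = "UNIV - {i0}"
    let ?y = "(\<chi> j. if j \<in> ?J then int R else x $ j) :: int^'n"
    have xb: "\<bar>int R - x $ i\<bar> \<le> 2 * int R" for i using supnorm_component[of x i] R(2) by linarith
    have "norm (u ?y - u x) \<le> real (card ?J) * (real_of_int (2 * int R) * (C / real R ^ ?d))"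
    proof (rule move_coordinates[OF bR[OF R(1)]])
      fix i J' assume "i \<in> ?J" "J' \<subseteq> ?J - {i}"
      then show "\<exists>j. j \<noteq> i \<and> \<bar>if j \<in> J' then int R else x $ j\<bar> \<ge> int R"
        using i0 by (intro exI[of _ i0]) auto
    qed (use xb B in auto)
    also have "\<dots> \<le> real ?d * (real_of_int (2 * int R) * (C / real R ^ ?d))"
      using B card_mono[of "UNIV::'n set" ?J] by (intro mult_right_mono mult_nonneg_nonneg) auto
    also have "\<dots> = 2 * real ?d * C / real R ^ m" using r0 by (simp add: d(1))
    finally have 1: "norm (u ?y - u x) \<le> 2 * real ?d * C / real R ^ m" .
    have ye: "e R = ?y + axis i0 (int R - x $ i0)" by (auto simp: e_def axis_def vec_eq_iff)
    obtain j where j: "j \<noteq> i0" using other by blast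
    have far: "supnorm (?y + axis i0 k) \<ge> R" for k
      using supnorm_component[of "?y + axis i0 k" j] j by (simp add: axis_def)
    have "norm (u (e R) - u ?y) \<le> real_of_int \<bar>int R - x $ i0\<bar> * (C / real R ^ ?d)"
      unfolding ye by (rule fdiff_line_bound[OF bR[OF R(1)] far])
    also have "\<dots> \<le> real_of_int (2 * int R) * (C / real R ^ ?d)" using xb[of i0] B by (intro mult_right_mono) (simp_all only: of_int_le_iff)
    also have "\<dots> = 2 * C / real R ^ m" using r0 by (simp add: d(1))
    finally have 2: "norm (u (e R) - u ?y) \<le> 2 * C / real R ^ m" .
    show ?thesis using norm_triangle_ineq[of "u (e R) - u ?y" "u ?y - u x"] 1 2 by simp
  qed
  define K where "K = 2 * real ?d * C"
  have K0: "K \<ge> 0" using C by (simp add: K_def)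
  \<comment> \<open>The bound is written as a telescoping difference, a discrete integral of R^-d.
    It rests on 1/R^m - 1/(R+1)^m >= (1/R^m) * (1/(R+1)) >= 1/(2 R^(m+1)) with m = d - 1; the 2 in
    \<open>K\<close> compensates the last step.\<close>
  have step: "norm (u (e (Suc R)) - u (e R)) \<le> K * (1 / real R ^ m - 1 / real (Suc R) ^ m)" if R: "R \<ge> R0" for R
  proof -
    have r0: "real R > 0" using R R0 by simp
    have B: "C / real R ^ ?d \<ge> 0" using C by simp
    have ee: "e (Suc R) = (\<chi> j. if j \<in> UNIV then int (Suc R) else e R $ j)" by (simp add: e_def)
    have "norm (u (e (Suc R)) - u (e R)) \<le> real (card (UNIV :: 'n set)) * (real_of_int 1 * (C / real R ^ ?d))"
      unfolding ee
    proof (rule move_coordinates[OF bR[OF R]])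
      fix i :: 'n and J' assume "i \<in> UNIV" "J' \<subseteq> UNIV - {i}"
      obtain j where "j \<noteq> i" using other by blast
      then show "\<exists>j. j \<noteq> i \<and> \<bar>if j \<in> J' then int (Suc R) else e R $ j\<bar> \<ge> int R"
        by (intro exI[of _ j]) (auto simp: e_def)
    qed (use B in \<open>auto simp: e_def\<close>)
    also have "\<dots> = K * (1 / (2 * real R * real R ^ m))" using r0 by (simp add: K_def d(1) field_simps)
    also have "\<dots> \<le> K * (1 / real R ^ m - 1 / real (Suc R) ^ m)"
    proof (intro mult_left_mono K0)
      have "(real R / real (Suc R)) ^ m \<le> (real R / real (Suc R)) ^ 1"
        using d(2) by (intro power_decreasing) auto
      then have "1 / real R ^ m * (real R / real (Suc R)) ^ m \<le> 1 / real R ^ m * (real R / real (Suc R))"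
        by (intro mult_left_mono) auto
      then have "1 / real (Suc R) ^ m \<le> 1 / real R ^ m * (real R / real (Suc R))"
        using r0 by (simp add: power_divide)
      then have "1 / real R ^ m - 1 / real (Suc R) ^ m \<ge> 1 / real R ^ m * (1 - real R / real (Suc R))"
        by (simp add: algebra_simps)
      also have "1 - real R / real (Suc R) = 1 / real (Suc R)" by (simp add: field_simps)
      finally have "1 / real R ^ m - 1 / real (Suc R) ^ m \<ge> 1 / real R ^ m * (1 / real (Suc R))" by simp
      moreover have "1 / real R ^ m * (1 / real (Suc R)) \<ge> 1 / real R ^ m * (1 / (2 * real R))"
        using r0 R R0 by (intro mult_left_mono divide_left_mono) auto
      ultimately show "1 / (2 * real R * real R ^ m) \<le> 1 / real R ^ m - 1 / real (Suc R) ^ m"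
        by (simp add: mult.commute)
    qed
    finally show ?thesis .
  qed
  have tele: "norm (u (e (R + k)) - u (e R)) \<le> K * (1 / real R ^ m - 1 / real (R + k) ^ m)" if "R \<ge> R0" for R k
  proof (induction k)
    case (Suc k)
    have "norm ((u (e (Suc (R + k))) - u (e (R + k))) + (u (e (R + k)) - u (e R)))
       \<le> K * (1 / real (R + k) ^ m - 1 / real (Suc (R + k)) ^ m) + K * (1 / real R ^ m - 1 / real (R + k) ^ m)"
      by (intro norm_triangle_mono step Suc) (use that in auto)
    then show ?case by (simp add: algebra_simps)
  qed simp
  have tele': "norm (u (e n) - u (e R)) \<le> K / real R ^ m" if "R \<ge> R0" "n \<ge> R" for R n
  proof -
    have "norm (u (e n) - u (e R)) \<le> K * (1 / real R ^ m - 1 / real n ^ m)"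
      using tele[OF that(1), of "n - R"] that(2) by simp
    also have "\<dots> \<le> K * (1 / real R ^ m)" using K0 by (intro mult_left_mono) auto
    finally show ?thesis by simp
  qed
  have "Cauchy (\<lambda>n. u (e n))"
  proof (rule CauchyI')
    fix \<epsilon> :: real assume \<epsilon>: "\<epsilon> > 0"
    obtain N :: nat where N: "real N > K / \<epsilon>" using reals_Archimedean2 by blast
    define R where "R = max R0 (max N 1)"
    have R: "R \<ge> R0" "real R \<ge> 1" "real R \<ge> real N" by (auto simp: R_def)
    have half: "norm (u (e n) - u (e k)) < \<epsilon>" if "k \<ge> R" "n \<ge> k" for n k
    proof -
      have k: "real k \<ge> real R" using that by simp
      have "norm (u (e n) - u (e k)) \<le> K / real k ^ m" by (rule tele') (use that R in auto)
      also have "\<dots> \<le> K / real k"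
      proof (rule divide_left_mono)
        show "real k \<le> real k ^ m" using power_increasing[of 1 m "real k"] d(2) k R(2) by simp
      qed (use K0 k R(2) in auto)
      also have "\<dots> < \<epsilon>"
      proof -
        have "K < \<epsilon> * real N" using N \<epsilon> by (simp add: field_simps)
        also have "\<dots> \<le> \<epsilon> * real k" using \<epsilon> k R(3) by (intro mult_left_mono) auto
        finally show ?thesis using k R(2) by (simp add: field_simps)
      qed
      finally show ?thesis .
    qed
    show "\<exists>M. \<forall>k\<ge>M. \<forall>n>k. dist (u (e k)) (u (e n)) < \<epsilon>"
      using half by (intro exI[of _ R]) (auto simp: dist_norm norm_minus_commute)
  qed
  then obtain c where c: "(\<lambda>n. u (e n)) \<longlonglongrightarrow> c" using Cauchy_convergent convergent_def by blast
  have ec: "norm (c - u (e R)) \<le> K / real R ^ m" if "R \<ge> R0" for R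
  proof (rule LIMSEQ_le_const2)
    show "(\<lambda>n. norm (u (e n) - u (e R))) \<longlonglongrightarrow> norm (c - u (e R))" by (intro tendsto_intros c)
    show "\<exists>N. \<forall>n\<ge>N. norm (u (e n) - u (e R)) \<le> K / real R ^ m" using tele'[OF that] by blast
  qed
  show thesis
  proof (rule that[of "2 * K + 2 * C + 1" c])
    show "2 * K + 2 * C + 1 > 0" using K0 C by simp
    fix x :: "int^'n" assume x: "supnorm x \<ge> R0"
    let ?R = "supnorm x"
    have "norm (u x - c) \<le> norm (u (e ?R) - u x) + norm (c - u (e ?R))"
      using norm_triangle_ineq[of "u x - u (e ?R)" "u (e ?R) - c"] by (simp add: norm_minus_commute)
    also have "\<dots> \<le> (K / real ?R ^ m + 2 * C / real ?R ^ m) + K / real ?R ^ m"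
      using add_mono[OF diag[OF x refl, folded K_def] ec[OF x]] .
    also have "\<dots> = (2 * K + 2 * C) / real ?R ^ m" by (simp add: add_divide_distrib)
    also have "\<dots> \<le> (2 * K + 2 * C + 1) / real ?R ^ m" by (intro divide_right_mono) auto
    finally show "norm (u x - c) \<le> (2 * K + 2 * C + 1) / real ?R ^ (CARD('n) - 1)" by (simp add: m_def)
  qed
qed

section \<open>Bravais lattices and triangulations\<close>

definition lattice_point :: "real^'n^'n \<Rightarrow> int^'n \<Rightarrow> real^'n" where
  "lattice_point A x = A *v (\<chi> i. real_of_int (x $ i))"

lemma lattice_point_add: "lattice_point A (x + y) = lattice_point A x + lattice_point A y"
proof -
  have "(\<chi> i. real_of_int ((x + y) $ i)) = (\<chi> i. real_of_int (x $ i)) + (\<chi> i. real_of_int (y $ i))"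
    by (simp add: vec_eq_iff)
  then show ?thesis by (simp add: lattice_point_def matrix_vector_right_distrib)
qed

lemma lattice_point_diff: "lattice_point A (x - y) = lattice_point A x - lattice_point A y"
  using lattice_point_add[of A "x - y" y] by simp

lemma range_lattice_point: "range (lattice_point A) = bravais_lattice A"
proof -
  have "\<exists>x. z = (\<chi> i. real_of_int (x $ i))" if "\<forall>i. z $ i \<in> \<int>" for z :: "real^'n"
  proof -
    have "z = (\<chi> i. real_of_int ((\<chi> i. \<lfloor>z $ i\<rfloor>) $ i))"
      using that by (simp add: vec_eq_iff)
    then show ?thesis by blast
  qed
  then show ?thesis unfolding bravais_lattice_def lattice_point_def by (auto simp: image_iff) blast
qed

lemma norm_real_of_int_vec:
  fixes x :: "int^'n"
  shows "real (supnorm x) \<le> norm (\<chi> i. real_of_int (x $ i))"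
    and "norm (\<chi> i. real_of_int (x $ i)) \<le> real CARD('n) * real (supnorm x)"
proof -
  let ?v = "(\<chi> i. real_of_int (x $ i)) :: real^'n"
  obtain i where i: "\<bar>x $ i\<bar> = int (supnorm x)" using supnorm_attained by blast
  have "\<bar>?v $ i\<bar> = real (supnorm x)" using i by (simp flip: of_int_abs)
  then show "real (supnorm x) \<le> norm ?v" using component_le_norm_cart[of ?v i] by simp
  have "norm ?v \<le> (\<Sum>i\<in>UNIV. \<bar>?v $ i\<bar>)" by (rule norm_le_l1_cart)
  also have "\<dots> \<le> (\<Sum>i\<in>(UNIV::'n set). real (supnorm x))"
  proof (rule sum_mono)
    fix i
    have "real_of_int \<bar>x $ i\<bar> \<le> real_of_int (int (supnorm x))" using supnorm_component[of x i] by (rule of_int_le_iff[THEN iffD2])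
    then show "\<bar>?v $ i\<bar> \<le> real (supnorm x)" by simp
  qed
  finally show "norm ?v \<le> real CARD('n) * real (supnorm x)" by simp
qed

lemma lattice_point_norm:
  fixes A :: "real^'n^'n"
  assumes "invertible A"
  obtains c C where "c > 0" "C > 0" "\<And>x. c * real (supnorm x) \<le> norm (lattice_point A x)"
    "\<And>x. norm (lattice_point A x) \<le> C * real (supnorm x)"
proof -
  obtain B where B: "A ** B = mat 1" "B ** A = mat 1" using assms unfolding invertible_def by blast
  obtain b where b: "b > 0" "\<And>x. norm (B *v x) \<le> norm x * b"
    using bounded_linear.pos_bounded[OF matrix_vector_mul_bounded_linear[of B]] by blast
  obtain a where a: "a > 0" "\<And>x. norm (A *v x) \<le> norm x * a"
    using bounded_linear.pos_bounded[OF matrix_vector_mul_bounded_linear[of A]] by blast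
  show thesis
  proof (rule that[of "1 / b" "a * CARD('n)"])
    show "1 / b > 0" "a * CARD('n) > 0" using a b by auto
    fix x :: "int^'n"
    let ?v = "(\<chi> i. real_of_int (x $ i)) :: real^'n"
    have "B *v (A *v ?v) = ?v" using B by (simp add: matrix_vector_mul_assoc)
    then have "norm ?v \<le> norm (A *v ?v) * b" using b(2)[of "A *v ?v"] by simp
    then show "1 / b * real (supnorm x) \<le> norm (lattice_point A x)"
      using norm_real_of_int_vec(1)[of x] b(1) by (simp add: lattice_point_def field_simps)
    have "norm (lattice_point A x) \<le> norm ?v * a" unfolding lattice_point_def by (rule a(2))
    also have "\<dots> \<le> (real CARD('n) * real (supnorm x)) * a" using a(1) norm_real_of_int_vec(2)[of x] by (intro mult_right_mono) auto
    finally show "norm (lattice_point A x) \<le> a * CARD('n) * real (supnorm x)" by (simp add: mult_ac)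
  qed
qed

lemma inj_lattice_point: "invertible A \<Longrightarrow> inj (lattice_point A)"
proof (rule injI)
  fix x y assume A: "invertible A" and e: "lattice_point A x = lattice_point A y"
  obtain c where "c > 0" "\<And>x. c * real (supnorm x) \<le> norm (lattice_point A x)"
    using lattice_point_norm[OF A] by metis
  then have "c * real (supnorm (x - y)) \<le> 0"
    using e by (metis lattice_point_diff diff_self norm_zero)
  then have "real (supnorm (x - y)) \<le> 0" using \<open>c > 0\<close> by (simp add: mult_le_0_iff)
  then show "x = y" using supnorm_eq_0[of "x - y"] by simp
qed

section \<open>Geometry of the node set\<close>

locale defect_nodes =
  fixes A :: "real^'n^'n" and \<Lambda> :: "(real^'n) set" and Rd :: real
  assumes A: "invertible A" and Rd: "Rd > 0"
    and config: "\<Lambda> - ball 0 Rd = bravais_lattice A - ball 0 Rd"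
    and config_finite: "finite (\<Lambda> \<inter> ball 0 Rd)"
begin

lemma outside: "norm l \<ge> Rd \<Longrightarrow> l \<in> \<Lambda> \<longleftrightarrow> l \<in> range (lattice_point A)"
proof -
  assume "norm l \<ge> Rd"
  then have "l \<notin> ball 0 Rd" by simp
  then have "l \<in> \<Lambda> \<longleftrightarrow> l \<in> \<Lambda> - ball 0 Rd" "l \<in> bravais_lattice A \<longleftrightarrow> l \<in> bravais_lattice A - ball 0 Rd" by blast+
  then show "l \<in> \<Lambda> \<longleftrightarrow> l \<in> range (lattice_point A)" by (simp only: config range_lattice_point)
qed

lemma card_lattice_ball: "\<exists>N. \<forall>x. finite (range (lattice_point A) \<inter> cball x r) \<and> card (range (lattice_point A) \<inter> cball x r) \<le> N"
proof -
  obtain c where c: "c > 0" "\<And>x. c * real (supnorm x) \<le> norm (lattice_point A x)"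
    using lattice_point_norm[OF A] by metis
  define M where "M = nat \<lceil>2 * r / c\<rceil>"
  have "finite (range (lattice_point A) \<inter> cball x r) \<and> card (range (lattice_point A) \<inter> cball x r) \<le> (2 * M + 1) ^ CARD('n)" for x
  proof (cases "range (lattice_point A) \<inter> cball x r = {}")
    case False
    then obtain z0 where z0: "lattice_point A z0 \<in> cball x r" by auto
    have "range (lattice_point A) \<inter> cball x r \<subseteq> lattice_point A ` cube M z0"
    proof clarify
      fix z assume z: "lattice_point A z \<in> cball x r"
      have "norm (lattice_point A (z - z0)) \<le> 2 * r"
        using z z0 dist_triangle2[of "lattice_point A z" "lattice_point A z0" x]
        by (simp add: lattice_point_diff dist_norm dist_commute[of x] norm_minus_commute)
      then have "c * real (supnorm (z - z0)) \<le> 2 * r" using c(2)[of "z - z0"] by linarith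
      then have "real (supnorm (z - z0)) \<le> 2 * r / c" using c(1) by (simp add: field_simps)
      then have "supnorm (z - z0) \<le> M" unfolding M_def by linarith
      then show "lattice_point A z \<in> lattice_point A ` cube M z0" by (simp add: cube_def)
    qed
    then have "finite (range (lattice_point A) \<inter> cball x r)" "card (range (lattice_point A) \<inter> cball x r) \<le> card (cube M z0)"
      using surj_card_le[OF finite_cube] finite_subset by (blast intro: finite_imageI finite_cube)+
    then show ?thesis by (simp add: card_cube)
  qed simp
  then show ?thesis by blast
qed

lemma card_nodes_ball: "\<exists>N. \<forall>x. finite (\<Lambda> \<inter> cball x r) \<and> card (\<Lambda> \<inter> cball x r) \<le> N"
proof -
  obtain N where N: "\<And>x. finite (range (lattice_point A) \<inter> cball x r)" "\<And>x. card (range (lattice_point A) \<inter> cball x r) \<le> N"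
    using card_lattice_ball by blast
  have "finite (\<Lambda> \<inter> cball x r) \<and> card (\<Lambda> \<inter> cball x r) \<le> card (\<Lambda> \<inter> ball 0 Rd) + N" for x
  proof -
    have sub: "\<Lambda> \<inter> cball x r \<subseteq> (\<Lambda> \<inter> ball 0 Rd) \<union> (range (lattice_point A) \<inter> cball x r)"
    proof
      fix l assume l: "l \<in> \<Lambda> \<inter> cball x r"
      then show "l \<in> (\<Lambda> \<inter> ball 0 Rd) \<union> (range (lattice_point A) \<inter> cball x r)"
        using outside[of l] by (cases "norm l < Rd") auto
    qed
    have fin: "finite ((\<Lambda> \<inter> ball 0 Rd) \<union> (range (lattice_point A) \<inter> cball x r))" using config_finite N(1) by blast
    have "card (\<Lambda> \<inter> cball x r) \<le> card ((\<Lambda> \<inter> ball 0 Rd) \<union> (range (lattice_point A) \<inter> cball x r))"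
      by (rule card_mono[OF fin sub])
    also have "\<dots> \<le> card (\<Lambda> \<inter> ball 0 Rd) + card (range (lattice_point A) \<inter> cball x r)" by (rule card_Un_le)
    finally show ?thesis using N(2)[of x] finite_subset[OF sub fin] by linarith
  qed
  then show ?thesis by blast
qed

lemma finite_nodes_ball: "finite (\<Lambda> \<inter> cball x r)"
  using card_nodes_ball[of r] by blast

text \<open>Lattice points have a positive minimal distance, and there are finitely many pairs in
  the ball of radius \<open>Rd + 1\<close>. In a remaining pair one node is outside that ball while
  the other is in the core, so they are at distance at least 1.\<close>

lemma nodes_separated: "\<exists>\<delta>>0. \<forall>l\<in>\<Lambda>. \<forall>m\<in>\<Lambda>. l \<noteq> m \<longrightarrow> \<delta> \<le> dist l m"
proof -
  obtain c where c: "c > 0" "\<And>x. c * real (supnorm x) \<le> norm (lattice_point A x)"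
    using lattice_point_norm[OF A] by metis
  define S where "S = \<Lambda> \<inter> cball 0 (Rd + 1)"
  define Ds where "Ds = insert (min 1 c) ((\<lambda>(l,m). dist l m) ` {(l,m) \<in> S \<times> S. l \<noteq> m})"
  have "finite {(l,m) \<in> S \<times> S. l \<noteq> m}"
    by (rule finite_subset[of _ "S \<times> S"]) (auto simp: S_def finite_nodes_ball)
  then have fin: "finite Ds" by (simp add: Ds_def)
  have pos: "Min Ds > 0" using fin c(1) by (auto simp: Ds_def Min_gr_iff)
  have le: "Min Ds \<le> 1" "Min Ds \<le> c" using fin Min_le[OF fin, of "min 1 c"] by (auto simp: Ds_def)
  have "Min Ds \<le> dist l m" if lm: "l \<in> \<Lambda>" "m \<in> \<Lambda>" "l \<noteq> m" for l m
  proof (cases "l \<in> S \<and> m \<in> S")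
    case True
    then have "(l,m) \<in> {(l,m) \<in> S \<times> S. l \<noteq> m}" using lm(3) by simp
    then have "dist l m \<in> Ds" unfolding Ds_def by (intro insertI2 image_eqI[of _ _ "(l,m)"]) auto
    then show ?thesis by (rule Min_le[OF fin])
  next
    case False
    then have big: "norm l > Rd + 1 \<or> norm m > Rd + 1" using lm by (auto simp: S_def not_le)
    show ?thesis
    proof (cases "norm l \<ge> Rd \<and> norm m \<ge> Rd")
      case True
      then obtain x y where xy: "l = lattice_point A x" "m = lattice_point A y" using outside lm by blast
      then have "supnorm (x - y) \<ge> 1" using lm(3) supnorm_eq_0[of "x - y"] by (cases "supnorm (x - y)") auto
      then have "c * 1 \<le> c * real (supnorm (x - y))" using c(1) by (intro mult_left_mono) auto
      then show ?thesis using c(2)[of "x - y"] le xy by (simp add: lattice_point_diff dist_norm)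
    next
      case False
      then have "1 \<le> dist l m" using big norm_triangle_ineq3[of l m] by (auto simp: dist_norm abs_le_iff)
      then show ?thesis using le by linarith
    qed
  qed
  then show ?thesis using pos by blast
qed

text \<open>Away from the core, rounding the coordinates finds a lattice point nearby that is a
  node. A point near or in the core uses a node close to an auxiliary point of norm
  \<open>Rd + K\<close>, at the price of a larger constant.\<close>

lemma nodes_dense: "\<exists>K>0. \<forall>x. \<exists>l\<in>\<Lambda>. dist l x \<le> K"
proof -
  obtain B where B: "A ** B = mat 1" using A unfolding invertible_def by blast
  obtain a where a: "a > 0" "\<And>x. norm (A *v x) \<le> norm x * a"
    using bounded_linear.pos_bounded[OF matrix_vector_mul_bounded_linear[of A]] by blast
  define K where "K = CARD('n) * a"
  have K: "K > 0" using a(1) by (simp add: K_def)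
  have near: "\<exists>l\<in>range (lattice_point A). dist l x \<le> K" for x
  proof -
    define y where "y = B *v x"
    have x: "x = A *v y" using B by (simp add: y_def matrix_vector_mul_assoc)
    let ?z = "(\<chi> i. \<lfloor>y $ i\<rfloor>) :: int^'n"
    let ?v = "(\<chi> i. real_of_int (?z $ i)) :: real^'n"
    have "norm (?v - y) \<le> (\<Sum>i\<in>UNIV. \<bar>(?v - y) $ i\<bar>)" by (rule norm_le_l1_cart)
    also have "\<dots> \<le> (\<Sum>i\<in>(UNIV::'n set). 1)" by (intro sum_mono) (simp, linarith)
    finally have "norm (?v - y) \<le> CARD('n)" by simp
    moreover have "dist (lattice_point A ?z) x = norm (A *v (?v - y))"
      by (simp only: dist_norm lattice_point_def x matrix_vector_mult_diff_distrib)
    ultimately have "dist (lattice_point A ?z) x \<le> K"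
      using a(2)[of "?v - y"] a(1) mult_right_mono[of "norm (?v - y)" "CARD('n)" a] unfolding K_def by linarith
    then show ?thesis by blast
  qed
  define K' where "K' = 2 * (Rd + K) + K"
  have "\<exists>l\<in>\<Lambda>. dist l x \<le> K'" for x
  proof (cases "norm x \<ge> Rd + K")
    case True
    obtain l where l: "l \<in> range (lattice_point A)" "dist l x \<le> K" using near by blast
    then have "norm l \<ge> Rd" using True norm_triangle_ineq3[of l x] by (auto simp: dist_norm abs_le_iff)
    then have "l \<in> \<Lambda>" using outside l(1) by blast
    moreover have "dist l x \<le> K'" using l(2) Rd K by (simp add: K'_def)
    ultimately show ?thesis by blast
  next
    case False
    obtain e :: "real^'n" where e: "norm e = Rd + K" using vector_choose_size[of "Rd + K"] Rd K by auto
    obtain l where l: "l \<in> range (lattice_point A)" "dist l e \<le> K" using near by blast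
    then have "norm l \<ge> Rd" using e norm_triangle_ineq3[of l e] by (auto simp: dist_norm abs_le_iff)
    then have "l \<in> \<Lambda>" using outside l(1) by blast
    moreover have "dist l x \<le> dist l e + dist e x" by (rule dist_triangle)
    moreover have "dist e x \<le> norm e + norm x" by (simp add: dist_norm norm_triangle_ineq4)
    ultimately show ?thesis using l(2) e False by (intro bexI[of _ l]) (auto simp: K'_def)
  qed
  moreover have "K' > 0" using Rd K by (simp add: K'_def)
  ultimately show ?thesis by blast
qed

end

section \<open>Simplices, quasi-uniformity and the interpolant\<close>

abbreviation vertices :: "'a::real_vector set \<Rightarrow> 'a set" where
  "vertices T \<equiv> {x. x extreme_point_of T}"

lemma affine_interpolation:
  fixes u :: "'a::euclidean_space \<Rightarrow> 'b::real_vector"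
  assumes "\<not> affine_dependent C"
  shows "\<exists>c L. linear L \<and> (\<forall>x\<in>C. c + L x = u x)"
proof (cases "C = {}")
  case True then show ?thesis by (intro exI[of _ 0] exI[of _ "\<lambda>_. 0"]) (simp add: linear_zero)
next
  case False
  then obtain a where a: "a \<in> C" by auto
  have "independent ((\<lambda>x. - a + x) ` (C - {a}))" using assms affine_dependent_iff_dependent2[OF a] by blast
  from linear_independent_extend[OF this, of "\<lambda>y. u (a + y) - u a"] obtain L where
    L: "linear L" "\<And>x. x \<in> C - {a} \<Longrightarrow> L (- a + x) = u (a + (- a + x)) - u a" by auto
  have "u a - L a + L x = u x" if "x \<in> C" for x
  proof (cases "x = a")
    case False
    then have "L (- a + x) = u x - u a" using L(2)[of x] that by simp
    then show ?thesis using linear_diff[OF L(1), of x a] by (simp add: algebra_simps)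
  qed simp
  then show ?thesis using L(1) by blast
qed

lemma convex_affine_preimage:
  assumes "linear L" "convex S" shows "convex {x. c + L x \<in> S}"
proof (rule convexI)
  fix x y and s t :: real assume *: "x \<in> {x. c + L x \<in> S}" "y \<in> {x. c + L x \<in> S}" "0 \<le> s" "0 \<le> t" "s + t = 1"
  have "c + L (s *\<^sub>R x + t *\<^sub>R y) = (s + t) *\<^sub>R c + (s *\<^sub>R L x + t *\<^sub>R L y)"
    using *(5) by (simp add: linear_add[OF assms(1)] linear_scale[OF assms(1)])
  also have "\<dots> = s *\<^sub>R (c + L x) + t *\<^sub>R (c + L y)" by (simp add: algebra_simps)
  also have "\<dots> \<in> S" using * assms(2) by (auto intro: convexD)
  finally show "s *\<^sub>R x + t *\<^sub>R y \<in> {x. c + L x \<in> S}" by simp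
qed

lemma affine_eq_on_hull:
  fixes L L' :: "'a::real_vector \<Rightarrow> 'b::real_vector"
  assumes "linear L" "linear L'" "\<And>x. x \<in> S \<Longrightarrow> c + L x = c' + L' x" "x \<in> convex hull S"
  shows "c + L x = c' + L' x"
proof -
  have "linear (\<lambda>x. L x - L' x)" by (rule linear_compose_sub[OF assms(1,2)])
  from convex_affine_preimage[OF this convex_singleton, of "c - c'" 0]
  have "convex {x. (c - c') + (L x - L' x) \<in> {0}}" .
  moreover have "S \<subseteq> {x. (c - c') + (L x - L' x) \<in> {0}}" using assms(3) by (force simp: algebra_simps)
  ultimately have "convex hull S \<subseteq> {x. (c - c') + (L x - L' x) \<in> {0}}" by (rule hull_minimal[rotated])
  then have "(c - c') + (L x - L' x) = 0" using assms(4) by blast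
  then show ?thesis by (simp add: algebra_simps)
qed

text \<open>Used twice: for the triangulation with the defect and, with the whole Bravais lattice as
  node set, for the homogeneous one in which stability is stated.\<close>

locale node_triangulation = defect_nodes A \<Lambda> Rd for A :: "real^'n^'n" and \<Lambda> and Rd +
  fixes \<T> :: "(real^'n) set set"
  assumes reg: "regular_triangulation \<T>" and nodes: "nodes \<T> = \<Lambda>"
begin

lemma element:
  assumes "T \<in> \<T>"
  shows "\<not> affine_dependent (vertices T)" "card (vertices T) = CARD('n) + 1" "finite (vertices T)"
    "T = convex hull (vertices T)" "compact T" "convex T" "vertices T \<subseteq> \<Lambda>" "vertices T \<subseteq> T"
proof -
  have "int CARD('n) simplex T" using reg assms unfolding regular_triangulation_def by blast
  then obtain C where C: "\<not> affine_dependent C" "int (card C) = int CARD('n) + 1" "T = convex hull C"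
    unfolding simplex_def by blast
  have v: "vertices T = C" using extreme_point_of_convex_hull_affine_independent[OF C(1)] C(3) by auto
  show "\<not> affine_dependent (vertices T)" "card (vertices T) = CARD('n) + 1" "T = convex hull (vertices T)"
    using C v by auto
  show "finite (vertices T)" using aff_independent_finite C(1) v by simp
  then show "compact T" using C(3) v by (metis finite_imp_compact_convex_hull)
  show "convex T" using C(3) by simp
  show "vertices T \<subseteq> \<Lambda>" using nodes assms unfolding nodes_def by blast
  show "vertices T \<subseteq> T" by (auto simp: extreme_point_of_def)
qed

lemma cover: "\<exists>T\<in>\<T>. x \<in> T"
  using reg unfolding regular_triangulation_def by blast

lemma faces: "T \<in> \<T> \<Longrightarrow> T' \<in> \<T> \<Longrightarrow> (T \<inter> T') face_of T"
  using reg unfolding regular_triangulation_def by blast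

lemma inscribed: "\<exists>\<sigma>>0. \<forall>T\<in>\<T>. \<exists>x r. r > 0 \<and> ball x r \<subseteq> T \<and> diameter T \<le> \<sigma> * r"
proof -
  obtain \<sigma> where s: "\<And>T. T \<in> \<T> \<Longrightarrow> \<exists>x r. r > 0 \<and> ball x r \<subseteq> T \<and> diameter T \<le> \<sigma> * r"
    using reg unfolding regular_triangulation_def by blast
  have "\<exists>x r. r > 0 \<and> ball x r \<subseteq> T \<and> diameter T \<le> (\<bar>\<sigma>\<bar> + 1) * r" if T: "T \<in> \<T>" for T
  proof -
    obtain x r where xr: "r > 0" "ball x r \<subseteq> T" "diameter T \<le> \<sigma> * r" using s[OF T] by blast
    have "\<sigma> * r \<le> (\<bar>\<sigma>\<bar> + 1) * r" using xr(1) by (intro mult_right_mono) auto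
    then show ?thesis using xr by (meson order_trans)
  qed
  then show ?thesis by (intro exI[of _ "\<bar>\<sigma>\<bar> + 1"]) auto
qed

lemma dist_le_diameter: "T \<in> \<T> \<Longrightarrow> x \<in> T \<Longrightarrow> y \<in> T \<Longrightarrow> dist x y \<le> diameter T"
  by (rule diameter_bounded_bound) (auto simp: element(5) compact_imp_bounded)

text \<open>A node is a vertex of some \<open>T'\<close>. If it were interior to \<open>T\<close>,
  the face \<open>T \<inter> T'\<close> of \<open>T\<close> would meet the interior of
  \<open>T\<close> and hence be all of \<open>T\<close>; then the vertex would lie in the interior
  of \<open>T'\<close>.\<close>

lemma no_node_in_interior:
  assumes "T \<in> \<T>" "l \<in> \<Lambda>" shows "l \<notin> interior T"
proof
  assume l: "l \<in> interior T"
  obtain T' where T': "T' \<in> \<T>" "l extreme_point_of T'" using assms(2) nodes unfolding nodes_def by blast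
  then have "l \<in> T'" by (simp add: extreme_point_of_def)
  then have "l \<in> (T \<inter> T') \<inter> interior T" using l interior_subset by auto
  then have "T \<inter> T' = T" using face_of_disjoint_interior[OF faces[OF assms(1) T'(1)]] by blast
  then have "interior T \<subseteq> interior T'" by (intro interior_mono) blast
  then show False using extreme_point_not_in_interior[OF T'(2)] l by blast
qed

text \<open>An inscribed ball contains no node, whereas nodes are dense at a fixed scale, so its
  radius is bounded; shape regularity passes the bound on to the diameter.\<close>

lemma diameter_bound: "\<exists>D>0. \<forall>T\<in>\<T>. diameter T \<le> D"
proof -
  obtain \<sigma> where s: "\<sigma> > 0" "\<And>T. T \<in> \<T> \<Longrightarrow> \<exists>x r. r > 0 \<and> ball x r \<subseteq> T \<and> diameter T \<le> \<sigma> * r"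
    using inscribed by blast
  obtain K where K: "K > 0" "\<And>x. \<exists>l\<in>\<Lambda>. dist l x \<le> K" using nodes_dense by blast
  have "diameter T \<le> \<sigma> * K" if T: "T \<in> \<T>" for T
  proof -
    obtain x r where xr: "r > 0" "ball x r \<subseteq> T" "diameter T \<le> \<sigma> * r" using s(2)[OF T] by blast
    have "r \<le> K"
    proof (rule ccontr)
      assume "\<not> r \<le> K"
      obtain l where l: "l \<in> \<Lambda>" "dist l x \<le> K" using K(2) by blast
      then have "l \<in> ball x r" using \<open>\<not> r \<le> K\<close> by (simp add: dist_commute)
      then have "l \<in> interior T" using xr(2) interior_maximal[OF xr(2)] by auto
      then show False using no_node_in_interior[OF T l(1)] by blast
    qed
    then have "\<sigma> * r \<le> \<sigma> * K" using s(1) by (intro mult_left_mono) auto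
    then show ?thesis using xr(3) by linarith
  qed
  then show ?thesis using s(1) K(1) by (intro exI[of _ "\<sigma> * K"]) auto
qed

text \<open>The converse direction: two vertices of an element are separated by a fixed distance, so
  its diameter, and by shape regularity its inscribed ball, cannot be small.\<close>

lemma inscribed_uniform: "\<exists>r>0. \<forall>T\<in>\<T>. \<exists>x. ball x r \<subseteq> T"
proof -
  obtain \<sigma> where s: "\<sigma> > 0" "\<And>T. T \<in> \<T> \<Longrightarrow> \<exists>x r. r > 0 \<and> ball x r \<subseteq> T \<and> diameter T \<le> \<sigma> * r"
    using inscribed by blast
  obtain \<delta> where d: "\<delta> > 0" "\<And>l m. l \<in> \<Lambda> \<Longrightarrow> m \<in> \<Lambda> \<Longrightarrow> l \<noteq> m \<Longrightarrow> \<delta> \<le> dist l m" using nodes_separated by blast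
  have "\<exists>x. ball x (\<delta> / \<sigma>) \<subseteq> T" if T: "T \<in> \<T>" for T
  proof -
    obtain x r where xr: "r > 0" "ball x r \<subseteq> T" "diameter T \<le> \<sigma> * r" using s(2)[OF T] by blast
    have "card (vertices T) \<ge> 2" using element(2)[OF T] by (simp add: Suc_le_eq)
    then obtain l m where lm: "l \<in> vertices T" "m \<in> vertices T" "l \<noteq> m"
    proof -
      obtain S where "S \<subseteq> vertices T" "card S = 2" by (rule obtain_subset_with_card_n[OF \<open>card (vertices T) \<ge> 2\<close>])
      then show ?thesis using that by (auto simp: card_2_iff)
    qed
    have "\<delta> \<le> dist l m" using lm element(7)[OF T] by (intro d(2)) auto
    also have "\<dots> \<le> diameter T" using lm element(8)[OF T] by (intro dist_le_diameter[OF T]) auto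
    finally have "\<delta> / \<sigma> \<le> r" using xr(3) s(1) by (simp add: field_simps)
    then show ?thesis using xr(2) by (meson order_trans subset_ball)
  qed
  then show ?thesis using d(1) s(1) by (intro exI[of _ "\<delta> / \<sigma>"]) auto
qed

text \<open>An element is the hull of its vertices, and elements near \<open>x\<close> have their
  vertices in a ball that contains finitely many nodes.\<close>

lemma locally_finite: "finite {T \<in> \<T>. T \<inter> cball x R \<noteq> {}}"
proof -
  obtain D where D: "D > 0" "\<And>T. T \<in> \<T> \<Longrightarrow> diameter T \<le> D" using diameter_bound by blast
  have vP: "vertices T \<in> Pow (\<Lambda> \<inter> cball x (R + D))" if T: "T \<in> \<T>" "T \<inter> cball x R \<noteq> {}" for T
  proof -
    obtain y where y: "y \<in> T" "dist x y \<le> R" using T(2) by auto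
    have "dist x l \<le> R + D" if "l \<in> vertices T" for l
    proof -
      have "dist y l \<le> D" using dist_le_diameter[OF T(1) y(1)] that element(8)[OF T(1)] D(2)[OF T(1)] by force
      then show ?thesis using y(2) dist_triangle[of x l y] by linarith
    qed
    then show ?thesis using element(7)[OF T(1)] by auto
  qed
  have "vertices ` {T \<in> \<T>. T \<inter> cball x R \<noteq> {}} \<subseteq> Pow (\<Lambda> \<inter> cball x (R + D))"
  proof (rule image_subsetI)
    fix T assume "T \<in> {T \<in> \<T>. T \<inter> cball x R \<noteq> {}}"
    then have "T \<in> \<T>" "T \<inter> cball x R \<noteq> {}" by simp_all
    then show "vertices T \<in> Pow (\<Lambda> \<inter> cball x (R + D))" by (rule vP)
  qed
  then have fin: "finite (vertices ` {T \<in> \<T>. T \<inter> cball x R \<noteq> {}})"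
    by (rule finite_subset) (simp only: finite_Pow_iff finite_nodes_ball)
  have inj: "inj_on vertices \<T>"
  proof (rule inj_onI)
    fix T T' assume T: "T \<in> \<T>" "T' \<in> \<T>" "vertices T = vertices T'"
    have "T = convex hull (vertices T)" by (rule element(4)[OF T(1)])
    also have "\<dots> = convex hull (vertices T')" by (simp only: T(3))
    also have "\<dots> = T'" by (rule element(4)[OF T(2), symmetric])
    finally show "T = T'" .
  qed
  show ?thesis by (rule finite_imageD[OF fin]) (rule inj_on_subset[OF inj], blast)
qed

lemma countable_elements: "countable \<T>"
proof -
  have "\<T> \<subseteq> (\<Union>n. {T \<in> \<T>. T \<inter> cball 0 (real n) \<noteq> {}})"
  proof
    fix T assume T: "T \<in> \<T>"
    have "vertices T \<noteq> {}" using element(2)[OF T] by (metis Suc_eq_plus1 card.empty nat.distinct(1))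
    then obtain y where y: "y \<in> T" using element(8)[OF T] by auto
    obtain n where "norm y \<le> real n" using real_arch_simple by blast
    then have "y \<in> T \<inter> cball 0 (real n)" using y by simp
    then show "T \<in> (\<Union>n. {T \<in> \<T>. T \<inter> cball 0 (real n) \<noteq> {}})" using T by blast
  qed
  then show ?thesis using locally_finite by (meson countable_UN countable_finite countable_subset countableI_type)
qed

lemma interpolant_unique:
  assumes "\<And>T. T \<in> \<T> \<Longrightarrow> \<exists>c L. linear L \<and> (\<forall>x\<in>T. w x = c + L x)" "\<And>l. l \<in> \<Lambda> \<Longrightarrow> w l = (u l :: real^'n)"
    and "\<And>T. T \<in> \<T> \<Longrightarrow> \<exists>c L. linear L \<and> (\<forall>x\<in>T. w' x = c + L x)" "\<And>l. l \<in> \<Lambda> \<Longrightarrow> w' l = u l"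
  shows "w = w'"
proof
  fix x
  obtain T where T: "T \<in> \<T>" "x \<in> T" using cover by blast
  obtain c L where L: "linear L" "\<And>x. x \<in> T \<Longrightarrow> w x = c + L x" using assms(1)[OF T(1)] by blast
  obtain c' L' where L': "linear L'" "\<And>x. x \<in> T \<Longrightarrow> w' x = c' + L' x" using assms(3)[OF T(1)] by blast
  have "c + L x = c' + L' x"
  proof (rule affine_eq_on_hull[OF L(1) L'(1), of "vertices T"])
    fix y assume "y \<in> vertices T"
    then have "y \<in> T" "y \<in> \<Lambda>" using element(7,8)[OF T(1)] by blast+
    then show "c + L y = c' + L' y"
      using L(2)[of y] L'(2)[of y] assms(2,4)[of y] by simp
  qed (use T element(4) in auto)
  then show "w x = w' x" using L L' T by simp
qed

text \<open>The affine interpolants of two elements agree on the intersection: it is a common face,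
  hence the hull of its own extreme points, and these are vertices of both elements. Local
  finiteness makes the glued function continuous.\<close>

lemma interpolant_exists:
  fixes u :: "real^'n \<Rightarrow> real^'n"
  shows "\<exists>w. continuous_on UNIV w \<and> (\<forall>T\<in>\<T>. \<exists>c L. linear L \<and> (\<forall>x\<in>T. w x = c + L x)) \<and> (\<forall>l\<in>\<Lambda>. w l = u l)"
proof -
  have "\<forall>T\<in>\<T>. \<exists>c L. linear L \<and> (\<forall>x\<in>vertices T. c + L x = u x)"
    using affine_interpolation[OF element(1)] by blast
  then obtain c L where cL: "\<And>T. T \<in> \<T> \<Longrightarrow> linear (L T)" "\<And>T x. T \<in> \<T> \<Longrightarrow> x \<in> vertices T \<Longrightarrow> c T + L T x = u x"
    unfolding bchoice_iff by metis
  have agree: "c T + L T x = c T' + L T' x" if T: "T \<in> \<T>" "T' \<in> \<T>" "x \<in> T" "x \<in> T'" for T T' x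
  proof -
    let ?F = "T \<inter> T'"
    have F: "?F face_of T" "?F face_of T'" using faces[OF T(1,2)] faces[OF T(2,1)] by (auto simp: Int_commute)
    have hull: "?F = convex hull (vertices ?F)"
      by (rule Krein_Milman_Minkowski) (auto intro: compact_Int convex_Int element T)
    show ?thesis
    proof (rule affine_eq_on_hull[OF cL(1) cL(1), of _ _ "vertices ?F"])
      fix y assume "y \<in> vertices ?F"
      then have "y \<in> vertices T" "y \<in> vertices T'" using extreme_point_of_face F by blast+
      then show "c T + L T y = c T' + L T' y" using cL(2) T by simp
    qed (use T hull in auto)
  qed
  define w where "w = (\<lambda>x. let T = (SOME T. T \<in> \<T> \<and> x \<in> T) in c T + L T x)"
  have w: "w x = c T + L T x" if "T \<in> \<T>" "x \<in> T" for T x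
  proof -
    have "\<exists>T. T \<in> \<T> \<and> x \<in> T" using that by blast
    from someI_ex[OF this] show ?thesis unfolding w_def Let_def using agree that by blast
  qed
  have cont: "isCont w x" for x
  proof -
    let ?S = "{T \<in> \<T>. T \<inter> cball x 1 \<noteq> {}}"
    have "continuous_on (\<Union>S') w" if "finite S'" "S' \<subseteq> \<T>" for S'
      using that
    proof (induction S' rule: finite_induct)
      case (insert T S')
      have "continuous_on T (\<lambda>y. c T + L T y)"
        using linear_continuous_on[of "L T" T] cL(1)[of T] insert.prems
        by (auto intro!: continuous_intros simp: linear_conv_bounded_linear)
      then have cT: "continuous_on T w" using w insert.prems by (subst continuous_on_cong[OF refl]) auto
      have "closed T" "closed (\<Union>S')"
        using insert element(5) by (auto intro!: closed_Union compact_imp_closed)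
      from continuous_on_closed_Un[OF this cT] insert show ?case by auto
    qed simp
    from this[OF locally_finite] have "continuous_on (\<Union>?S) w" by blast
    moreover have "ball x 1 \<subseteq> \<Union>?S"
    proof
      fix y assume y: "y \<in> ball x 1"
      obtain T where "T \<in> \<T>" "y \<in> T" using cover by blast
      then show "y \<in> \<Union>?S" using y by (auto intro!: exI[of _ T])
    qed
    ultimately have "continuous_on (ball x 1) w" by (rule continuous_on_subset)
    then show ?thesis using continuous_on_eq_continuous_at[OF open_ball] centre_in_ball zero_less_one by blast
  qed
  have "w l = u l" if "l \<in> \<Lambda>" for l
  proof -
    obtain T where T: "T \<in> \<T>" "l \<in> vertices T" using \<open>l \<in> \<Lambda>\<close> nodes unfolding nodes_def by blast
    then have "l \<in> T" using element(8) by blast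
    then show ?thesis using w[OF T(1)] cL(2)[OF T] by simp
  qed
  moreover have "\<exists>c L. linear L \<and> (\<forall>x\<in>T. w x = c + L x)" if "T \<in> \<T>" for T using w cL(1) that by blast
  moreover have "continuous_on UNIV w" by (rule continuous_at_imp_continuous_on) (simp add: cont)
  ultimately show ?thesis by (intro exI[of _ w] conjI ballI) auto
qed

lemma p1_interpolant:
  fixes u :: "real^'n \<Rightarrow> real^'n"
  shows "continuous_on UNIV (p1_interpolant \<T> u)"
    and "T \<in> \<T> \<Longrightarrow> \<exists>c L. linear L \<and> (\<forall>x\<in>T. p1_interpolant \<T> u x = c + L x)"
    and "l \<in> \<Lambda> \<Longrightarrow> p1_interpolant \<T> u l = u l"
proof -
  have "\<exists>!w. continuous_on UNIV w \<and> (\<forall>T\<in>\<T>. \<exists>c L. linear L \<and> (\<forall>x\<in>T. w x = c + L x)) \<and> (\<forall>l\<in>nodes \<T>. w l = u l)"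
    unfolding nodes
  proof (rule ex_ex1I[OF interpolant_exists])
    fix w w' :: "real^'n \<Rightarrow> real^'n"
    assume "continuous_on UNIV w \<and> (\<forall>T\<in>\<T>. \<exists>c L. linear L \<and> (\<forall>x\<in>T. w x = c + L x)) \<and> (\<forall>l\<in>\<Lambda>. w l = u l)"
      "continuous_on UNIV w' \<and> (\<forall>T\<in>\<T>. \<exists>c L. linear L \<and> (\<forall>x\<in>T. w' x = c + L x)) \<and> (\<forall>l\<in>\<Lambda>. w' l = u l)"
    then show "w = w'" by (intro interpolant_unique[of w u w']) auto
  qed
  from theI'[OF this] have *: "continuous_on UNIV (p1_interpolant \<T> u) \<and> (\<forall>T\<in>\<T>. \<exists>c L. linear L \<and> (\<forall>x\<in>T. p1_interpolant \<T> u x = c + L x)) \<and> (\<forall>l\<in>nodes \<T>. p1_interpolant \<T> u l = u l)"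
    unfolding p1_interpolant_def .
  show "continuous_on UNIV (p1_interpolant \<T> u)" using * by blast
  show "T \<in> \<T> \<Longrightarrow> \<exists>c L. linear L \<and> (\<forall>x\<in>T. p1_interpolant \<T> u x = c + L x)" using * by blast
  show "l \<in> \<Lambda> \<Longrightarrow> p1_interpolant \<T> u l = u l" using * nodes by blast
qed

definition piece :: "(real^'n \<Rightarrow> real^'n) \<Rightarrow> (real^'n) set \<Rightarrow> real^'n^'n" where
  "piece u T = (SOME B. \<exists>c. \<forall>x\<in>T. p1_interpolant \<T> u x = c + B *v x)"

lemma piece: "T \<in> \<T> \<Longrightarrow> \<exists>c. \<forall>x\<in>T. p1_interpolant \<T> u x = c + piece u T *v x"
proof -
  assume "T \<in> \<T>"
  then obtain c L where "linear L" "\<forall>x\<in>T. p1_interpolant \<T> u x = c + L x" using p1_interpolant(2) by blast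
  then have "\<forall>x\<in>T. p1_interpolant \<T> u x = c + matrix L *v x" by simp
  then have "\<exists>B c. \<forall>x\<in>T. p1_interpolant \<T> u x = c + B *v x" by blast
  from someI_ex[OF this] show ?thesis unfolding piece_def .
qed

lemma piece_diff:
  assumes "T \<in> \<T>" "x \<in> T" "y \<in> T"
  shows "p1_interpolant \<T> u x - p1_interpolant \<T> u y = piece u T *v (x - y)"
proof -
  obtain c where "\<forall>x\<in>T. p1_interpolant \<T> u x = c + piece u T *v x" using piece[OF assms(1)] by blast
  then show ?thesis using assms(2,3) by (simp add: matrix_vector_mult_diff_distrib)
qed

lemma p1_grad_interior:
  assumes T: "T \<in> \<T>" "x \<in> interior T"
  shows "p1_grad \<T> u x = piece u T"
proof -
  obtain c where c: "\<And>x. x \<in> T \<Longrightarrow> p1_interpolant \<T> u x = c + piece u T *v x" using piece[OF T(1)] by blast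
  have "((\<lambda>y. c + piece u T *v y) has_derivative (\<lambda>y. piece u T *v y)) (at x)"
    by (auto intro!: derivative_eq_intros bounded_linear_imp_has_derivative)
  then have D: "(p1_interpolant \<T> u has_derivative (\<lambda>y. piece u T *v y)) (at x)"
    by (rule has_derivative_transform_within_open[OF _ open_interior T(2)]) (use c interior_subset in force)
  then have "frechet_derivative (p1_interpolant \<T> u) (at x) = (\<lambda>y. piece u T *v y)"
    by (rule frechet_derivative_at[symmetric])
  moreover have "p1_interpolant \<T> u differentiable (at x)" using D unfolding differentiable_def by blast
  ultimately show ?thesis by (simp add: p1_grad_def)
qed

lemma interiors_cover: "AE x in lebesgue. \<exists>T\<in>\<T>. x \<in> interior T"
proof -
  have "negligible (\<Union>T\<in>\<T>. frontier T)"
    by (rule negligible_countable_Union) (auto simp: countable_elements element(6) negligible_convex_frontier)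
  then have "(\<Union>T\<in>\<T>. frontier T) \<in> null_sets lebesgue" by (simp add: negligible_iff_null_sets)
  then show ?thesis
  proof (rule AE_I')
    show "{x \<in> space lebesgue. \<not> (\<exists>T\<in>\<T>. x \<in> interior T)} \<subseteq> (\<Union>T\<in>\<T>. frontier T)"
    proof
      fix x assume "x \<in> {x \<in> space lebesgue. \<not> (\<exists>T\<in>\<T>. x \<in> interior T)}"
      then have no: "\<forall>T\<in>\<T>. x \<notin> interior T" by simp
      obtain T where T: "T \<in> \<T>" "x \<in> T" using cover by blast
      then have "x \<in> frontier T" using no closure_subset[of T] by (auto simp: frontier_def)
      then show "x \<in> (\<Union>T\<in>\<T>. frontier T)" using T(1) by blast
    qed
  qed
qed

text \<open>The gradient is constant on each of countably many open interiors. The rest is a null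
  set, on which every function is measurable because Lebesgue measure is complete.\<close>

lemma p1_grad_measurable: "p1_grad \<T> u \<in> borel_measurable lebesgue"
proof -
  let ?N = "UNIV - (\<Union>T\<in>\<T>. interior T)"
  have "?N \<in> null_sets lebesgue"
    using interiors_cover unfolding eventually_ae_filter
  proof (elim bexE)
    fix N assume "N \<in> null_sets lebesgue" "{x \<in> space lebesgue. \<not> (\<exists>T\<in>\<T>. x \<in> interior T)} \<subseteq> N"
    then have "negligible N" "?N \<subseteq> N" by (auto simp: negligible_iff_null_sets)
    then have "negligible ?N" by (rule negligible_subset)
    then show ?thesis by (simp add: negligible_iff_null_sets)
  qed
  then have neg: "negligible ?N" by (simp add: negligible_iff_null_sets)
  have nsets: "S \<in> sets lebesgue" if "S \<subseteq> ?N" for S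
    using negligible_subset[OF neg that] by (simp add: negligible_iff_null_sets null_setsD2)
  show ?thesis
  proof (rule measurable_piecewise_restrict[where C = "insert ?N (interior ` \<T>)"])
    show "countable (insert ?N (interior ` \<T>))" using countable_elements by simp
    show "space lebesgue \<subseteq> \<Union>(insert ?N (interior ` \<T>))" by auto
    show "\<Omega> \<inter> space lebesgue \<in> sets lebesgue" if "\<Omega> \<in> insert ?N (interior ` \<T>)" for \<Omega>
      using that nsets[of ?N] by auto
    show "p1_grad \<T> u \<in> borel_measurable (restrict_space lebesgue \<Omega>)" if \<Omega>: "\<Omega> \<in> insert ?N (interior ` \<T>)" for \<Omega>
    proof (cases "\<Omega> = ?N")
      case True
      show ?thesis
      proof (rule measurableI)
        fix S :: "(real^'n^'n) set"
        have "p1_grad \<T> u -` S \<inter> ?N \<in> sets lebesgue" by (rule nsets) blast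
        then have "p1_grad \<T> u -` S \<inter> ?N \<in> sets (restrict_space lebesgue ?N)"
          using nsets[of ?N] by (subst sets_restrict_space_iff) auto
        then show "p1_grad \<T> u -` S \<inter> space (restrict_space lebesgue \<Omega>) \<in> sets (restrict_space lebesgue \<Omega>)"
          unfolding True by (simp add: space_restrict_space)
      qed simp
    next
      case False
      then obtain T where T: "T \<in> \<T>" "\<Omega> = interior T" using \<Omega> by blast
      have "(\<lambda>_. piece u T) \<in> borel_measurable (restrict_space lebesgue \<Omega>)" by simp
      then show ?thesis
        by (rule measurable_cong[THEN iffD2, rotated]) (simp add: space_restrict_space p1_grad_interior[OF T(1)] T(2))
    qed
  qed
qed

lemma W_12_iff: "u \<in> W_12 \<T> \<longleftrightarrow> integrable lebesgue (\<lambda>x. (norm (p1_grad \<T> u x))\<^sup>2)"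
  unfolding W_12_def using p1_grad_measurable by simp

lemma W_seminorm_sq: "(W_seminorm \<T> u)\<^sup>2 = (LINT x|lebesgue. (norm (p1_grad \<T> u x))\<^sup>2)"
  unfolding W_seminorm_def by (rule real_sqrt_pow2) (simp add: integral_nonneg)

end

section \<open>Equivalence of the gradient seminorm with finite differences\<close>

lemma norm_matrix_vector_le: "norm (B *v x) \<le> norm B * norm (x :: real^'n)" for B :: "real^'n^'m"
proof -
  have "norm (B *v x) = L2_set (\<lambda>i. norm ((B *v x) $ i)) UNIV" by (rule norm_vec_def)
  also have "\<dots> \<le> L2_set (\<lambda>i. norm (B $ i) * norm x) UNIV"
    by (rule L2_set_mono) (auto simp: matrix_vector_mul_component Cauchy_Schwarz_ineq2)
  also have "\<dots> = norm B * norm x" by (simp add: L2_set_left_distrib[symmetric] norm_vec_def)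
  finally show ?thesis .
qed

lemma norm_matrix_le_entries: "norm B \<le> (\<Sum>i\<in>UNIV. \<Sum>j\<in>UNIV. \<bar>B $ i $ j\<bar>)" for B :: "real^'n^'m"
proof -
  have "norm B \<le> (\<Sum>i\<in>UNIV. norm (B $ i))" unfolding norm_vec_def[of B] by (rule L2_set_le_sum) auto
  also have "\<dots> \<le> (\<Sum>i\<in>UNIV. \<Sum>j\<in>UNIV. \<bar>B $ i $ j\<bar>)" by (intro sum_mono norm_le_l1_cart)
  finally show ?thesis .
qed

context node_triangulation
begin

text \<open>A substitute for the seminorm that does not mention the mesh: all finite sums of squared
  differences over pairs of nodes at distance at most \<open>s\<close> are bounded by
  \<open>S\<close>. In this form norms pass between the triangulations and the integer
  lattice.\<close>

definition diff_bounded :: "real \<Rightarrow> (real^'n \<Rightarrow> real^'n) \<Rightarrow> real \<Rightarrow> bool" where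
  "diff_bounded s u S \<longleftrightarrow> (\<forall>F. finite F \<longrightarrow> F \<subseteq> {(l,m). l \<in> \<Lambda> \<and> m \<in> \<Lambda> \<and> dist l m \<le> s} \<longrightarrow>
     (\<Sum>(l,m)\<in>F. (norm (u l - u m))\<^sup>2) \<le> S)"

lemma element_subset_cball:
  assumes "T \<in> \<T>" "x \<in> T" "diameter T \<le> D" shows "T \<subseteq> cball x D"
  using dist_le_diameter[OF assms(1,2)] assms(3) by force

text \<open>
  Along a segment the interpolant is piecewise affine, so its increment is controlled by the
  largest gradient on the finitely many elements met, hence by a local integral.
\<close>

lemma edge_le_integral:
  "\<exists>C K. C \<ge> 0 \<and> (\<forall>u\<in>W_12 \<T>. \<forall>l\<in>\<Lambda>. \<forall>m\<in>\<Lambda>. dist l m \<le> s \<longrightarrow>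
     (norm (u l - u m))\<^sup>2 \<le> C * (LINT x|lebesgue. indicator (cball l K) x * (norm (p1_grad \<T> u x))\<^sup>2))"
proof -
  obtain D where D: "D > 0" "\<And>T. T \<in> \<T> \<Longrightarrow> diameter T \<le> D" using diameter_bound by blast
  obtain r where r: "r > 0" "\<And>T. T \<in> \<T> \<Longrightarrow> \<exists>x. ball x r \<subseteq> T" using inscribed_uniform by blast
  define \<mu> where "\<mu> = measure lebesgue (ball (0::real^'n) r)"
  have mu: "measure lebesgue (ball x r) = \<mu>" for x :: "real^'n"
    using r(1) by (simp add: \<mu>_def content_ball)
  have mu0: "\<mu> > 0" using content_ball_pos[OF r(1), of "0::real^'n"] by (simp add: \<mu>_def)
  have "(norm (u l - u m))\<^sup>2 \<le> s\<^sup>2 / \<mu> * (LINT x|lebesgue. indicator (cball l (s + D)) x * (norm (p1_grad \<T> u x))\<^sup>2)"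
    if u: "u \<in> W_12 \<T>" and l: "l \<in> \<Lambda>" and m: "m \<in> \<Lambda>" and lm: "dist l m \<le> s" for u l m
  proof -
    let ?w = "p1_interpolant \<T> u"
    let ?I = "LINT x|lebesgue. indicator (cball l (s + D)) x * (norm (p1_grad \<T> u x))\<^sup>2"
    have s0: "s \<ge> 0" using lm zero_le_dist[of l m] by linarith
    define S where "S = {T \<in> \<T>. T \<inter> cball l s \<noteq> {}}"
    have finS: "finite S" unfolding S_def by (rule locally_finite)
    define M where "M = Max (insert 0 ((\<lambda>T. norm (piece u T)) ` S))"
    have M0: "M \<ge> 0" unfolding M_def using finS by (intro Max_ge) auto
    have MT: "norm (piece u T) \<le> M" if "T \<in> S" for T unfolding M_def using finS that by (intro Max_ge) auto
    define \<gamma> where "\<gamma> = (\<lambda>t::real. l + t *\<^sub>R (m - l))"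
    have \<gamma>_diff: "\<gamma> t - \<gamma> t' = (t - t') *\<^sub>R (m - l)" for t t' by (simp add: \<gamma>_def algebra_simps)
    have "(M * dist l m)-lipschitz_on {0..1} (\<lambda>t. ?w (\<gamma> t))"
    proof (rule lipschitz_on_closed_Union[where I = S and U = "\<lambda>T. \<gamma> -` T"])
      show "finite S" by (rule finS)
      show "M * dist l m \<ge> 0" using M0 by simp
      fix T assume T: "T \<in> S"
      then have TT: "T \<in> \<T>" by (simp add: S_def)
      show "closed (\<gamma> -` T)"
        using element(5)[OF TT] unfolding \<gamma>_def by (intro continuous_closed_vimage compact_imp_closed continuous_intros)
      show "(M * dist l m)-lipschitz_on (\<gamma> -` T) (\<lambda>t. ?w (\<gamma> t))"
      proof (rule lipschitz_onI)
        fix t t' assume "t \<in> \<gamma> -` T" "t' \<in> \<gamma> -` T"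
        then have "dist (?w (\<gamma> t)) (?w (\<gamma> t')) = norm (piece u T *v (\<gamma> t - \<gamma> t'))"
          using piece_diff[OF TT, of "\<gamma> t" "\<gamma> t'" u] by (simp add: dist_norm)
        also have "\<dots> \<le> norm (piece u T) * norm (\<gamma> t - \<gamma> t')" by (rule norm_matrix_vector_le)
        also have "\<dots> \<le> M * norm (\<gamma> t - \<gamma> t')" using MT[OF T] by (intro mult_right_mono) auto
        also have "\<dots> = M * dist l m * dist t t'" by (simp add: \<gamma>_diff dist_norm norm_minus_commute)
        finally show "dist (?w (\<gamma> t)) (?w (\<gamma> t')) \<le> M * dist l m * dist t t'" .
      qed (use M0 in simp)
    next
      show "{0..1} \<subseteq> (\<Union>T\<in>S. \<gamma> -` T)"
      proof
        fix t :: real assume t: "t \<in> {0..1}"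
        obtain T where T: "T \<in> \<T>" "\<gamma> t \<in> T" using cover by blast
        have "dist l (\<gamma> t) = t * dist l m" using t by (simp add: \<gamma>_def dist_norm norm_minus_commute)
        also have "\<dots> \<le> 1 * dist l m" using t by (intro mult_right_mono) auto
        finally have "\<gamma> t \<in> cball l s" using lm by simp
        then have "T \<inter> cball l s \<noteq> {}" using T(2) by blast
        then show "t \<in> (\<Union>T\<in>S. \<gamma> -` T)" using T by (auto simp: S_def)
      qed
    qed
    then have "dist (?w (\<gamma> 0)) (?w (\<gamma> 1)) \<le> (M * dist l m) * dist (0::real) 1" by (rule lipschitz_onD) auto
    then have "norm (u l - u m) \<le> M * dist l m" using l m by (simp add: \<gamma>_def dist_norm p1_interpolant(3))
    also have "\<dots> \<le> M * s" using M0 lm by (intro mult_left_mono) auto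
    finally have "(norm (u l - u m))\<^sup>2 \<le> (M * s)\<^sup>2" by (intro power_mono) auto
    moreover have "M\<^sup>2 * \<mu> \<le> ?I"
    proof -
      have G: "integrable lebesgue (\<lambda>x. (norm (p1_grad \<T> u x))\<^sup>2)" using u W_12_iff by blast
      have Gi: "integrable lebesgue (\<lambda>x. indicator (cball l (s + D)) x * (norm (p1_grad \<T> u x))\<^sup>2)"
        using integrable_mult_indicator[OF _ G, of "cball l (s + D)"] by simp
      show ?thesis
      proof (cases "M = 0")
        case True
        then show ?thesis by (simp add: integral_nonneg)
      next
        case False
        have "M \<in> insert 0 ((\<lambda>T. norm (piece u T)) ` S)" unfolding M_def using finS by (intro Max_in) auto
        then obtain T where T: "T \<in> S" "M = norm (piece u T)" using False by auto
        then have TT: "T \<in> \<T>" by (simp add: S_def)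
        obtain y where y: "y \<in> T" "dist l y \<le> s" using T(1) by (auto simp: S_def)
        have "T \<subseteq> cball y D" by (rule element_subset_cball[OF TT y(1) D(2)[OF TT]])
        have Tsub: "T \<subseteq> cball l (s + D)"
        proof
          fix z assume "z \<in> T"
          then have "dist y z \<le> D" using \<open>T \<subseteq> cball y D\<close> by auto
          then show "z \<in> cball l (s + D)" using y(2) dist_triangle[of l z y] by simp
        qed
        \<comment> \<open>The element on which the maximal gradient \<open>M\<close> is attained
          contains a ball of fixed radius, where the norm of the gradient equals \<open>M\<close>;
          so the integral sees at least \<open>M^2\<close> times the volume of that ball.\<close>
        obtain x0 where x0: "ball x0 r \<subseteq> T" using r(2)[OF TT] by blast
        then have int: "ball x0 r \<subseteq> interior T" by (rule interior_maximal) simp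
        have "M\<^sup>2 * \<mu> = (LINT x|lebesgue. indicator (ball x0 r) x * M\<^sup>2)"
          using mu[of x0] by (simp add: mult.commute)
        also have "\<dots> \<le> ?I"
        proof (rule integral_mono[OF _ Gi])
          show "integrable lebesgue (\<lambda>x. indicator (ball x0 r) x * M\<^sup>2)"
            using emeasure_lborel_ball_finite[of x0 r]
            by (intro integrable_mult_left integrable_real_indicator) (auto simp: infinity_ennreal_def)
          fix x
          show "indicator (ball x0 r) x * M\<^sup>2 \<le> indicator (cball l (s + D)) x * (norm (p1_grad \<T> u x))\<^sup>2"
          proof (cases "x \<in> ball x0 r")
            case True
            then have "p1_grad \<T> u x = piece u T" using int p1_grad_interior[OF TT] by blast
            moreover have "x \<in> cball l (s + D)" using True x0 Tsub by blast
            ultimately show ?thesis using True T(2) by simp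
          qed simp
        qed
        finally show ?thesis .
      qed
    qed
    ultimately have "(norm (u l - u m))\<^sup>2 * \<mu> \<le> s\<^sup>2 * ?I"
    proof -
      assume a: "(norm (u l - u m))\<^sup>2 \<le> (M * s)\<^sup>2" and b: "M\<^sup>2 * \<mu> \<le> ?I"
      have "(norm (u l - u m))\<^sup>2 * \<mu> \<le> (M * s)\<^sup>2 * \<mu>" using a mu0 by (intro mult_right_mono) auto
      also have "\<dots> = s\<^sup>2 * (M\<^sup>2 * \<mu>)" by (simp add: power_mult_distrib)
      also have "\<dots> \<le> s\<^sup>2 * ?I" by (intro mult_left_mono b) auto
      finally show ?thesis .
    qed
    then show ?thesis using mu0 by (simp add: field_simps)
  qed
  then show ?thesis using mu0 by (intro exI[of _ "s\<^sup>2 / \<mu>"] exI[of _ "s + D"]) auto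
qed

text \<open>Each edge is bounded by an integral over a ball around its first node. A given point
  lies in a bounded number of these balls, since both ends of the edge are nodes near it, so the sum
  costs only the factor \<open>N * N\<close>.\<close>

lemma diff_bounded_of_W_12:
  "\<exists>C\<ge>0. \<forall>u\<in>W_12 \<T>. diff_bounded s u (C * (W_seminorm \<T> u)\<^sup>2)"
proof -
  obtain C K where C: "C \<ge> 0" "\<And>u l m. u \<in> W_12 \<T> \<Longrightarrow> l \<in> \<Lambda> \<Longrightarrow> m \<in> \<Lambda> \<Longrightarrow> dist l m \<le> s \<Longrightarrow>
     (norm (u l - u m))\<^sup>2 \<le> C * (LINT x|lebesgue. indicator (cball l K) x * (norm (p1_grad \<T> u x))\<^sup>2)"
    using edge_le_integral by blast
  obtain N where N: "\<And>x. finite (\<Lambda> \<inter> cball x (K + s))" "\<And>x. card (\<Lambda> \<inter> cball x (K + s)) \<le> N"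
    using card_nodes_ball by blast
  have "diff_bounded s u (C * (N * N) * (W_seminorm \<T> u)\<^sup>2)" if u: "u \<in> W_12 \<T>" for u
    unfolding diff_bounded_def
  proof (intro allI impI)
    fix F assume F: "finite F" "F \<subseteq> {(l,m). l \<in> \<Lambda> \<and> m \<in> \<Lambda> \<and> dist l m \<le> s}"
    let ?G = "\<lambda>x. (norm (p1_grad \<T> u x))\<^sup>2"
    have G: "integrable lebesgue ?G" using u W_12_iff by blast
    have Gi: "integrable lebesgue (\<lambda>x. indicator (cball l K) x * ?G x)" for l
      using integrable_mult_indicator[OF _ G, of "cball l K"] by simp
    have "(\<Sum>(l,m)\<in>F. (norm (u l - u m))\<^sup>2) \<le> (\<Sum>p\<in>F. C * (LINT x|lebesgue. indicator (cball (fst p) K) x * ?G x))"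
      by (rule sum_mono) (use F(2) C(2)[OF u] in auto)
    also have "\<dots> = C * (LINT x|lebesgue. (\<Sum>p\<in>F. indicator (cball (fst p) K) x * ?G x))"
      unfolding sum_distrib_left[symmetric] by (subst Bochner_Integration.integral_sum[OF Gi]) simp
    also have "\<dots> \<le> C * (LINT x|lebesgue. (N * N) * ?G x)"
    proof (intro mult_left_mono integral_mono C(1) Bochner_Integration.integrable_sum Gi integrable_mult_right G)
      fix x
      have "(\<Sum>p\<in>F. indicator (cball (fst p) K) x * ?G x) = (\<Sum>p\<in>F. indicator (cball (fst p) K) x) * ?G x"
        by (rule sum_distrib_right[symmetric])
      also have "(\<Sum>p\<in>F. indicator (cball (fst p) K) x) = real (card {p \<in> F. x \<in> cball (fst p) K})"
        using F(1) by (simp add: indicator_def sum.If_cases Int_def)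
      also have "card {p \<in> F. x \<in> cball (fst p) K} \<le> card ((\<Lambda> \<inter> cball x (K + s)) \<times> (\<Lambda> \<inter> cball x (K + s)))"
      proof (rule card_mono)
        show "finite ((\<Lambda> \<inter> cball x (K + s)) \<times> (\<Lambda> \<inter> cball x (K + s)))" using N(1) by blast
        show "{p \<in> F. x \<in> cball (fst p) K} \<subseteq> (\<Lambda> \<inter> cball x (K + s)) \<times> (\<Lambda> \<inter> cball x (K + s))"
        proof
          fix p assume p: "p \<in> {p \<in> F. x \<in> cball (fst p) K}"
          obtain l m where lm: "p = (l,m)" by (cases p)
          have *: "l \<in> \<Lambda>" "m \<in> \<Lambda>" "dist l m \<le> s" "dist l x \<le> K" using p F(2) lm by auto
          have "dist x m \<le> K + s" using dist_triangle[of x m l] * by (simp add: dist_commute)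
          moreover have "dist x l \<le> K + s" using *(3,4) zero_le_dist[of l m] dist_commute[of x l] by linarith
          ultimately show "p \<in> (\<Lambda> \<inter> cball x (K + s)) \<times> (\<Lambda> \<inter> cball x (K + s))" using * lm by simp
        qed
      qed
      also have "\<dots> \<le> N * N" unfolding card_cartesian_product by (intro mult_le_mono N(2))
      finally show "(\<Sum>p\<in>F. indicator (cball (fst p) K) x * ?G x) \<le> (N * N) * ?G x"
        by (simp add: mult_right_mono del: of_nat_mult)
    qed
    also have "\<dots> = C * (N * N) * (W_seminorm \<T> u)\<^sup>2"
      unfolding W_seminorm_sq by simp
    finally show "(\<Sum>(l,m)\<in>F. (norm (u l - u m))\<^sup>2) \<le> C * (N * N) * (W_seminorm \<T> u)\<^sup>2" .
  qed
  then show ?thesis using C(1) by (intro exI[of _ "C * (N * N)"]) auto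
qed

text \<open>By convexity the interpolant stays within \<open>B\<close> of one of its vertex values
  on the whole element. A step of length \<open>r / 2\<close> inside the inscribed ball then changes
  it by at most \<open>2 * B\<close>, which bounds every entry of the gradient by
  \<open>4 / r * B\<close>.\<close>

lemma piece_le_vertices:
  "\<exists>C\<ge>0. \<forall>u. \<forall>T\<in>\<T>. (norm (piece u T))\<^sup>2 \<le> C * (\<Sum>(l,m)\<in>vertices T \<times> vertices T. (norm (u l - u m))\<^sup>2)"
proof -
  obtain r where r: "r > 0" "\<And>T. T \<in> \<T> \<Longrightarrow> \<exists>x. ball x r \<subseteq> T" using inscribed_uniform by blast
  let ?d = "real CARD('n)"
  have "(norm (piece u T))\<^sup>2 \<le> (?d * ?d * (4 / r))\<^sup>2 * ((?d + 1)\<^sup>2 * (\<Sum>(l,m)\<in>vertices T \<times> vertices T. (norm (u l - u m))\<^sup>2))"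
    if T: "T \<in> \<T>" for u T
  proof -
    let ?w = "p1_interpolant \<T> u"
    let ?V = "vertices T \<times> vertices T"
    have finV: "finite ?V" using element(3)[OF T] by blast
    define B where "B = (\<Sum>(l,m)\<in>?V. norm (u l - u m))"
    have B0: "B \<ge> 0" unfolding B_def by (intro sum_nonneg) auto
    obtain c where c: "\<And>x. x \<in> T \<Longrightarrow> ?w x = c + piece u T *v x" using piece[OF T] by blast
    have "vertices T \<noteq> {}" using element(2)[OF T] by (metis Suc_eq_plus1 card.empty nat.distinct(1))
    then obtain m0 where m0: "m0 \<in> vertices T" by blast
    have near: "norm (?w x - u m0) \<le> B" if x: "x \<in> T" for x
    proof -
      have "convex {x. c + piece u T *v x \<in> cball (u m0) B}"
        by (rule convex_affine_preimage) auto
      moreover have "vertices T \<subseteq> {x. c + piece u T *v x \<in> cball (u m0) B}"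
      proof
        fix l assume l: "l \<in> vertices T"
        then have "l \<in> T" "l \<in> \<Lambda>" using element(7,8)[OF T] by blast+
        then have "c + piece u T *v l = u l" using c[of l] p1_interpolant(3)[of l u] by simp
        moreover have "norm (u l - u m0) \<le> B"
          unfolding B_def using member_le_sum[of "(l,m0)" ?V "\<lambda>(l,m). norm (u l - u m)"] l m0 finV by auto
        ultimately show "l \<in> {x. c + piece u T *v x \<in> cball (u m0) B}" by (simp add: dist_norm norm_minus_commute)
      qed
      ultimately have "convex hull (vertices T) \<subseteq> {x. c + piece u T *v x \<in> cball (u m0) B}" by (rule hull_minimal[rotated])
      then have "x \<in> {x. c + piece u T *v x \<in> cball (u m0) B}" using x element(4)[OF T] by blast
      then show ?thesis using c[OF x] by (simp add: dist_norm norm_minus_commute)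
    qed
    obtain x0 where x0: "ball x0 r \<subseteq> T" using r(2)[OF T] by blast
    have ent: "\<bar>piece u T $ i $ j\<bar> \<le> 4 / r * B" for i j
    proof -
      let ?y = "x0 + (r / 2) *\<^sub>R axis j 1"
      have y: "?y \<in> T" "x0 \<in> T" using x0 r(1) by (auto simp: dist_norm subset_eq)
      have "piece u T *v ((r / 2) *\<^sub>R axis j 1) = ?w ?y - ?w x0" using piece_diff[OF T y, of u] by simp
      also have "norm \<dots> \<le> norm (?w ?y - u m0) + norm (?w x0 - u m0)"
        using norm_triangle_ineq4[of "?w ?y - u m0" "?w x0 - u m0"] by simp
      also have "\<dots> \<le> 2 * B" using near[OF y(1)] near[OF y(2)] by simp
      finally have "norm ((r / 2) *\<^sub>R (piece u T *v axis j 1)) \<le> 2 * B" by (simp add: matrix_vector_mult_scaleR)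
      then have "norm (piece u T *v axis j 1) \<le> 4 / r * B" using r(1) by (simp add: field_simps)
      moreover have "(piece u T *v axis j 1) $ i = piece u T $ i $ j"
        by (simp add: matrix_vector_mul_component inner_axis)
      ultimately show ?thesis using component_le_norm_cart[of "piece u T *v axis j 1" i] by simp
    qed
    have "norm (piece u T) \<le> (\<Sum>i\<in>UNIV. \<Sum>j\<in>UNIV. \<bar>piece u T $ i $ j\<bar>)" by (rule norm_matrix_le_entries)
    also have "\<dots> \<le> (\<Sum>i\<in>(UNIV::'n set). \<Sum>j\<in>(UNIV::'n set). 4 / r * B)" by (intro sum_mono ent)
    also have "\<dots> = ?d * ?d * (4 / r) * B" by simp
    finally have "(norm (piece u T))\<^sup>2 \<le> (?d * ?d * (4 / r) * B)\<^sup>2" by (intro power_mono) auto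
    also have "\<dots> = (?d * ?d * (4 / r))\<^sup>2 * B\<^sup>2" by (rule power_mult_distrib)
    also have "\<dots> \<le> (?d * ?d * (4 / r))\<^sup>2 * ((?d + 1)\<^sup>2 * (\<Sum>(l,m)\<in>?V. (norm (u l - u m))\<^sup>2))"
    proof (intro mult_left_mono)
      have "B\<^sup>2 = (norm (\<Sum>p\<in>?V. norm (u (fst p) - u (snd p))))\<^sup>2" by (simp add: B_def case_prod_unfold)
      also have "\<dots> \<le> card ?V * (\<Sum>p\<in>?V. (norm (norm (u (fst p) - u (snd p))))\<^sup>2)" by (rule norm_sum_sq_le[OF finV])
      also have "real (card ?V) = (?d + 1)\<^sup>2" using element(2)[OF T] by (simp add: card_cartesian_product power2_eq_square algebra_simps)
      finally show "B\<^sup>2 \<le> (?d + 1)\<^sup>2 * (\<Sum>(l,m)\<in>?V. (norm (u l - u m))\<^sup>2)" by (simp add: case_prod_unfold)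
    qed auto
    finally show ?thesis .
  qed
  then show ?thesis
    by (intro exI[of _ "(?d * ?d * (4 / r))\<^sup>2 * (?d + 1)\<^sup>2"]) (auto simp: mult.assoc)
qed

text \<open>Almost every point is interior to an element, whose vertices are within the mesh size
  \<open>D\<close> of the point and of each other, so the squared gradient is dominated by
  indicators of balls around nodes. \<open>diff_bounded\<close> concerns finite sets of pairs; hence
  the integral is first taken over a ball, and monotone convergence lets the ball grow.\<close>

lemma W_12_of_diff_bounded:
  "\<exists>C s. C \<ge> 0 \<and> (\<forall>u S. diff_bounded s u S \<longrightarrow> u \<in> W_12 \<T> \<and> (W_seminorm \<T> u)\<^sup>2 \<le> C * S)"
proof -
  obtain D where D: "D > 0" "\<And>T. T \<in> \<T> \<Longrightarrow> diameter T \<le> D" using diameter_bound by blast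
  obtain C where C: "C \<ge> 0" "\<And>u T. T \<in> \<T> \<Longrightarrow> (norm (piece u T))\<^sup>2 \<le> C * (\<Sum>(l,m)\<in>vertices T \<times> vertices T. (norm (u l - u m))\<^sup>2)"
    using piece_le_vertices by blast
  define b where "b = measure lebesgue (cball (0::real^'n) D)"
  have b: "emeasure lebesgue (cball l D) = ennreal b" for l :: "real^'n"
  proof -
    have "emeasure lebesgue (cball l D) = ennreal (measure lebesgue (cball l D))"
      by (rule emeasure_eq_ennreal_measure) (use emeasure_lborel_cball_finite[of l D] in auto)
    moreover have "measure lebesgue (cball l D) = b" using D(1) by (simp add: b_def content_cball)
    ultimately show ?thesis by simp
  qed
  have b0: "b \<ge> 0" by (simp add: b_def)
  have "u \<in> W_12 \<T> \<and> (W_seminorm \<T> u)\<^sup>2 \<le> C * b * S" if bd: "diff_bounded D u S" for u S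
  proof -
    let ?G = "\<lambda>x. (norm (p1_grad \<T> u x))\<^sup>2"
    let ?h = "\<lambda>p. (norm (u (fst p) - u (snd p)))\<^sup>2"
    have S0: "S \<ge> 0" using bd[unfolded diff_bounded_def, rule_format, of "{}"] by simp
    have mG: "?G \<in> borel_measurable lebesgue" using p1_grad_measurable[of u] by measurable
    have part: "(\<integral>\<^sup>+ x. ennreal (indicator (cball 0 (real n)) x * ?G x) \<partial>lebesgue) \<le> ennreal (C * b * S)" for n
    proof -
      define Q where "Q = {(l,m). l \<in> \<Lambda> \<inter> cball 0 (real n + D) \<and> m \<in> \<Lambda> \<inter> cball 0 (real n + D) \<and> dist l m \<le> D}"
      have finQ: "finite Q"
        by (rule finite_subset[of _ "(\<Lambda> \<inter> cball 0 (real n + D)) \<times> (\<Lambda> \<inter> cball 0 (real n + D))"])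
           (auto simp: Q_def finite_nodes_ball)
      have "AE x in lebesgue. ennreal (indicator (cball 0 (real n)) x * ?G x)
          \<le> (\<Sum>p\<in>Q. ennreal (C * ?h p) * indicator (cball (fst p) D) x)"
        using interiors_cover
      proof eventually_elim
        case (elim x)
        then obtain T where T: "T \<in> \<T>" "x \<in> interior T" by blast
        then have xT: "x \<in> T" using interior_subset by blast
        show ?case
        proof (cases "x \<in> cball 0 (real n)")
          case True
          have Tx: "T \<subseteq> cball x D" by (rule element_subset_cball[OF T(1) xT D(2)[OF T(1)]])
          have sub: "vertices T \<times> vertices T \<subseteq> {p \<in> Q. x \<in> cball (fst p) D}"
          proof
            fix p assume "p \<in> vertices T \<times> vertices T"
            then obtain l m where p: "p = (l,m)" "l \<in> vertices T" "m \<in> vertices T" by blast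
            have lm: "l \<in> T" "m \<in> T" "l \<in> \<Lambda>" "m \<in> \<Lambda>" using p element(7,8)[OF T(1)] by blast+
            have "dist x l \<le> D" "dist x m \<le> D" using lm Tx by auto
            moreover have "dist l m \<le> D" using dist_le_diameter[OF T(1) lm(1,2)] D(2)[OF T(1)] by linarith
            moreover have "norm x \<le> real n" using True by simp
            ultimately show "p \<in> {p \<in> Q. x \<in> cball (fst p) D}"
              using lm p(1) dist_triangle[of 0 l x] dist_triangle[of 0 m x] by (auto simp: Q_def dist_commute)
          qed
          have "?G x \<le> C * (\<Sum>p\<in>vertices T \<times> vertices T. ?h p)"
            using C(2)[OF T(1), of u] p1_grad_interior[OF T, of u] by (simp add: case_prod_unfold)
          also have "\<dots> \<le> C * (\<Sum>p\<in>{p \<in> Q. x \<in> cball (fst p) D}. ?h p)"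
            by (intro mult_left_mono sum_mono2 sub C(1)) (auto simp: finQ)
          also have "\<dots> = (\<Sum>p\<in>Q. C * ?h p * indicator (cball (fst p) D) x)"
            unfolding sum_distrib_left by (rule sum.mono_neutral_cong_left) (auto simp: finQ indicator_def)
          finally have "ennreal (?G x) \<le> ennreal (\<Sum>p\<in>Q. C * ?h p * indicator (cball (fst p) D) x)" by (rule ennreal_leI)
          also have "\<dots> = (\<Sum>p\<in>Q. ennreal (C * ?h p * indicator (cball (fst p) D) x))"
            using C(1) by (intro sum_ennreal[symmetric]) auto
          also have "\<dots> = (\<Sum>p\<in>Q. ennreal (C * ?h p) * indicator (cball (fst p) D) x)"
            using C(1) by (intro sum.cong refl) (simp add: ennreal_mult ennreal_indicator)
          finally show ?thesis using True by simp
        qed simp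
      qed
      then have "(\<integral>\<^sup>+ x. ennreal (indicator (cball 0 (real n)) x * ?G x) \<partial>lebesgue)
        \<le> (\<integral>\<^sup>+ x. (\<Sum>p\<in>Q. ennreal (C * ?h p) * indicator (cball (fst p) D) x) \<partial>lebesgue)"
        by (rule nn_integral_mono_AE)
      also have "\<dots> = (\<Sum>p\<in>Q. \<integral>\<^sup>+ x. ennreal (C * ?h p) * indicator (cball (fst p) D) x \<partial>lebesgue)"
      proof (rule nn_integral_sum)
        fix p assume "p \<in> Q"
        have "cball (fst p) D \<in> sets lebesgue" by simp
        then show "(\<lambda>x. ennreal (C * ?h p) * indicator (cball (fst p) D) x) \<in> borel_measurable lebesgue"
          by measurable
      qed
      also have "\<dots> = (\<Sum>p\<in>Q. ennreal (C * ?h p) * ennreal b)"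
        by (intro sum.cong refl) (simp add: nn_integral_cmult_indicator b)
      also have "\<dots> = (\<Sum>p\<in>Q. ennreal (C * b * ?h p))"
        using C(1) b0 by (intro sum.cong refl) (simp add: ennreal_mult[symmetric] mult_ac)
      also have "\<dots> = ennreal (C * b * (\<Sum>p\<in>Q. ?h p))"
        using C(1) b0 by (subst sum_ennreal) (auto simp: sum_distrib_left)
      also have "\<dots> \<le> ennreal (C * b * S)"
      proof (intro ennreal_leI mult_left_mono)
        have "Q \<subseteq> {(l,m). l \<in> \<Lambda> \<and> m \<in> \<Lambda> \<and> dist l m \<le> D}" by (auto simp: Q_def)
        then show "(\<Sum>p\<in>Q. ?h p) \<le> S" using bd finQ unfolding diff_bounded_def by (auto simp: case_prod_unfold)
      qed (use C(1) b0 in auto)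
      finally show ?thesis .
    qed
    have sup: "(SUP n. ennreal (indicator (cball 0 (real n)) x * ?G x)) = ennreal (?G x)" for x
    proof (rule antisym)
      show "(SUP n. ennreal (indicator (cball 0 (real n)) x * ?G x)) \<le> ennreal (?G x)"
        by (intro SUP_least ennreal_leI) (auto simp: indicator_def)
      obtain n where "norm x \<le> real n" using real_arch_simple by blast
      then have "ennreal (?G x) = ennreal (indicator (cball 0 (real n)) x * ?G x)" by simp
      also have "\<dots> \<le> (SUP n. ennreal (indicator (cball 0 (real n)) x * ?G x))" by (rule SUP_upper) simp
      finally show "ennreal (?G x) \<le> (SUP n. ennreal (indicator (cball 0 (real n)) x * ?G x))" .
    qed
    have "(\<integral>\<^sup>+ x. ennreal (?G x) \<partial>lebesgue) = (SUP n. \<integral>\<^sup>+ x. ennreal (indicator (cball 0 (real n)) x * ?G x) \<partial>lebesgue)"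
      unfolding sup[symmetric]
    proof (rule nn_integral_monotone_convergence_SUP)
      show "incseq (\<lambda>n x. ennreal (indicator (cball 0 (real n)) x * ?G x))"
        by (auto simp: incseq_def le_fun_def indicator_def intro!: ennreal_leI)
      fix n show "(\<lambda>x. ennreal (indicator (cball 0 (real n)) x * ?G x)) \<in> borel_measurable lebesgue"
        using mG by (intro measurable_compose[OF _ measurable_ennreal] borel_measurable_times borel_measurable_indicator) auto
    qed
    also have "\<dots> \<le> ennreal (C * b * S)" by (intro SUP_least part)
    finally have le: "(\<integral>\<^sup>+ x. ennreal (?G x) \<partial>lebesgue) \<le> ennreal (C * b * S)" .
    then have "(\<integral>\<^sup>+ x. ennreal (norm (?G x)) \<partial>lebesgue) < \<infinity>"
      by (simp add: le_less_trans)
    then have int: "integrable lebesgue ?G" using mG by (simp add: integrable_iff_bounded)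
    have "(LINT x|lebesgue. ?G x) = enn2real (\<integral>\<^sup>+ x. ennreal (?G x) \<partial>lebesgue)"
      by (rule integral_eq_nn_integral[OF mG]) simp
    also have "\<dots> \<le> enn2real (ennreal (C * b * S))" using le by (intro enn2real_mono) auto
    also have "\<dots> = C * b * S" using C(1) b0 S0 by simp
    finally show ?thesis using int by (simp add: W_12_iff W_seminorm_sq)
  qed
  then show ?thesis using C(1) b0 by (intro exI[of _ "C * b"] exI[of _ D]) auto
qed

text \<open>Compactness of support is demanded of the gradient only, so the function may equal a
  nonzero constant far out. The truncations of \<open>u\<close> are of this kind.\<close>

lemma W_c_of_finite:
  assumes "finite {l \<in> \<Lambda>. u l \<noteq> c}" shows "u \<in> W_c \<T>"
proof -
  obtain D where D: "D > 0" "\<And>T. T \<in> \<T> \<Longrightarrow> diameter T \<le> D" using diameter_bound by blast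
  obtain R where R: "R > 0" "\<And>l. l \<in> \<Lambda> \<Longrightarrow> u l \<noteq> c \<Longrightarrow> norm l \<le> R"
    using finite_imp_bounded[OF assms] by (auto simp: bounded_pos)
  let ?w = "p1_interpolant \<T> u"
  have const: "?w x = c" if x: "norm x > R + D" for x
  proof -
    obtain T where T: "T \<in> \<T>" "x \<in> T" using cover by blast
    obtain c' L where L: "linear L" "\<And>x. x \<in> T \<Longrightarrow> ?w x = c' + L x" using p1_interpolant(2)[OF T(1)] by blast
    have "c' + L x = c + 0"
    proof (rule affine_eq_on_hull[OF L(1), of "\<lambda>_. 0" "vertices T"])
      fix y assume y: "y \<in> vertices T"
      then have y': "y \<in> T" "y \<in> \<Lambda>" using element(7,8)[OF T(1)] by blast+
      have "dist x y \<le> D" using dist_le_diameter[OF T y'(1)] D(2)[OF T(1)] by linarith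
      then have "norm y > R" using x norm_triangle_ineq2[of x y] by (simp add: dist_norm)
      then have "u y = c" using R(2)[of y] y'(2) by force
      then show "c' + L y = c + 0" using L(2)[OF y'(1)] p1_interpolant(3)[OF y'(2), of u] by simp
    qed (use T element(4) in \<open>auto simp: linear_zero\<close>)
    then show ?thesis using L(2)[OF T(2)] by simp
  qed
  have "{x. p1_grad \<T> u x \<noteq> 0} \<subseteq> cball 0 (R + D)"
  proof (rule subsetI, rule ccontr)
    fix x assume "x \<in> {x. p1_grad \<T> u x \<noteq> 0}" "x \<notin> cball 0 (R + D)"
    then have x: "p1_grad \<T> u x \<noteq> 0" "x \<in> - cball 0 (R + D)" by auto
    have "((\<lambda>_. c) has_derivative (\<lambda>_. 0)) (at x)" by simp
    then have D: "(?w has_derivative (\<lambda>_. 0)) (at x)"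
      by (rule has_derivative_transform_within_open[OF _ _ x(2)]) (use const in auto)
    then have "frechet_derivative ?w (at x) = (\<lambda>_. 0)" by (rule frechet_derivative_at[symmetric])
    then have "p1_grad \<T> u x = 0" by (simp add: p1_grad_def matrix_def vec_eq_iff)
    then show False using x(1) by simp
  qed
  then have "bounded {x. p1_grad \<T> u x \<noteq> 0}" using bounded_cball bounded_subset by blast
  then show ?thesis unfolding W_c_def by (simp add: compact_closure)
qed

end

subsection \<open>Extension of lattice functions to the node set\<close>

text \<open>Nodes of the core that are off the lattice receive the default value 0. This is harmless
  for functions that vanish near the core, and on the full lattice there are no such nodes.\<close>

definition on_lattice :: "real^'n^'n \<Rightarrow> (int^'n \<Rightarrow> 'b::zero) \<Rightarrow> real^'n \<Rightarrow> 'b" where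
  "on_lattice A f l = (if l \<in> range (lattice_point A) then f (inv (lattice_point A) l) else 0)"

lemma on_lattice_point: "invertible A \<Longrightarrow> on_lattice A f (lattice_point A x) = f x"
  by (simp add: on_lattice_def inv_f_f inj_lattice_point)

context node_triangulation
begin

lemma diff_bounded_add:
  assumes "diff_bounded s u S" "diff_bounded s v S'"
  shows "diff_bounded s (\<lambda>l. u l + t *\<^sub>R v l) (2 * S + 2 * (t\<^sup>2 * S'))"
  unfolding diff_bounded_def
proof (intro allI impI)
  fix F assume F: "finite F" "F \<subseteq> {(l,m). l \<in> \<Lambda> \<and> m \<in> \<Lambda> \<and> dist l m \<le> s}"
  have "(\<Sum>(l,m)\<in>F. (norm ((u l + t *\<^sub>R v l) - (u m + t *\<^sub>R v m)))\<^sup>2)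
    \<le> (\<Sum>p\<in>F. 2 * (norm (u (fst p) - u (snd p)))\<^sup>2 + 2 * (t\<^sup>2 * (norm (v (fst p) - v (snd p)))\<^sup>2))"
  proof (rule sum_mono, clarify)
    fix l m
    have eq: "(u l + t *\<^sub>R v l) - (u m + t *\<^sub>R v m) = (u l - u m) + t *\<^sub>R (v l - v m)" by (simp add: algebra_simps)
    show "(norm ((u l + t *\<^sub>R v l) - (u m + t *\<^sub>R v m)))\<^sup>2
      \<le> 2 * (norm (u (fst (l,m)) - u (snd (l,m))))\<^sup>2 + 2 * (t\<^sup>2 * (norm (v (fst (l,m)) - v (snd (l,m))))\<^sup>2)"
      unfolding fst_conv snd_conv eq
      using norm_add_sq_le[of "u l - u m" "t *\<^sub>R (v l - v m)"] by (simp only: norm_scaleR power_mult_distrib power2_abs)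
  qed
  also have "\<dots> = 2 * (\<Sum>(l,m)\<in>F. (norm (u l - u m))\<^sup>2) + 2 * (t\<^sup>2 * (\<Sum>(l,m)\<in>F. (norm (v l - v m))\<^sup>2))"
    by (simp add: sum.distrib sum_distrib_left case_prod_unfold)
  also have "\<dots> \<le> 2 * S + 2 * (t\<^sup>2 * S')"
    using assms F unfolding diff_bounded_def by (intro add_mono mult_left_mono) auto
  finally show "(\<Sum>(l,m)\<in>F. (norm ((u l + t *\<^sub>R v l) - (u m + t *\<^sub>R v m)))\<^sup>2) \<le> 2 * S + 2 * (t\<^sup>2 * S')" .
qed

lemma diff_bounded_finite_support:
  assumes "finite {l \<in> \<Lambda>. v l \<noteq> 0}" shows "\<exists>S. diff_bounded s v S"
proof -
  obtain B where B: "\<And>l. l \<in> \<Lambda> \<Longrightarrow> v l \<noteq> 0 \<Longrightarrow> norm l \<le> B"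
    using finite_imp_bounded[OF assms] unfolding bounded_iff by blast
  define X where "X = (\<Lambda> \<inter> cball 0 (B + \<bar>s\<bar>)) \<times> (\<Lambda> \<inter> cball 0 (B + \<bar>s\<bar>))"
  have finX: "finite X" unfolding X_def using finite_nodes_ball by blast
  have "(\<Sum>(l,m)\<in>F. (norm (v l - v m))\<^sup>2) \<le> (\<Sum>(l,m)\<in>X. (norm (v l - v m))\<^sup>2)"
    if F: "finite F" "F \<subseteq> {(l,m). l \<in> \<Lambda> \<and> m \<in> \<Lambda> \<and> dist l m \<le> s}" for F
  proof -
    have zero: "v l - v m = 0" if "(l,m) \<in> F - X" for l m
    proof (rule ccontr)
      assume "v l - v m \<noteq> 0"
      then have "v l \<noteq> 0 \<or> v m \<noteq> 0" by auto
      moreover have lm: "l \<in> \<Lambda>" "m \<in> \<Lambda>" "dist l m \<le> s" using that F(2) by auto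
      ultimately have "norm l \<le> B \<or> norm m \<le> B" using B by blast
      then have "norm l \<le> B + \<bar>s\<bar>" "norm m \<le> B + \<bar>s\<bar>"
        using lm(3) norm_triangle_ineq3[of l m] by (auto simp: dist_norm abs_le_iff)
      then show False using that lm by (auto simp: X_def)
    qed
    have "(\<Sum>(l,m)\<in>F. (norm (v l - v m))\<^sup>2) = (\<Sum>(l,m)\<in>F \<inter> X. (norm (v l - v m))\<^sup>2)"
    proof (rule sum.mono_neutral_right)
      show "\<forall>p\<in>F - F \<inter> X. (case p of (l, m) \<Rightarrow> (norm (v l - v m))\<^sup>2) = 0"
      proof
        fix p assume p: "p \<in> F - F \<inter> X"
        obtain l m where lm: "p = (l,m)" by (cases p)
        show "(case p of (l, m) \<Rightarrow> (norm (v l - v m))\<^sup>2) = 0"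
          using zero[of l m] p unfolding lm by simp
      qed
    qed (use F(1) in auto)
    also have "\<dots> \<le> (\<Sum>(l,m)\<in>X. (norm (v l - v m))\<^sup>2)" by (rule sum_mono2) (auto simp: finX)
    finally show ?thesis .
  qed
  then show ?thesis unfolding diff_bounded_def by blast
qed

lemma W_12_finite_support: "finite {l \<in> \<Lambda>. v l \<noteq> 0} \<Longrightarrow> v \<in> W_12 \<T>"
  using W_12_of_diff_bounded diff_bounded_finite_support by blast

lemma W_12_add:
  assumes "u \<in> W_12 \<T>" "v \<in> W_12 \<T>" shows "(\<lambda>l. u l + t *\<^sub>R v l) \<in> W_12 \<T>"
proof -
  obtain C s where C: "\<And>u S. diff_bounded s u S \<Longrightarrow> u \<in> W_12 \<T>" using W_12_of_diff_bounded by blast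
  obtain C' where "\<And>u. u \<in> W_12 \<T> \<Longrightarrow> diff_bounded s u (C' * (W_seminorm \<T> u)\<^sup>2)"
    using diff_bounded_of_W_12[of s] by blast
  from C[OF diff_bounded_add[OF this[OF assms(1)] this[OF assms(2)]]] show ?thesis .
qed

text \<open>A pair of nodes that are not both lattice points lies so close to the core that the
  function is 0 at both. All other pairs are differences along one of finitely many vectors, bounded
  by \<open>energy_fdiff\<close>.\<close>

lemma diff_bounded_on_lattice:
  fixes P :: "(int^'n) set"
  assumes "lattice_stencil P"
  shows "\<exists>C\<ge>0. \<forall>f. lattice_stencil.finite_energy P f \<longrightarrow>
      \<Lambda> \<subseteq> range (lattice_point A) \<or> (\<forall>x. norm (lattice_point A x) < Rd + s \<longrightarrow> f x = 0) \<longrightarrow>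
      diff_bounded s (on_lattice A f) (C * lattice_stencil.energy P f)"
proof -
  interpret lattice_stencil P by fact
  let ?pt = "lattice_point A"
  obtain c where c: "c > 0" "\<And>x. c * real (supnorm x) \<le> norm (?pt x)" using lattice_point_norm[OF A] by metis
  define N where "N = nat \<lceil>s / c\<rceil>"
  define C where "C = real (card (cube N (0::int^'n))) * (2 ^ (CARD('n) + 1) * (real N)\<^sup>2)"
  have "diff_bounded s (on_lattice A f) (C * energy f)"
    if f: "finite_energy f" and z: "\<Lambda> \<subseteq> range ?pt \<or> (\<forall>x. norm (?pt x) < Rd + s \<longrightarrow> f x = 0)" for f :: "int^'n \<Rightarrow> real^'n"
    unfolding diff_bounded_def
  proof (intro allI impI)
    fix F assume F: "finite F" "F \<subseteq> {(l,m). l \<in> \<Lambda> \<and> m \<in> \<Lambda> \<and> dist l m \<le> s}"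
    let ?f = "on_lattice A f"
    let ?h = "\<lambda>p. (norm (?f (fst p) - ?f (snd p)))\<^sup>2"
    define F' where "F' = F \<inter> (range ?pt \<times> range ?pt)"
    have zero: "?h p = 0" if "p \<in> F - F'" for p
    proof -
      obtain l m where p: "p = (l,m)" by (cases p)
      have lm: "l \<in> \<Lambda>" "m \<in> \<Lambda>" "dist l m \<le> s" "l \<notin> range ?pt \<or> m \<notin> range ?pt"
        using that F(2) p by (auto simp: F'_def)
      then have v: "\<forall>x. norm (?pt x) < Rd + s \<longrightarrow> f x = 0" using z by blast
      have "norm l < Rd \<or> norm m < Rd" using lm outside[of l] outside[of m] by (meson not_le)
      then have "norm l < Rd + s" "norm m < Rd + s"
        using lm(3) norm_triangle_ineq3[of l m] zero_le_dist[of l m] by (auto simp: dist_norm abs_le_iff)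
      then have "?f l = 0" "?f m = 0"
        using v by (auto simp: on_lattice_def inv_f_f inj_lattice_point[OF A])
      then show ?thesis by (simp add: p)
    qed
    have "(\<Sum>(l,m)\<in>F. (norm (?f l - ?f m))\<^sup>2) = (\<Sum>p\<in>F. ?h p)" by (simp add: case_prod_unfold)
    also have "\<dots> = (\<Sum>p\<in>F'. ?h p)"
      by (rule sum.mono_neutral_right) (use F(1) zero in \<open>auto simp: F'_def\<close>)
    also have "\<dots> \<le> (\<Sum>\<xi>\<in>cube N 0. sum_sq (fdiff \<xi> f))"
    proof -
      define X where "X = inv ?pt ` snd ` F'"
      have finX: "finite X" using F(1) by (simp add: X_def F'_def)
      have "F' \<subseteq> (\<lambda>(\<xi>, x). (?pt (x + \<xi>), ?pt x)) ` (cube N 0 \<times> X)"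
      proof
        fix p assume p: "p \<in> F'"
        then obtain y x where yx: "p = (?pt y, ?pt x)" by (auto simp: F'_def)
        have "dist (?pt y) (?pt x) \<le> s" using p yx F(2) by (auto simp: F'_def)
        then have "c * real (supnorm (y - x)) \<le> s" using c(2)[of "y - x"] by (simp add: lattice_point_diff dist_norm)
        then have "real (supnorm (y - x)) \<le> s / c" using c(1) by (simp add: field_simps)
        then have "supnorm (y - x) \<le> N" unfolding N_def by linarith
        moreover have "x \<in> X" unfolding X_def using p yx by (force simp: inv_f_f inj_lattice_point[OF A] image_iff)
        ultimately show "p \<in> (\<lambda>(\<xi>, x). (?pt (x + \<xi>), ?pt x)) ` (cube N 0 \<times> X)"
          using yx by (intro image_eqI[of _ _ "(y - x, x)"]) (auto simp: cube_def)
      qed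
      then have "(\<Sum>p\<in>F'. ?h p) \<le> (\<Sum>p\<in>(\<lambda>(\<xi>, x). (?pt (x + \<xi>), ?pt x)) ` (cube N 0 \<times> X). ?h p)"
        using finX by (intro sum_mono2) auto
      also have "\<dots> \<le> sum (?h \<circ> (\<lambda>(\<xi>, x). (?pt (x + \<xi>), ?pt x))) (cube N 0 \<times> X)"
        by (rule sum_image_le) (auto simp: finX)
      also have "\<dots> = (\<Sum>q\<in>cube N 0 \<times> X. (norm (fdiff (fst q) f (snd q)))\<^sup>2)"
        by (intro sum.cong refl) (auto simp: on_lattice_point[OF A] fdiff_def)
      also have "\<dots> = (\<Sum>\<xi>\<in>cube N 0. \<Sum>x\<in>X. (norm (fdiff \<xi> f x))\<^sup>2)"
        by (simp add: sum.cartesian_product case_prod_unfold)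
      also have "\<dots> \<le> (\<Sum>\<xi>\<in>cube N 0. sum_sq (fdiff \<xi> f))"
        by (intro sum_mono finite_sum_le_infsum energy_fdiff(1)[OF f] finX) auto
      finally show ?thesis .
    qed
    also have "\<dots> \<le> (\<Sum>\<xi>\<in>cube N (0::int^'n). 2 ^ (CARD('n) + 1) * (real N)\<^sup>2 * energy f)"
    proof (rule sum_mono)
      fix \<xi> :: "int^'n" assume "\<xi> \<in> cube N 0"
      then have "supnorm \<xi> \<le> N" by (simp add: cube_def)
      then have "2 ^ (CARD('n) + 1) * (real (supnorm \<xi>))\<^sup>2 * energy f \<le> 2 ^ (CARD('n) + 1) * (real N)\<^sup>2 * energy f"
        by (intro mult_right_mono mult_left_mono power_mono) auto
      then show "sum_sq (fdiff \<xi> f) \<le> 2 ^ (CARD('n) + 1) * (real N)\<^sup>2 * energy f"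
        using energy_fdiff(2)[OF f, of \<xi>] by linarith
    qed
    also have "\<dots> = C * energy f" by (simp add: C_def)
    finally show "(\<Sum>(l,m)\<in>F. (norm (?f l - ?f m))\<^sup>2) \<le> C * energy f" .
  qed
  moreover have "C \<ge> 0" by (simp add: C_def)
  ultimately show ?thesis by blast
qed

end

section \<open>Point defects\<close>

locale point_defect =
  fixes A :: "real^'n^'n"
    and \<Lambda> :: "(real^'n) set"
    and \<T> \<T>\<^sub>A :: "(real^'n) set set"
    and Rdef rcut c\<^sub>A :: real
    and R :: "real^'n \<Rightarrow> (real^'n) set"
    and R\<^sub>0 :: "(real^'n) set"
    and V :: "real^'n \<Rightarrow> (real^'n \<Rightarrow> real^'n) \<Rightarrow> real"
    and V\<^sub>0 :: "(real^'n \<Rightarrow> real^'n) \<Rightarrow> real"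
    and E :: "(real^'n \<Rightarrow> real^'n) \<Rightarrow> real"
    and u :: "real^'n \<Rightarrow> real^'n"
    and k :: nat
  assumes dim: "CARD('n) \<ge> 2"
    and A: "invertible A"
    and Rdef: "Rdef > 0"
    and config: "\<Lambda> - ball 0 Rdef = bravais_lattice A - ball 0 Rdef"
    and config_finite: "finite (\<Lambda> \<inter> ball 0 Rdef)"
    and triang: "regular_triangulation \<T>"
    and triang_nodes: "nodes \<T> = \<Lambda>"
    and rcut: "rcut > 0"
    and stencil: "\<And>l. l \<in> \<Lambda> \<Longrightarrow> R l \<subseteq> (ball 0 rcut \<inter> {\<rho>. l + \<rho> \<in> \<Lambda>}) - {0}"
    and V_stencil: "\<And>l. l \<in> \<Lambda> \<Longrightarrow> depends_only_on (R l) (V l)"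
    and V_smooth: "\<And>l. l \<in> \<Lambda> \<Longrightarrow> class_C k (V l)"
    and V_zero: "\<And>l. l \<in> \<Lambda> \<Longrightarrow> V l (\<lambda>_. 0) = 0"
    and hom_stencil: "\<And>l. \<lbrakk>l \<in> \<Lambda>; norm l \<ge> Rdef\<rbrakk> \<Longrightarrow> R l = R\<^sub>0"
    and hom_V: "\<And>l. \<lbrakk>l \<in> \<Lambda>; norm l \<ge> Rdef\<rbrakk> \<Longrightarrow> V l = V\<^sub>0"
    and stencil_basis: "\<And>i. A *v axis i 1 \<in> R\<^sub>0"
    and energy: "energy_extension \<T> V E"
    and triang_A: "regular_triangulation \<T>\<^sub>A"
    and triang_A_nodes: "nodes \<T>\<^sub>A = bravais_lattice A"
    and k: "k \<ge> 3"
    and c\<^sub>A: "c\<^sub>A > 0"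
    and stable: "\<And>v. v \<in> W_c \<T>\<^sub>A \<Longrightarrow>
        (\<Sum>\<^sub>\<infinity>l\<in>bravais_lattice A.
           second_variation V\<^sub>0 (\<lambda>_. 0) (stencil_diff v l) (stencil_diff v l))
        \<ge> c\<^sub>A * (W_seminorm \<T>\<^sub>A v)\<^sup>2"
    and critical: "critical_point \<T> E u"
begin

section \<open>Transfer of the model to integer coordinates\<close>

abbreviation pt :: "int^'n \<Rightarrow> real^'n" where "pt \<equiv> lattice_point A"

sublocale tri: node_triangulation A \<Lambda> Rdef \<T>
  by unfold_locales (fact A Rdef config config_finite triang triang_nodes)+

lemma hom_nodes: "node_triangulation A (bravais_lattice A) Rdef \<T>\<^sub>A"
proof -
  have "finite (range pt \<inter> cball 0 Rdef)" using tri.card_lattice_ball[of Rdef] by blast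
  then have "finite (bravais_lattice A \<inter> ball 0 Rdef)"
    unfolding range_lattice_point by (rule finite_subset[rotated]) auto
  then show ?thesis by unfold_locales (use A Rdef triang_A triang_A_nodes in auto)
qed

lemma inj_pt: "pt x = pt y \<longleftrightarrow> x = y"
  using inj_lattice_point[OF A] by (auto dest: injD)

lemma pt_bounds: obtains c C where "c > 0" "C > 0" "\<And>x. c * real (supnorm x) \<le> norm (pt x)"
    "\<And>x. norm (pt x) \<le> C * real (supnorm x)"
  using lattice_point_norm[OF A] by blast

lemma pt_in_nodes: "norm (pt x) \<ge> Rdef \<Longrightarrow> pt x \<in> \<Lambda>"
  using tri.outside by blast

lemma bounded_in_cube: "\<exists>M. \<forall>x. norm (pt x) \<le> r \<longrightarrow> x \<in> cube M 0"
proof -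
  obtain c where c: "c > 0" "\<And>x. c * real (supnorm x) \<le> norm (pt x)" using pt_bounds by metis
  have "x \<in> cube (nat \<lceil>r / c\<rceil>) 0" if "norm (pt x) \<le> r" for x
  proof -
    have "c * real (supnorm x) \<le> r" using c(2)[of x] that by linarith
    then have "real (supnorm x) \<le> r / c" using c(1) by (simp add: field_simps)
    then have "supnorm x \<le> nat \<lceil>r / c\<rceil>" by linarith
    then show ?thesis by (simp add: cube_def)
  qed
  then show ?thesis by blast
qed

lemma far_site: "\<exists>l\<in>\<Lambda>. norm l \<ge> r"
proof -
  obtain M where M: "\<And>x. norm (pt x) \<le> max r Rdef \<Longrightarrow> x \<in> cube M 0" using bounded_in_cube by blast
  let ?x = "axis undefined (int (M + 1)) :: int^'n"
  have "?x \<notin> cube M 0" by (simp add: cube_def)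
  then have "norm (pt ?x) > max r Rdef" using M by (meson not_le)
  then show ?thesis using pt_in_nodes[of ?x] by (intro bexI[of _ "pt ?x"]) auto
qed

text \<open>The hypotheses speak about sites in \<open>\<Lambda>\<close> only. A single site beyond
  \<open>Rdef + rcut\<close> passes them on to \<open>R\<^sub>0\<close> and
  \<open>V\<^sub>0\<close>; the additional \<open>rcut\<close> keeps its neighbours outside the core
  as well.\<close>

lemma hom_site: obtains l where "l \<in> \<Lambda>" "norm l \<ge> Rdef + rcut" "R l = R\<^sub>0" "V l = V\<^sub>0"
proof -
  obtain l where "l \<in> \<Lambda>" "norm l \<ge> Rdef + rcut" using far_site by blast
  then show thesis using that hom_stencil[of l] hom_V[of l] rcut by auto
qed

lemma R0_bounded: "R\<^sub>0 \<subseteq> ball 0 rcut"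
proof -
  obtain l where "l \<in> \<Lambda>" "R l = R\<^sub>0" by (rule hom_site)
  then show ?thesis using stencil[of l] by auto
qed

lemma R0_lattice: "R\<^sub>0 \<subseteq> range pt"
proof
  fix \<rho> assume \<rho>: "\<rho> \<in> R\<^sub>0"
  obtain l where l: "l \<in> \<Lambda>" "norm l \<ge> Rdef + rcut" "R l = R\<^sub>0" by (rule hom_site)
  have "l + \<rho> \<in> \<Lambda>" "norm \<rho> < rcut" using stencil[OF l(1)] \<rho> l(3) by auto
  moreover have "norm (l + \<rho>) \<ge> Rdef"
    using l(2) \<open>norm \<rho> < rcut\<close> norm_triangle_ineq4[of "l + \<rho>" \<rho>] by simp
  ultimately obtain y where y: "l + \<rho> = pt y" using tri.outside by blast
  obtain x where x: "l = pt x" using l rcut tri.outside by (metis add_increasing2 imageE le_add_same_cancel1 less_imp_le order_trans)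
  have "\<rho> = pt (y - x)" using x y by (simp add: lattice_point_diff algebra_simps)
  then show "\<rho> \<in> range pt" by blast
qed

definition P :: "(int^'n) set" where "P = {\<xi>. pt \<xi> \<in> R\<^sub>0}"

lemma pt_P: "pt ` P = R\<^sub>0" using R0_lattice by (auto simp: P_def)

lemma inj_on_P: "inj_on pt P" using inj_lattice_point[OF A] by (rule inj_on_subset) simp

lemma finite_R0: "finite R\<^sub>0"
proof -
  have "R\<^sub>0 \<subseteq> range pt \<inter> cball 0 rcut" using R0_bounded R0_lattice by auto
  then show ?thesis using tri.card_lattice_ball[of rcut] finite_subset by blast
qed

lemma V0: "depends_only_on R\<^sub>0 V\<^sub>0" "class_C k V\<^sub>0"
  using hom_site V_stencil V_smooth by metis+

sublocale lst: lattice_stencil P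
proof
  show "finite P" using finite_R0 pt_P inj_on_P by (metis finite_imageD)
  have "pt (axis i 1) = A *v axis i 1" for i
  proof -
    have "(\<chi> j. real_of_int (axis i 1 $ j)) = (axis i 1 :: real^'n)" by (auto simp: axis_def vec_eq_iff)
    then show ?thesis by (simp add: lattice_point_def)
  qed
  then show "axis i 1 \<in> P" for i using stencil_basis by (simp add: P_def)
qed

definition q :: "int^'n \<Rightarrow> int^'n \<Rightarrow> real^'n \<Rightarrow> real^'n \<Rightarrow> real" where
  "q \<rho> \<sigma> x y = second_variation V\<^sub>0 (\<lambda>_. 0) (stencil_unit (pt \<rho>, x)) (stencil_unit (pt \<sigma>, y))"

lemma C2_V0: "class_C (Suc (Suc 0)) V\<^sub>0"
  by (rule class_C_mono[OF V0(2)]) (use k in simp)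

lemma second_variation_q:
  "second_variation V\<^sub>0 (\<lambda>_. 0) X Y = (\<Sum>\<rho>\<in>P. \<Sum>\<sigma>\<in>P. q \<rho> \<sigma> (X (pt \<rho>)) (Y (pt \<sigma>)))"
proof -
  have R0: "(\<Sum>\<rho>\<in>R\<^sub>0. h \<rho>) = (\<Sum>\<rho>\<in>P. h (pt \<rho>))" for h :: "real^'n \<Rightarrow> real"
    using sum.reindex[OF inj_on_P, of h] by (simp add: pt_P o_def)
  show ?thesis
    by (rule trans[OF second_variation_stencil[OF C2_V0 V0(1) finite_R0]]) (simp only: R0 q_def)
qed

lemma stencil_diff_on_lattice: "stencil_diff (on_lattice A v) (pt x) (pt \<rho>) = fdiff \<rho> v x"
  by (simp add: stencil_diff_def fdiff_def on_lattice_point[OF A] flip: lattice_point_add)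

text \<open>Stability is stated with the gradient of the interpolant, the lattice estimates with
  stencil differences; \<open>diff_bounded_of_W_12\<close> on the homogeneous triangulation bounds
  the latter by the former with constant \<open>C\<close>. Passing to \<open>C + 1\<close> avoids a
  division by zero.\<close>

lemma coercivity:
  "\<exists>c0>0. \<forall>v. finite {x. v x \<noteq> 0} \<longrightarrow>
     infsum (\<lambda>x. \<Sum>\<rho>\<in>P. \<Sum>\<sigma>\<in>P. q \<rho> \<sigma> (fdiff \<rho> v x) (fdiff \<sigma> v x)) UNIV \<ge> c0 * lst.energy v"
proof -
  interpret hom: node_triangulation A "bravais_lattice A" Rdef \<T>\<^sub>A by (rule hom_nodes)
  obtain C where C: "C \<ge> 0" "\<And>u. u \<in> W_12 \<T>\<^sub>A \<Longrightarrow> hom.diff_bounded rcut u (C * (W_seminorm \<T>\<^sub>A u)\<^sup>2)"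
    using hom.diff_bounded_of_W_12 by blast
  have "infsum (\<lambda>x. \<Sum>\<rho>\<in>P. \<Sum>\<sigma>\<in>P. q \<rho> \<sigma> (fdiff \<rho> v x) (fdiff \<sigma> v x)) UNIV \<ge> c\<^sub>A / (C + 1) * lst.energy v"
    if fin: "finite {x. v x \<noteq> 0}" for v
  proof -
    let ?v = "on_lattice A v"
    have "{l \<in> bravais_lattice A. ?v l \<noteq> 0} \<subseteq> pt ` {x. v x \<noteq> 0}"
      by (auto simp: on_lattice_point[OF A] simp flip: range_lattice_point)
    then have finv: "finite {l \<in> bravais_lattice A. ?v l \<noteq> 0}" using fin finite_surj by blast
    have v12: "?v \<in> W_12 \<T>\<^sub>A" by (rule hom.W_12_finite_support[OF finv])
    have vc: "?v \<in> W_c \<T>\<^sub>A" by (rule hom.W_c_of_finite[OF finv])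
    have "sum (lst.dens v) F \<le> C * (W_seminorm \<T>\<^sub>A ?v)\<^sup>2" if F: "finite F" for F
    proof -
      define Q where "Q = (\<lambda>(x, \<rho>). (pt (x + \<rho>), pt x)) ` (F \<times> P)"
      have inj: "inj_on (\<lambda>(x, \<rho>). (pt (x + \<rho>), pt x)) (F \<times> P)" by (auto simp: inj_on_def inj_pt)
      have "sum (lst.dens v) F = (\<Sum>p\<in>F \<times> P. (norm (fdiff (snd p) v (fst p)))\<^sup>2)"
        by (simp add: lst.dens_def sum.cartesian_product case_prod_unfold)
      also have "\<dots> = (\<Sum>(l,m)\<in>Q. (norm (?v l - ?v m))\<^sup>2)"
        unfolding Q_def sum.reindex[OF inj]
        by (intro sum.cong refl) (auto simp: on_lattice_point[OF A] fdiff_def)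
      also have "\<dots> \<le> C * (W_seminorm \<T>\<^sub>A ?v)\<^sup>2"
      proof -
        have nP: "norm (pt \<rho>) \<le> rcut" if "\<rho> \<in> P" for \<rho>
          using R0_bounded that by (force simp: P_def)
        have "finite Q" using F lst.finite_stencil by (simp add: Q_def)
        moreover have "Q \<subseteq> {(l,m). l \<in> bravais_lattice A \<and> m \<in> bravais_lattice A \<and> dist l m \<le> rcut}"
          using nP
          by (auto simp: Q_def lattice_point_add dist_norm simp flip: range_lattice_point) (auto simp flip: lattice_point_add)
        ultimately show ?thesis using C(2)[OF v12] unfolding hom.diff_bounded_def by blast
      qed
      finally show ?thesis .
    qed
    then have "lst.energy v \<le> C * (W_seminorm \<T>\<^sub>A ?v)\<^sup>2"
      unfolding lst.energy_def
      by (intro infsum_le_finite_sums) (use lst.finite_energy_fsupp[OF fin] in \<open>auto simp: lst.finite_energy_def\<close>)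
    also have "\<dots> \<le> (C + 1) * (W_seminorm \<T>\<^sub>A ?v)\<^sup>2" by (intro mult_right_mono) auto
    finally have "c\<^sub>A / (C + 1) * lst.energy v \<le> c\<^sub>A / (C + 1) * ((C + 1) * (W_seminorm \<T>\<^sub>A ?v)\<^sup>2)"
      using c\<^sub>A C(1) by (intro mult_left_mono) auto
    also have "\<dots> = c\<^sub>A * (W_seminorm \<T>\<^sub>A ?v)\<^sup>2" using C(1) by simp
    also have "\<dots> \<le> (\<Sum>\<^sub>\<infinity>l\<in>bravais_lattice A. second_variation V\<^sub>0 (\<lambda>_. 0) (stencil_diff ?v l) (stencil_diff ?v l))"
      by (rule stable[OF vc])
    also have "\<dots> = infsum (\<lambda>x. second_variation V\<^sub>0 (\<lambda>_. 0) (stencil_diff ?v (pt x)) (stencil_diff ?v (pt x))) UNIV"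
      unfolding range_lattice_point[symmetric] by (subst infsum_reindex[OF inj_lattice_point[OF A]]) (simp add: o_def)
    also have "\<dots> = infsum (\<lambda>x. \<Sum>\<rho>\<in>P. \<Sum>\<sigma>\<in>P. q \<rho> \<sigma> (fdiff \<rho> v x) (fdiff \<sigma> v x)) UNIV"
      unfolding second_variation_q stencil_diff_on_lattice ..
    finally show ?thesis .
  qed
  then show ?thesis using c\<^sub>A C(1) by (intro exI[of _ "c\<^sub>A / (C + 1)"]) auto
qed

text \<open>The displacement transplanted to the full lattice. The value 0 in the core alters
  finitely many sites only, so the energy stays finite, and the far equation never looks at these
  sites.\<close>

definition ut :: "int^'n \<Rightarrow> real^'n" where
  "ut x = (if norm (pt x) \<ge> Rdef then u (pt x) else 0)"

lemma u_W12: "u \<in> W_12 \<T>" using critical unfolding critical_point_def by blast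

lemma finite_energy_ut: "lst.finite_energy ut"
proof (rule lst.finite_energyI)
  fix \<rho> assume \<rho>: "\<rho> \<in> P"
  obtain C where C: "tri.diff_bounded rcut u C" using tri.diff_bounded_of_W_12[of rcut] u_W12 by blast
  obtain M where M: "\<And>x. norm (pt x) \<le> Rdef + rcut \<Longrightarrow> x \<in> cube M 0" using bounded_in_cube by blast
  let ?h = "\<lambda>x. (norm (fdiff \<rho> ut x))\<^sup>2"
  have rho: "norm (pt \<rho>) < rcut" using \<rho> R0_bounded by (auto simp: P_def)
  have "sum ?h F \<le> sum ?h (cube M 0) + C" if F: "finite F" for F
  proof -
    have far: "norm (pt x) \<ge> Rdef" "norm (pt (x + \<rho>)) \<ge> Rdef" if "x \<notin> cube M 0" for x
    proof -
      have x: "norm (pt x) > Rdef + rcut" using M that by (meson not_le)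
      then show "norm (pt x) \<ge> Rdef" using rcut by simp
      show "norm (pt (x + \<rho>)) \<ge> Rdef"
        using x rho norm_triangle_ineq4[of "pt (x + \<rho>)" "pt \<rho>"] by (simp add: lattice_point_add)
    qed
    have "sum ?h F = sum ?h (F \<inter> cube M 0) + sum ?h (F - cube M 0)"
      by (rule sum.Int_Diff[OF F])
    also have "sum ?h (F \<inter> cube M 0) \<le> sum ?h (cube M 0)" by (rule sum_mono2) auto
    also have "sum ?h (F - cube M 0) = (\<Sum>(l,m)\<in>(\<lambda>x. (pt (x + \<rho>), pt x)) ` (F - cube M 0). (norm (u l - u m))\<^sup>2)"
      by (subst sum.reindex) (auto simp: inj_on_def inj_pt fdiff_def ut_def far intro!: sum.cong)
    also have "\<dots> \<le> C"
    proof -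
      have "(\<lambda>x. (pt (x + \<rho>), pt x)) ` (F - cube M 0) \<subseteq> {(l,m). l \<in> \<Lambda> \<and> m \<in> \<Lambda> \<and> dist l m \<le> rcut}"
      proof (clarify)
        fix x :: "int^'n" assume x: "x \<notin> cube M 0"
        have "dist (pt (x + \<rho>)) (pt x) \<le> rcut" using rho by (simp add: dist_norm lattice_point_add)
        then show "pt (x + \<rho>) \<in> \<Lambda> \<and> pt x \<in> \<Lambda> \<and> dist (pt (x + \<rho>)) (pt x) \<le> rcut"
          using pt_in_nodes[OF far(1)[OF x]] pt_in_nodes[OF far(2)[OF x]] by simp
      qed
      then show ?thesis using F by (intro C[unfolded tri.diff_bounded_def, rule_format] finite_imageI) auto
    qed
    finally show ?thesis by simp
  qed
  then show "?h summable_on UNIV"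
    by (intro nonneg_bdd_above_summable_on bdd_aboveI[of _ "sum ?h (cube M 0) + C"]) auto
qed

text \<open>The energy is given by a sum over sites on \<open>W_c\<close> only and is elsewhere a
  continuous extension. So \<open>u\<close> is approximated in the seminorm by functions that are
  constant off a finite set and coincide with \<open>u\<close> on a prescribed ball.\<close>

lemma approximants:
  assumes e: "\<epsilon> > 0"
  obtains w c where "finite {l \<in> \<Lambda>. w l \<noteq> c}" "\<And>l. l \<in> \<Lambda> \<Longrightarrow> norm l \<le> r \<Longrightarrow> w l = u l"
    "w \<in> W_12 \<T>" "W_seminorm \<T> (\<lambda>l. w l - u l) < \<epsilon>"
proof -
  obtain C1 s where C1: "C1 \<ge> 0" "\<And>u S. tri.diff_bounded s u S \<Longrightarrow> u \<in> W_12 \<T> \<and> (W_seminorm \<T> u)\<^sup>2 \<le> C1 * S"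
    using tri.W_12_of_diff_bounded by blast
  obtain C2 where C2: "C2 \<ge> 0" "\<And>f. lst.finite_energy f \<Longrightarrow> (\<And>x. norm (pt x) < Rdef + s \<Longrightarrow> f x = 0) \<Longrightarrow>
      tri.diff_bounded s (on_lattice A f) (C2 * lst.energy f)"
    using tri.diff_bounded_on_lattice[OF lst.lattice_stencil_axioms, of s] by blast
  define e where "e = \<epsilon>\<^sup>2 / (C1 * C2 + 1)"
  have C12: "C1 * C2 + 1 > 0" using C1(1) C2(1) by (simp add: add_nonneg_pos)
  have e0: "e > 0" using \<open>\<epsilon> > 0\<close> C12 by (simp add: e_def)
  obtain M where M: "\<And>x. norm (pt x) \<le> max r (Rdef + \<bar>s\<bar>) \<Longrightarrow> x \<in> cube M 0" using bounded_in_cube by blast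
  obtain w0 c where w0: "finite {x. w0 x \<noteq> 0}" "\<And>x. x \<in> cube M 0 \<Longrightarrow> w0 x = ut x - c"
    "lst.finite_energy (\<lambda>x. ut x - w0 x)" "lst.energy (\<lambda>x. ut x - w0 x) < e"
    using lst.finite_support_approximation[OF finite_energy_ut e0, of M] by blast
  \<comment> \<open>Adding \<open>c\<close> back makes the correction vanish on the chosen cube.
    That cube covers the core and its surroundings, where \<open>ut\<close> does not record the
    values of \<open>u\<close>, so \<open>u\<close> is left untouched there.\<close>
  define f where "f = (\<lambda>x. w0 x + c - ut x)"
  have "lst.dens f = lst.dens (\<lambda>x. ut x - w0 x)"
    unfolding lst.dens_def f_def fdiff_def
    by (intro ext sum.cong refl arg_cong[where f = "\<lambda>t. t\<^sup>2"]) (metis (no_types, lifting) add_diff_cancel_left' diff_add_eq diff_diff_eq2 norm_minus_commute add.commute)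
  then have f: "lst.finite_energy f" "lst.energy f < e"
    using w0(3,4) by (auto simp: lst.finite_energy_def lst.energy_def)
  have f0: "f x = 0" if "norm (pt x) \<le> max r (Rdef + \<bar>s\<bar>)" for x
    using w0(2)[OF M[OF that]] by (simp add: f_def)
  have "tri.diff_bounded s (on_lattice A f) (C2 * lst.energy f)"
    by (rule C2(2)[OF f(1)]) (use f0 in auto)
  then have W: "on_lattice A f \<in> W_12 \<T>" "(W_seminorm \<T> (on_lattice A f))\<^sup>2 \<le> C1 * (C2 * lst.energy f)"
    using C1(2) by blast+
  define w where "w = (\<lambda>l. u l + 1 *\<^sub>R on_lattice A f l)"
  show thesis
  proof (rule that[of w c])
    have "{l \<in> \<Lambda>. w l \<noteq> c} \<subseteq> (\<Lambda> \<inter> ball 0 Rdef) \<union> pt ` {x. w0 x \<noteq> 0}"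
    proof
      fix l assume l: "l \<in> {l \<in> \<Lambda>. w l \<noteq> c}"
      show "l \<in> (\<Lambda> \<inter> ball 0 Rdef) \<union> pt ` {x. w0 x \<noteq> 0}"
      proof (cases "norm l < Rdef")
        case False
        then obtain x where x: "l = pt x" using l tri.outside[of l] by auto
        then have "w l = w0 x + c" using False by (simp add: w_def on_lattice_point[OF A] f_def ut_def)
        then show ?thesis using l x by auto
      qed (use l in auto)
    qed
    then show "finite {l \<in> \<Lambda>. w l \<noteq> c}" by (rule finite_subset) (use config_finite w0(1) in auto)
    show "w l = u l" if "l \<in> \<Lambda>" "norm l \<le> r" for l
      using f0 that(2) by (auto simp: w_def on_lattice_def inv_f_f inj_lattice_point[OF A])
    show "w \<in> W_12 \<T>" unfolding w_def by (rule tri.W_12_add[OF u_W12 W(1)])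
    have "(W_seminorm \<T> (on_lattice A f))\<^sup>2 \<le> (C1 * C2) * e"
      using W(2) f(2) C1(1) C2(1) mult_left_mono[of "lst.energy f" e "C1 * C2"] by (simp add: mult.assoc)
    also have "\<dots> < (C1 * C2 + 1) * e" using e0 by simp
    also have "\<dots> = \<epsilon>\<^sup>2" using C12 by (simp add: e_def)
    finally have "(W_seminorm \<T> (on_lattice A f))\<^sup>2 < \<epsilon>\<^sup>2" .
    then have "W_seminorm \<T> (on_lattice A f) < \<epsilon>" using e by (simp add: power2_less_imp_less)
    then show "W_seminorm \<T> (\<lambda>l. w l - u l) < \<epsilon>" by (simp add: w_def)
  qed
qed

section \<open>Locality of the energy difference and the Euler--Lagrange equation\<close>

lemma energy_finite_sum:
  assumes w: "finite {l \<in> \<Lambda>. w l \<noteq> c}"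
  shows "\<exists>B. finite B \<and> B \<subseteq> \<Lambda> \<and> (\<forall>B'. finite B' \<longrightarrow> B \<subseteq> B' \<longrightarrow> B' \<subseteq> \<Lambda> \<longrightarrow> E w = (\<Sum>l\<in>B'. V l (stencil_diff w l)))"
proof -
  obtain b where b: "\<And>l. l \<in> \<Lambda> \<Longrightarrow> w l \<noteq> c \<Longrightarrow> norm l \<le> b"
    using finite_imp_bounded[OF w] unfolding bounded_iff by blast
  define B where "B = \<Lambda> \<inter> cball 0 (b + rcut)"
  have fin: "finite B" unfolding B_def by (rule tri.finite_nodes_ball)
  have zero: "V l (stencil_diff w l) = 0" if l: "l \<in> \<Lambda>" "l \<notin> B" for l
  proof -
    have nl: "norm l > b + rcut" using l by (auto simp: B_def)
    have "stencil_diff w l \<rho> = 0" if "\<rho> \<in> R l" for \<rho>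
    proof -
      have \<rho>: "norm \<rho> < rcut" "l + \<rho> \<in> \<Lambda>" using stencil[OF l(1)] that by auto
      have "norm (l + \<rho>) > b" using nl \<rho>(1) norm_triangle_ineq4[of "l + \<rho>" \<rho>] by simp
      then have "w (l + \<rho>) = c" using b[OF \<rho>(2)] by force
      moreover have "w l = c" using b[OF l(1)] nl rcut by force
      ultimately show ?thesis by (simp add: stencil_diff_def)
    qed
    then have "V l (stencil_diff w l) = V l (\<lambda>_. 0)" by (intro depends_only_onD[OF V_stencil[OF l(1)]]) auto
    then show ?thesis using V_zero[OF l(1)] by simp
  qed
  have "w \<in> W_c \<T>" by (rule tri.W_c_of_finite[OF w])
  then have Ew: "E w = (\<Sum>\<^sub>\<infinity>l\<in>\<Lambda>. V l (stencil_diff w l))"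
    using energy triang_nodes unfolding energy_extension_def by auto
  have "E w = (\<Sum>l\<in>B'. V l (stencil_diff w l))" if "finite B'" "B \<subseteq> B'" "B' \<subseteq> \<Lambda>" for B'
    unfolding Ew infsum_finite[OF that(1), symmetric]
    by (rule infsum_cong_neutral) (use that zero in auto)
  then show ?thesis using fin by (intro exI[of _ B]) (auto simp: B_def)
qed

text \<open>Neither energy on the left need be a convergent sum over sites, but their difference is
  local. For approximants that coincide with \<open>u\<close> around \<open>S\<close> it equals the
  finite sum exactly, whatever they do far away, and continuity of the energy at \<open>u\<close>
  and at the perturbed function transfers this to the limit.\<close>

lemma energy_difference:
  assumes psi: "finite {l \<in> \<Lambda>. \<psi> l \<noteq> 0}" and S: "finite S" "S \<subseteq> \<Lambda>"
    and off: "\<And>l \<rho>. l \<in> \<Lambda> \<Longrightarrow> l \<notin> S \<Longrightarrow> \<rho> \<in> R l \<Longrightarrow> \<psi> (l + \<rho>) = \<psi> l"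
  shows "E (\<lambda>l. u l + t *\<^sub>R \<psi> l) - E u
    = (\<Sum>l\<in>S. V l (\<lambda>\<rho>. stencil_diff u l \<rho> + t *\<^sub>R stencil_diff \<psi> l \<rho>) - V l (stencil_diff u l))"
proof -
  define \<Delta> where "\<Delta> = (\<Sum>l\<in>S. V l (\<lambda>\<rho>. stencil_diff u l \<rho> + t *\<^sub>R stencil_diff \<psi> l \<rho>) - V l (stencil_diff u l))"
  let ?u = "\<lambda>l. u l + t *\<^sub>R \<psi> l"
  have u1: "?u \<in> W_12 \<T>" by (rule tri.W_12_add[OF u_W12 tri.W_12_finite_support[OF psi]])
  obtain r0 where r0: "\<And>l. l \<in> S \<Longrightarrow> norm l \<le> r0" using finite_imp_bounded[OF S(1)] unfolding bounded_iff by blast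
  have close: "\<bar>E ?u - E u - \<Delta>\<bar> \<le> 2 * \<epsilon>" if \<epsilon>: "\<epsilon> > 0" for \<epsilon>
  proof -
    have cont: "\<exists>\<delta>>0. \<forall>v\<in>W_12 \<T>. W_seminorm \<T> (\<lambda>l. v l - u' l) < \<delta> \<longrightarrow> \<bar>E v - E u'\<bar> < \<epsilon>" if "u' \<in> W_12 \<T>" for u'
      using energy that \<epsilon> unfolding energy_extension_def by blast
    obtain d1 where d1: "d1 > 0" "\<And>v. v \<in> W_12 \<T> \<Longrightarrow> W_seminorm \<T> (\<lambda>l. v l - u l) < d1 \<Longrightarrow> \<bar>E v - E u\<bar> < \<epsilon>"
      using cont[OF u_W12] by blast
    obtain d2 where d2: "d2 > 0" "\<And>v. v \<in> W_12 \<T> \<Longrightarrow> W_seminorm \<T> (\<lambda>l. v l - ?u l) < d2 \<Longrightarrow> \<bar>E v - E ?u\<bar> < \<epsilon>"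
      using cont[OF u1] by blast
    obtain w c where w: "finite {l \<in> \<Lambda>. w l \<noteq> c}" "\<And>l. l \<in> \<Lambda> \<Longrightarrow> norm l \<le> r0 + rcut \<Longrightarrow> w l = u l"
      "w \<in> W_12 \<T>" "W_seminorm \<T> (\<lambda>l. w l - u l) < min d1 d2"
      by (rule approximants[of "min d1 d2" "r0 + rcut"]) (use d1(1) d2(1) in simp, rule that)
    let ?w = "\<lambda>l. w l + t *\<^sub>R \<psi> l"
    have "{l \<in> \<Lambda>. ?w l \<noteq> c} \<subseteq> {l \<in> \<Lambda>. w l \<noteq> c} \<union> {l \<in> \<Lambda>. \<psi> l \<noteq> 0}" by auto
    then have w1: "finite {l \<in> \<Lambda>. ?w l \<noteq> c}" using w(1) psi finite_subset by blast
    obtain B1 where B1: "finite B1" "B1 \<subseteq> \<Lambda>" "\<And>B'. finite B' \<Longrightarrow> B1 \<subseteq> B' \<Longrightarrow> B' \<subseteq> \<Lambda> \<Longrightarrow> E w = (\<Sum>l\<in>B'. V l (stencil_diff w l))"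
      using energy_finite_sum[OF w(1)] by blast
    obtain B2 where B2: "finite B2" "B2 \<subseteq> \<Lambda>" "\<And>B'. finite B' \<Longrightarrow> B2 \<subseteq> B' \<Longrightarrow> B' \<subseteq> \<Lambda> \<Longrightarrow> E ?w = (\<Sum>l\<in>B'. V l (stencil_diff ?w l))"
      using energy_finite_sum[OF w1] by blast
    define B where "B = B1 \<union> B2 \<union> S"
    have B: "finite B" "B1 \<subseteq> B" "B2 \<subseteq> B" "S \<subseteq> B" "B \<subseteq> \<Lambda>" using B1 B2 S by (auto simp: B_def)
    have sd: "stencil_diff ?w l = (\<lambda>\<rho>. stencil_diff w l \<rho> + t *\<^sub>R stencil_diff \<psi> l \<rho>)" for l
      by (auto simp: stencil_diff_def algebra_simps)
    have "E ?w - E w = (\<Sum>l\<in>B. V l (stencil_diff ?w l) - V l (stencil_diff w l))"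
      using B1(3)[OF B(1,2,5)] B2(3)[OF B(1,3,5)] by (simp add: sum_subtractf)
    also have "\<dots> = (\<Sum>l\<in>S. V l (stencil_diff ?w l) - V l (stencil_diff w l))"
    proof (rule sum.mono_neutral_right[OF B(1,4)], rule ballI)
      fix l assume l: "l \<in> B - S"
      then have lL: "l \<in> \<Lambda>" using B(5) by blast
      have "V l (stencil_diff ?w l) = V l (stencil_diff w l)"
        by (rule depends_only_onD[OF V_stencil[OF lL]]) (use off[OF lL] l in \<open>auto simp: sd stencil_diff_def\<close>)
      then show "V l (stencil_diff ?w l) - V l (stencil_diff w l) = 0" by simp
    qed
    also have "\<dots> = \<Delta>"
      unfolding \<Delta>_def
    proof (rule sum.cong[OF refl])
      fix l assume l: "l \<in> S"
      then have lL: "l \<in> \<Lambda>" using S(2) by blast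
      have eq: "stencil_diff w l \<rho> = stencil_diff u l \<rho>" if "\<rho> \<in> R l" for \<rho>
      proof -
        have \<rho>: "norm \<rho> < rcut" "l + \<rho> \<in> \<Lambda>" using stencil[OF lL] that by auto
        have "norm (l + \<rho>) \<le> r0 + rcut" using r0[OF l] \<rho>(1) norm_triangle_ineq[of l \<rho>] by linarith
        moreover have "norm l \<le> r0 + rcut" using r0[OF l] rcut by linarith
        ultimately show ?thesis using w(2) \<rho>(2) lL by (simp add: stencil_diff_def)
      qed
      have "V l (stencil_diff ?w l) = V l (\<lambda>\<rho>. stencil_diff u l \<rho> + t *\<^sub>R stencil_diff \<psi> l \<rho>)"
        by (rule depends_only_onD[OF V_stencil[OF lL]]) (simp add: sd eq)
      moreover have "V l (stencil_diff w l) = V l (stencil_diff u l)"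
        by (rule depends_only_onD[OF V_stencil[OF lL]]) (simp add: eq)
      ultimately show "V l (stencil_diff ?w l) - V l (stencil_diff w l)
        = V l (\<lambda>\<rho>. stencil_diff u l \<rho> + t *\<^sub>R stencil_diff \<psi> l \<rho>) - V l (stencil_diff u l)" by simp
    qed
    finally have "E ?w - E w = \<Delta>" .
    moreover have "\<bar>E w - E u\<bar> < \<epsilon>" by (rule d1(2)[OF w(3)]) (use w(4) in simp)
    moreover have "\<bar>E ?w - E ?u\<bar> < \<epsilon>"
      by (rule d2(2)[OF tri.W_12_add[OF w(3) tri.W_12_finite_support[OF psi]]]) (use w(4) in simp)
    ultimately show ?thesis by linarith
  qed
  have "\<bar>E ?u - E u - \<Delta>\<bar> \<le> 0"
  proof (rule field_le_epsilon)
    fix e :: real assume "e > 0"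
    then show "\<bar>E ?u - E u - \<Delta>\<bar> \<le> 0 + e" using close[of "e / 2"] by simp
  qed
  then show ?thesis by (simp add: \<Delta>_def)
qed

text \<open>\<open>energy_difference\<close> holds for every \<open>t\<close>, so the derivative of
  the energy along \<open>\<psi>\<close> is that of a finite sum of site energies.\<close>

lemma euler_lagrange:
  assumes psi: "finite {l \<in> \<Lambda>. \<psi> l \<noteq> 0}" and S: "finite S" "S \<subseteq> \<Lambda>"
    and off: "\<And>l \<rho>. l \<in> \<Lambda> \<Longrightarrow> l \<notin> S \<Longrightarrow> \<rho> \<in> R l \<Longrightarrow> \<psi> (l + \<rho>) = \<psi> l"
  shows "(\<Sum>l\<in>S. first_variation (V l) (stencil_diff u l) (stencil_diff \<psi> l)) = 0"
proof -
  have E: "E (\<lambda>l. u l + t *\<^sub>R \<psi> l) = E u + (\<Sum>l\<in>S. V l (\<lambda>\<rho>. stencil_diff u l \<rho> + t *\<^sub>R stencil_diff \<psi> l \<rho>) - V l (stencil_diff u l))" for t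
    using energy_difference[OF psi S off, of t] by linarith
  have "((\<lambda>t. E u + (\<Sum>l\<in>S. V l (\<lambda>\<rho>. stencil_diff u l \<rho> + t *\<^sub>R stencil_diff \<psi> l \<rho>) - V l (stencil_diff u l)))
    has_real_derivative (0 + (\<Sum>l\<in>S. first_variation (V l) (stencil_diff u l) (stencil_diff \<psi> l) - 0))) (at 0)"
  proof (intro DERIV_add DERIV_sum DERIV_diff DERIV_const)
    fix l assume "l \<in> S"
    then have "class_C (Suc (k - 1)) (V l)" using V_smooth[of l] S(2) k by auto
    then show "((\<lambda>t. V l (\<lambda>\<rho>. stencil_diff u l \<rho> + t *\<^sub>R stencil_diff \<psi> l \<rho>)) has_real_derivative
        first_variation (V l) (stencil_diff u l) (stencil_diff \<psi> l)) (at 0)"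
      by (rule class_C_Suc_first_variation(1))
  qed
  moreover have "((\<lambda>t. E (\<lambda>l. u l + t *\<^sub>R \<psi> l)) has_real_derivative 0) (at 0)"
    using critical tri.W_12_finite_support[OF psi] unfolding critical_point_def by blast
  ultimately show ?thesis unfolding E using DERIV_unique by fastforce
qed

end

section \<open>The far equation and its nonlinear flux\<close>

lemma uniform_constants:
  fixes f h :: "'i \<Rightarrow> 'x \<Rightarrow> real" and N :: "'x \<Rightarrow> real"
  assumes "finite I" and "\<And>i. i \<in> I \<Longrightarrow> \<exists>C e. e > 0 \<and> (\<forall>x. N x \<le> e \<longrightarrow> f i x \<le> C * h i x)"
    and h: "\<And>i x. h i x \<ge> (0::real)"
  shows "\<exists>C e. C \<ge> 0 \<and> e > 0 \<and> (\<forall>i\<in>I. \<forall>x. N x \<le> e \<longrightarrow> f i x \<le> C * h i x)"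
  using assms(1,2)
proof (induction I rule: finite_induct)
  case empty then show ?case by (intro exI[of _ 0] exI[of _ 1]) auto
next
  case (insert i I)
  obtain C e where C: "C \<ge> 0" "e > 0" "\<And>j x. j \<in> I \<Longrightarrow> N x \<le> e \<Longrightarrow> f j x \<le> C * h j x"
    using insert.IH insert.prems by auto
  obtain C' e' where C': "e' > 0" "\<And>x. N x \<le> e' \<Longrightarrow> f i x \<le> C' * h i x" using insert.prems[of i] by auto
  have "f j x \<le> max C C' * h j x" if "j \<in> insert i I" "N x \<le> min e e'" for j x
  proof (cases "j = i")
    case True
    have "f i x \<le> C' * h i x" by (rule C'(2)) (use that in simp)
    also have "\<dots> \<le> max C C' * h i x" by (intro mult_right_mono h) simp
    finally show ?thesis using True by simp
  next
    case False
    have "f j x \<le> C * h j x" by (rule C(3)) (use that False in auto)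
    also have "\<dots> \<le> max C C' * h j x" by (intro mult_right_mono h) simp
    finally show ?thesis .
  qed
  then show ?case using C(1,2) C'(1) by (intro exI[of _ "max C C'"] exI[of _ "min e e'"]) auto
qed

context point_defect
begin

definition lattice_stencil_diff :: "(int^'n \<Rightarrow> real^'n) \<Rightarrow> int^'n \<Rightarrow> real^'n \<Rightarrow> real^'n" where
  "lattice_stencil_diff v x = stencil_diff (on_lattice A v) (pt x)"

lemma lattice_stencil_diff_pt: "lattice_stencil_diff v x (pt \<rho>) = fdiff \<rho> v x"
  unfolding lattice_stencil_diff_def by (rule stencil_diff_on_lattice)

lemma R0_E: assumes "s \<in> R\<^sub>0" obtains \<xi> where "\<xi> \<in> P" "s = pt \<xi>"
proof -
  have "s \<in> pt ` P" using assms by (simp only: pt_P)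
  then show thesis using that by (rule imageE)
qed

lemma sum_R0: "(\<Sum>\<rho>\<in>R\<^sub>0. h \<rho>) = (\<Sum>\<rho>\<in>P. h (pt \<rho>))"
  using sum.reindex[OF inj_on_P, of h] by (simp add: pt_P o_def)

text \<open>The nonlinear part of the stress: the remainder when \<open>\<delta>V\<close> is
  linearised at 0, in one component.\<close>

definition residual :: "int^'n \<Rightarrow> real^'n \<Rightarrow> int^'n \<Rightarrow> real" where
  "residual \<rho> b x = first_variation V\<^sub>0 (lattice_stencil_diff ut x) (stencil_unit (pt \<rho>, b))
     - first_variation V\<^sub>0 (\<lambda>_. 0) (stencil_unit (pt \<rho>, b))
     - second_variation V\<^sub>0 (\<lambda>_. 0) (lattice_stencil_diff ut x) (stencil_unit (pt \<rho>, b))"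

text \<open>Inside the cube the flux is set to 0: there the residual is not known to be small, while
  the gradients of the admissible test functions vanish. The sign is chosen so that the equation
  reads \<open>form\<close> equals \<open>flux_pair\<close>.\<close>

definition flux :: "nat \<Rightarrow> int^'n \<Rightarrow> int^'n \<Rightarrow> real^'n" where
  "flux M \<rho> x = (if x \<in> cube M 0 then 0 else - (\<Sum>b\<in>Basis. residual \<rho> b x *\<^sub>R b))"

lemma sum_stencil_basis:
  "(\<Sum>p\<in>R\<^sub>0 \<times> Basis. (lattice_stencil_diff v x (fst p) \<bullet> snd p) * h p)
    = (\<Sum>\<rho>\<in>P. \<Sum>b\<in>Basis. (fdiff \<rho> v x \<bullet> b) * h (pt \<rho>, b))"
proof -
  have "(\<Sum>p\<in>R\<^sub>0 \<times> Basis. (lattice_stencil_diff v x (fst p) \<bullet> snd p) * h p)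
    = (\<Sum>\<rho>\<in>R\<^sub>0. \<Sum>b\<in>Basis. (lattice_stencil_diff v x \<rho> \<bullet> b) * h (\<rho>, b))"
    by (simp add: sum.cartesian_product case_prod_unfold)
  then show ?thesis unfolding sum_R0 lattice_stencil_diff_pt .
qed

text \<open>Three contributions: the residual, the constant stress \<open>\<delta>V(0)\<close>,
  which summation by parts will remove, and the density of the elliptic form.\<close>

lemma first_variation_split:
  "first_variation V\<^sub>0 (lattice_stencil_diff ut x) (lattice_stencil_diff v x)
    = (\<Sum>\<rho>\<in>P. (\<Sum>b\<in>Basis. residual \<rho> b x *\<^sub>R b) \<bullet> fdiff \<rho> v x)
      + (\<Sum>\<rho>\<in>P. (\<Sum>b\<in>Basis. first_variation V\<^sub>0 (\<lambda>_. 0) (stencil_unit (pt \<rho>, b)) *\<^sub>R b) \<bullet> fdiff \<rho> v x)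
      + (\<Sum>\<rho>\<in>P. \<Sum>\<sigma>\<in>P. q \<rho> \<sigma> (fdiff \<rho> ut x) (fdiff \<sigma> v x))"
proof -
  let ?X = "lattice_stencil_diff ut x" and ?Y = "lattice_stencil_diff v x"
  note V1 = class_C_SucD[OF C2_V0]
  have comb: "(\<Sum>\<rho>\<in>P. (\<Sum>b\<in>Basis. c \<rho> b *\<^sub>R b) \<bullet> fdiff \<rho> v x) = (\<Sum>\<rho>\<in>P. \<Sum>b\<in>Basis. (fdiff \<rho> v x \<bullet> b) * c \<rho> b)" for c
    by (intro sum.cong refl) (subst inner_commute, simp add: inner_sum_right mult.commute)
  have sv: "second_variation V\<^sub>0 (\<lambda>_. 0) ?X ?Y
    = (\<Sum>\<rho>\<in>P. \<Sum>b\<in>Basis. (fdiff \<rho> v x \<bullet> b) * second_variation V\<^sub>0 (\<lambda>_. 0) ?X (stencil_unit (pt \<rho>, b)))"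
  proof -
    have "second_variation V\<^sub>0 (\<lambda>_. 0) ?X ?Y = first_variation (\<lambda>g. first_variation V\<^sub>0 g ?X) (\<lambda>_. 0) ?Y"
      unfolding second_variation_sym[OF C2_V0, of _ ?X ?Y] by (rule second_variation_eq)
    also have "\<dots> = (\<Sum>p\<in>R\<^sub>0 \<times> Basis. (?Y (fst p) \<bullet> snd p) * first_variation (\<lambda>g. first_variation V\<^sub>0 g ?X) (\<lambda>_. 0) (stencil_unit p))"
      by (rule first_variation_expand[OF class_C_Suc_first_variation(2)[OF C2_V0] finite_R0 depends_only_on_first_variation[OF V0(1)]])
    also have "\<dots> = (\<Sum>p\<in>R\<^sub>0 \<times> Basis. (?Y (fst p) \<bullet> snd p) * second_variation V\<^sub>0 (\<lambda>_. 0) ?X (stencil_unit p))"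
      unfolding second_variation_eq[symmetric] second_variation_sym[OF C2_V0, of _ ?X] ..
    finally show ?thesis unfolding sum_stencil_basis .
  qed
  have "first_variation V\<^sub>0 ?X ?Y = (\<Sum>\<rho>\<in>P. \<Sum>b\<in>Basis. (fdiff \<rho> v x \<bullet> b) * first_variation V\<^sub>0 ?X (stencil_unit (pt \<rho>, b)))"
    unfolding first_variation_expand[OF V1 finite_R0 V0(1), of ?X ?Y] sum_stencil_basis ..
  also have "\<dots> = (\<Sum>\<rho>\<in>P. \<Sum>b\<in>Basis. (fdiff \<rho> v x \<bullet> b) * residual \<rho> b x)
      + (\<Sum>\<rho>\<in>P. \<Sum>b\<in>Basis. (fdiff \<rho> v x \<bullet> b) * first_variation V\<^sub>0 (\<lambda>_. 0) (stencil_unit (pt \<rho>, b)))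
      + second_variation V\<^sub>0 (\<lambda>_. 0) ?X ?Y"
    unfolding sv residual_def by (simp add: sum.distrib[symmetric] algebra_simps)
  finally show ?thesis
    unfolding comb second_variation_q lattice_stencil_diff_pt .
qed

text \<open>Every site within \<open>Rdef + rcut\<close> has its stencil in the ball of radius
  \<open>Rdef + 2 * rcut\<close>, where the test function is constant; so the inhomogeneous site
  energies do not contribute. The margin \<open>range_bound\<close> makes the differences of
  \<open>v\<close> vanish at all sites of \<open>cube M 0\<close>, where the flux was set to
  0.\<close>

lemma far_equation:
  assumes M: "\<And>x. norm (pt x) \<le> Rdef + 2 * rcut \<Longrightarrow> x \<in> cube M 0"
    and v: "finite {x. v x \<noteq> 0}" and vc: "\<And>x. x \<in> cube (M + lst.range_bound) 0 \<Longrightarrow> v x = v 0"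
  shows "infsum (\<lambda>x. \<Sum>\<rho>\<in>P. \<Sum>\<sigma>\<in>P. q \<rho> \<sigma> (fdiff \<rho> ut x) (fdiff \<sigma> v x)) UNIV = lst.flux_pair (flux M) v"
proof -
  define T where "T = {x. x \<notin> cube M 0 \<and> (\<exists>\<rho>\<in>P. fdiff \<rho> v x \<noteq> 0)}"
  \<comment> \<open>The test function on the nodes: \<open>v\<close> at lattice points, and its
    constant value \<open>v 0\<close> throughout the core, whatever nodes the core contains.\<close>
  define \<psi> where "\<psi> l = (if l \<in> range pt \<and> norm l \<ge> Rdef then v (inv pt l) else v 0)" for l
  have "T \<subseteq> (\<Union>\<rho>\<in>P. {x. fdiff \<rho> v x \<noteq> 0})" by (auto simp: T_def)
  then have finT: "finite T" by (rule finite_subset) (use lst.fdiff_fsupp[OF v] lst.finite_stencil in blast)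
  have far: "norm (pt x) > Rdef + 2 * rcut" if "x \<notin> cube M 0" for x using M that by (meson not_le)
  have near: "fdiff \<rho> v x = 0" if "x \<in> cube M 0" "\<rho> \<in> P" for x \<rho>
  proof -
    have "x + \<rho> \<in> cube (M + lst.range_bound) 0"
      using supnorm_add[of x \<rho>] lst.supnorm_stencil[OF that(2)] that(1) by (simp add: cube_def)
    moreover have "x \<in> cube (M + lst.range_bound) 0" using that(1) by (simp add: cube_def)
    ultimately show ?thesis by (simp only: fdiff_def vc[of "x + \<rho>"] vc[of x] diff_self)
  qed
  have zero: "fdiff \<rho> v x = 0" if "x \<notin> T" "\<rho> \<in> P" for x \<rho>
    using near that unfolding T_def by blast
  have v0: "v x = v 0" if "x \<in> cube M 0" for x using vc[of x] that by (simp add: cube_def)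
  have psi_near: "\<psi> l = v 0" if l: "norm l \<le> Rdef + 2 * rcut" for l
  proof (cases "l \<in> range pt")
    case True
    then obtain x where x: "l = pt x" by blast
    have "v x = v 0" by (rule v0, rule M) (use l x in simp)
    then show ?thesis using x by (simp add: \<psi>_def inv_f_f[OF inj_lattice_point[OF A]])
  qed (simp add: \<psi>_def)
  have psi_pt: "\<psi> (pt x) = v x" for x
  proof (cases "norm (pt x) \<le> Rdef + 2 * rcut")
    case True
    then have "v x = v 0" by (intro v0 M)
    then show ?thesis using psi_near[OF True] by simp
  next
    case False
    then show ?thesis using rcut by (simp add: \<psi>_def inv_f_f[OF inj_lattice_point[OF A]])
  qed
  have TL: "pt ` T \<subseteq> \<Lambda>" using far Rdef rcut by (force simp: T_def intro!: pt_in_nodes)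
  have "{l \<in> \<Lambda>. \<psi> l \<noteq> 0} \<subseteq> (\<Lambda> \<inter> ball 0 Rdef) \<union> pt ` {x. v x \<noteq> 0}"
  proof
    fix l assume l: "l \<in> {l \<in> \<Lambda>. \<psi> l \<noteq> 0}"
    show "l \<in> (\<Lambda> \<inter> ball 0 Rdef) \<union> pt ` {x. v x \<noteq> 0}"
    proof (cases "norm l < Rdef")
      case False
      then obtain x where "l = pt x" using l tri.outside[of l] by auto
      then show ?thesis using l psi_pt by auto
    qed (use l in auto)
  qed
  then have finpsi: "finite {l \<in> \<Lambda>. \<psi> l \<noteq> 0}" by (rule finite_subset) (use config_finite v in auto)
  have off: "\<psi> (l + \<rho>) = \<psi> l" if l: "l \<in> \<Lambda>" "l \<notin> pt ` T" "\<rho> \<in> R l" for l \<rho>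
  proof (cases "norm l \<le> Rdef + rcut")
    case True
    have "norm \<rho> < rcut" using stencil[OF l(1)] l(3) by auto
    then have "norm (l + \<rho>) \<le> Rdef + 2 * rcut" using True norm_triangle_ineq[of l \<rho>] by linarith
    then show ?thesis using psi_near[of l] psi_near[of "l + \<rho>"] True rcut by simp
  next
    case False
    then obtain x where x: "l = pt x" using l(1) tri.outside[of l] rcut by auto
    have "\<rho> \<in> R\<^sub>0" using hom_stencil[OF l(1)] False rcut l(3) by simp
    then obtain \<xi> where \<xi>: "\<xi> \<in> P" "\<rho> = pt \<xi>" by (rule R0_E)
    have "fdiff \<xi> v x = 0" by (rule zero) (use l(2) x \<xi>(1) in auto)
    then show ?thesis by (simp add: x \<xi>(2) psi_pt fdiff_def flip: lattice_point_add)
  qed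
  have site: "first_variation (V (pt x)) (stencil_diff u (pt x)) (stencil_diff \<psi> (pt x))
      = first_variation V\<^sub>0 (lattice_stencil_diff ut x) (lattice_stencil_diff v x)" if "x \<in> T" for x
  proof -
    have nx: "norm (pt x) > Rdef + 2 * rcut" using far that by (auto simp: T_def)
    have V: "V (pt x) = V\<^sub>0" using hom_V[OF pt_in_nodes] nx rcut by auto
    show ?thesis unfolding V
    proof (rule first_variation_depends[OF V0(1)])
      fix \<rho> assume \<rho>: "\<rho> \<in> R\<^sub>0"
      then obtain \<xi> where \<xi>: "\<xi> \<in> P" "\<rho> = pt \<xi>" by (rule R0_E)
      have "norm \<rho> < rcut" using R0_bounded \<rho> by auto
      then have "norm (pt x + \<rho>) \<ge> Rdef"
        using nx rcut norm_triangle_ineq4[of "pt x + \<rho>" \<rho>] by simp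
      then show "stencil_diff u (pt x) \<rho> = lattice_stencil_diff ut x \<rho>"
        using nx rcut unfolding \<xi>(2) lattice_stencil_diff_pt
        by (simp add: stencil_diff_def fdiff_def ut_def lattice_point_add)
      show "stencil_diff \<psi> (pt x) \<rho> = lattice_stencil_diff v x \<rho>"
        unfolding \<xi>(2) lattice_stencil_diff_pt by (simp add: stencil_diff_def fdiff_def psi_pt flip: lattice_point_add)
    qed
  qed
  define a where "a x = (\<Sum>\<rho>\<in>P. \<Sum>\<sigma>\<in>P. q \<rho> \<sigma> (fdiff \<rho> ut x) (fdiff \<sigma> v x))" for x
  define b where "b x = (\<Sum>\<rho>\<in>P. flux M \<rho> x \<bullet> fdiff \<rho> v x)" for x
  define f0 where "f0 \<rho> = (\<Sum>b\<in>Basis. first_variation V\<^sub>0 (\<lambda>_. 0) (stencil_unit (pt \<rho>, b)) *\<^sub>R b)" for \<rho>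
  define c where "c x = (\<Sum>\<rho>\<in>P. f0 \<rho> \<bullet> fdiff \<rho> v x)" for x
  have q0: "q \<rho> \<sigma> y 0 = 0" for \<rho> \<sigma> y
    unfolding q_def by (rule bounded_bilinear.zero_right[OF bounded_bilinear_second_variation[OF C2_V0]])
  have off_T: "a x = 0" "b x = 0" "c x = 0" if "x \<notin> T" for x
    using zero[OF that] by (simp_all add: a_def b_def c_def q0)
  have to_T: "infsum f UNIV = sum f T" if "\<And>x. x \<notin> T \<Longrightarrow> f x = 0" for f :: "int^'n \<Rightarrow> real"
    by (subst infsum_finite[OF finT, symmetric], rule infsum_cong_neutral) (use that in auto)
  have c0: "sum c T = 0"
    unfolding c_def
  proof (subst sum.swap, rule sum.neutral, rule ballI)
    fix \<rho> assume \<rho>: "\<rho> \<in> P"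
    have "infsum (\<lambda>x. f0 \<rho> \<bullet> fdiff \<rho> v x) UNIV = (\<Sum>x\<in>T. f0 \<rho> \<bullet> fdiff \<rho> v x)"
      by (rule to_T) (use zero[OF _ \<rho>] in simp)
    then show "(\<Sum>x\<in>T. f0 \<rho> \<bullet> fdiff \<rho> v x) = 0" using infsum_inner_fdiff(2)[OF v] by simp
  qed
  have "0 = (\<Sum>l\<in>pt ` T. first_variation (V l) (stencil_diff u l) (stencil_diff \<psi> l))"
    by (rule euler_lagrange[OF finpsi _ TL off, symmetric]) (use finT in auto)
  also have "\<dots> = (\<Sum>x\<in>T. first_variation V\<^sub>0 (lattice_stencil_diff ut x) (lattice_stencil_diff v x))"
    by (subst sum.reindex) (auto simp: inj_on_def inj_pt site)
  also have "\<dots> = (\<Sum>x\<in>T. - b x + c x + a x)"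
  proof (rule sum.cong[OF refl])
    fix x assume "x \<in> T"
    then have "x \<notin> cube M 0" by (simp add: T_def)
    then have "- b x = (\<Sum>\<rho>\<in>P. (\<Sum>b\<in>Basis. residual \<rho> b x *\<^sub>R b) \<bullet> fdiff \<rho> v x)"
      by (simp add: b_def flux_def sum_negf)
    then show "first_variation V\<^sub>0 (lattice_stencil_diff ut x) (lattice_stencil_diff v x) = - b x + c x + a x"
      unfolding first_variation_split a_def c_def f0_def by simp
  qed
  also have "\<dots> = sum a T - sum b T" by (simp only: sum.distrib sum_negf c0)
  finally have "sum a T = sum b T" by simp
  then show ?thesis unfolding lst.flux_pair_def using to_T[OF off_T(1)] to_T[OF off_T(2)] by (simp add: a_def b_def)
qed

text \<open>The two terms subtracted in \<open>residual\<close> are exactly the Taylor terms of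
  degree 0 and 1, so the expansion starts with degree 2. The order is at most \<open>k - 1\<close>
  because one derivative has gone into the first variation.\<close>

lemma residual_taylor:
  assumes n: "2 \<le> n" "n \<le> k - 1"
  shows "\<exists>c C e. e > 0 \<and> (\<forall>x. (\<Sum>\<sigma>\<in>P. norm (fdiff \<sigma> ut x)) \<le> e \<longrightarrow>
    \<bar>residual \<rho> b x - (\<Sum>i\<in>{2..<n}. \<Sum>ps\<in>index_lists (R\<^sub>0 \<times> Basis) i.
        c ps * stencil_monomial (lattice_stencil_diff ut x) ps)\<bar>
      \<le> C * (\<Sum>\<sigma>\<in>P. norm (fdiff \<sigma> ut x)) ^ n)"
proof -
  let ?U = "stencil_unit (pt \<rho>, b)"
  let ?G = "\<lambda>g. first_variation V\<^sub>0 g ?U"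
  let ?I = "R\<^sub>0 \<times> (Basis :: (real^'n) set)"
  have "class_C (Suc n) V\<^sub>0" by (rule class_C_mono[OF V0(2)]) (use n k in simp)
  then have CG: "class_C n ?G" by (rule class_C_Suc_first_variation(2))
  have CG1: "class_C (Suc 0) ?G" by (rule class_C_mono[OF CG]) (use n in simp)
  note DG = depends_only_on_first_variation[OF V0(1), of ?U]
  obtain c C e where t0: "e > 0" "n \<ge> 1 \<longrightarrow> c [] = ?G (\<lambda>_. 0)"
    "n \<ge> 2 \<longrightarrow> (\<forall>p\<in>?I. c [p] = first_variation ?G (\<lambda>_. 0) (stencil_unit p))"
    "\<forall>X. (\<forall>s\<in>R\<^sub>0. norm (X s) \<le> e) \<longrightarrow>
      \<bar>?G X - (\<Sum>i<n. \<Sum>ps\<in>index_lists ?I i. c ps * stencil_monomial X ps)\<bar> \<le> C * (\<Sum>s\<in>R\<^sub>0. norm (X s)) ^ n"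
    using taylor_stencil[OF finite_R0 DG CG] by (elim exE conjE) (rule that)
  have t: "e > 0" "c [] = ?G (\<lambda>_. 0)" "\<And>p. p \<in> ?I \<Longrightarrow> c [p] = first_variation ?G (\<lambda>_. 0) (stencil_unit p)"
    "\<And>X. (\<forall>s\<in>R\<^sub>0. norm (X s) \<le> e) \<Longrightarrow>
      \<bar>?G X - (\<Sum>i<n. \<Sum>ps\<in>index_lists ?I i. c ps * stencil_monomial X ps)\<bar> \<le> C * (\<Sum>s\<in>R\<^sub>0. norm (X s)) ^ n"
    using t0(1) t0(2)[rule_format] t0(3)[rule_format] t0(4)[rule_format] n by fastforce+
  have split: "(\<Sum>i<n. h i) = h 0 + h 1 + (\<Sum>i\<in>{2..<n}. h i)" for h :: "nat \<Rightarrow> real"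
  proof -
    have "{..<n} = {0, 1} \<union> {2..<n}" using n by auto
    then show ?thesis by (simp add: sum.union_disjoint)
  qed
  have nil: "index_lists ?I 0 = {[]}" by auto
  have one: "(\<Sum>ps\<in>index_lists ?I 1. h ps) = (\<Sum>p\<in>?I. h [p])" for h :: "_ \<Rightarrow> real"
    using sum_index_lists_Suc[of h ?I 0] unfolding nil by simp
  have "residual \<rho> b x - (\<Sum>i\<in>{2..<n}. \<Sum>ps\<in>index_lists ?I i. c ps * stencil_monomial (lattice_stencil_diff ut x) ps)
     = ?G (lattice_stencil_diff ut x) - (\<Sum>i<n. \<Sum>ps\<in>index_lists ?I i. c ps * stencil_monomial (lattice_stencil_diff ut x) ps)" for x
  proof -
    let ?X = "lattice_stencil_diff ut x"
    have "second_variation V\<^sub>0 (\<lambda>_. 0) ?X ?U = (\<Sum>p\<in>?I. (?X (fst p) \<bullet> snd p) * first_variation ?G (\<lambda>_. 0) (stencil_unit p))"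
      unfolding second_variation_eq by (rule first_variation_expand[OF CG1 finite_R0 DG])
    also have "\<dots> = (\<Sum>ps\<in>index_lists ?I 1. c ps * stencil_monomial ?X ps)"
      unfolding one by (rule sum.cong[OF refl]) (simp add: t(3) stencil_monomial_def mult.commute)
    finally have sv: "second_variation V\<^sub>0 (\<lambda>_. 0) ?X ?U = (\<Sum>ps\<in>index_lists ?I 1. c ps * stencil_monomial ?X ps)" .
    have "(\<Sum>ps\<in>index_lists ?I 0. c ps * stencil_monomial ?X ps) = ?G (\<lambda>_. 0)"
      unfolding nil by (simp add: t(2) stencil_monomial_def)
    then show ?thesis unfolding split residual_def sv by simp
  qed
  moreover have "\<bar>?G (lattice_stencil_diff ut x) - (\<Sum>i<n. \<Sum>ps\<in>index_lists ?I i. c ps * stencil_monomial (lattice_stencil_diff ut x) ps)\<bar>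
      \<le> C * (\<Sum>\<sigma>\<in>P. norm (fdiff \<sigma> ut x)) ^ n" if x: "(\<Sum>\<sigma>\<in>P. norm (fdiff \<sigma> ut x)) \<le> e" for x
  proof -
    have "norm (lattice_stencil_diff ut x s) \<le> e" if s: "s \<in> R\<^sub>0" for s
    proof -
      obtain \<xi> where \<xi>: "\<xi> \<in> P" "s = pt \<xi>" by (rule R0_E[OF s])
      have "norm (fdiff \<xi> ut x) \<le> (\<Sum>\<sigma>\<in>P. norm (fdiff \<sigma> ut x))"
        using lst.finite_stencil \<xi>(1) by (intro member_le_sum) auto
      then show ?thesis using x by (simp add: \<xi>(2) lattice_stencil_diff_pt)
    qed
    then have "\<forall>s\<in>R\<^sub>0. norm (lattice_stencil_diff ut x s) \<le> e" by blast
    from t(4)[OF this] show ?thesis unfolding sum_R0 lattice_stencil_diff_pt .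
  qed
  ultimately show ?thesis using t(1) by (intro exI[of _ c] exI[of _ C] exI[of _ e]) auto
qed

lemma sum_norm_sq_le_dens: "(\<Sum>\<sigma>\<in>P. norm (fdiff \<sigma> ut x))\<^sup>2 \<le> card P * lst.dens ut x"
proof -
  have "(\<Sum>\<sigma>\<in>P. norm (fdiff \<sigma> ut x) * 1)\<^sup>2 \<le> (\<Sum>\<sigma>\<in>P. (norm (fdiff \<sigma> ut x))\<^sup>2) * (\<Sum>\<sigma>\<in>P. 1\<^sup>2)"
    by (rule Cauchy_Schwarz_ineq_sum)
  then show ?thesis by (simp add: lst.dens_def mult.commute)
qed

text \<open>The expansion of order 2 has no polynomial part left. It is valid for small stencils
  only, and off a large cube they are small because the energy density is summable.\<close>

lemma residual_quadratic:
  "\<exists>C\<ge>0. \<exists>M. \<forall>x. x \<notin> cube M 0 \<longrightarrow> (\<forall>\<rho>\<in>P. \<forall>b\<in>Basis. \<bar>residual \<rho> b x\<bar> \<le> C * lst.dens ut x)"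
proof -
  let ?N = "\<lambda>x. \<Sum>\<sigma>\<in>P. norm (fdiff \<sigma> ut x)"
  let ?I = "P \<times> (Basis :: (real^'n) set)"
  have "\<exists>C e. C \<ge> 0 \<and> e > 0 \<and> (\<forall>p\<in>?I. \<forall>x. ?N x \<le> e \<longrightarrow> \<bar>residual (fst p) (snd p) x\<bar> \<le> C * (?N x)\<^sup>2)"
  proof (rule uniform_constants)
    show "finite ?I" using lst.finite_stencil by simp
    show "\<exists>C e. e > 0 \<and> (\<forall>x. ?N x \<le> e \<longrightarrow> \<bar>residual (fst p) (snd p) x\<bar> \<le> C * (?N x)\<^sup>2)" for p
      using residual_taylor[of 2 "fst p" "snd p"] k by auto
  qed simp
  then obtain C e where C: "C \<ge> 0" "e > 0"
    "\<And>p x. p \<in> ?I \<Longrightarrow> ?N x \<le> e \<Longrightarrow> \<bar>residual (fst p) (snd p) x\<bar> \<le> C * (?N x)\<^sup>2" by blast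
  define e' where "e' = e\<^sup>2 / (card P + 1)"
  have e': "e' > 0" using C(2) by (simp add: e'_def add_nonneg_pos)
  obtain M where M: "infsum (lst.dens ut) (- cube M 0) < e'"
    using summable_tail[OF _ _ e', of "lst.dens ut"] finite_energy_ut by (auto simp: lst.finite_energy_def)
  have "\<bar>residual \<rho> b x\<bar> \<le> C * card P * lst.dens ut x" if x: "x \<notin> cube M 0" and p: "\<rho> \<in> P" "b \<in> Basis" for \<rho> b x
  proof -
    have sm: "lst.dens ut summable_on - cube M 0"
      using finite_energy_ut unfolding lst.finite_energy_def by (rule summable_on_subset_banach) simp
    have "sum (lst.dens ut) {x} \<le> infsum (lst.dens ut) (- cube M 0)"
      by (rule finite_sum_le_infsum[OF sm]) (use x in auto)
    then have "lst.dens ut x < e'" using M by simp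
    then have "card P * lst.dens ut x \<le> (card P + 1) * e'" by (intro mult_mono) auto
    also have "\<dots> = e\<^sup>2" by (simp add: e'_def field_simps add_nonneg_eq_0_iff)
    finally have "(?N x)\<^sup>2 \<le> e\<^sup>2" using sum_norm_sq_le_dens[of x] by linarith
    then have "?N x \<le> e" by (rule power2_le_imp_le) (use C(2) in simp)
    then have "\<bar>residual \<rho> b x\<bar> \<le> C * (?N x)\<^sup>2" using C(3)[of "(\<rho>, b)" x] p by simp
    also have "\<dots> \<le> C * (card P * lst.dens ut x)" by (intro mult_left_mono sum_norm_sq_le_dens C(1))
    finally show ?thesis by (simp add: mult.assoc)
  qed
  then show ?thesis using C(1) by (intro exI[of _ "C * card P"] conjI exI[of _ M]) auto
qed

text \<open>Expansion of order \<open>k - 1\<close>. The monomials have degree at least 2 and are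
  covered by the product rule, at twice the base rate. No differences of the remainder are
  controlled, but it is so small that \<open>decays_of_bound\<close> applies.\<close>

lemma residual_decays:
  assumes m: "m < k - 3" and dec: "\<And>\<sigma>. \<sigma> \<in> P \<Longrightarrow> lst.decays CARD('n) m (fdiff \<sigma> ut)"
  shows "lst.decays (2 * CARD('n)) m (residual \<rho> b)"
proof -
  let ?d = "CARD('n)"
  let ?I = "R\<^sub>0 \<times> (Basis :: (real^'n) set)"
  let ?N = "\<lambda>x. \<Sum>\<sigma>\<in>P. norm (fdiff \<sigma> ut x)"
  let ?X = "lattice_stencil_diff ut"
  have "2 \<le> k - 1" "k - 1 \<le> k - 1" using k by auto
  from residual_taylor[OF this, of \<rho> b] obtain c C e where t0: "e > 0" "\<forall>x. ?N x \<le> e \<longrightarrow>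
    \<bar>residual \<rho> b x - (\<Sum>i\<in>{2..<k-1}. \<Sum>ps\<in>index_lists ?I i. c ps * stencil_monomial (?X x) ps)\<bar> \<le> C * ?N x ^ (k - 1)"
    by (elim exE conjE) (rule that)
  note t = t0(1) t0(2)[rule_format]
  define pol where "pol x = (\<Sum>i\<in>{2..<k-1}. \<Sum>ps\<in>index_lists ?I i. c ps * stencil_monomial (?X x) ps)" for x
  have pol: "lst.decays (2 * ?d) m pol"
    unfolding pol_def
  proof (intro lst.decays_sum)
    fix i ps assume i: "i \<in> {2..<k-1}" and ps: "ps \<in> index_lists ?I i"
    have "lst.decays ?d m (\<lambda>x. ?X x (fst p) \<bullet> snd p)" if "p \<in> ?I" for p
    proof -
      have "fst p \<in> R\<^sub>0" using that by auto
      then obtain \<xi> where \<xi>: "\<xi> \<in> P" "fst p = pt \<xi>" by (rule R0_E)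
      show ?thesis unfolding \<xi>(2) lattice_stencil_diff_pt
        by (rule lst.decays_bounded_linear[OF dec[OF \<xi>(1)] bounded_linear_inner_left])
    qed
    then have "lst.decays (length ps * ?d) m (\<lambda>x. stencil_monomial (?X x) ps)"
      by (rule lst.decays_stencil_monomial) (use ps i in auto)
    then have "lst.decays (2 * ?d) m (\<lambda>x. stencil_monomial (?X x) ps)"
      by (rule lst.decays_mono) (use ps i in auto)
    then show "lst.decays (2 * ?d) m (\<lambda>x. c ps * stencil_monomial (?X x) ps)"
      by (rule lst.decays_bounded_linear) (rule bounded_linear_mult_right)
  qed
  have "lst.decays (2 * ?d) m (\<lambda>x. residual \<rho> b x - pol x)"
  proof (rule lst.decays_of_bound)
    obtain K R1 where K: "K > 0" "\<And>\<sigma> \<rho>s x. \<sigma> \<in> P \<Longrightarrow> set \<rho>s \<subseteq> P \<Longrightarrow> length \<rho>s \<le> m \<Longrightarrow> supnorm x \<ge> R1 \<Longrightarrow>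
        norm (lst.idiff \<rho>s (fdiff \<sigma> ut) x) \<le> K / real (supnorm x) ^ (?d + length \<rho>s)"
      by (rule lst.decays_uniform[OF dec]) (assumption, rule that)
    define K' where "K' = card P * K"
    have N: "?N x \<le> K' / real (supnorm x) ^ ?d" if "supnorm x \<ge> R1" for x
    proof -
      have "?N x \<le> (\<Sum>\<sigma>\<in>P. K / real (supnorm x) ^ ?d)"
        by (rule sum_mono) (use K(2)[of _ "[]" x] that in auto)
      then show ?thesis by (simp add: K'_def)
    qed
    have K'0: "K' \<ge> 0" using K(1) by (simp add: K'_def)
    obtain R2 :: nat where R2: "real R2 \<ge> K' / e" using real_arch_simple by blast
    have bound: "norm (residual \<rho> b x - pol x) \<le> \<bar>C\<bar> * K' ^ (k - 1) / real (supnorm x) ^ (2 * ?d + m)"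
      if x: "supnorm x \<ge> max (max R1 R2) 1" for x
    proof -
      let ?s = "real (supnorm x)"
      have s1: "?s \<ge> 1" "supnorm x \<ge> R1" "supnorm x \<ge> R2" using x by auto
      have N0: "?N x \<ge> 0" by (intro sum_nonneg) auto
      have pw: "?s ^ ?d \<ge> ?s" using s1(1) self_le_power[of ?s ?d] by simp
      have "K' / e \<le> ?s ^ ?d" using R2 s1(3) pw by linarith
      then have "K' / ?s ^ ?d \<le> e" using t(1) s1(1) by (simp add: field_simps)
      then have "?N x \<le> e" using N[OF s1(2)] by linarith
      then have "norm (residual \<rho> b x - pol x) \<le> C * ?N x ^ (k - 1)" using t(2)[of x] by (simp add: pol_def)
      also have "\<dots> \<le> \<bar>C\<bar> * ?N x ^ (k - 1)" using N0 by (intro mult_right_mono) auto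
      also have "\<dots> \<le> \<bar>C\<bar> * (K' / ?s ^ ?d) ^ (k - 1)" by (intro mult_left_mono power_mono N[OF s1(2)] N0) auto
      also have "\<dots> = \<bar>C\<bar> * K' ^ (k - 1) / ?s ^ (?d * (k - 1))" by (simp add: power_divide power_mult)
      also have "\<dots> \<le> \<bar>C\<bar> * K' ^ (k - 1) / ?s ^ (2 * ?d + m)"
      proof (intro divide_left_mono power_increasing)
        have "k - 1 = 2 + (k - 3)" using k by simp
        then have "?d * (k - 1) = 2 * ?d + ?d * (k - 3)" by (simp add: algebra_simps)
        moreover have "?d * (k - 3) \<ge> k - 3" using dim by simp
        ultimately show "2 * ?d + m \<le> ?d * (k - 1)" using m by linarith
      qed (use s1(1) K'0 in auto)
      finally show ?thesis .
    qed
    then show "lst.decays (2 * ?d + m) 0 (\<lambda>x. residual \<rho> b x - pol x)"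
      unfolding lst.decays_0 by (intro exI[of _ "\<bar>C\<bar> * K' ^ (k - 1)"] exI[of _ "max (max R1 R2) 1"]) blast
  qed
  from lst.decays_add[OF this pol] show ?thesis by simp
qed

lemma flux_decays:
  assumes "m < k - 3" "\<And>\<sigma>. \<sigma> \<in> P \<Longrightarrow> lst.decays CARD('n) m (fdiff \<sigma> ut)"
  shows "lst.decays (2 * CARD('n)) m (flux M \<rho>)"
proof (rule lst.decays_cong_far)
  show "lst.decays (2 * CARD('n)) m (\<lambda>x. \<Sum>b\<in>Basis. residual \<rho> b x *\<^sub>R - b)"
    by (intro lst.decays_sum lst.decays_bounded_linear[OF residual_decays[OF assms]] bounded_linear_scaleR_left)
  show "(\<Sum>b\<in>Basis. residual \<rho> b x *\<^sub>R - b) = flux M \<rho> x" if "supnorm x \<ge> Suc M" for x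
    using that by (simp add: flux_def cube_def sum_negf)
qed

lemma flux_quadratic:
  fixes C :: real
  assumes C: "C \<ge> 0" "\<And>x \<rho> b. x \<notin> cube M 0 \<Longrightarrow> \<rho> \<in> P \<Longrightarrow> b \<in> Basis \<Longrightarrow> \<bar>residual \<rho> b x\<bar> \<le> C * lst.dens ut x"
  shows "lst.flux_dens (flux M) x \<le> card P * (CARD('n) * C)\<^sup>2 * (lst.dens ut x)\<^sup>2"
proof (cases "x \<in> cube M 0")
  case True
  then show ?thesis by (simp add: lst.flux_dens_def flux_def)
next
  case False
  have "norm (flux M \<rho> x) \<le> CARD('n) * C * lst.dens ut x" if "\<rho> \<in> P" for \<rho>
  proof -
    have "norm (flux M \<rho> x) = norm (\<Sum>b\<in>Basis. residual \<rho> b x *\<^sub>R b)" using False by (simp add: flux_def)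
    also have "\<dots> \<le> (\<Sum>b\<in>(Basis :: (real^'n) set). C * lst.dens ut x)"
      by (rule sum_norm_le) (use C(2)[OF False that] in simp)
    finally show ?thesis by (simp add: mult.assoc)
  qed
  then have "lst.flux_dens (flux M) x \<le> (\<Sum>\<rho>\<in>P. (CARD('n) * C * lst.dens ut x)\<^sup>2)"
    unfolding lst.flux_dens_def by (intro sum_mono power_mono) auto
  then show ?thesis by (simp add: power_mult_distrib)
qed

end

section \<open>Back to the node set\<close>

context point_defect
begin

lemma lattice_differences_decay:
  assumes "j \<le> k - 3" "\<sigma> \<in> P" shows "lst.decays CARD('n) j (fdiff \<sigma> ut)"
proof -
  obtain c0 where c0: "c0 > 0" "\<And>v. finite {x. v x \<noteq> 0} \<Longrightarrow>
     infsum (\<lambda>x. \<Sum>\<rho>\<in>P. \<Sum>\<sigma>\<in>P. q \<rho> \<sigma> (fdiff \<rho> v x) (fdiff \<sigma> v x)) UNIV \<ge> c0 * lst.energy v"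
    using coercivity by blast
  obtain M1 where M1: "\<And>x. norm (pt x) \<le> Rdef + 2 * rcut \<Longrightarrow> x \<in> cube M1 0" using bounded_in_cube by blast
  obtain C M2 where C: "C \<ge> 0"
    "\<And>x \<rho> b. x \<notin> cube M2 0 \<Longrightarrow> \<rho> \<in> P \<Longrightarrow> b \<in> Basis \<Longrightarrow> \<bar>residual \<rho> b x\<bar> \<le> C * lst.dens ut x"
    using residual_quadratic by blast
  define M where "M = max M1 M2"
  have M: "cube M1 0 \<subseteq> cube M 0" "cube M2 0 \<subseteq> cube M 0" unfolding M_def by (auto simp: cube_def)
  interpret elliptic_form P q c0
  proof (intro elliptic_form.intro lst.lattice_stencil_axioms elliptic_form_axioms.intro)
    show "bounded_bilinear (q \<rho> \<sigma>)" for \<rho> \<sigma>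
      unfolding q_def by (rule bounded_bilinear_second_variation[OF C2_V0])
    show "q \<rho> \<sigma> x y = q \<sigma> \<rho> y x" for \<rho> \<sigma> x y unfolding q_def by (rule second_variation_sym[OF C2_V0])
  qed (fact c0)+
  interpret far_field P q c0 ut "flux M" "M + lst.range_bound" "k - 3" "card P * (CARD('n) * C)\<^sup>2"
  proof
    show "CARD('n) \<ge> 2" by (rule dim)
    show "lst.finite_energy ut" by (rule finite_energy_ut)
    show "form ut v = lst.flux_pair (flux M) v"
      if "finite {x. v x \<noteq> 0}" "\<And>x. x \<in> cube (M + lst.range_bound) 0 \<Longrightarrow> v x = v 0" for v
      unfolding form_def form_dens_def by (rule far_equation[OF _ that]) (use M1 M in blast)+
    show "lst.flux_dens (flux M) x \<le> card P * (CARD('n) * C)\<^sup>2 * (lst.dens ut x)\<^sup>2" for x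
      by (rule flux_quadratic[OF C(1)]) (use C(2) M in blast)
    show "lst.decays (2 * CARD('n)) m (flux M \<rho>)"
      if "m < k - 3" "\<And>\<sigma>. \<sigma> \<in> P \<Longrightarrow> lst.decays CARD('n) m (fdiff \<sigma> ut)" for m \<rho>
      by (rule flux_decays[OF that])
  qed
  show ?thesis by (rule decays_all[OF assms])
qed

text \<open>Each difference moves by less than \<open>rcut\<close>, so at the stated distance no
  site reached by the iterated difference lies in the core, where \<open>ut\<close> differs from
  \<open>u\<close>.\<close>

lemma iter_diff_pt:
  assumes "norm (pt x) \<ge> Rdef + length \<rho>s * rcut" "set \<rho>s \<subseteq> P"
  shows "iter_diff (map pt \<rho>s) u (pt x) = lst.idiff \<rho>s ut x"
  using assms
proof (induction \<rho>s arbitrary: x)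
  case Nil then show ?case by (simp add: ut_def)
next
  case (Cons \<rho> \<rho>s)
  have \<rho>: "norm (pt \<rho>) < rcut" using Cons.prems(2) R0_bounded by (auto simp: P_def)
  have x: "norm (pt x) \<ge> Rdef + length \<rho>s * rcut + rcut" using Cons.prems(1) by (simp add: algebra_simps)
  then have "norm (pt (x + \<rho>)) \<ge> Rdef + length \<rho>s * rcut"
    using \<rho> norm_triangle_ineq4[of "pt (x + \<rho>)" "pt \<rho>"] by (simp add: lattice_point_add)
  moreover have "norm (pt x) \<ge> Rdef + length \<rho>s * rcut" using x rcut by simp
  ultimately show ?case using Cons.IH[of x] Cons.IH[of "x + \<rho>"] Cons.prems(2)
    by (simp add: fdiff_def lattice_point_add)
qed

lemma stencil_list_E:
  assumes "set \<rho>s \<subseteq> R\<^sub>0" obtains \<tau>s where "set \<tau>s \<subseteq> P" "\<rho>s = map pt \<tau>s"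
proof -
  have "\<rho>s \<in> map pt ` lists P" unfolding lists_image[symmetric] using assms by (simp only: pt_P in_lists_conv_set subset_iff) blast
  then show thesis using that by (auto simp: lists_eq_set)
qed

text \<open>A j-fold difference is a first difference followed by j - 1 <= k - 3 further ones, so
  its lattice rate is d + (j - 1). It remains to pass from the maximum norm of integer coordinates
  to the Euclidean norm in space.\<close>

theorem critical_point_decay:
  "\<exists>C>0. \<exists>uinf. \<exists>r>0. \<forall>l\<in>\<Lambda>. norm l \<ge> r \<longrightarrow>
      (\<forall>j\<in>{1..k - 2}.
         iter_diff_norm (R l) j u l \<le> C * norm l powi (1 - int CARD('n) - int j)) \<and>
      norm (u l - uinf) \<le> C * norm l powi (1 - int CARD('n))"
proof -
  let ?d = "CARD('n)"
  obtain K R1 where K: "K > 0" "\<And>\<sigma> \<rho>s x. \<sigma> \<in> P \<Longrightarrow> set \<rho>s \<subseteq> P \<Longrightarrow> length \<rho>s \<le> k - 3 \<Longrightarrow> supnorm x \<ge> R1 \<Longrightarrow>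
      norm (lst.idiff \<rho>s (fdiff \<sigma> ut) x) \<le> K / real (supnorm x) ^ (?d + length \<rho>s)"
    by (rule lst.decays_uniform[OF lattice_differences_decay[OF order_refl]]) (assumption, rule that)
  \<comment> \<open>The maximum with 1 excludes the origin, where the bounds would divide by
    0.\<close>
  define R2 where "R2 = max R1 1"
  have R2: "R2 \<ge> 1" by (simp add: R2_def)
  have axis: "norm (fdiff (axis i 1) ut x) \<le> K / real (supnorm x) ^ ?d" if "supnorm x \<ge> R2" for i x
    using K(2)[OF lst.axis_stencil[of i], of "[]" x] that by (simp add: R2_def)
  obtain uinf K' where K': "K' > 0" "\<And>x. supnorm x \<ge> R2 \<Longrightarrow> norm (ut x - uinf) \<le> K' / real (supnorm x) ^ (?d - 1)"
    by (rule limit_at_infinity[OF dim less_imp_le[OF K(1)] R2 axis]) (assumption, rule that)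
  obtain L0 where L0: "L0 > 0" "\<And>x. norm (pt x) \<le> L0 * real (supnorm x)" by (rule pt_bounds) (rule that)
  define L where "L = max 1 L0"
  have L: "L \<ge> 1" "norm (pt x) \<le> L * real (supnorm x)" for x
    using L0(2)[of x] mult_right_mono[of L0 L "real (supnorm x)"] by (auto simp: L_def)
  define r where "r = Rdef + real k * rcut + L * R2"
  define N where "N = (\<Sum>j\<le>k. card (index_lists R\<^sub>0 j))"
  \<comment> \<open>All exponents that occur are at most d + k and L >= 1, so one power of
    \<open>L\<close> serves every conversion of norms. \<open>N\<close> bounds the number of
    difference lists, since the Euclidean norm of a collection is at most the sum of its
    entries.\<close>
  define C where "C = (N * K + K') * L ^ (?d + k)"
  have convert: "B / real (supnorm x) ^ a \<le> B * L ^ (?d + k) * norm (pt x) powi (- int a)"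
    if "B \<ge> 0" "supnorm x \<ge> R2" "norm (pt x) > 0" "a \<le> ?d + k" for B a x
  proof -
    have s: "real (supnorm x) > 0" using that(2) by (simp add: R2_def)
    have "norm (pt x) ^ a \<le> (L * real (supnorm x)) ^ a" by (rule power_mono[OF L(2)]) simp
    also have "\<dots> \<le> L ^ (?d + k) * real (supnorm x) ^ a"
      unfolding power_mult_distrib by (intro mult_right_mono power_increasing that(4) L(1)) simp
    finally have "B * norm (pt x) ^ a \<le> B * (L ^ (?d + k) * real (supnorm x) ^ a)" by (rule mult_left_mono[OF _ that(1)])
    then show ?thesis using s that(3) by (simp add: power_int_minus divide_simps mult_ac)
  qed
  have "(\<forall>j\<in>{1..k - 2}. iter_diff_norm (R l) j u l \<le> C * norm l powi (1 - int ?d - int j)) \<and>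
      norm (u l - uinf) \<le> C * norm l powi (1 - int ?d)"
    if l: "l \<in> \<Lambda>" "norm l \<ge> r" for l
  proof -
    have LR: "L * R2 \<ge> 1" using mult_mono[of 1 L 1 "real R2"] L(1) by (simp add: R2_def)
    have l': "norm l \<ge> Rdef + real k * rcut" "norm l \<ge> L * R2" "norm l \<ge> Rdef" "norm l > 0"
      using l(2) LR Rdef rcut unfolding r_def by (smt (verit) mult_nonneg_nonneg of_nat_0_le_iff)+
    obtain x where x: "l = pt x" using l(1) l'(3) tri.outside[of l] by auto
    have "L * R2 \<le> L * real (supnorm x)" using l'(2) L(2)[of x] unfolding x by linarith
    then have s: "supnorm x \<ge> R2" using L(1) by simp
    have Rl: "R l = R\<^sub>0" by (rule hom_stencil[OF l(1) l'(3)])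
    have pos: "norm l powi a \<ge> 0" for a by (rule zero_le_power_int) simp
    have j: "iter_diff_norm (R l) j u l \<le> C * norm l powi (1 - int ?d - int j)" if j: "j \<in> {1..k - 2}" for j
    proof -
      have "norm (iter_diff \<rho>s u l) \<le> K / real (supnorm x) ^ (?d + (j - 1))"
        if \<rho>s: "\<rho>s \<in> index_lists R\<^sub>0 j" for \<rho>s
      proof -
        have "set \<rho>s \<subseteq> R\<^sub>0" using \<rho>s by simp
        then obtain \<tau>s where \<tau>s: "set \<tau>s \<subseteq> P" "\<rho>s = map pt \<tau>s" by (rule stencil_list_E)
        have len: "length \<tau>s = j" using \<rho>s \<tau>s(2) by simp
        then obtain \<sigma> \<tau>' where \<sigma>: "\<tau>s = \<sigma> # \<tau>'" using j by (cases \<tau>s) auto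
        have "j * rcut \<le> k * rcut" using j rcut by (intro mult_right_mono) auto
        then have "iter_diff \<rho>s u l = lst.idiff \<tau>s ut x"
          unfolding \<tau>s(2) x by (intro iter_diff_pt \<tau>s(1)) (use l'(1) x len in simp)
        also have "\<dots> = lst.idiff \<tau>' (fdiff \<sigma> ut) x" by (simp add: \<sigma> lst.idiff_fdiff)
        finally show ?thesis
          using K(2)[of \<sigma> \<tau>' x] \<tau>s(1) \<sigma> len s j by (auto simp: R2_def)
      qed
      then have "(\<Sum>\<rho>s\<in>index_lists R\<^sub>0 j. norm (iter_diff \<rho>s u l)) \<le> (\<Sum>\<rho>s\<in>index_lists R\<^sub>0 j. K / real (supnorm x) ^ (?d + (j - 1)))"
        by (rule sum_mono)
      also have "\<dots> = card (index_lists R\<^sub>0 j) * K / real (supnorm x) ^ (?d + (j - 1))" by simp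
      also have "\<dots> \<le> (card (index_lists R\<^sub>0 j) * K) * L ^ (?d + k) * norm l powi (- int (?d + (j - 1)))"
        unfolding x by (rule convert) (use K(1) s l'(4) x j in auto)
      also have "\<dots> \<le> C * norm l powi (- int (?d + (j - 1)))"
      proof (rule mult_right_mono[OF _ pos])
        have "card (index_lists R\<^sub>0 j) \<le> N" unfolding N_def using j by (intro member_le_sum) auto
        then have "card (index_lists R\<^sub>0 j) * K \<le> N * K" using K(1) by (intro mult_right_mono) auto
        then show "card (index_lists R\<^sub>0 j) * K * L ^ (?d + k) \<le> C"
          unfolding C_def using K'(1) L(1) by (intro mult_right_mono) auto
      qed
      also have "- int (?d + (j - 1)) = 1 - int ?d - int j" using j by (simp add: of_nat_diff)
      finally show ?thesis
        unfolding iter_diff_norm_def Rl by (intro order_trans[OF L2_set_le_sum]) auto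
    qed
    have "norm (u l - uinf) \<le> K' / real (supnorm x) ^ (?d - 1)"
      using K'(2)[OF s] l'(3) by (simp add: ut_def x)
    also have "\<dots> \<le> K' * L ^ (?d + k) * norm l powi (- int (?d - 1))"
      unfolding x by (rule convert) (use K'(1) s l'(4) x in auto)
    also have "\<dots> \<le> C * norm l powi (- int (?d - 1))"
      unfolding C_def using K(1) L(1) by (intro mult_right_mono pos) auto
    also have "- int (?d - 1) = 1 - int ?d" using dim by (simp add: of_nat_diff)
    finally show ?thesis using j by blast
  qed
  moreover have "C > 0" using K(1) K'(1) L(1) by (simp add: C_def add_nonneg_pos)
  moreover have "r > 0" using Rdef rcut L(1) by (simp add: r_def add_pos_nonneg)
  ultimately show ?thesis by blast
qed

end

theorem theorem2p3:
  fixes A :: "real^'n^'n"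
    and \<Lambda> :: "(real^'n) set"
    and \<T> \<T>\<^sub>A :: "(real^'n) set set"
    and Rdef rcut c\<^sub>A :: real
    and R :: "real^'n \<Rightarrow> (real^'n) set"
    and R\<^sub>0 :: "(real^'n) set"
    and V :: "real^'n \<Rightarrow> (real^'n \<Rightarrow> real^'n) \<Rightarrow> real"
    and V\<^sub>0 :: "(real^'n \<Rightarrow> real^'n) \<Rightarrow> real"
    and E :: "(real^'n \<Rightarrow> real^'n) \<Rightarrow> real"
    and u :: "real^'n \<Rightarrow> real^'n"
    and k :: nat
  assumes dim: "CARD('n) = 2 \<or> CARD('n) = 3"
    and A: "invertible A"
    and Rdef: "Rdef > 0"
    and config: "\<Lambda> - ball 0 Rdef = bravais_lattice A - ball 0 Rdef"
    and config_finite: "finite (\<Lambda> \<inter> ball 0 Rdef)"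
    and triang: "regular_triangulation \<T>"
    and triang_nodes: "nodes \<T> = \<Lambda>"
    and triang_homogeneous:
      "\<And>T \<rho>. \<lbrakk>T \<in> \<T>; \<rho> \<in> bravais_lattice A; T \<subseteq> - ball 0 Rdef; (+) \<rho> ` T \<subseteq> - ball 0 Rdef\<rbrakk>
        \<Longrightarrow> (+) \<rho> ` T \<in> \<T>"
    and rcut: "rcut > 0"
    and stencil: "\<And>l. l \<in> \<Lambda> \<Longrightarrow> R l \<subseteq> (ball 0 rcut \<inter> {\<rho>. l + \<rho> \<in> \<Lambda>}) - {0}"
    and stencil_edges:
      "\<And>l \<rho> T. \<lbrakk>l \<in> \<Lambda>; T \<in> \<T>; l + \<rho> \<in> \<Lambda>; closed_segment l (l + \<rho>) edge_of T\<rbrakk> \<Longrightarrow> \<rho> \<in> R l"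
    and V_stencil: "\<And>l. l \<in> \<Lambda> \<Longrightarrow> depends_only_on (R l) (V l)"
    and V_smooth: "\<And>l. l \<in> \<Lambda> \<Longrightarrow> class_C k (V l)"
    and V_zero: "\<And>l. l \<in> \<Lambda> \<Longrightarrow> V l (\<lambda>_. 0) = 0"
    and hom_stencil: "\<And>l. \<lbrakk>l \<in> \<Lambda>; norm l \<ge> Rdef\<rbrakk> \<Longrightarrow> R l = R\<^sub>0"
    and hom_V: "\<And>l. \<lbrakk>l \<in> \<Lambda>; norm l \<ge> Rdef\<rbrakk> \<Longrightarrow> V l = V\<^sub>0"
    and sym_stencil: "uminus ` R\<^sub>0 = R\<^sub>0"
    and sym_V: "\<And>g. V\<^sub>0 (\<lambda>\<rho>. - g (- \<rho>)) = V\<^sub>0 g"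
    and stencil_basis: "\<And>i. A *v axis i 1 \<in> R\<^sub>0"
    and energy: "energy_extension \<T> V E"
    and triang_A: "regular_triangulation \<T>\<^sub>A"
    and triang_A_nodes: "nodes \<T>\<^sub>A = bravais_lattice A"
    and triang_A_invariant:
      "\<And>T \<rho>. \<lbrakk>T \<in> \<T>\<^sub>A; \<rho> \<in> bravais_lattice A\<rbrakk> \<Longrightarrow> (+) \<rho> ` T \<in> \<T>\<^sub>A"
    and k: "k \<ge> 3"
    and c\<^sub>A: "c\<^sub>A > 0"
    and stable: "\<And>v. v \<in> W_c \<T>\<^sub>A \<Longrightarrow>
        (\<Sum>\<^sub>\<infinity>l\<in>bravais_lattice A.
           second_variation V\<^sub>0 (\<lambda>_. 0) (stencil_diff v l) (stencil_diff v l))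
        \<ge> c\<^sub>A * (W_seminorm \<T>\<^sub>A v)\<^sup>2"
    and critical: "critical_point \<T> E u"
  shows "\<exists>C>0. \<exists>uinf. \<exists>r>0. \<forall>l\<in>\<Lambda>. norm l \<ge> r \<longrightarrow>
      (\<forall>j\<in>{1..k - 2}.
         iter_diff_norm (R l) j u l \<le> C * norm l powi (1 - int CARD('n) - int j)) \<and>
      norm (u l - uinf) \<le> C * norm l powi (1 - int CARD('n))"
proof -
  interpret point_defect A \<Lambda> \<T> \<T>\<^sub>A Rdef rcut c\<^sub>A R R\<^sub>0 V V\<^sub>0 E u k
  proof (unfold_locales, goal_cases)
    case 1 then show ?case using dim by auto
  qed (fact assms)+
  show ?thesis by (rule critical_point_decay)
qed

end
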